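(* Let $\gamma = 2^*/2$ and \[ J(u) = \frac{a}{2} \int_\Omega |\nabla u|^2\, dx + \frac{b}{2\gamma} \left(\int_\Omega |\nabla u|^2\, dx\right)^\gamma - \frac{\lambda}{2} \int_\Omega u^2\, dx - \frac{1}{2^*} \int_\Omega |u|^{2^*} dx, \quad u \in H^1_0(\Omega). \] (i) Let $a > 0$, $0 < b < S^{-2^*/2}$, and $0 < \lambda < a\lambda_1$. Set \[ c^* = \frac{1}{N} \left(\frac{a^{2^*/2}}{S^{-2^*/2} - b}\right)^{2/(2^*-2)}. \] Then $J$ satisfies the $(\mathrm{PS})_c$ condition for all $c < c^*$. (ii) If $a \ge 0$ and $b > S^{-2^*/2}$, then $J$ satisfies the $(\mathrm{PS})_c$ condition for all $c \in \mathbb{R}$ for any $\lambda > 0$.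
   Context: $\Omega$ is a bounded domain in $\mathbb{R}^N$, $N \ge 3$, and $2^* = 2N/(N-2)$. $H^1_0(\Omega)$ is normed by $\|u\|^2 = \int_\Omega |\nabla u|^2\, dx$. $\lambda_1 > 0$ is the first Dirichlet eigenvalue of $-\Delta$ in $\Omega$. The best Sobolev constant is $S = \inf_{u \in H^1_0(\Omega) \setminus \{0\}} \int_\Omega |\nabla u|^2\, dx \big/ \left(\int_\Omega |u|^{2^*} dx\right)^{2/2^*}$. A $C^1$-functional $J$ on $H^1_0(\Omega)$ satisfies the $(\mathrm{PS})_c$ condition ($c \in \mathbb{R}$) if every sequence $(u_j)$ in $H^1_0(\Omega)$ with $J(u_j) \to c$ and $J'(u_j) \to 0$ has a strongly convergent subsequence. *)

theory Defs
  imports "HOL-Analysis.Analysis"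
begin

section \<open>Test functions\<close>

definition partial_deriv :: "'a::euclidean_space \<Rightarrow> ('a \<Rightarrow> real) \<Rightarrow> 'a \<Rightarrow> real" where
  "partial_deriv i f x = frechet_derivative f (at x) i"

fun Ck :: "nat \<Rightarrow> ('a::euclidean_space \<Rightarrow> real) \<Rightarrow> bool" where
  "Ck 0 f \<longleftrightarrow> continuous_on UNIV f"
| "Ck (Suc k) f \<longleftrightarrow> (\<forall>x. f differentiable (at x)) \<and> (\<forall>i\<in>Basis. Ck k (partial_deriv i f))"

definition test_function :: "'a::euclidean_space set \<Rightarrow> ('a \<Rightarrow> real) \<Rightarrow> bool" where
  "test_function \<Omega> \<phi> \<longleftrightarrow>
     (\<forall>k. Ck k \<phi>) \<and> compact (closure {x. \<phi> x \<noteq> 0}) \<and> closure {x. \<phi> x \<noteq> 0} \<subseteq> \<Omega>"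

section \<open>Sobolev spaces\<close>

text \<open>
  Elements of the spaces below are functions on the whole space of which only the values on
  \<open>\<Omega>\<close> matter; they represent classes modulo equality almost everywhere in \<open>\<Omega>\<close>.
  The zero class is \<open>ae_zero\<close>.
\<close>

definition ae_zero :: "'a::euclidean_space set \<Rightarrow> ('a \<Rightarrow> real) \<Rightarrow> bool" where
  "ae_zero \<Omega> u \<longleftrightarrow> (AE x in lebesgue_on \<Omega>. u x = 0)"

definition L2 :: "'a::euclidean_space set \<Rightarrow> ('a \<Rightarrow> 'b::euclidean_space) set" where
  "L2 \<Omega> = {u. u \<in> borel_measurable (lebesgue_on \<Omega>) \<and>
              integrable (lebesgue_on \<Omega>) (\<lambda>x. (norm (u x))\<^sup>2)}"

definition has_weak_gradient ::
    "'a::euclidean_space set \<Rightarrow> ('a \<Rightarrow> real) \<Rightarrow> ('a \<Rightarrow> 'a) \<Rightarrow> bool" where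
  "has_weak_gradient \<Omega> u g \<longleftrightarrow> u \<in> L2 \<Omega> \<and> g \<in> L2 \<Omega> \<and>
     (\<forall>\<phi>. test_function \<Omega> \<phi> \<longrightarrow>
        (\<forall>i\<in>Basis. (LINT x|lebesgue_on \<Omega>. u x * partial_deriv i \<phi> x)
                  = - (LINT x|lebesgue_on \<Omega>. (g x \<bullet> i) * \<phi> x)))"

definition H1 :: "'a::euclidean_space set \<Rightarrow> ('a \<Rightarrow> real) set" where
  "H1 \<Omega> = {u. \<exists>g. has_weak_gradient \<Omega> u g}"

text \<open>A weak gradient is unique up to null sets, so the choice does not affect the integrals below.\<close>

definition weak_gradient :: "'a::euclidean_space set \<Rightarrow> ('a \<Rightarrow> real) \<Rightarrow> 'a \<Rightarrow> 'a" where
  "weak_gradient \<Omega> u = (SOME g. has_weak_gradient \<Omega> u g)"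

definition dirichlet_energy :: "'a::euclidean_space set \<Rightarrow> ('a \<Rightarrow> real) \<Rightarrow> real" where
  "dirichlet_energy \<Omega> u = (LINT x|lebesgue_on \<Omega>. (norm (weak_gradient \<Omega> u x))\<^sup>2)"

definition H1_norm :: "'a::euclidean_space set \<Rightarrow> ('a \<Rightarrow> real) \<Rightarrow> real" where
  "H1_norm \<Omega> u = sqrt ((LINT x|lebesgue_on \<Omega>. (u x)\<^sup>2) + dirichlet_energy \<Omega> u)"

definition H10 :: "'a::euclidean_space set \<Rightarrow> ('a \<Rightarrow> real) set" where
  "H10 \<Omega> = {u \<in> H1 \<Omega>. \<exists>\<phi>. (\<forall>k. test_function \<Omega> (\<phi> k)) \<and>
              (\<lambda>k::nat. H1_norm \<Omega> (\<lambda>x. \<phi> k x - u x)) \<longlonglongrightarrow> 0}"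

definition H10_norm :: "'a::euclidean_space set \<Rightarrow> ('a \<Rightarrow> real) \<Rightarrow> real" where
  "H10_norm \<Omega> u = sqrt (dirichlet_energy \<Omega> u)"

section \<open>First eigenvalue and best Sobolev constant\<close>

definition dirichlet_eigenvalue :: "'a::euclidean_space set \<Rightarrow> real \<Rightarrow> bool" where
  "dirichlet_eigenvalue \<Omega> \<mu> \<longleftrightarrow> (\<exists>u\<in>H10 \<Omega>. \<not> ae_zero \<Omega> u \<and>
     (\<forall>v\<in>H10 \<Omega>. (LINT x|lebesgue_on \<Omega>. weak_gradient \<Omega> u x \<bullet> weak_gradient \<Omega> v x)
              = \<mu> * (LINT x|lebesgue_on \<Omega>. u x * v x)))"

definition first_eigenvalue :: "'a::euclidean_space set \<Rightarrow> real" where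
  "first_eigenvalue \<Omega> = (LEAST \<mu>. dirichlet_eigenvalue \<Omega> \<mu>)"

definition crit_exp :: "nat \<Rightarrow> real" where
  "crit_exp N = 2 * real N / (real N - 2)"

definition sobolev_constant :: "'a::euclidean_space set \<Rightarrow> real" where
  "sobolev_constant \<Omega> =
     (INF u \<in> {u \<in> H10 \<Omega>. \<not> ae_zero \<Omega> u}.
        dirichlet_energy \<Omega> u /
        (LINT x|lebesgue_on \<Omega>. \<bar>u x\<bar> powr crit_exp DIM('a)) powr (2 / crit_exp DIM('a)))"

section \<open>Functionals of class C1 and the Palais-Smale condition\<close>

text \<open>
  The space depends on the term \<open>\<Omega>\<close> and is not a type, so the dual space, its norm and the
  Frechet derivative are written out relative to the carrier \<open>H10 \<Omega>\<close>.
\<close>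

definition H10_dual :: "'a::euclidean_space set \<Rightarrow> (('a \<Rightarrow> real) \<Rightarrow> real) set" where
  "H10_dual \<Omega> = {L.
     (\<forall>u\<in>H10 \<Omega>. \<forall>v\<in>H10 \<Omega>. L (\<lambda>x. u x + v x) = L u + L v) \<and>
     (\<forall>c. \<forall>u\<in>H10 \<Omega>. L (\<lambda>x. c * u x) = c * L u) \<and>
     (\<exists>C. \<forall>u\<in>H10 \<Omega>. \<bar>L u\<bar> \<le> C * H10_norm \<Omega> u)}"

definition dual_norm :: "'a::euclidean_space set \<Rightarrow> (('a \<Rightarrow> real) \<Rightarrow> real) \<Rightarrow> real" where
  "dual_norm \<Omega> L = (SUP v \<in> {v \<in> H10 \<Omega>. H10_norm \<Omega> v \<le> 1}. \<bar>L v\<bar>)"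

definition has_H10_derivative ::
    "'a::euclidean_space set \<Rightarrow> (('a \<Rightarrow> real) \<Rightarrow> real) \<Rightarrow> (('a \<Rightarrow> real) \<Rightarrow> real) \<Rightarrow> ('a \<Rightarrow> real) \<Rightarrow> bool"
  where
  "has_H10_derivative \<Omega> J L u \<longleftrightarrow> L \<in> H10_dual \<Omega> \<and>
     (\<forall>\<epsilon>>0. \<exists>\<delta>>0. \<forall>h\<in>H10 \<Omega>. H10_norm \<Omega> h < \<delta> \<longrightarrow>
        \<bar>J (\<lambda>x. u x + h x) - J u - L h\<bar> \<le> \<epsilon> * H10_norm \<Omega> h)"

definition C1_with_derivative ::
    "'a::euclidean_space set \<Rightarrow> (('a \<Rightarrow> real) \<Rightarrow> real)
      \<Rightarrow> (('a \<Rightarrow> real) \<Rightarrow> ('a \<Rightarrow> real) \<Rightarrow> real) \<Rightarrow> bool" where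
  "C1_with_derivative \<Omega> J J' \<longleftrightarrow>
     (\<forall>u\<in>H10 \<Omega>. has_H10_derivative \<Omega> J (J' u) u) \<and>
     (\<forall>u\<in>H10 \<Omega>. \<forall>\<epsilon>>0. \<exists>\<delta>>0. \<forall>v\<in>H10 \<Omega>.
        H10_norm \<Omega> (\<lambda>x. v x - u x) < \<delta> \<longrightarrow> dual_norm \<Omega> (\<lambda>h. J' v h - J' u h) < \<epsilon>)"

text \<open>
  The condition is a property of functionals of class C1, and this is part of the definition.
  The derivative is unique as a functional on \<open>H10 \<Omega>\<close>, so it makes no difference that \<open>J'\<close> is
  bound by an existential quantifier.
\<close>

definition palais_smale ::
    "'a::euclidean_space set \<Rightarrow> (('a \<Rightarrow> real) \<Rightarrow> real) \<Rightarrow> real \<Rightarrow> bool" where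
  "palais_smale \<Omega> J c \<longleftrightarrow> (\<exists>J'. C1_with_derivative \<Omega> J J' \<and>
     (\<forall>u :: nat \<Rightarrow> 'a \<Rightarrow> real.
        (\<forall>j. u j \<in> H10 \<Omega>) \<longrightarrow>
        (\<lambda>j. J (u j)) \<longlonglongrightarrow> c \<longrightarrow>
        (\<lambda>j. dual_norm \<Omega> (J' (u j))) \<longlonglongrightarrow> 0 \<longrightarrow>
        (\<exists>r v. strict_mono (r :: nat \<Rightarrow> nat) \<and> v \<in> H10 \<Omega> \<and>
               (\<lambda>k. H10_norm \<Omega> (\<lambda>x. u (r k) x - v x)) \<longlonglongrightarrow> 0)))"

section \<open>The functional\<close>

definition kirchhoff_functional ::
    "real \<Rightarrow> real \<Rightarrow> real \<Rightarrow> 'a::euclidean_space set \<Rightarrow> ('a \<Rightarrow> real) \<Rightarrow> real" where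
  "kirchhoff_functional a b lam \<Omega> u =
     (let p = crit_exp DIM('a); \<gamma> = p / 2 in
        a / 2 * dirichlet_energy \<Omega> u
      + b / (2 * \<gamma>) * dirichlet_energy \<Omega> u powr \<gamma>
      - lam / 2 * (LINT x|lebesgue_on \<Omega>. (u x)\<^sup>2)
      - 1 / p * (LINT x|lebesgue_on \<Omega>. \<bar>u x\<bar> powr p))"

end

theory Submission
  imports Defs "HOL-Complex_Analysis.Great_Picard"
begin

text \<open>
  Write $p = 2^*$. A Palais-Smale sequence $(u_j)$ is bounded: in case (i) because
  $J(u) - J'(u)u/p = (a \|u\|^2 - \lambda |u|_2^2)/N$ and $\lambda < a \lambda_1$, in case (ii)
  because $b > S^{-p/2}$ makes $J$ coercive. For a weak limit $v$, testing $J'(u_j)$ with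
  $z_j = u_j - v$ gives, by the Brezis-Lieb splitting, for $\sigma = \lim \|z_j\|$
  \[ (a + b \sigma^{p-2}) \sigma^2 \le \lim |z_j|_p^p \le S^{-p/2} \sigma^p . \]
  If $\sigma > 0$ this is absurd in case (ii), and in case (i) it bounds $\sigma$ from below, so that
  $c \ge a \sigma^2 / N \ge c^*$.

  The Sobolev inequality is obtained by truncation: a translation estimate for the truncations of a
  test function at the levels $2^k$ yields a recursion for the measures of its level sets.
  The same translation estimate gives the compact embedding in $L^2$.
\<close>

section \<open>Smooth functions\<close>

text \<open>At the critical exponent p compactness is available in L2 only, so passing to a weak
  limit may lose an amount \<sigma> of norm, and the argument measures this loss. Since \<gamma> =
  p/2, the nonlocal term and the critical integral have the same degree p and compete only through
  the constants b and S^(-p/2). The nonlocal coefficient |u_j|^(p-2) tends to (|v|^2 +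
  \<sigma>^2)^((p-2)/2) and not to |v|^(p-2), so v need not be a critical point. The derivative is
  tested with z_j only, and b >= 0 allows this coefficient to be lowered to \<sigma>^(p-2). Two
  Sobolev constants occur. A crude one comes from the level-set recursion and serves
  differentiability and boundedness; the sharp one enters the inequality for \<sigma>. That S is
  positive has to be proved, because \<open>0 powr x\<close> is 0. The Palais-Smale condition
  includes class C1, so each of the four terms of J gets a Taylor estimate. As p - 2 = 4/(N-2) can
  be less than 1, these estimates rest on inequalities for powers that survive a derivative which is
  only Hoelder continuous.\<close>

lemma partial_deriv_eqI:
  "(f has_derivative f') (at x) \<Longrightarrow> partial_deriv i f x = f' i"
  unfolding partial_deriv_def using frechet_derivative_at by metis

lemma partial_deriv_has_derivative:
  assumes "f differentiable (at x)"
  shows "(f has_derivative (\<lambda>h. \<Sum>i\<in>Basis. (h \<bullet> i) * partial_deriv i f x)) (at x)"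
proof -
  have d: "(f has_derivative frechet_derivative f (at x)) (at x)"
    using assms frechet_derivative_works by blast
  interpret linear "frechet_derivative f (at x)"
    using d has_derivative_linear by blast
  have "frechet_derivative f (at x) h = (\<Sum>i\<in>Basis. (h \<bullet> i) * partial_deriv i f x)" for h
  proof -
    have "frechet_derivative f (at x) (\<Sum>i\<in>Basis. (h \<bullet> i) *\<^sub>R i)
        = (\<Sum>i\<in>Basis. (h \<bullet> i) * partial_deriv i f x)"
      by (simp add: sum scale partial_deriv_def)
    thus ?thesis by (simp add: euclidean_representation)
  qed
  hence "frechet_derivative f (at x) = (\<lambda>h. \<Sum>i\<in>Basis. (h \<bullet> i) * partial_deriv i f x)" by blast
  thus ?thesis using d by simp
qed

lemma Ck_Suc_imp: "Ck (Suc k) f \<Longrightarrow> Ck k f"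
proof (induction k arbitrary: f)
  case 0
  thus ?case by (auto intro!: continuous_at_imp_continuous_on differentiable_imp_continuous_within)
next
  case (Suc k)
  thus ?case by simp
qed

lemma partial_deriv_const: "partial_deriv i (\<lambda>x. c) = (\<lambda>x. 0)"
  by (rule ext, rule partial_deriv_eqI) auto

lemma Ck_const: "Ck k (\<lambda>x. c)"
  by (induction k arbitrary: c) (auto simp: partial_deriv_const)

lemma partial_deriv_add:
  assumes "\<forall>x. f differentiable (at x)" "\<forall>x. g differentiable (at x)"
  shows "partial_deriv i (\<lambda>x. f x + g x) = (\<lambda>x. partial_deriv i f x + partial_deriv i g x)"
proof
  fix x
  have "(f has_derivative frechet_derivative f (at x)) (at x)" "(g has_derivative frechet_derivative g (at x)) (at x)"
    using assms frechet_derivative_works by blast+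
  from has_derivative_add[OF this] show "partial_deriv i (\<lambda>x. f x + g x) x = partial_deriv i f x + partial_deriv i g x"
    by (subst partial_deriv_eqI) (auto simp: partial_deriv_def)
qed

lemma partial_deriv_mult:
  assumes "\<forall>x. f differentiable (at x)" "\<forall>x. g differentiable (at x)"
  shows "partial_deriv i (\<lambda>x. f x * g x) = (\<lambda>x. f x * partial_deriv i g x + partial_deriv i f x * g x)"
proof
  fix x
  have "(f has_derivative frechet_derivative f (at x)) (at x)" "(g has_derivative frechet_derivative g (at x)) (at x)"
    using assms frechet_derivative_works by blast+
  from has_derivative_mult[OF this] show "partial_deriv i (\<lambda>x. f x * g x) x = f x * partial_deriv i g x + partial_deriv i f x * g x"
    by (subst partial_deriv_eqI) (auto simp: partial_deriv_def)
qed

lemma Ck_add: "Ck k f \<Longrightarrow> Ck k g \<Longrightarrow> Ck k (\<lambda>x. f x + g x)"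
  by (induction k arbitrary: f g) (auto intro: continuous_intros simp: partial_deriv_add)

lemma Ck_mult: "Ck k f \<Longrightarrow> Ck k g \<Longrightarrow> Ck k (\<lambda>x. f x * g x)"
proof (induction k arbitrary: f g)
  case 0
  thus ?case by (auto intro: continuous_intros)
next
  case (Suc k)
  \<comment> \<open>The product rule leaves one factor undifferentiated, so order k of f and g
    themselves is needed as well.\<close>
  have "Ck k f" "Ck k g" using Suc.prems Ck_Suc_imp by blast+
  with Suc show ?case by (auto simp: partial_deriv_mult intro!: Ck_add Suc.IH)
qed

lemma Ck_prod: "finite A \<Longrightarrow> (\<And>i. i \<in> A \<Longrightarrow> Ck k (f i)) \<Longrightarrow> Ck k (\<lambda>x. \<Prod>i\<in>A. f i x)"
  by (induction A rule: finite_induct) (auto intro: Ck_const Ck_mult)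

text \<open>A partial derivative of \<open>F n\<close> after an affine map is a constant times
  \<open>F (Suc n)\<close> after the same map. The induction therefore needs the whole family of
  successive derivatives instead of one function.\<close>

lemma Ck_compose_affine:
  fixes F :: "nat \<Rightarrow> real \<Rightarrow> real"
  assumes F: "\<And>n t. (F n has_real_derivative F (Suc n) t) (at t)"
  shows "Ck k (\<lambda>x. F n (x \<bullet> v + d))"
proof (induction k arbitrary: n)
  case 0
  have "isCont (F n) t" for t using F DERIV_isCont by blast
  hence "continuous_on UNIV (F n)" by (simp add: continuous_at_imp_continuous_on)
  hence "continuous_on UNIV (F n \<circ> (\<lambda>x. x \<bullet> v + d))"
    by (intro continuous_on_compose continuous_intros) (auto intro: continuous_on_subset)
  thus ?case by (simp add: o_def)
next
  case (Suc k)
  have D: "((\<lambda>x. F n (x \<bullet> v + d)) has_derivative (\<lambda>h. (h \<bullet> v) * F (Suc n) (x \<bullet> v + d))) (at x)" for x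
  proof -
    have 1: "((\<lambda>x. x \<bullet> v + d) has_derivative (\<lambda>h. h \<bullet> v)) (at x)"
      by (auto intro!: derivative_eq_intros)
    from has_derivative_compose[OF 1 F[of n, unfolded has_field_derivative_def]]
    show ?thesis by (simp add: mult.commute)
  qed
  have "partial_deriv i (\<lambda>x. F n (x \<bullet> v + d)) = (\<lambda>x. (i \<bullet> v) * F (Suc n) (x \<bullet> v + d))" for i
    by (rule ext) (rule partial_deriv_eqI[OF D])
  thus ?case using D Suc by (auto simp: differentiable_def intro!: Ck_mult Ck_const)
qed

text \<open>The factor \<open>poly P (1 / t)\<close> makes the class closed under differentiation,
  also at 0, so smoothness of exp(-1/t) follows from a single derivative formula.\<close>

definition flat_fun :: "real poly \<Rightarrow> real \<Rightarrow> real" where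
  "flat_fun P t = (if t > 0 then poly P (1 / t) * exp (- (1 / t)) else 0)"

text \<open>With s = 1/t, the derivative in t of P(s) exp(-s) is s^2 (P(s) - P'(s)) exp(-s);
  \<open>[:0, 0, 1:]\<close> is the monomial s^2.\<close>

definition flat_poly :: "real poly \<Rightarrow> real poly" where
  "flat_poly P = [:0, 0, 1:] * (P - pderiv P)"

lemma poly_div_exp_tendsto_0: "((\<lambda>x::real. poly P x * exp (- x)) \<longlongrightarrow> 0) at_top"
proof (induction P)
  case 0
  thus ?case by simp
next
  case (pCons a P)
  have "((\<lambda>x::real. (\<Sum>i\<le>degree (pCons a P). coeff (pCons a P) i * (x ^ i / exp x))) \<longlongrightarrow> (\<Sum>i\<le>degree (pCons a P). coeff (pCons a P) i * 0)) at_top"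
    by (intro tendsto_sum tendsto_mult tendsto_const tendsto_power_div_exp_0)
  moreover have "(\<lambda>x::real. (\<Sum>i\<le>degree (pCons a P). coeff (pCons a P) i * (x ^ i / exp x))) = (\<lambda>x. poly (pCons a P) x * exp (- x))"
    by (rule ext, subst poly_altdef) (simp only: sum_distrib_right exp_minus divide_inverse mult.assoc)
  ultimately show ?case by simp
qed

lemma DERIV_transfer_ev:
  assumes "(f has_real_derivative D) (at t)" "\<forall>\<^sub>F x in nhds t. f x = g x"
  shows "(g has_real_derivative D) (at t)"
  using DERIV_cong_ev[OF refl assms(2) refl] assms(1) by blast

lemma flat_fun_deriv: "(flat_fun P has_real_derivative flat_fun (flat_poly P) t) (at t)"
proof -
  consider "t > 0" | "t < 0" | "t = 0" by linarith
  thus ?thesis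
  proof cases
    case 1
    have "((\<lambda>t. poly P (1 / t) * exp (- (1 / t))) has_real_derivative flat_fun (flat_poly P) t) (at t)"
      using 1
      by (auto intro!: derivative_eq_intros DERIV_chain2[OF poly_DERIV] simp: flat_fun_def flat_poly_def field_simps power2_eq_square)
    moreover have "\<forall>\<^sub>F x in nhds t. poly P (1 / x) * exp (- (1 / x)) = flat_fun P x"
      using eventually_nhds_in_open[of "{0<..}" t] 1 by (auto elim!: eventually_mono simp: flat_fun_def)
    ultimately show ?thesis by (rule DERIV_transfer_ev)
  next
    case 2
    have "((\<lambda>t. 0) has_real_derivative flat_fun (flat_poly P) t) (at t)"
      using 2 by (auto simp: flat_fun_def)
    moreover have "\<forall>\<^sub>F x in nhds t. 0 = flat_fun P x"
      using eventually_nhds_in_open[of "{..<0}" t] 2 by (auto elim!: eventually_mono simp: flat_fun_def)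
    ultimately show ?thesis by (rule DERIV_transfer_ev)
  next
    case 3
    have R: "((\<lambda>h. flat_fun P h / h) \<longlongrightarrow> 0) (at_right 0)"
    proof -
      \<comment> \<open>From the right, the difference quotient at 0 is Q(1/h) exp(-1/h) with Q = X
        P, which turns the limit into decay at infinity.\<close>
      have "((\<lambda>x::real. poly ([:0,1:] * P) x * exp (- x)) \<longlongrightarrow> 0) at_top" by (rule poly_div_exp_tendsto_0)
      hence "((\<lambda>h::real. poly ([:0,1:] * P) (inverse h) * exp (- inverse h)) \<longlongrightarrow> 0) (at_right 0)"
        by (rule filterlim_compose) (rule filterlim_inverse_at_top_right)
      moreover have "\<forall>\<^sub>F h in at_right (0::real). poly ([:0,1:] * P) (inverse h) * exp (- inverse h) = flat_fun P h / h"
        by (auto simp: eventually_at_filter flat_fun_def field_simps)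
      ultimately show ?thesis by (rule Lim_transform_eventually)
    qed
    have L: "((\<lambda>h. flat_fun P h / h) \<longlongrightarrow> 0) (at_left 0)"
    proof -
      have "\<forall>\<^sub>F h in at_left (0::real). 0 = flat_fun P h / h"
        by (auto simp: eventually_at_filter flat_fun_def)
      thus ?thesis by (rule Lim_transform_eventually[OF tendsto_const])
    qed
    have "((\<lambda>h. flat_fun P h / h) \<longlongrightarrow> 0) (at 0)"
      by (rule filterlim_split_at[OF L R])
    thus ?thesis using 3 by (simp add: DERIV_def flat_fun_def)
  qed
qed

definition flat_exp :: "real \<Rightarrow> real" where "flat_exp = flat_fun 1"

lemma flat_exp_simps: "flat_exp t = (if t > 0 then exp (- (1 / t)) else 0)"
  by (simp add: flat_exp_def flat_fun_def)

text \<open>Iterating \<open>flat_poly\<close> from 1 yields the successive derivatives of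
  \<open>flat_exp\<close>, which is the family that \<open>Ck_compose_affine\<close> asks
  for.\<close>

lemma Ck_flat_exp: "Ck k (\<lambda>x. flat_exp (x \<bullet> v + d))"
proof -
  have "Ck k (\<lambda>x. (\<lambda>n. flat_fun ((flat_poly ^^ n) 1)) 0 (x \<bullet> v + d))"
    by (rule Ck_compose_affine) (simp add: flat_fun_deriv)
  thus ?thesis by (simp add: flat_exp_def)
qed

text \<open>The function \<open>flat_exp (n * t)\<close> is the \<open>n\<close>-th root of \<open>flat_exp t\<close>; hence the bumps tend to
  the indicator of the box as \<open>n\<close> grows.\<close>

definition bump :: "real \<Rightarrow> 'a::euclidean_space \<Rightarrow> 'a \<Rightarrow> 'a \<Rightarrow> real" where
  "bump n l u x = (\<Prod>i\<in>Basis. flat_exp (n * (x \<bullet> i - l \<bullet> i)) * flat_exp (n * (u \<bullet> i - x \<bullet> i)))"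

lemma Ck_bump: "Ck k (bump n l u)"
proof -
  have 1: "Ck k (\<lambda>x. flat_exp (n * (x \<bullet> i - l \<bullet> i)))" for i
    using Ck_flat_exp[of k "n *\<^sub>R i" "- (n * (l \<bullet> i))"] by (simp add: algebra_simps)
  have 2: "Ck k (\<lambda>x. flat_exp (n * (u \<bullet> i - x \<bullet> i)))" for i
    using Ck_flat_exp[of k "- n *\<^sub>R i" "n * (u \<bullet> i)"] by (simp add: algebra_simps)
  have "Ck k (\<lambda>x. \<Prod>i\<in>Basis. flat_exp (n * (x \<bullet> i - l \<bullet> i)) * flat_exp (n * (u \<bullet> i - x \<bullet> i)))"
    by (intro Ck_prod Ck_mult 1 2) simp
  thus ?thesis by (simp add: bump_def[abs_def])
qed

lemma bump_eq_0: "n > 0 \<Longrightarrow> x \<notin> box l u \<Longrightarrow> bump n l u x = 0"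
  by (auto simp: bump_def flat_exp_simps mem_box zero_less_mult_iff)

lemma bump_bounds: "0 \<le> bump n l u x" "bump n l u x \<le> 1"
proof -
  have f: "0 \<le> flat_exp t" "flat_exp t \<le> 1" for t by (auto simp: flat_exp_simps)
  show "0 \<le> bump n l u x" unfolding bump_def by (intro prod_nonneg) (auto simp: f)
  show "bump n l u x \<le> 1" unfolding bump_def by (intro prod_le_1) (auto simp: f mult_le_one)
qed

lemma bump_tendsto_indicator: "(\<lambda>n. bump (real (Suc n)) l u x) \<longlonglongrightarrow> indicator (box l u) x"
proof (cases "x \<in> box l u")
  case True
  have e: "(\<lambda>n. flat_exp (real (Suc n) * t)) \<longlonglongrightarrow> 1" if "t > 0" for t
  proof -
    have "(\<lambda>n. exp (- ((1 / t) * inverse (real (Suc n))))) \<longlonglongrightarrow> exp (- ((1 / t) * 0))"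
      by (intro tendsto_intros LIMSEQ_inverse_real_of_nat)
    moreover have "(\<lambda>n. exp (- ((1 / t) * inverse (real (Suc n))))) = (\<lambda>n. flat_exp (real (Suc n) * t))"
      using that by (intro ext) (simp add: flat_exp_simps zero_less_mult_iff inverse_eq_divide del: of_nat_Suc)
    ultimately show ?thesis by (simp del: of_nat_Suc)
  qed
  have "(\<lambda>n. bump (real (Suc n)) l u x) \<longlonglongrightarrow> (\<Prod>i\<in>(Basis::'a set). 1 * 1)"
    unfolding bump_def using True by (intro tendsto_prod tendsto_mult e) (auto simp: mem_box)
  thus ?thesis using True by simp
next
  case False
  thus ?thesis by (simp add: bump_eq_0 del: of_nat_Suc)
qed

text \<open>A bump vanishes off the open box, so its support lies in the closed one; hence the
  hypothesis on \<open>cbox\<close>.\<close>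

lemma test_function_bump:
  assumes "n > 0" "cbox l u \<subseteq> \<Omega>"
  shows "test_function \<Omega> (bump n l u)"
proof -
  have "{x. bump n l u x \<noteq> 0} \<subseteq> cbox l u"
    using assms bump_eq_0 box_subset_cbox by blast
  hence "closure {x. bump n l u x \<noteq> 0} \<subseteq> cbox l u" by (intro closure_minimal closed_cbox)
  thus ?thesis unfolding test_function_def using Ck_bump assms(2)
    by (metis bounded_cbox bounded_subset closed_closure compact_eq_bounded_closed order_trans)
qed

section \<open>Test functions\<close>

lemma test_function_continuous: "test_function \<Omega> \<phi> \<Longrightarrow> continuous_on UNIV \<phi>"
  unfolding test_function_def using Ck.simps(1) by blast

lemma test_function_differentiable: "test_function \<Omega> \<phi> \<Longrightarrow> \<phi> differentiable (at x)"
  unfolding test_function_def by (metis Ck.simps(2))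

lemma test_function_outside: "test_function \<Omega> \<phi> \<Longrightarrow> x \<notin> \<Omega> \<Longrightarrow> \<phi> x = 0"
  unfolding test_function_def using subsetD[OF closure_subset, of x "{x. \<phi> x \<noteq> 0}"] by auto

lemma test_functionI:
  assumes "\<And>k. Ck k f" "closed K" "K \<subseteq> \<Omega>" "bounded K" "\<And>x. x \<notin> K \<Longrightarrow> f x = 0"
  shows "test_function \<Omega> f"
proof -
  have "{x. f x \<noteq> 0} \<subseteq> K" using assms by blast
  hence "closure {x. f x \<noteq> 0} \<subseteq> K" using assms closure_minimal by blast
  thus ?thesis unfolding test_function_def using assms
    by (meson bounded_subset closed_closure compact_eq_bounded_closed order_trans)
qed

lemma test_function_supp:
  assumes "test_function \<Omega> \<phi>"
  obtains K where "compact K" "K \<subseteq> \<Omega>" "\<And>x. x \<notin> K \<Longrightarrow> \<phi> x = 0"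
proof (rule that[of "closure {x. \<phi> x \<noteq> 0}"])
  show "\<phi> x = 0" if "x \<notin> closure {x. \<phi> x \<noteq> 0}" for x
    using that subsetD[OF closure_subset, of x "{x. \<phi> x \<noteq> 0}"] by auto
qed (use assms in \<open>auto simp: test_function_def\<close>)

lemma test_function_add:
  assumes "test_function \<Omega> \<phi>" "test_function \<Omega> \<psi>"
  shows "test_function \<Omega> (\<lambda>x. \<phi> x + \<psi> x)"
proof -
  obtain K where K: "compact K" "K \<subseteq> \<Omega>" "\<And>x. x \<notin> K \<Longrightarrow> \<phi> x = 0" by (rule test_function_supp[OF assms(1)]) auto
  obtain L where L: "compact L" "L \<subseteq> \<Omega>" "\<And>x. x \<notin> L \<Longrightarrow> \<psi> x = 0" by (rule test_function_supp[OF assms(2)]) auto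
  show ?thesis
    by (rule test_functionI[of _ "K \<union> L"]) (use assms K L in \<open>auto simp: compact_imp_bounded compact_imp_closed test_function_def intro: Ck_add\<close>)
qed

lemma test_function_mult:
  assumes "test_function \<Omega> \<phi>" "\<And>k. Ck k \<psi>"
  shows "test_function \<Omega> (\<lambda>x. \<psi> x * \<phi> x)"
proof -
  obtain K where K: "compact K" "K \<subseteq> \<Omega>" "\<And>x. x \<notin> K \<Longrightarrow> \<phi> x = 0" by (rule test_function_supp[OF assms(1)]) auto
  show ?thesis
    by (rule test_functionI[of _ K]) (use assms K in \<open>auto simp: compact_imp_bounded compact_imp_closed test_function_def intro: Ck_mult\<close>)
qed

text \<open>Off K the function agrees with 0 on an open set. So differentiation does not enlarge the
  compact set that carries a test function.\<close>

lemma test_function_partial_deriv_outside: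
  assumes "closed K" "\<And>x. x \<notin> K \<Longrightarrow> \<phi> x = 0" "x \<notin> K"
  shows "partial_deriv i \<phi> x = 0"
proof -
  have "((\<lambda>x. 0) has_derivative (\<lambda>h. 0)) (at x)" by simp
  hence "(\<phi> has_derivative (\<lambda>h. 0)) (at x)"
    by (rule has_derivative_transform_within_open[where s = "- K"]) (use assms in auto)
  thus ?thesis by (rule partial_deriv_eqI)
qed

lemma test_function_partial_deriv:
  assumes "test_function \<Omega> \<phi>" "i \<in> Basis"
  shows "test_function \<Omega> (partial_deriv i \<phi>)"
proof -
  obtain K where K: "compact K" "K \<subseteq> \<Omega>" "\<And>x. x \<notin> K \<Longrightarrow> \<phi> x = 0" by (rule test_function_supp[OF assms(1)]) auto
  have "Ck k (partial_deriv i \<phi>)" for k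
  proof -
    have "Ck (Suc k) \<phi>" using assms(1) by (simp add: test_function_def)
    thus ?thesis using assms(2) by simp
  qed
  thus ?thesis
    by (rule test_functionI[of _ K]) (use K in \<open>auto simp: compact_imp_bounded compact_imp_closed intro: test_function_partial_deriv_outside[of K]\<close>)
qed

lemma test_function_zero: "test_function \<Omega> (\<lambda>x. 0)"
  by (rule test_functionI[of _ "{}"]) (auto intro: Ck_const)

lemma test_function_bounded:
  assumes "test_function \<Omega> \<phi>"
  obtains B where "\<And>x. \<bar>\<phi> x\<bar> \<le> B" "B > 0"
proof -
  obtain K where K: "compact K" "K \<subseteq> \<Omega>" "\<And>x. x \<notin> K \<Longrightarrow> \<phi> x = 0" by (rule test_function_supp[OF assms(1)]) auto
  have "compact (\<phi> ` K)"
    by (intro compact_continuous_image K(1) continuous_on_subset[OF test_function_continuous[OF assms]]) simp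
  hence "bounded (\<phi> ` K)" by (rule compact_imp_bounded)
  then obtain B where B: "\<And>y. y \<in> \<phi> ` K \<Longrightarrow> norm y \<le> B"
    by (auto simp: bounded_iff)
  have "\<bar>\<phi> x\<bar> \<le> max B 1" for x
    using B[of "\<phi> x"] K(3)[of x] by (cases "x \<in> K") auto
  thus ?thesis by (intro that[of "max B 1"]) auto
qed

section \<open>Gradients of test functions\<close>

definition grad :: "('a::euclidean_space \<Rightarrow> real) \<Rightarrow> 'a \<Rightarrow> 'a" where
  "grad \<phi> x = (\<Sum>i\<in>Basis. partial_deriv i \<phi> x *\<^sub>R i)"

lemma grad_inner_Basis: "i \<in> Basis \<Longrightarrow> grad \<phi> x \<bullet> i = partial_deriv i \<phi> x"
  unfolding grad_def by (simp add: inner_sum_left inner_Basis if_distrib sum.delta cong: if_cong)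

lemma test_function_has_derivative:
  assumes "test_function \<Omega> \<phi>"
  shows "(\<phi> has_derivative (\<lambda>h. grad \<phi> x \<bullet> h)) (at x)"
proof -
  have "(\<lambda>h. grad \<phi> x \<bullet> h) = (\<lambda>h. \<Sum>i\<in>Basis. (h \<bullet> i) * partial_deriv i \<phi> x)"
    unfolding grad_def by (rule ext, subst inner_commute) (simp add: inner_sum_right mult.commute)
  thus ?thesis using partial_deriv_has_derivative[OF test_function_differentiable[OF assms]] by simp
qed

lemma grad_continuous: "test_function \<Omega> \<phi> \<Longrightarrow> continuous_on UNIV (grad \<phi>)"
  unfolding grad_def[abs_def] by (intro continuous_intros test_function_continuous[OF test_function_partial_deriv])

lemma grad_outside: "test_function \<Omega> \<phi> \<Longrightarrow> x \<notin> \<Omega> \<Longrightarrow> grad \<phi> x = 0"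
  unfolding grad_def using test_function_outside[OF test_function_partial_deriv] by (metis (no_types, lifting) scaleR_zero_left sum.neutral)

section \<open>Square integrable functions\<close>

text \<open>The condition of \<open>L2\<close> for a general measure, since Cauchy-Schwarz is
  applied both over \<open>lebesgue_on \<Omega>\<close> and over \<open>lborel\<close>.\<close>

definition sq_int :: "'x measure \<Rightarrow> ('x \<Rightarrow> 'b::euclidean_space) \<Rightarrow> bool" where
  "sq_int M f \<longleftrightarrow> f \<in> borel_measurable M \<and> integrable M (\<lambda>x. (norm (f x))\<^sup>2)"

definition l2_norm :: "'x measure \<Rightarrow> ('x \<Rightarrow> 'b::euclidean_space) \<Rightarrow> real" where
  "l2_norm M f = sqrt (LINT x|M. (norm (f x))\<^sup>2)"

lemma L2_eq_sq_int: "u \<in> L2 \<Omega> \<longleftrightarrow> sq_int (lebesgue_on \<Omega>) u"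
  by (simp add: L2_def sq_int_def)

lemma l2_norm_nonneg: "0 \<le> l2_norm M f"
  by (simp add: l2_norm_def)

lemma l2_norm_sq: "(l2_norm M f)\<^sup>2 = (LINT x|M. (norm (f x))\<^sup>2)"
  by (simp add: l2_norm_def)

lemma sq_int_inner_integrable:
  assumes "sq_int M f" "sq_int M g"
  shows "integrable M (\<lambda>x. f x \<bullet> g x)"
proof (rule Bochner_Integration.integrable_bound)
  show "integrable M (\<lambda>x. (norm (f x))\<^sup>2 + (norm (g x))\<^sup>2)"
    using assms by (simp add: sq_int_def)
  show "(\<lambda>x. f x \<bullet> g x) \<in> borel_measurable M"
    using assms by (auto simp: sq_int_def intro: borel_measurable_inner)
  have "\<bar>f x \<bullet> g x\<bar> \<le> (norm (f x))\<^sup>2 + (norm (g x))\<^sup>2" for x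
  proof -
    have "\<bar>f x \<bullet> g x\<bar> \<le> norm (f x) * norm (g x)" by (rule Cauchy_Schwarz_ineq2)
    also have "\<dots> \<le> (norm (f x))\<^sup>2 + (norm (g x))\<^sup>2"
    proof -
      have "0 \<le> norm (f x) * norm (g x)" by simp
      thus ?thesis using sum_squares_bound[of "norm (f x)" "norm (g x)"] by linarith
    qed
    finally show ?thesis .
  qed
  thus "AE x in M. norm (f x \<bullet> g x) \<le> norm ((norm (f x))\<^sup>2 + (norm (g x))\<^sup>2)"
    by simp
qed

lemma sq_int_scaleR: "sq_int M f \<Longrightarrow> sq_int M (\<lambda>x. c *\<^sub>R f x)"
  by (auto simp: sq_int_def power_mult_distrib)

lemma norm_add_sq: "(norm (a + b))\<^sup>2 = (norm a)\<^sup>2 + 2 * (a \<bullet> b) + (norm (b::'b::real_inner))\<^sup>2"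
  by (simp add: power2_norm_eq_inner inner_simps inner_commute)

lemma sq_int_add:
  assumes "sq_int M f" "sq_int M g"
  shows "sq_int M (\<lambda>x. f x + g x)"
  using assms sq_int_inner_integrable[OF assms] by (auto simp: sq_int_def norm_add_sq)

lemma sq_int_diff:
  assumes "sq_int M f" "sq_int M g"
  shows "sq_int M (\<lambda>x. f x - g x)"
  using sq_int_add[OF assms(1) sq_int_scaleR[OF assms(2), of "-1"]] by simp

lemma integral_norm_add_sq:
  assumes "sq_int M f" "sq_int M g"
  shows "(LINT x|M. (norm (f x + g x))\<^sup>2) = (LINT x|M. (norm (f x))\<^sup>2) + 2 * (LINT x|M. f x \<bullet> g x) + (LINT x|M. (norm (g x))\<^sup>2)"
  using assms sq_int_inner_integrable[OF assms] by (simp add: sq_int_def norm_add_sq)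

text \<open>The discriminant criterion, kept purely numerical because it serves the Cauchy-Schwarz
  inequality and also, with A = 0, the Euler equation of a minimizer.\<close>

lemma real_quadratic_CS:
  fixes A B C :: real
  assumes "\<And>t. 0 \<le> A + 2 * t * B + t\<^sup>2 * C" "0 \<le> A" "0 \<le> C"
  shows "\<bar>B\<bar> \<le> sqrt A * sqrt C"
proof -
  have "B\<^sup>2 \<le> A * C"
  proof (cases "C = 0")
    case True
    have "B = 0"
    proof (rule ccontr)
      assume "B \<noteq> 0"
      \<comment> \<open>For C = 0 this t makes A + 2 t B equal to -1.\<close>
      thus False using assms(1)[of "- (A + 1) / (2 * B)"] True by (simp add: field_simps)
    qed
    thus ?thesis using assms by simp
  next
    case False
    hence C: "C > 0" using assms by simp
    \<comment> \<open>t = -B/C is the minimum point of the quadratic.\<close>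
    have "0 \<le> A + 2 * (- B / C) * B + (- B / C)\<^sup>2 * C" by (rule assms(1))
    also have "\<dots> = A - B\<^sup>2 / C" using C by (simp add: field_simps power2_eq_square)
    finally show ?thesis using C by (simp add: field_simps)
  qed
  hence "sqrt (B\<^sup>2) \<le> sqrt (A * C)" by (rule real_sqrt_le_mono)
  thus ?thesis by (simp add: real_sqrt_mult)
qed

lemma l2_Cauchy_Schwarz:
  assumes "sq_int M f" "sq_int M g"
  shows "\<bar>LINT x|M. f x \<bullet> g x\<bar> \<le> l2_norm M f * l2_norm M g"
  unfolding l2_norm_def
proof (rule real_quadratic_CS)
  fix t :: real
  have "0 \<le> (LINT x|M. (norm (f x + t *\<^sub>R g x))\<^sup>2)" by simp
  also have "\<dots> = (LINT x|M. (norm (f x))\<^sup>2) + 2 * (LINT x|M. f x \<bullet> (t *\<^sub>R g x)) + (LINT x|M. (norm (t *\<^sub>R g x))\<^sup>2)"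
    by (rule integral_norm_add_sq[OF assms(1) sq_int_scaleR[OF assms(2)]])
  also have "\<dots> = (LINT x|M. (norm (f x))\<^sup>2) + 2 * t * (LINT x|M. f x \<bullet> g x) + t\<^sup>2 * (LINT x|M. (norm (g x))\<^sup>2)"
    by (simp add: power_mult_distrib)
  finally show "0 \<le> (LINT x|M. (norm (f x))\<^sup>2) + 2 * t * (LINT x|M. f x \<bullet> g x) + t\<^sup>2 * (LINT x|M. (norm (g x))\<^sup>2)" .
qed auto

lemma l2_norm_triangle:
  assumes "sq_int M f" "sq_int M g"
  shows "l2_norm M (\<lambda>x. f x + g x) \<le> l2_norm M f + l2_norm M g"
proof (rule power2_le_imp_le)
  have "(l2_norm M (\<lambda>x. f x + g x))\<^sup>2 = (l2_norm M f)\<^sup>2 + 2 * (LINT x|M. f x \<bullet> g x) + (l2_norm M g)\<^sup>2"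
    by (simp only: l2_norm_sq integral_norm_add_sq[OF assms])
  also have "\<dots> \<le> (l2_norm M f + l2_norm M g)\<^sup>2"
    using l2_Cauchy_Schwarz[OF assms] by (simp add: power2_sum)
  finally show "(l2_norm M (\<lambda>x. f x + g x))\<^sup>2 \<le> (l2_norm M f + l2_norm M g)\<^sup>2" .
qed (simp add: l2_norm_nonneg)

lemma l2_norm_scaleR: "l2_norm M (\<lambda>x. c *\<^sub>R f x) = \<bar>c\<bar> * l2_norm M f"
  by (simp add: l2_norm_def power_mult_distrib real_sqrt_mult)

lemma l2_norm_minus_commute: "l2_norm M (\<lambda>x. f x - g x) = l2_norm M (\<lambda>x. g x - f x)"
  by (simp add: l2_norm_def norm_minus_commute)

text \<open>Fatou's lemma for Bochner integrals, with integrability of the limit as part of the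
  conclusion. It serves the completeness of L2 and the passage of the Sobolev inequality to
  limits.\<close>

lemma integral_fatou_bound:
  fixes g :: "nat \<Rightarrow> 'x \<Rightarrow> real"
  assumes "\<And>k. integrable M (g k)" "\<And>k x. 0 \<le> g k x" "h \<in> borel_measurable M"
    "AE x in M. (\<lambda>k. g k x) \<longlonglongrightarrow> h x" "\<And>k. (LINT x|M. g k x) \<le> C"
  shows "integrable M h" "(LINT x|M. h x) \<le> C"
proof -
  have meas: "\<And>k. g k \<in> borel_measurable M" using assms(1) by blast
  have "0 \<le> (LINT x|M. g 0 x)" using assms(2) by simp
  hence C: "0 \<le> C" using assms(5)[of 0] by linarith
  have nonneg: "AE x in M. 0 \<le> h x"
    using assms(4) by eventually_elim (rule LIMSEQ_le_const, auto simp: assms(2))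
  have "(\<integral>\<^sup>+x. ennreal (h x) \<partial>M) = (\<integral>\<^sup>+x. liminf (\<lambda>k. ennreal (g k x)) \<partial>M)"
  proof (rule nn_integral_cong_AE)
    show "AE x in M. ennreal (h x) = liminf (\<lambda>k. ennreal (g k x))"
      using assms(4)
    proof eventually_elim
      case (elim x)
      hence "(\<lambda>k. ennreal (g k x)) \<longlonglongrightarrow> ennreal (h x)" by (rule tendsto_ennrealI)
      thus ?case using lim_imp_Liminf[OF sequentially_bot] by metis
    qed
  qed
  also have "\<dots> \<le> liminf (\<lambda>k. \<integral>\<^sup>+x. ennreal (g k x) \<partial>M)"
    by (rule nn_integral_liminf) (use meas in simp)
  also have "\<dots> \<le> liminf (\<lambda>k::nat. ennreal C)"
  proof (rule Liminf_mono, rule always_eventually, rule allI)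
    fix k
    have "(\<integral>\<^sup>+x. ennreal (g k x) \<partial>M) = ennreal (LINT x|M. g k x)"
      using assms by (intro nn_integral_eq_integral) auto
    thus "(\<integral>\<^sup>+x. ennreal (g k x) \<partial>M) \<le> ennreal C" using assms(5) ennreal_leI by simp
  qed
  also have "\<dots> = ennreal C" by (simp add: Liminf_const)
  finally have le: "(\<integral>\<^sup>+x. ennreal (h x) \<partial>M) \<le> ennreal C" .
  show int: "integrable M h"
  proof (rule integrableI_nonneg[OF assms(3) nonneg])
    show "(\<integral>\<^sup>+x. ennreal (h x) \<partial>M) < \<infinity>" using le by (simp add: order_le_less_trans)
  qed
  have "ennreal (LINT x|M. h x) \<le> ennreal C"
    using le nn_integral_eq_integral[OF int nonneg] by simp
  thus "(LINT x|M. h x) \<le> C" using C by (simp add: ennreal_le_iff)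
qed

text \<open>Cauchy-Schwarz against the constant 1. On a finite measure L2 bounds thus control L1,
  which opens the way to the L1 theorems on almost everywhere convergent subsequences.\<close>

lemma (in finite_measure) sq_int_integrable_norm:
  assumes "sq_int M f"
  shows "integrable M (\<lambda>x. norm (f x))" "(LINT x|M. norm (f x)) \<le> sqrt (measure M (space M)) * l2_norm M f"
proof -
  have 1: "sq_int M (\<lambda>x. norm (f x))" using assms by (auto simp: sq_int_def)
  have 2: "sq_int M (\<lambda>x. 1::real)" by (auto simp: sq_int_def)
  show "integrable M (\<lambda>x. norm (f x))" using sq_int_inner_integrable[OF 1 2] by simp
  have "\<bar>LINT x|M. norm (f x)\<bar> \<le> l2_norm M (\<lambda>x. norm (f x)) * l2_norm M (\<lambda>x. 1::real)"
    using l2_Cauchy_Schwarz[OF 1 2] by simp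
  thus "(LINT x|M. norm (f x)) \<le> sqrt (measure M (space M)) * l2_norm M f"
    by (simp add: l2_norm_def mult.commute)
qed

text \<open>An L2-Cauchy sequence is L1-Cauchy on a finite measure, so a subsequence converges
  almost everywhere. Fatou's lemma in the second index then bounds the L2 distance of each term to
  the pointwise limit.\<close>

lemma (in finite_measure) l2_complete:
  fixes s :: "nat \<Rightarrow> 'a \<Rightarrow> 'b::euclidean_space"
  assumes s: "\<And>n. sq_int M (s n)"
    and Cauchy: "\<And>e. e > 0 \<Longrightarrow> \<exists>N. \<forall>i\<ge>N. \<forall>j\<ge>N. l2_norm M (\<lambda>x. s i x - s j x) < e"
  obtains f where "sq_int M f" "(\<lambda>n. l2_norm M (\<lambda>x. s n x - f x)) \<longlonglongrightarrow> 0"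
proof -
  have [measurable]: "s n \<in> borel_measurable M" for n using s by (simp add: sq_int_def)
  have int: "integrable M (s n)" for n
    using sq_int_integrable_norm(1)[OF s] by (simp add: integrable_norm_iff)
  define V where "V = sqrt (measure M (space M))"
  have V: "V \<ge> 0" by (simp add: V_def)
  have "\<exists>N. \<forall>i\<ge>N. \<forall>j\<ge>N. (LINT x|M. norm (s i x - s j x)) < e" if "e > 0" for e
  proof -
    \<comment> \<open>V + 1 instead of V, because the whole space may be null.\<close>
    have "e / (V + 1) > 0" using that V by simp
    from Cauchy[OF this] obtain N where N: "\<And>i j. i \<ge> N \<Longrightarrow> j \<ge> N \<Longrightarrow> l2_norm M (\<lambda>x. s i x - s j x) < e / (V + 1)" by blast
    have "(LINT x|M. norm (s i x - s j x)) < e" if "i \<ge> N" "j \<ge> N" for i j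
    proof -
      have "(LINT x|M. norm (s i x - s j x)) \<le> V * l2_norm M (\<lambda>x. s i x - s j x)"
        unfolding V_def by (rule sq_int_integrable_norm(2)[OF sq_int_diff[OF s s]])
      also have "\<dots> \<le> V * (e / (V + 1))" using N[OF that] V by (intro mult_left_mono) auto
      also have "\<dots> < e" using V \<open>e > 0\<close> by (simp add: field_simps)
      finally show ?thesis .
    qed
    thus ?thesis by blast
  qed
  from cauchy_L1_AE_cauchy_subseq[OF int this] obtain r where r: "strict_mono r" "AE x in M. Cauchy (\<lambda>i. s (r i) x)" by blast
  define f where "f = (\<lambda>x. lim (\<lambda>i. s (r i) x))"
  have f_meas[measurable]: "f \<in> borel_measurable M" unfolding f_def by measurable
  have lim: "AE x in M. (\<lambda>i. s (r i) x) \<longlonglongrightarrow> f x"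
    using r(2) by eventually_elim (simp add: f_def Cauchy_convergent_iff convergent_LIMSEQ_iff)
  \<comment> \<open>Fatou along the subsequence; the shift puts all indices \<open>r (k + N)\<close>
    beyond N.\<close>
  have key: "integrable M (\<lambda>x. (norm (s n x - f x))\<^sup>2) \<and> (LINT x|M. (norm (s n x - f x))\<^sup>2) \<le> e\<^sup>2"
    if N: "\<And>i j. i \<ge> N \<Longrightarrow> j \<ge> N \<Longrightarrow> l2_norm M (\<lambda>x. s i x - s j x) < e" and n: "n \<ge> N" for N n e
  proof -
    have e: "e \<ge> 0" using N[OF n n] l2_norm_nonneg[of M] order_le_less_trans less_imp_le by blast
    have A: "integrable M (\<lambda>x. (norm (s n x - s (r (k + N)) x))\<^sup>2)" for k
      using sq_int_diff[OF s s] by (simp add: sq_int_def)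
    have B: "(LINT x|M. (norm (s n x - s (r (k + N)) x))\<^sup>2) \<le> e\<^sup>2" for k
    proof -
      have "r (k + N) \<ge> N" using seq_suble[OF r(1), of "k + N"] by linarith
      hence "l2_norm M (\<lambda>x. s n x - s (r (k + N)) x) \<le> e" using N n by force
      thus ?thesis by (metis l2_norm_sq l2_norm_nonneg power_mono)
    qed
    have C: "AE x in M. (\<lambda>k. (norm (s n x - s (r (k + N)) x))\<^sup>2) \<longlonglongrightarrow> (norm (s n x - f x))\<^sup>2"
      using lim
    proof eventually_elim
      case (elim x)
      have "(\<lambda>k. s (r (k + N)) x) \<longlonglongrightarrow> f x" by (rule LIMSEQ_ignore_initial_segment[OF elim])
      thus ?case by (intro tendsto_intros)
    qed
    have D: "(\<lambda>x. (norm (s n x - f x))\<^sup>2) \<in> borel_measurable M" by measurable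
    show ?thesis
      using integral_fatou_bound[where g = "\<lambda>k x. (norm (s n x - s (r (k + N)) x))\<^sup>2", OF A _ D C B] by simp
  qed
  obtain N1 where N1: "\<And>i j. i \<ge> N1 \<Longrightarrow> j \<ge> N1 \<Longrightarrow> l2_norm M (\<lambda>x. s i x - s j x) < 1"
    using Cauchy[of 1] by auto
  have "sq_int M (\<lambda>x. s N1 x - f x)" using key[OF N1, of N1] by (simp add: sq_int_def)
  \<comment> \<open>f is recovered as s N1 minus the square integrable function s N1 - f.\<close>
  from sq_int_diff[OF s[of N1] this] have f: "sq_int M f" by simp
  have "(\<lambda>n. l2_norm M (\<lambda>x. s n x - f x)) \<longlonglongrightarrow> 0"
  proof (rule LIMSEQ_I)
    fix e :: real assume e: "e > 0"
    obtain N where N: "\<And>i j. i \<ge> N \<Longrightarrow> j \<ge> N \<Longrightarrow> l2_norm M (\<lambda>x. s i x - s j x) < e / 2"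
      using Cauchy[of "e / 2"] e by auto
    have "norm (l2_norm M (\<lambda>x. s n x - f x) - 0) < e" if "n \<ge> N" for n
    proof -
      have "l2_norm M (\<lambda>x. s n x - f x) \<le> sqrt ((e / 2)\<^sup>2)"
        unfolding l2_norm_def using key[OF N that] by (intro real_sqrt_le_mono) auto
      thus ?thesis using e l2_norm_nonneg[of M "\<lambda>x. s n x - f x"] by simp
    qed
    thus "\<exists>no. \<forall>n\<ge>no. norm (l2_norm M (\<lambda>x. s n x - f x) - 0) < e" by blast
  qed
  with f show ?thesis by (rule that)
qed

text \<open>L2 convergence gives L1 convergence on a finite measure. The pointwise limits obtained
  here feed Fatou's lemma and the Brezis-Lieb argument.\<close>

lemma (in finite_measure) l2_AE_subseq:
  fixes s :: "nat \<Rightarrow> 'a \<Rightarrow> 'b::euclidean_space"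
  assumes s: "\<And>n. sq_int M (s n)" and f: "sq_int M f"
    and lim: "(\<lambda>n. l2_norm M (\<lambda>x. s n x - f x)) \<longlonglongrightarrow> 0"
  obtains r where "strict_mono r" "AE x in M. (\<lambda>n. s (r n) x) \<longlonglongrightarrow> f x"
proof -
  have d: "sq_int M (\<lambda>x. s n x - f x)" for n by (rule sq_int_diff[OF s f])
  have int: "integrable M (\<lambda>x. s n x - f x)" for n
    using sq_int_integrable_norm(1)[OF d] d by (simp add: integrable_norm_iff sq_int_def)
  have "(\<lambda>n. LINT x|M. norm (s n x - f x)) \<longlonglongrightarrow> 0"
  proof (rule tendsto_sandwich[OF _ _ tendsto_const])
    show "(\<lambda>n. sqrt (measure M (space M)) * l2_norm M (\<lambda>x. s n x - f x)) \<longlonglongrightarrow> 0"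
      using tendsto_mult_left[OF lim] by simp
  qed (use sq_int_integrable_norm(2)[OF d] in auto)
  from tendsto_L1_AE_subseq[OF int this] obtain r where r: "strict_mono r" "AE x in M. (\<lambda>n. s (r n) x - f x) \<longlonglongrightarrow> 0" by blast
  have "AE x in M. (\<lambda>n. s (r n) x) \<longlonglongrightarrow> f x"
    using r(2) by eventually_elim (simp add: LIM_zero_iff)
  with r(1) show ?thesis by (rule that)
qed

text \<open>Each factor is at most the largest of a, b, c, and the exponents add up to p: a crude
  Young inequality.\<close>

lemma powr_three_bound:
  fixes a b c p :: real
  assumes "p > 2" "a \<ge> 0" "b \<ge> 0" "c \<ge> 0"
  shows "a powr (p - 2) * b * c \<le> a powr p + b powr p + c powr p"
proof -
  define m where "m = max a (max b c)"
  have m: "a \<le> m" "b \<le> m" "c \<le> m" "m \<ge> 0" using assms by (auto simp: m_def)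
  have "a powr (p - 2) * b * c \<le> m powr (p - 2) * m * m"
    using assms m by (intro mult_mono powr_mono2) auto
  also have "\<dots> = m powr p"
  proof (cases "m = 0")
    case False
    hence "m > 0" using m by simp
    have "m powr p = m powr (p - 2 + 2)" by simp
    hence "m powr p = m powr (p - 2) * m powr 2" by (simp only: powr_add)
    also have "m powr 2 = m * m" using \<open>m > 0\<close> by (simp add: powr_numeral power2_eq_square)
    finally show ?thesis by simp
  qed (use assms in auto)
  also have "\<dots> \<le> a powr p + b powr p + c powr p"
    unfolding m_def max_def by (auto intro: add_increasing add_increasing2)
  finally show ?thesis .
qed

text \<open>Hoelder's inequality with exponents p/(p-2), p, p up to the factor 3: divide by the
  bounds and apply \<open>powr_three_bound\<close> pointwise. The bounds \<alpha>, \<beta>, \<gamma>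
  are free numbers and not the norms, so that uniform bounds can be inserted directly. The 3 is
  harmless because only Lipschitz constants come out of the inequality.\<close>

lemma Holder_three:
  fixes A B C :: "'x \<Rightarrow> real" and \<alpha> \<beta> \<gamma> p :: real
  assumes p: "p > 2"
    and m[measurable]: "A \<in> borel_measurable M" "B \<in> borel_measurable M" "C \<in> borel_measurable M"
    and nn: "\<And>x. A x \<ge> 0" "\<And>x. B x \<ge> 0" "\<And>x. C x \<ge> 0"
    and int: "integrable M (\<lambda>x. A x powr p)" "integrable M (\<lambda>x. B x powr p)" "integrable M (\<lambda>x. C x powr p)"
    and le: "(LINT x|M. A x powr p) \<le> \<alpha> powr p" "(LINT x|M. B x powr p) \<le> \<beta> powr p" "(LINT x|M. C x powr p) \<le> \<gamma> powr p"
    and pos: "\<alpha> \<ge> 0" "\<beta> \<ge> 0" "\<gamma> \<ge> 0"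
  shows "integrable M (\<lambda>x. A x powr (p - 2) * B x * C x)"
    and "(LINT x|M. A x powr (p - 2) * B x * C x) \<le> 3 * \<alpha> powr (p - 2) * \<beta> * \<gamma>"
proof -
  show I: "integrable M (\<lambda>x. A x powr (p - 2) * B x * C x)"
  proof (rule Bochner_Integration.integrable_bound)
    show "integrable M (\<lambda>x. A x powr p + B x powr p + C x powr p)" using int by simp
    show "AE x in M. norm (A x powr (p - 2) * B x * C x) \<le> norm (A x powr p + B x powr p + C x powr p)"
      using powr_three_bound[OF p nn] nn by (auto simp: abs_mult)
  qed measurable
  \<comment> \<open>A bound equal to 0 cannot be divided by, but it forces its function to vanish
    almost everywhere.\<close>
  have zero: "AE x in M. F x = 0"
    if "(LINT x|M. F x powr p) \<le> \<delta> powr p" "integrable M (\<lambda>x. F x powr p)" "\<delta> = 0" "\<And>x. F x \<ge> 0" for F \<delta>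
  proof -
    have "(LINT x|M. F x powr p) \<ge> 0" by simp
    moreover have "(LINT x|M. F x powr p) \<le> 0" using that(1,3) p by simp
    ultimately have "(LINT x|M. F x powr p) = 0" by (rule antisym[rotated])
    hence "AE x in M. F x powr p = 0" using that(2) by (subst (asm) integral_nonneg_eq_0_iff_AE) auto
    thus ?thesis by eventually_elim simp
  qed
  show "(LINT x|M. A x powr (p - 2) * B x * C x) \<le> 3 * \<alpha> powr (p - 2) * \<beta> * \<gamma>"
  proof (cases "\<alpha> = 0 \<or> \<beta> = 0 \<or> \<gamma> = 0")
    case True
    hence "AE x in M. A x = 0 \<or> B x = 0 \<or> C x = 0"
      using zero[OF le(1) int(1) _ nn(1)] zero[OF le(2) int(2) _ nn(2)] zero[OF le(3) int(3) _ nn(3)] by auto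
    hence "AE x in M. A x powr (p - 2) * B x * C x = 0" by eventually_elim auto
    hence "(LINT x|M. A x powr (p - 2) * B x * C x) = 0" by (rule integral_eq_zero_AE)
    thus ?thesis using pos by simp
  next
    case False
    hence g: "\<alpha> > 0" "\<beta> > 0" "\<gamma> > 0" using pos by auto
    have scale: "(LINT x|M. (F x / \<delta>) powr p) \<le> 1 \<and> integrable M (\<lambda>x. (F x / \<delta>) powr p)"
      if "(LINT x|M. F x powr p) \<le> \<delta> powr p" "integrable M (\<lambda>x. F x powr p)" "\<delta> > 0" "\<And>x. F x \<ge> 0" for F \<delta>
    proof -
      have "(F x / \<delta>) powr p = F x powr p / \<delta> powr p" for x using that by (simp add: powr_divide)
      thus ?thesis using that by (simp add: divide_le_eq)
    qed
    note sA = scale[OF le(1) int(1) g(1) nn(1)] and sB = scale[OF le(2) int(2) g(2) nn(2)] and sC = scale[OF le(3) int(3) g(3) nn(3)]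
    have "A x powr (p - 2) * B x * C x \<le> (\<alpha> powr (p - 2) * \<beta> * \<gamma>) * ((A x / \<alpha>) powr p + (B x / \<beta>) powr p + (C x / \<gamma>) powr p)" for x
    proof -
      have "A x powr (p - 2) * B x * C x = (\<alpha> powr (p - 2) * \<beta> * \<gamma>) * ((A x / \<alpha>) powr (p - 2) * (B x / \<beta>) * (C x / \<gamma>))"
        using g nn by (simp add: powr_divide)
      also have "\<dots> \<le> (\<alpha> powr (p - 2) * \<beta> * \<gamma>) * ((A x / \<alpha>) powr p + (B x / \<beta>) powr p + (C x / \<gamma>) powr p)"
        using g nn by (intro mult_left_mono powr_three_bound p) auto
      finally show ?thesis .
    qed
    hence "(LINT x|M. A x powr (p - 2) * B x * C x) \<le> (LINT x|M. (\<alpha> powr (p - 2) * \<beta> * \<gamma>) * ((A x / \<alpha>) powr p + (B x / \<beta>) powr p + (C x / \<gamma>) powr p))"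
      using I sA sB sC by (intro integral_mono) auto
    also have "\<dots> = (\<alpha> powr (p - 2) * \<beta> * \<gamma>) * ((LINT x|M. (A x / \<alpha>) powr p) + (LINT x|M. (B x / \<beta>) powr p) + (LINT x|M. (C x / \<gamma>) powr p))"
      using sA sB sC by simp
    also have "\<dots> \<le> (\<alpha> powr (p - 2) * \<beta> * \<gamma>) * 3"
      using sA sB sC g by (intro mult_left_mono) auto
    finally show ?thesis by (simp add: mult.commute mult.left_commute)
  qed
qed

section \<open>Uniqueness of weak gradients\<close>

lemma AE_lebesgue_on_notin:
  assumes "S \<in> sets lebesgue" "negligible T"
  shows "AE x in lebesgue_on S. x \<notin> T"
proof -
  have "AE x in lebesgue. x \<notin> T" using assms(2) AE_not_in negligible_iff_null_sets by blast
  thus ?thesis using assms(1) by (subst AE_restrict_space_iff) (auto elim: eventually_mono)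
qed

lemma borel_measurable_lebesgue_on_borel:
  "f \<in> borel_measurable borel \<Longrightarrow> f \<in> borel_measurable (lebesgue_on S)"
  by (intro measurable_restrict_space1 measurable_completion) simp

lemma integrable_indicator_mult:
  fixes f :: "'x \<Rightarrow> real"
  assumes "integrable M f" "A \<inter> space M \<in> sets M"
  shows "integrable M (\<lambda>x. f x * indicator A x)"
proof -
  have "integrable M (\<lambda>x. indicator (A \<inter> space M) x *\<^sub>R f x)"
    using assms by (intro integrable_mult_indicator)
  also have "integrable M (\<lambda>x. indicator (A \<inter> space M) x *\<^sub>R f x) \<longleftrightarrow> integrable M (\<lambda>x. f x * indicator A x)"
    by (rule Bochner_Integration.integrable_cong) (auto simp: indicator_def)
  finally show ?thesis .
qed

lemma borel_inter_sets_lebesgue_on: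
  assumes "S \<in> sets lebesgue" "A \<in> sets borel"
  shows "A \<inter> space (lebesgue_on S) \<in> sets (lebesgue_on S)"
proof -
  have "A \<in> sets lebesgue" using assms(2) by (intro sets_completionI_sets) simp
  hence "S \<inter> A \<in> sets (lebesgue_on S)" by (auto simp: sets_restrict_space)
  thus ?thesis by (simp add: space_restrict_space Int_commute)
qed

context
  fixes \<Omega> :: "'a::euclidean_space set" and f :: "'a \<Rightarrow> real"
  assumes op: "open \<Omega>" and bd: "bounded \<Omega>" and int: "integrable (lebesgue_on \<Omega>) f"
    and ortho: "\<And>\<phi>. test_function \<Omega> \<phi> \<Longrightarrow> (LINT x|lebesgue_on \<Omega>. f x * \<phi> x) = 0"
begin

text \<open>The bumps lie between 0 and 1 and tend to the indicator of the box, so dominated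
  convergence applies with |f|.\<close>

lemma ortho_box:
  assumes "cbox l u \<subseteq> \<Omega>"
  shows "(LINT x|lebesgue_on \<Omega>. f x * indicator (box l u) x) = 0"
proof -
  have bm: "bump n l u \<in> borel_measurable (lebesgue_on \<Omega>)" for n
  proof -
    have "continuous_on UNIV (bump n l u)" using Ck_bump[of 0] by simp
    thus ?thesis by (intro borel_measurable_lebesgue_on_borel borel_measurable_continuous_onI)
  qed
  have "(\<lambda>n. LINT x|lebesgue_on \<Omega>. f x * bump (real (Suc n)) l u x) \<longlonglongrightarrow> (LINT x|lebesgue_on \<Omega>. f x * indicator (box l u) x)"
  proof (rule integral_dominated_convergence[where w = "\<lambda>x. \<bar>f x\<bar>"])
    show "integrable (lebesgue_on \<Omega>) (\<lambda>x. \<bar>f x\<bar>)" using int by simp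
    show "(\<lambda>x. f x * bump (real (Suc n)) l u x) \<in> borel_measurable (lebesgue_on \<Omega>)" for n
      using int bm by (intro borel_measurable_times) auto
    have "indicator (box l u) \<in> borel_measurable (lebesgue_on \<Omega>)"
      by (intro borel_measurable_lebesgue_on_borel borel_measurable_indicator) simp
    thus "(\<lambda>x. f x * indicator (box l u) x) \<in> borel_measurable (lebesgue_on \<Omega>)"
      using int by (intro borel_measurable_times) auto
    show "AE x in lebesgue_on \<Omega>. (\<lambda>n. f x * bump (real (Suc n)) l u x) \<longlonglongrightarrow> f x * indicator (box l u) x"
      by (intro AE_I2 tendsto_mult tendsto_const bump_tendsto_indicator)
    show "AE x in lebesgue_on \<Omega>. norm (f x * bump (real (Suc n)) l u x) \<le> \<bar>f x\<bar>" for n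
    proof (rule AE_I2)
      fix x
      have "\<bar>f x\<bar> * \<bar>bump (real (Suc n)) l u x\<bar> \<le> \<bar>f x\<bar> * 1"
        using bump_bounds[of "real (Suc n)" l u x] by (intro mult_left_mono) (auto simp: abs_le_iff)
      thus "norm (f x * bump (real (Suc n)) l u x) \<le> \<bar>f x\<bar>" by (simp add: abs_mult)
    qed
  qed
  moreover have "(LINT x|lebesgue_on \<Omega>. f x * bump (real (Suc n)) l u x) = 0" for n
    by (rule ortho, rule test_function_bump[OF _ assms]) simp
  ultimately show ?thesis by (simp add: LIMSEQ_const_iff)
qed

text \<open>Boxes form an intersection-stable generator, so the pi-lambda theorem extends
  \<open>ortho_box\<close> to Borel sets. The fixed factor \<open>box l u\<close> keeps everything
  inside a box whose closure is in \<Omega>, where bumps are available; complements are taken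
  relative to it.\<close>

lemma ortho_borel:
  assumes lu: "cbox l u \<subseteq> \<Omega>" and A: "A \<in> sets borel"
  shows "(LINT x|lebesgue_on \<Omega>. f x * indicator (A \<inter> box l u) x) = 0"
proof -
  let ?N = "lebesgue_on \<Omega>"
  let ?G = "range (\<lambda>(a, b). box a b) :: 'a set set"
  have Om: "\<Omega> \<in> sets lebesgue" using op by simp
  have I: "integrable ?N (\<lambda>x. f x * indicator B x)" if "B \<in> sets borel" for B
    by (rule integrable_indicator_mult[OF int borel_inter_sets_lebesgue_on[OF Om that]])
  have "Int_stable ?G"
    by (auto simp: Int_stable_def box_Int_box)
  moreover have "?G \<subseteq> Pow UNIV" by simp
  moreover have bor: "sets (borel :: 'a measure) = sigma_sets UNIV ?G"
    by (subst borel_eq_box) (simp add: sets_measure_of)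
  have "A \<in> sigma_sets UNIV ?G" using A bor by simp
  ultimately show ?thesis
  proof (induction rule: sigma_sets_induct_disjoint)
    case (basic A)
    then obtain a b where ab: "A \<inter> box l u = box a b" by (auto simp: box_Int_box)
    show ?case
    proof (cases "box a b = {}")
      case False
      \<comment> \<open>The generating boxes are arbitrary, but their trace on
        \<open>box l u\<close> is a box with closure in \<Omega>.\<close>
      have "closure (box a b) \<subseteq> closure (box l u)" using ab by (intro closure_mono) blast
      moreover have "closure (box l u) \<subseteq> cbox l u" by (intro closure_minimal box_subset_cbox closed_cbox)
      ultimately have "cbox a b \<subseteq> \<Omega>" using lu closure_box[OF False] by auto
      thus ?thesis using ab ortho_box by simp
    qed (simp add: ab)
  next
    case empty
    show ?case by simp
  next
    case (compl A)
    hence A: "A \<in> sets borel" using bor by simp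
    have "(LINT x|?N. f x * indicator ((UNIV - A) \<inter> box l u) x)
        = (LINT x|?N. f x * indicator (box l u) x - f x * indicator (A \<inter> box l u) x)"
      by (intro Bochner_Integration.integral_cong) (auto simp: indicator_def)
    also have "\<dots> = (LINT x|?N. f x * indicator (box l u) x) - (LINT x|?N. f x * indicator (A \<inter> box l u) x)"
      using A by (intro Bochner_Integration.integral_diff I) auto
    finally show ?case using compl ortho_box[OF lu] by simp
  next
    case (union A)
    have A: "A i \<in> sets borel" for i using union(2) bor by auto
    have "(\<lambda>n. LINT x|?N. f x * indicator ((\<Union>i<n. A i) \<inter> box l u) x) \<longlonglongrightarrow> (LINT x|?N. f x * indicator ((\<Union>i. A i) \<inter> box l u) x)"
    proof (rule integral_dominated_convergence[where w = "\<lambda>x. \<bar>f x\<bar>"])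
      show "integrable ?N (\<lambda>x. \<bar>f x\<bar>)" using int by simp
      show "(\<lambda>x. f x * indicator ((\<Union>i<n. A i) \<inter> box l u) x) \<in> borel_measurable ?N" for n
        using I[of "(\<Union>i<n. A i) \<inter> box l u"] A by (auto dest: borel_measurable_integrable)
      show "(\<lambda>x. f x * indicator ((\<Union>i. A i) \<inter> box l u) x) \<in> borel_measurable ?N"
        using I[of "(\<Union>i. A i) \<inter> box l u"] A by (auto dest: borel_measurable_integrable)
      show "AE x in ?N. (\<lambda>n. f x * indicator ((\<Union>i<n. A i) \<inter> box l u) x) \<longlonglongrightarrow> f x * indicator ((\<Union>i. A i) \<inter> box l u) x"
        unfolding indicator_inter_arith
        by (intro AE_I2 tendsto_mult tendsto_const LIMSEQ_indicator_UN)
      show "AE x in ?N. norm (f x * indicator ((\<Union>i<n. A i) \<inter> box l u) x) \<le> \<bar>f x\<bar>" for n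
        by (intro AE_I2) (simp add: indicator_def)
    qed
    moreover have "(LINT x|?N. f x * indicator ((\<Union>i<n. A i) \<inter> box l u) x) = 0" for n
    proof (induction n)
      case (Suc n)
      have disj: "A n \<inter> (\<Union>i<n. A i) = {}" 
      proof -
        have "A n \<inter> A i = {}" if "i < n" for i
          using disjoint_family_onD[OF union(1), of n i] that by simp
        thus ?thesis by blast
      qed
      have "(LINT x|?N. f x * indicator ((\<Union>i<Suc n. A i) \<inter> box l u) x)
          = (LINT x|?N. f x * indicator ((\<Union>i<n. A i) \<inter> box l u) x + f x * indicator (A n \<inter> box l u) x)"
      proof (intro Bochner_Integration.integral_cong refl)
        fix x
        show "f x * indicator ((\<Union>i<Suc n. A i) \<inter> box l u) x
            = f x * indicator ((\<Union>i<n. A i) \<inter> box l u) x + f x * indicator (A n \<inter> box l u) x"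
          using disj by (auto simp: indicator_def lessThan_Suc)
      qed
      also have "\<dots> = (LINT x|?N. f x * indicator ((\<Union>i<n. A i) \<inter> box l u) x) + (LINT x|?N. f x * indicator (A n \<inter> box l u) x)"
        using A by (intro Bochner_Integration.integral_add I) auto
      finally show ?case using Suc union(3)[of n] by simp
    qed simp
    ultimately show ?case by (simp add: LIMSEQ_const_iff)
  qed
qed

text \<open>A function with zero integral over every measurable set vanishes almost everywhere. The
  measurable sets are Lebesgue sets here; each is an F-sigma set up to a null set, and F-sigma sets
  are covered by \<open>ortho_borel\<close>.\<close>

lemma ortho_AE_cbox:
  assumes lu: "cbox l u \<subseteq> \<Omega>"
  shows "AE x in lebesgue_on \<Omega>. x \<in> cbox l u \<longrightarrow> f x = 0"
proof -
  let ?N = "lebesgue_on \<Omega>"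
  have Om: "\<Omega> \<in> sets lebesgue" using op by simp
  have "finite_measure ?N" using bd op by (intro finite_measure_lebesgue_on) (rule lmeasurable_open)
  then interpret N: finite_measure ?N .
  have "AE x in ?N. f x * indicator (box l u) x = 0"
  proof (rule N.density_zero)
    show "integrable ?N (\<lambda>x. f x * indicator (box l u) x)"
      by (rule integrable_indicator_mult[OF int borel_inter_sets_lebesgue_on[OF Om]]) simp
    fix A assume "A \<in> sets ?N"
    hence "A \<in> sets lebesgue" using Om by (auto simp: sets_restrict_space)
    then obtain C T where CT: "fsigma C" "T \<in> null_sets lebesgue" "C \<union> T = A"
      by (rule lebesgue_set_almost_fsigma) blast
    have C: "C \<in> sets borel"
      using CT(1)
    proof (cases rule: fsigma.cases)
      case (1 F)
      thus ?thesis by (auto intro!: sets.countable_UN borel_closed)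
    qed
    have "set_lebesgue_integral ?N A (\<lambda>x. f x * indicator (box l u) x) = (LINT x|?N. f x * indicator (C \<inter> box l u) x)"
      unfolding set_lebesgue_integral_def
    proof (rule integral_cong_AE)
      show "AE x in ?N. indicator A x *\<^sub>R (f x * indicator (box l u) x) = f x * indicator (C \<inter> box l u) x"
        using AE_lebesgue_on_notin[OF Om CT(2)[folded negligible_iff_null_sets]] by eventually_elim (use CT(3) in \<open>auto simp: indicator_def\<close>)
      have "integrable ?N (\<lambda>x. f x * indicator (C \<inter> box l u) x)"
        by (rule integrable_indicator_mult[OF int borel_inter_sets_lebesgue_on[OF Om]]) (use C in auto)
      thus "(\<lambda>x. f x * indicator (C \<inter> box l u) x) \<in> borel_measurable ?N" by simp
      have "integrable ?N (\<lambda>x. f x * indicator (box l u) x)"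
        by (rule integrable_indicator_mult[OF int borel_inter_sets_lebesgue_on[OF Om]]) simp
      thus "(\<lambda>x. indicator A x *\<^sub>R (f x * indicator (box l u) x)) \<in> borel_measurable ?N"
        using \<open>A \<in> sets ?N\<close> by (intro borel_measurable_scaleR borel_measurable_indicator) auto
    qed
    also have "\<dots> = 0" by (rule ortho_borel[OF lu C])
    finally show "set_lebesgue_integral ?N A (\<lambda>x. f x * indicator (box l u) x) = 0" .
  qed
  moreover have "AE x in ?N. x \<notin> cbox l u - box l u"
    by (rule AE_lebesgue_on_notin[OF Om negligible_frontier_interval])
  ultimately show ?thesis by eventually_elim auto
qed

text \<open>The fundamental lemma of the calculus of variations. An open set is a countable union of
  closed boxes, so the exceptional null sets can be united.\<close>

lemma test_function_ortho_AE_zero: "AE x in lebesgue_on \<Omega>. f x = 0"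
proof -
  obtain \<D> where D: "countable \<D>" "\<D> \<subseteq> Pow \<Omega>" "\<And>X. X \<in> \<D> \<Longrightarrow> \<exists>a b. X = cbox a b" "\<Union>\<D> = \<Omega>"
    by (rule open_countable_Union_open_cbox[OF op]) blast
  have "AE x in lebesgue_on \<Omega>. \<forall>X\<in>\<D>. x \<in> X \<longrightarrow> f x = 0"
  proof (subst AE_ball_countable[OF D(1)], rule ballI)
    fix X assume X: "X \<in> \<D>"
    then obtain a b where "X = cbox a b" using D(3) by blast
    thus "AE x in lebesgue_on \<Omega>. x \<in> X \<longrightarrow> f x = 0" using ortho_AE_cbox[of a b] X D(2) by auto
  qed
  moreover have "AE x in lebesgue_on \<Omega>. x \<in> \<Omega>" using op by (intro AE_I2) simp
  ultimately show ?thesis by eventually_elim (use D(4) in blast)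
qed

end

section \<open>Integration by parts for test functions\<close>

text \<open>The bridge between two measures: the spaces live on \<open>lebesgue_on \<Omega>\<close>,
  whereas translations need the whole space and \<open>lborel\<close>.\<close>

lemma LINT_lebesgue_on_eq_lborel:
  fixes f :: "'a::euclidean_space \<Rightarrow> real"
  assumes "S \<in> sets lebesgue" "f \<in> borel_measurable borel" "\<And>x. x \<notin> S \<Longrightarrow> f x = 0"
  shows "(LINT x|lebesgue_on S. f x) = (LINT x|lborel. f x)"
proof -
  have "(LINT x|lebesgue_on S. f x) = (LINT x|lebesgue. indicator S x *\<^sub>R f x)"
    using assms(1) by (intro integral_restrict_space) simp
  also have "\<dots> = (LINT x|lebesgue. f x)"
    by (intro Bochner_Integration.integral_cong) (auto simp: indicator_def assms(3))
  also have "\<dots> = (LINT x|lborel. f x)" using assms(2) by (intro integral_completion) simp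
  finally show ?thesis .
qed

lemma test_function_borel: "test_function \<Omega> \<phi> \<Longrightarrow> \<phi> \<in> borel_measurable borel"
  by (rule borel_measurable_continuous_onI[OF test_function_continuous])

lemma grad_borel: "test_function \<Omega> \<phi> \<Longrightarrow> grad \<phi> \<in> borel_measurable borel"
  by (rule borel_measurable_continuous_onI[OF grad_continuous])

lemma grad_bounded:
  assumes "test_function \<Omega> \<phi>"
  obtains B where "\<And>x. norm (grad \<phi> x) \<le> B" "B \<ge> 0"
proof -
  have "\<exists>B. \<forall>x. \<bar>partial_deriv i \<phi> x\<bar> \<le> B" if "i \<in> Basis" for i
    by (rule test_function_bounded[OF test_function_partial_deriv[OF assms that]]) auto
  then obtain B where B: "\<And>i x. i \<in> Basis \<Longrightarrow> \<bar>partial_deriv i \<phi> x\<bar> \<le> B i" by metis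
  have *: "norm (grad \<phi> x) \<le> (\<Sum>i\<in>Basis. B i)" for x
  proof -
    have "norm (grad \<phi> x) \<le> (\<Sum>i\<in>Basis. \<bar>grad \<phi> x \<bullet> i\<bar>)" by (rule norm_le_l1)
    also have "\<dots> \<le> (\<Sum>i\<in>Basis. B i)" by (rule sum_mono) (simp add: grad_inner_Basis B)
    finally show ?thesis .
  qed
  have "0 \<le> (\<Sum>i\<in>Basis. B i)" using *[of 0] norm_ge_zero order_trans by blast
  with * show ?thesis by (rule that)
qed

lemma integral_lborel_shift:
  fixes f :: "'a::euclidean_space \<Rightarrow> real"
  assumes "f \<in> borel_measurable borel"
  shows "(LINT x|lborel. f (h + x)) = (LINT x|lborel. f x)"
proof -
  have "(LINT x|lborel. f x) = (LINT x|distr lborel borel ((+) h). f x)" by (simp add: lborel_distr_plus)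
  also have "\<dots> = (LINT x|lborel. f (h + x))" using assms by (intro integral_distr) auto
  finally show ?thesis by simp
qed

lemma nn_integral_lborel_shift:
  fixes f :: "'a::euclidean_space \<Rightarrow> ennreal"
  assumes "f \<in> borel_measurable borel"
  shows "(\<integral>\<^sup>+x. f (h + x) \<partial>lborel) = (\<integral>\<^sup>+x. f x \<partial>lborel)"
proof -
  have "(\<integral>\<^sup>+x. f x \<partial>lborel) = (\<integral>\<^sup>+x. f x \<partial>distr lborel borel ((+) h))" by (simp add: lborel_distr_plus)
  also have "\<dots> = (\<integral>\<^sup>+x. f (h + x) \<partial>lborel)" using assms by (intro nn_integral_distr) auto
  finally show ?thesis by simp
qed

lemma bounded_cball_cover:
  fixes K :: "'a::real_normed_vector set"
  assumes "bounded K"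
  obtains R where "K \<subseteq> cball 0 R"
proof -
  obtain R where "\<forall>x\<in>K. norm x \<le> R" using assms unfolding bounded_iff by blast
  thus ?thesis by (intro that[of R]) auto
qed

lemma integrable_lborel_bounded_support:
  fixes f :: "'a::euclidean_space \<Rightarrow> real"
  assumes "f \<in> borel_measurable borel" "\<And>x. \<bar>f x\<bar> \<le> B" "bounded K" "\<And>x. x \<notin> K \<Longrightarrow> f x = 0"
  shows "integrable lborel f"
proof -
  obtain R where R: "K \<subseteq> cball 0 R" by (rule bounded_cball_cover[OF assms(3)]) blast
  show ?thesis
  proof (rule Bochner_Integration.integrable_bound)
    show "integrable lborel (\<lambda>x. B * indicator (cball 0 R) x :: real)"
      by (intro integrable_mult_right integrable_real_indicator emeasure_lborel_cball_finite) simp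
    show "AE x in lborel. norm (f x) \<le> norm (B * indicator (cball 0 R) x :: real)"
    proof (rule AE_I2)
      fix x show "norm (f x) \<le> norm (B * indicator (cball 0 R) x :: real)"
      proof (cases "x \<in> cball 0 R")
        case False
        hence "x \<notin> K" using R by blast
        thus ?thesis using assms(4) by simp
      qed (use assms(2)[of x] in auto)
    qed
  qed (use assms(1) in simp)
qed

text \<open>Translation invariance makes the integral of every difference quotient zero. The
  quotients converge to the derivative and are dominated by means of the Lipschitz constant of
  \<phi>.\<close>

lemma test_function_integral_partial_deriv:
  assumes t: "test_function \<Omega> \<phi>" and i: "i \<in> Basis"
  shows "(LINT x|lborel. partial_deriv i \<phi> x) = 0"
proof -
  obtain K where K: "compact K" "K \<subseteq> \<Omega>" "\<And>x. x \<notin> K \<Longrightarrow> \<phi> x = 0" by (rule test_function_supp[OF t]) auto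
  obtain B where B: "\<And>x. norm (grad \<phi> x) \<le> B" "B \<ge> 0" by (rule grad_bounded[OF t]) auto
  obtain C where C: "\<And>x. \<bar>\<phi> x\<bar> \<le> C" by (rule test_function_bounded[OF t]) auto
  obtain R where R: "K \<subseteq> cball 0 R" by (rule bounded_cball_cover[OF compact_imp_bounded[OF K(1)]]) blast
  note [measurable] = test_function_borel[OF t] test_function_borel[OF test_function_partial_deriv[OF t i]]
  have lip: "\<bar>\<phi> x - \<phi> y\<bar> \<le> B * norm (x - y)" for x y
  proof -
    have "norm (\<phi> x - \<phi> y) \<le> B * norm (x - y)"
    proof (rule differentiable_bound[of UNIV])
      show "(\<phi> has_derivative (\<lambda>h. grad \<phi> z \<bullet> h)) (at z within UNIV)" for z
        using test_function_has_derivative[OF t] by simp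
      show "onorm (\<lambda>h. grad \<phi> z \<bullet> h) \<le> B" for z
        by (rule onorm_le) (metis B(1) Cauchy_Schwarz_ineq2 mult_right_mono norm_ge_zero order_trans real_norm_def)
    qed auto
    thus ?thesis by simp
  qed
  have int: "integrable lborel \<phi>"
    by (rule integrable_lborel_bounded_support[OF _ C compact_imp_bounded[OF K(1)] K(3)]) simp
  \<comment> \<open>Steps of length at most 1 keep all supports within
    \<open>cball 0 (R + 1)\<close>.\<close>
  define D where "D = (\<lambda>n x. real (Suc n) * (\<phi> ((1 / real (Suc n)) *\<^sub>R i + x) - \<phi> x))"
  have "(\<lambda>n. LINT x|lborel. D n x) \<longlonglongrightarrow> (LINT x|lborel. partial_deriv i \<phi> x)"
  proof (rule integral_dominated_convergence[where w = "\<lambda>x. B * indicator (cball 0 (R + 1)) x"])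
    show "partial_deriv i \<phi> \<in> borel_measurable lborel" by simp
    show "D n \<in> borel_measurable lborel" for n unfolding D_def by measurable
    show "integrable lborel (\<lambda>x. B * indicator (cball 0 (R + 1)) x :: real)"
      by (intro integrable_mult_right integrable_real_indicator emeasure_lborel_cball_finite) simp
    show "AE x in lborel. (\<lambda>n. D n x) \<longlonglongrightarrow> partial_deriv i \<phi> x"
    proof (rule AE_I2)
      fix x
      have 1: "((\<lambda>t::real. t *\<^sub>R i + x) has_derivative (\<lambda>t. t *\<^sub>R i)) (at 0)"
        by (auto intro!: derivative_eq_intros)
      have "((\<lambda>t. \<phi> (t *\<^sub>R i + x)) has_derivative (\<lambda>t. grad \<phi> x \<bullet> (t *\<^sub>R i))) (at 0)"
        using has_derivative_compose[OF 1, of \<phi> "\<lambda>h. grad \<phi> x \<bullet> h"] test_function_has_derivative[OF t, of x] by simp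
      moreover have "(\<lambda>t. grad \<phi> x \<bullet> (t *\<^sub>R i)) = (*) (partial_deriv i \<phi> x)"
        by (rule ext) (simp add: grad_inner_Basis[OF i])
      ultimately have "((\<lambda>t. \<phi> (t *\<^sub>R i + x)) has_real_derivative partial_deriv i \<phi> x) (at 0)"
        by (simp add: has_field_derivative_def)
      hence "((\<lambda>h. (\<phi> (h *\<^sub>R i + x) - \<phi> x) / h) \<longlongrightarrow> partial_deriv i \<phi> x) (at 0)"
        by (simp add: DERIV_def)
      moreover have "filterlim (\<lambda>n. 1 / real (Suc n)) (at 0) sequentially"
        using LIMSEQ_Suc[OF lim_1_over_n] by (auto simp: filterlim_at)
      ultimately have "(\<lambda>n. (\<phi> ((1 / real (Suc n)) *\<^sub>R i + x) - \<phi> x) / (1 / real (Suc n))) \<longlonglongrightarrow> partial_deriv i \<phi> x"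
        by (rule filterlim_compose)
      moreover have "(\<lambda>n. (\<phi> ((1 / real (Suc n)) *\<^sub>R i + x) - \<phi> x) / (1 / real (Suc n))) = (\<lambda>n. D n x)"
        unfolding D_def by (rule ext) (simp del: of_nat_Suc)
      ultimately show "(\<lambda>n. D n x) \<longlonglongrightarrow> partial_deriv i \<phi> x" by simp
    qed
    show "AE x in lborel. norm (D n x) \<le> B * indicator (cball 0 (R + 1)) x" for n
    proof (rule AE_I2)
      fix x
      have nn: "norm ((1 / real (Suc n)) *\<^sub>R i) = 1 / real (Suc n)" using i by (simp del: of_nat_Suc)
      show "norm (D n x) \<le> B * indicator (cball 0 (R + 1)) x"
      proof (cases "x \<in> cball 0 (R + 1)")
        case True
        have "\<bar>\<phi> ((1 / real (Suc n)) *\<^sub>R i + x) - \<phi> x\<bar> \<le> B * (1 / real (Suc n))"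
          using lip[of "(1 / real (Suc n)) *\<^sub>R i + x" x] nn by (simp del: of_nat_Suc)
        hence "real (Suc n) * \<bar>\<phi> ((1 / real (Suc n)) *\<^sub>R i + x) - \<phi> x\<bar> \<le> real (Suc n) * (B * (1 / real (Suc n)))"
          by (intro mult_left_mono) auto
        thus ?thesis using True unfolding D_def by (simp add: abs_mult del: of_nat_Suc)
      next
        case False
        have "norm x \<le> norm ((1 / real (Suc n)) *\<^sub>R i + x) + norm ((1 / real (Suc n)) *\<^sub>R i)"
          using norm_triangle_ineq4[of "(1 / real (Suc n)) *\<^sub>R i + x" "(1 / real (Suc n)) *\<^sub>R i"] by simp
        moreover have "1 / real (Suc n) \<le> 1" by simp
        moreover have "norm x > R + 1" using False by simp
        ultimately have "norm ((1 / real (Suc n)) *\<^sub>R i + x) > R" "norm x > R"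
          using nn by linarith+
        moreover have "norm y \<le> R" if "y \<in> K" for y using subsetD[OF R that] by simp
        ultimately have "(1 / real (Suc n)) *\<^sub>R i + x \<notin> K" "x \<notin> K"
          by (meson not_le)+
        thus ?thesis using K(3) False by (simp add: D_def)
      qed
    qed
  qed
  moreover have "(LINT x|lborel. D n x) = 0" for n
  proof -
    have i2: "integrable lborel (\<lambda>x. \<phi> ((1 / real (Suc n)) *\<^sub>R i + x))"
    proof -
      have "integrable (distr lborel borel ((+) ((1 / real (Suc n)) *\<^sub>R i))) \<phi>"
        using int by (simp only: lborel_distr_plus)
      thus ?thesis by (subst (asm) integrable_distr_eq) auto
    qed
    have "(LINT x|lborel. D n x) = real (Suc n) * ((LINT x|lborel. \<phi> ((1 / real (Suc n)) *\<^sub>R i + x)) - (LINT x|lborel. \<phi> x))"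
      unfolding D_def using int i2 by (simp del: of_nat_Suc)
    thus ?thesis by (simp add: integral_lborel_shift)
  qed
  ultimately show ?thesis by (simp add: LIMSEQ_const_iff)
qed

text \<open>The product is again a test function, so the integral of its derivative is zero.\<close>

lemma test_function_parts:
  assumes "test_function \<Omega> \<phi>" "test_function \<Omega> \<psi>" "i \<in> Basis"
  shows "(LINT x|lborel. \<phi> x * partial_deriv i \<psi> x) = - (LINT x|lborel. partial_deriv i \<phi> x * \<psi> x)"
proof -
  have I: "integrable lborel (\<lambda>x. \<alpha> x * \<beta> x)" if t: "test_function \<Omega> \<alpha>" "test_function \<Omega> \<beta>" for \<alpha> \<beta> :: "'a \<Rightarrow> real"
  proof -
    obtain K where K: "compact K" "K \<subseteq> \<Omega>" "\<And>x. x \<notin> K \<Longrightarrow> \<alpha> x = 0" by (rule test_function_supp[OF t(1)]) auto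
    obtain A where A: "\<And>x. \<bar>\<alpha> x\<bar> \<le> A" "A > 0" by (rule test_function_bounded[OF t(1)]) auto
    obtain B where B: "\<And>x. \<bar>\<beta> x\<bar> \<le> B" "B > 0" by (rule test_function_bounded[OF t(2)]) auto
    show ?thesis
    proof (rule integrable_lborel_bounded_support[OF _ _ compact_imp_bounded[OF K(1)]])
      show "\<bar>\<alpha> x * \<beta> x\<bar> \<le> A * B" for x
        using A B by (simp add: abs_mult mult_mono)
      show "(\<lambda>x. \<alpha> x * \<beta> x) \<in> borel_measurable borel"
        by (intro borel_measurable_times test_function_borel[OF t(1)] test_function_borel[OF t(2)])
    qed (simp add: K(3))
  qed
  have t: "test_function \<Omega> (\<lambda>x. \<phi> x * \<psi> x)"
    by (rule test_function_mult) (use assms in \<open>auto simp: test_function_def\<close>)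
  have "partial_deriv i (\<lambda>x. \<phi> x * \<psi> x) = (\<lambda>x. \<phi> x * partial_deriv i \<psi> x + partial_deriv i \<phi> x * \<psi> x)"
    by (rule partial_deriv_mult) (use assms test_function_differentiable in blast)+
  hence "0 = (LINT x|lborel. \<phi> x * partial_deriv i \<psi> x + partial_deriv i \<phi> x * \<psi> x)"
    using test_function_integral_partial_deriv[OF t assms(3)] by simp
  also have "\<dots> = (LINT x|lborel. \<phi> x * partial_deriv i \<psi> x) + (LINT x|lborel. partial_deriv i \<phi> x * \<psi> x)"
    by (intro Bochner_Integration.integral_add I assms test_function_partial_deriv)
  finally show ?thesis by simp
qed

section \<open>Translation estimates\<close>

text \<open>Jensen's inequality for the square on the unit interval, read off from the nonnegative
  variance of q about its mean.\<close>

lemma integral_sq_le: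
  fixes q :: "real \<Rightarrow> real"
  assumes "continuous_on {0..1} q"
  shows "(integral {0..1} q)\<^sup>2 \<le> integral {0..1} (\<lambda>t. (q t)\<^sup>2)"
proof -
  define m where "m = integral {0..1} q"
  have i: "q integrable_on {0..1}" "(\<lambda>t. (q t)\<^sup>2) integrable_on {0..1}" "(\<lambda>t. (q t - m)\<^sup>2) integrable_on {0..1}"
    by (intro integrable_continuous_interval continuous_intros assms)+
  have "0 \<le> integral {0..1} (\<lambda>t. (q t - m)\<^sup>2)" by (rule integral_nonneg[OF i(3)]) simp
  also have "\<dots> = integral {0..1} (\<lambda>t. (q t)\<^sup>2 - 2 * m * q t + m\<^sup>2)"
    by (intro integral_cong) (simp add: power2_eq_square algebra_simps)
  also have "\<dots> = integral {0..1} (\<lambda>t. (q t)\<^sup>2) - 2 * m * integral {0..1} q + m\<^sup>2"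
  proof -
    have "((\<lambda>t. (q t)\<^sup>2 - 2 * m * q t + m\<^sup>2) has_integral (integral {0..1} (\<lambda>t. (q t)\<^sup>2) - 2 * m * integral {0..1} q + m\<^sup>2)) {0..1}"
      using has_integral_const_real[of "m\<^sup>2" 0 1]
      by (intro has_integral_add has_integral_diff has_integral_mult_right integrable_integral i) simp
    thus ?thesis by (rule integral_unique)
  qed
  finally show ?thesis unfolding m_def[symmetric] by (simp add: power2_eq_square)
qed

context
  fixes \<psi> :: "'a::euclidean_space \<Rightarrow> real" and g :: "'a \<Rightarrow> 'a"
  assumes der: "\<And>x. (\<psi> has_derivative (\<lambda>h. g x \<bullet> h)) (at x)"
    and cont: "continuous_on UNIV g"
begin

lemma C1_cont: "continuous_on UNIV \<psi>"
  using der has_derivative_continuous by (intro continuous_at_imp_continuous_on) blast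

lemma C1_borel: "\<psi> \<in> borel_measurable borel" "g \<in> borel_measurable borel"
  using C1_cont cont by (auto intro: borel_measurable_continuous_onI)

text \<open>The increment is the integral of the directional derivative along the segment, and
  \<open>integral_sq_le\<close> moves the square inside. The context asks for class C1 because
  truncated test functions have no more regularity than that.\<close>

lemma difference_sq_le: "(\<psi> (x + h) - \<psi> x)\<^sup>2 \<le> (norm h)\<^sup>2 * integral {0..1} (\<lambda>t. (norm (g (x + t *\<^sub>R h)))\<^sup>2)"
proof -
  have c: "continuous_on {0..1} (\<lambda>t::real. g (x + t *\<^sub>R h))"
    by (rule continuous_on_compose2[OF cont]) (auto intro!: continuous_intros)
  have c1: "continuous_on {0..1} (\<lambda>t::real. g (x + t *\<^sub>R h) \<bullet> h)" by (intro continuous_intros c)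
  have "((\<lambda>t. g (x + t *\<^sub>R h) \<bullet> h) has_integral (\<psi> (x + 1 *\<^sub>R h) - \<psi> (x + 0 *\<^sub>R h))) {0..1}"
  proof (rule fundamental_theorem_of_calculus)
    fix t :: real
    have 1: "((\<lambda>t::real. x + t *\<^sub>R h) has_derivative (\<lambda>t. t *\<^sub>R h)) (at t within {0..1})"
      by (auto intro!: derivative_eq_intros)
    have "((\<lambda>t. \<psi> (x + t *\<^sub>R h)) has_derivative (\<lambda>s. g (x + t *\<^sub>R h) \<bullet> (s *\<^sub>R h))) (at t within {0..1})"
      by (rule has_derivative_compose[OF 1 der])
    thus "((\<lambda>t. \<psi> (x + t *\<^sub>R h)) has_vector_derivative g (x + t *\<^sub>R h) \<bullet> h) (at t within {0..1})"
      by (simp add: has_vector_derivative_def)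
  qed simp
  hence "\<psi> (x + h) - \<psi> x = integral {0..1} (\<lambda>t. g (x + t *\<^sub>R h) \<bullet> h)" by (simp add: integral_unique)
  hence "(\<psi> (x + h) - \<psi> x)\<^sup>2 \<le> integral {0..1} (\<lambda>t. (g (x + t *\<^sub>R h) \<bullet> h)\<^sup>2)"
    using integral_sq_le[OF c1] by simp
  also have "\<dots> \<le> integral {0..1} (\<lambda>t. (norm h)\<^sup>2 * (norm (g (x + t *\<^sub>R h)))\<^sup>2)"
  proof (rule integral_le)
    fix t :: real
    have "\<bar>g (x + t *\<^sub>R h) \<bullet> h\<bar> \<le> norm h * norm (g (x + t *\<^sub>R h))"
      by (metis Cauchy_Schwarz_ineq2 mult.commute)
    hence "\<bar>g (x + t *\<^sub>R h) \<bullet> h\<bar>\<^sup>2 \<le> (norm h * norm (g (x + t *\<^sub>R h)))\<^sup>2" by (intro power_mono) auto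
    thus "(g (x + t *\<^sub>R h) \<bullet> h)\<^sup>2 \<le> (norm h)\<^sup>2 * (norm (g (x + t *\<^sub>R h)))\<^sup>2" by (simp add: power_mult_distrib)
  qed (intro integrable_continuous_interval continuous_intros c)+
  finally show ?thesis by simp
qed

text \<open>Integrate the pointwise bound in x, exchange the integrals, and remove the translation
  by t h. Integrals of nonnegative functions make this legitimate even for infinite energy.\<close>

lemma translation_estimate:
  "(\<integral>\<^sup>+x. ennreal ((\<psi> (x + h) - \<psi> x)\<^sup>2) \<partial>lborel) \<le> ennreal ((norm h)\<^sup>2) * (\<integral>\<^sup>+x. ennreal ((norm (g x))\<^sup>2) \<partial>lborel)"
proof -
  note [measurable] = C1_borel
  let ?G = "\<lambda>(x, t::real). indicator {0..1} t * ennreal ((norm (g (x + t *\<^sub>R h)))\<^sup>2)"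
  have G: "?G \<in> borel_measurable (lborel \<Otimes>\<^sub>M lborel)" by measurable
  have 1: "ennreal ((\<psi> (x + h) - \<psi> x)\<^sup>2) \<le> ennreal ((norm h)\<^sup>2) * (\<integral>\<^sup>+t. ?G (x, t) \<partial>lborel)" for x
  proof -
    have c: "continuous_on {0..1} (\<lambda>t::real. g (x + t *\<^sub>R h))"
      by (rule continuous_on_compose2[OF cont]) (auto intro!: continuous_intros)
    have "((\<lambda>t. (norm (g (x + t *\<^sub>R h)))\<^sup>2) has_integral integral {0..1} (\<lambda>t. (norm (g (x + t *\<^sub>R h)))\<^sup>2)) {0..1}"
      by (intro integrable_integral integrable_continuous_interval continuous_intros c)
    hence "((\<lambda>t. if t \<in> {0..1} then (norm (g (x + t *\<^sub>R h)))\<^sup>2 else 0) has_integral integral {0..1} (\<lambda>t. (norm (g (x + t *\<^sub>R h)))\<^sup>2)) UNIV"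
      by (simp only: has_integral_restrict_UNIV)
    moreover have "(\<lambda>t. if t \<in> {0..1} then (norm (g (x + t *\<^sub>R h)))\<^sup>2 else 0) = (\<lambda>t. indicator {0..1} t * (norm (g (x + t *\<^sub>R h)))\<^sup>2)"
      by (auto simp: indicator_def)
    moreover have "(\<lambda>t::real. indicator {0..1} t * (norm (g (x + t *\<^sub>R h)))\<^sup>2) \<in> borel_measurable borel" by measurable
    ultimately have "(\<integral>\<^sup>+t. ennreal (indicator {0..1} t * (norm (g (x + t *\<^sub>R h)))\<^sup>2) \<partial>lborel) = ennreal (integral {0..1} (\<lambda>t. (norm (g (x + t *\<^sub>R h)))\<^sup>2))"
      by (intro nn_integral_has_integral_lborel) auto
    moreover have "(\<integral>\<^sup>+t. ennreal (indicator {0..1} t * (norm (g (x + t *\<^sub>R h)))\<^sup>2) \<partial>lborel) = (\<integral>\<^sup>+t. ?G (x, t) \<partial>lborel)"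
      by (intro nn_integral_cong) (auto simp: indicator_def)
    moreover have "ennreal ((\<psi> (x + h) - \<psi> x)\<^sup>2) \<le> ennreal ((norm h)\<^sup>2 * integral {0..1} (\<lambda>t. (norm (g (x + t *\<^sub>R h)))\<^sup>2))"
      by (intro ennreal_leI difference_sq_le)
    ultimately show ?thesis by (simp add: ennreal_mult')
  qed
  have "(\<integral>\<^sup>+x. ennreal ((\<psi> (x + h) - \<psi> x)\<^sup>2) \<partial>lborel) \<le> (\<integral>\<^sup>+x. ennreal ((norm h)\<^sup>2) * (\<integral>\<^sup>+t. ?G (x, t) \<partial>lborel) \<partial>lborel)"
    by (intro nn_integral_mono 1)
  also have "\<dots> = ennreal ((norm h)\<^sup>2) * (\<integral>\<^sup>+x. (\<integral>\<^sup>+t. ?G (x, t) \<partial>lborel) \<partial>lborel)"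
    by (intro nn_integral_cmult) measurable
  also have "(\<integral>\<^sup>+x. (\<integral>\<^sup>+t. ?G (x, t) \<partial>lborel) \<partial>lborel) = (\<integral>\<^sup>+t. (\<integral>\<^sup>+x. ?G (x, t) \<partial>lborel) \<partial>lborel)"
    using lborel_pair.Fubini'[OF G] by simp
  also have "\<dots> = (\<integral>\<^sup>+t. indicator {0..1::real} t * (\<integral>\<^sup>+x. ennreal ((norm (g x))\<^sup>2) \<partial>lborel) \<partial>lborel)"
  proof (rule nn_integral_cong)
    fix t :: real
    have "(\<integral>\<^sup>+x. ?G (x, t) \<partial>lborel) = indicator {0..1} t * (\<integral>\<^sup>+x. ennreal ((norm (g (x + t *\<^sub>R h)))\<^sup>2) \<partial>lborel)"
      unfolding prod.case by (intro nn_integral_cmult) measurable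
    also have "(\<integral>\<^sup>+x. ennreal ((norm (g (x + t *\<^sub>R h)))\<^sup>2) \<partial>lborel) = (\<integral>\<^sup>+x. ennreal ((norm (g x))\<^sup>2) \<partial>lborel)"
      using nn_integral_lborel_shift[of "\<lambda>x. ennreal ((norm (g x))\<^sup>2)" "t *\<^sub>R h"] by (simp add: add.commute)
    finally show "(\<integral>\<^sup>+x. ?G (x, t) \<partial>lborel) = indicator {0..1} t * (\<integral>\<^sup>+x. ennreal ((norm (g x))\<^sup>2) \<partial>lborel)" .
  qed
  also have "\<dots> = (\<integral>\<^sup>+x. ennreal ((norm (g x))\<^sup>2) \<partial>lborel)"
    by (subst nn_integral_multc) auto
  finally show ?thesis .
qed

text \<open>The translation estimate integrated over |h| < r. Both the level-set recursion and the
  compactness estimate use the gradient in this form.\<close>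

lemma ball_translation_estimate:
  assumes "r > 0"
  shows "(\<integral>\<^sup>+x. (\<integral>\<^sup>+h. indicator (ball 0 r) h * ennreal ((\<psi> (x + h) - \<psi> x)\<^sup>2) \<partial>lborel) \<partial>lborel)
    \<le> emeasure lborel (ball (0::'a) r) * ennreal (r\<^sup>2) * (\<integral>\<^sup>+x. ennreal ((norm (g x))\<^sup>2) \<partial>lborel)"
proof -
  note [measurable] = C1_borel
  let ?F = "\<lambda>(x, h). indicator (ball 0 r) h * ennreal ((\<psi> (x + h) - \<psi> x)\<^sup>2)"
  have [measurable]: "ball (0::'a) r \<in> sets borel" by simp
  have F: "?F \<in> borel_measurable (lborel \<Otimes>\<^sub>M lborel)" by measurable
  have "(\<integral>\<^sup>+x. (\<integral>\<^sup>+h. indicator (ball 0 r) h * ennreal ((\<psi> (x + h) - \<psi> x)\<^sup>2) \<partial>lborel) \<partial>lborel)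
      = (\<integral>\<^sup>+h. (\<integral>\<^sup>+x. indicator (ball 0 r) h * ennreal ((\<psi> (x + h) - \<psi> x)\<^sup>2) \<partial>lborel) \<partial>lborel)"
    using lborel_pair.Fubini'[OF F] by simp
  also have "\<dots> \<le> (\<integral>\<^sup>+h. indicator (ball (0::'a) r) h * (ennreal (r\<^sup>2) * (\<integral>\<^sup>+x. ennreal ((norm (g x))\<^sup>2) \<partial>lborel)) \<partial>lborel)"
  proof (rule nn_integral_mono)
    fix h :: 'a
    have "(\<integral>\<^sup>+x. indicator (ball 0 r) h * ennreal ((\<psi> (x + h) - \<psi> x)\<^sup>2) \<partial>lborel) = indicator (ball 0 r) h * (\<integral>\<^sup>+x. ennreal ((\<psi> (x + h) - \<psi> x)\<^sup>2) \<partial>lborel)"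
      by (intro nn_integral_cmult) measurable
    also have "\<dots> \<le> indicator (ball 0 r) h * (ennreal ((norm h)\<^sup>2) * (\<integral>\<^sup>+x. ennreal ((norm (g x))\<^sup>2) \<partial>lborel))"
      by (intro mult_left_mono translation_estimate) simp
    also have "\<dots> \<le> indicator (ball 0 r) h * (ennreal (r\<^sup>2) * (\<integral>\<^sup>+x. ennreal ((norm (g x))\<^sup>2) \<partial>lborel))"
    proof (cases "h \<in> ball 0 r")
      case True
      hence "(norm h)\<^sup>2 \<le> r\<^sup>2" by (intro power_mono) auto
      thus ?thesis by (intro mult_left_mono mult_right_mono ennreal_leI) auto
    qed simp
    finally show "(\<integral>\<^sup>+x. indicator (ball 0 r) h * ennreal ((\<psi> (x + h) - \<psi> x)\<^sup>2) \<partial>lborel)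
      \<le> indicator (ball 0 r) h * (ennreal (r\<^sup>2) * (\<integral>\<^sup>+x. ennreal ((norm (g x))\<^sup>2) \<partial>lborel))" .
  qed
  also have "\<dots> = emeasure lborel (ball (0::'a) r) * ennreal (r\<^sup>2) * (\<integral>\<^sup>+x. ennreal ((norm (g x))\<^sup>2) \<partial>lborel)"
    by (subst nn_integral_multc) (auto simp: mult.assoc)
  finally show ?thesis .
qed

text \<open>A has at most half the measure of the ball of radius r, so from each x in A' at least
  half of the displacements h lead out of A. There \<psi> drops from m to 0, at a cost of m^2 per
  displacement, and the translation estimate bounds the total cost by the energy.\<close>

lemma level_step:
  assumes A[measurable]: "A \<in> sets borel" and A'[measurable]: "A' \<in> sets borel"
    and fin: "emeasure lborel A < \<infinity>" and sub: "A' \<subseteq> A"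
    and val: "\<And>x. x \<in> A' \<Longrightarrow> \<psi> x = m" "\<And>x. x \<notin> A \<Longrightarrow> \<psi> x = 0"
    and r: "r > 0" "2 * measure lborel A \<le> measure lborel (ball (0::'a) r)"
    and E: "(\<integral>\<^sup>+x. ennreal ((norm (g x))\<^sup>2) \<partial>lborel) \<le> ennreal e" "e \<ge> 0"
  shows "m\<^sup>2 * measure lborel A' \<le> 2 * r\<^sup>2 * e"
proof -
  note [measurable] = C1_borel
  define B where "B = measure lborel (ball (0::'a) r)"
  have Bpos: "B > 0" using content_ball_pos[OF r(1)] by (simp add: B_def)
  have emB: "emeasure lborel (ball (0::'a) r) = ennreal B"
    unfolding B_def using emeasure_lborel_ball_finite[of "0::'a" r] by (intro emeasure_eq_ennreal_measure) auto
  have emA: "emeasure lborel A = ennreal (measure lborel A)"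
    using fin by (intro emeasure_eq_ennreal_measure) auto
  have "emeasure lborel A' \<le> emeasure lborel A" using sub by (intro emeasure_mono) auto
  hence emA': "emeasure lborel A' = ennreal (measure lborel A')"
    using fin by (intro emeasure_eq_ennreal_measure) auto
  \<comment> \<open>The translate of A by -x has the measure of A, so removing it leaves at least
    half of the ball.\<close>
  have half: "ennreal (B / 2) \<le> emeasure lborel {h \<in> ball 0 r. x + h \<notin> A}" for x
  proof -
    have m1[measurable]: "{h. x + h \<in> A} \<in> sets borel" by measurable
    have "emeasure lborel {h. x + h \<in> A} = emeasure (distr lborel borel ((+) x)) A"
      by (subst emeasure_distr) (auto simp: vimage_def)
    hence eA: "emeasure lborel {h. x + h \<in> A} = ennreal (measure lborel A)" by (simp add: lborel_distr_plus emA)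
    have m2: "{h \<in> ball 0 r. x + h \<notin> A} \<in> sets lborel" by measurable
    have "ennreal B \<le> emeasure lborel ({h \<in> ball 0 r. x + h \<notin> A} \<union> {h. x + h \<in> A})"
      unfolding emB[symmetric] by (intro emeasure_mono) (use m1 m2 in auto)
    also have "\<dots> \<le> emeasure lborel {h \<in> ball 0 r. x + h \<notin> A} + emeasure lborel {h. x + h \<in> A}"
      by (intro emeasure_subadditive) (use m1 m2 in auto)
    also have "\<dots> \<le> emeasure lborel {h \<in> ball 0 r. x + h \<notin> A} + ennreal (B / 2)"
      unfolding eA using r(2) by (intro add_left_mono ennreal_leI) (simp add: B_def)
    finally have le: "ennreal B \<le> emeasure lborel {h \<in> ball 0 r. x + h \<notin> A} + ennreal (B / 2)" .
    have "emeasure lborel {h \<in> ball 0 r. x + h \<notin> A} \<le> emeasure lborel (ball (0::'a) r)"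
      by (intro emeasure_mono) auto
    hence "emeasure lborel {h \<in> ball 0 r. x + h \<notin> A} < \<infinity>" unfolding emB by (simp add: order_le_less_trans)
    then obtain z where z: "emeasure lborel {h \<in> ball 0 r. x + h \<notin> A} = ennreal z" "z \<ge> 0"
      by (cases "emeasure lborel {h \<in> ball 0 r. x + h \<notin> A}") auto
    have "ennreal B \<le> ennreal (z + B / 2)" using le z Bpos by (simp add: ennreal_plus)
    hence "B \<le> z + B / 2" using z Bpos by (subst (asm) ennreal_le_iff) auto
    thus ?thesis using z by (simp add: ennreal_leI)
  qed
  have "ennreal (m\<^sup>2 * (B / 2) * measure lborel A') = (\<integral>\<^sup>+x. ennreal (m\<^sup>2) * ennreal (B / 2) * indicator A' x \<partial>lborel)"
    using Bpos by (subst nn_integral_cmult_indicator) (auto simp: emA' ennreal_mult[symmetric])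
  also have "\<dots> \<le> (\<integral>\<^sup>+x. (\<integral>\<^sup>+h. indicator (ball 0 r) h * ennreal ((\<psi> (x + h) - \<psi> x)\<^sup>2) \<partial>lborel) \<partial>lborel)"
  proof (rule nn_integral_mono)
    fix x
    show "ennreal (m\<^sup>2) * ennreal (B / 2) * indicator A' x \<le> (\<integral>\<^sup>+h. indicator (ball 0 r) h * ennreal ((\<psi> (x + h) - \<psi> x)\<^sup>2) \<partial>lborel)"
    proof (cases "x \<in> A'")
      case True
      have "ennreal (m\<^sup>2) * ennreal (B / 2) * indicator A' x \<le> ennreal (m\<^sup>2) * emeasure lborel {h \<in> ball 0 r. x + h \<notin> A}"
        using half[of x] True by (simp add: mult_left_mono)
      also have "\<dots> = (\<integral>\<^sup>+h. ennreal (m\<^sup>2) * indicator {h \<in> ball 0 r. x + h \<notin> A} h \<partial>lborel)"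
        by (subst nn_integral_cmult_indicator) auto
      also have "\<dots> \<le> (\<integral>\<^sup>+h. indicator (ball 0 r) h * ennreal ((\<psi> (x + h) - \<psi> x)\<^sup>2) \<partial>lborel)"
        by (intro nn_integral_mono) (auto simp: indicator_def val(1)[OF True] val(2))
      finally show ?thesis .
    qed simp
  qed
  also have "\<dots> \<le> ennreal B * ennreal (r\<^sup>2) * (\<integral>\<^sup>+x. ennreal ((norm (g x))\<^sup>2) \<partial>lborel)"
    using ball_translation_estimate[OF r(1)] by (simp add: emB)
  also have "\<dots> \<le> ennreal B * ennreal (r\<^sup>2) * ennreal e" by (intro mult_left_mono E) simp
  also have "\<dots> = ennreal (B * r\<^sup>2 * e)" using Bpos E(2) by (simp add: ennreal_mult)
  finally have "m\<^sup>2 * (B / 2) * measure lborel A' \<le> B * r\<^sup>2 * e"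
    using Bpos E(2) by (subst (asm) ennreal_le_iff) auto
  hence "B * (m\<^sup>2 * measure lborel A') \<le> B * (2 * r\<^sup>2 * e)" by (simp add: algebra_simps)
  thus ?thesis using Bpos by simp
qed

end

section \<open>Truncations\<close>

lemma DERIV_max0_sq: "((\<lambda>x. (max 0 x)\<^sup>2) has_real_derivative 2 * max 0 x) (at x)"
proof -
  consider "x > 0" | "x < 0" | "x = 0" by linarith
  thus ?thesis
  proof cases
    case 1
    have "((\<lambda>x. x\<^sup>2) has_real_derivative 2 * max 0 x) (at x)" using 1 by (auto intro!: derivative_eq_intros)
    moreover have "\<forall>\<^sub>F y in nhds x. y\<^sup>2 = (max 0 y)\<^sup>2"
      using eventually_nhds_in_open[of "{0<..}" x] 1 by (auto elim!: eventually_mono)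
    ultimately show ?thesis by (rule DERIV_transfer_ev)
  next
    case 2
    have "((\<lambda>x. 0) has_real_derivative 2 * max 0 x) (at x)" using 2 by auto
    moreover have "\<forall>\<^sub>F y in nhds x. 0 = (max 0 y)\<^sup>2"
      using eventually_nhds_in_open[of "{..<0}" x] 2 by (auto elim!: eventually_mono)
    ultimately show ?thesis by (rule DERIV_transfer_ev)
  next
    case 3
    have "((\<lambda>h::real. max 0 h) \<longlongrightarrow> max 0 0) (at 0)" by (intro tendsto_intros)
    moreover have "\<forall>\<^sub>F h in at (0::real). max 0 h = (max 0 h)\<^sup>2 / h"
      by (auto simp: eventually_at_filter max_def power2_eq_square)
    ultimately have "((\<lambda>h::real. (max 0 h)\<^sup>2 / h) \<longlongrightarrow> max 0 0) (at 0)"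
      by (rule Lim_transform_eventually)
    thus ?thesis using 3 by (simp add: DERIV_def)
  qed
qed

text \<open>A second difference of the squared positive part, hence a step of class $C^1$ with bounded derivative.\<close>

definition ramp :: "real \<Rightarrow> real" where
  "ramp y = ((max 0 (y - 1))\<^sup>2 - 2 * (max 0 (y - 2))\<^sup>2 + (max 0 (y - 3))\<^sup>2) / 2"

text \<open>The derivative of \<open>ramp\<close>: a tent over [1, 3] with value 1 at 2. Its area 1
  is the total rise of \<open>ramp\<close>.\<close>

definition hat :: "real \<Rightarrow> real" where
  "hat y = max 0 (y - 1) - 2 * max 0 (y - 2) + max 0 (y - 3)"

lemma ramp_deriv: "(ramp has_real_derivative hat y) (at y)"
proof -
  have d: "((\<lambda>y. (max 0 (y - c))\<^sup>2) has_real_derivative 2 * max 0 (y - c)) (at y)" for c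
  proof -
    have "((\<lambda>y. y - c) has_real_derivative 1) (at y)" by (auto intro!: derivative_eq_intros)
    from DERIV_chain2[OF DERIV_max0_sq this] show ?thesis by simp
  qed
  show ?thesis unfolding ramp_def[abs_def] hat_def
    by (rule DERIV_cong[OF DERIV_cdivide[OF DERIV_add[OF DERIV_diff[OF d DERIV_cmult[OF d]] d]]]) simp
qed

lemma ramp_0: "y \<le> 1 \<Longrightarrow> ramp y = 0" by (simp add: ramp_def max_def)
lemma ramp_1: "y \<ge> 3 \<Longrightarrow> ramp y = 1" by (simp add: ramp_def max_def power2_eq_square algebra_simps)
lemma hat_bounds: "0 \<le> hat y" "hat y \<le> 1" by (auto simp: hat_def max_def)
lemma hat_0: "y \<le> 1 \<or> y \<ge> 3 \<Longrightarrow> hat y = 0" by (auto simp: hat_def max_def)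

text \<open>The square avoids absolute values and keeps class C1 at s = 0. The rise from 0 to 2^k
  takes place while |s| runs from 2^k to sqrt 3 times 2^k, hence before 2^(k+1).\<close>

definition trunc :: "nat \<Rightarrow> real \<Rightarrow> real" where "trunc k s = 2 ^ k * ramp (s\<^sup>2 / 4 ^ k)"
definition trunc' :: "nat \<Rightarrow> real \<Rightarrow> real" where "trunc' k s = 2 ^ k * hat (s\<^sup>2 / 4 ^ k) * (2 * s / 4 ^ k)"

lemma trunc_deriv: "(trunc k has_real_derivative trunc' k s) (at s)"
proof -
  have "((\<lambda>s. ramp (s\<^sup>2 / 4 ^ k)) has_real_derivative hat (s\<^sup>2 / 4 ^ k) * (2 * s / 4 ^ k)) (at s)"
    by (rule DERIV_chain2[OF ramp_deriv]) (auto intro!: derivative_eq_intros)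
  from DERIV_cmult[OF this, of "2 ^ k"] show ?thesis
    unfolding trunc_def[abs_def] trunc'_def by (simp add: mult.assoc)
qed

lemma four_power: "(4::real) ^ k = (2 ^ k)\<^sup>2"
  using power_mult_distrib[of "2::real" 2 k] by (simp add: power2_eq_square)

lemma trunc_0: "\<bar>s\<bar> \<le> 2 ^ k \<Longrightarrow> trunc k s = 0"
  unfolding trunc_def by (subst ramp_0) (auto simp: four_power abs_le_square_iff[symmetric])

lemma trunc_1: "\<bar>s\<bar> \<ge> 2 ^ Suc k \<Longrightarrow> trunc k s = 2 ^ k"
proof -
  assume "\<bar>s\<bar> \<ge> 2 ^ Suc k"
  hence "(2 ^ Suc k)\<^sup>2 \<le> \<bar>s\<bar>\<^sup>2" by (intro power_mono) auto
  hence "4 * 4 ^ k \<le> s\<^sup>2" by (simp add: four_power power_mult_distrib)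
  moreover have "0 < (4::real) ^ k" by simp
  ultimately have "3 * 4 ^ k \<le> s\<^sup>2" by linarith
  hence "s\<^sup>2 / 4 ^ k \<ge> 3" by (simp add: le_divide_eq)
  thus ?thesis by (simp add: trunc_def ramp_1)
qed

lemma trunc'_nonzero: "trunc' k s \<noteq> 0 \<Longrightarrow> 4 ^ k < s\<^sup>2 \<and> s\<^sup>2 < 3 * 4 ^ k"
  using hat_0[of "s\<^sup>2 / 4 ^ k"] by (auto simp: trunc'_def field_simps not_le intro: ccontr)

text \<open>In the transition range s^2/4^k is below 3, which bounds the square of the slope by 12,
  rounded up to 16. Height and level scale alike, so the bound is the same for all k.\<close>

lemma trunc'_bound: "(trunc' k s)\<^sup>2 \<le> 16"
proof (cases "trunc' k s = 0")
  case False
  have "(trunc' k s)\<^sup>2 = (hat (s\<^sup>2 / 4 ^ k))\<^sup>2 * (4 * (s\<^sup>2 / 4 ^ k))"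
    by (simp add: trunc'_def four_power power2_eq_square field_simps)
  also have "\<dots> \<le> 1 * (4 * 3)"
    using trunc'_nonzero[OF False] hat_bounds[of "s\<^sup>2 / 4 ^ k"]
    by (intro mult_mono) (auto simp: power_le_one field_simps)
  finally show ?thesis by simp
qed simp

lemma trunc'_cont: "continuous_on UNIV (trunc' k)"
  unfolding trunc'_def[abs_def] hat_def by (intro continuous_intros) auto

lemma sum_at_most_one:
  fixes f :: "nat \<Rightarrow> real"
  assumes "\<And>k. 0 \<le> f k" "\<And>k. f k \<le> B" "\<And>k l. k < l \<Longrightarrow> f k \<noteq> 0 \<Longrightarrow> f l = 0" "0 \<le> B"
  shows "(\<Sum>k<K. f k) \<le> B"
proof (cases "\<exists>k<K. f k \<noteq> 0")
  case True
  then obtain k where k: "k < K" "f k \<noteq> 0" by blast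
  have "f l = 0" if "l \<noteq> k" for l
    using assms(3)[of k l] assms(3)[of l k] k that by (cases "k < l") auto
  hence "(\<Sum>l<K. f l) = (\<Sum>l<K. if l = k then f k else 0)" by (intro sum.cong) auto
  thus ?thesis using k assms(2) by simp
qed (use assms in auto)

text \<open>The ranges 4^k < s^2 < 3 4^k are disjoint because 3 < 4, so at most one summand is
  nonzero. The energies of all truncations together thus cost only a constant factor.\<close>

lemma trunc'_sum: "(\<Sum>k<K. (trunc' k s)\<^sup>2) \<le> 16"
proof (rule sum_at_most_one)
  fix k l :: nat assume kl: "k < l" "(trunc' k s)\<^sup>2 \<noteq> 0"
  show "(trunc' l s)\<^sup>2 = 0"
  proof (rule ccontr)
    assume "(trunc' l s)\<^sup>2 \<noteq> 0"
    hence "4 ^ l < s\<^sup>2" using trunc'_nonzero[of l s] by auto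
    moreover have "s\<^sup>2 < 3 * 4 ^ k" using trunc'_nonzero[of k s] kl(2) by auto
    moreover have "(4::real) ^ Suc k \<le> 4 ^ l" using kl(1) by (intro power_increasing) auto
    moreover have "0 < (4::real) ^ k" by simp
    ultimately show False by (simp only: power_Suc)
  qed
qed (auto simp: trunc'_bound)

section \<open>The Sobolev inequality for test functions\<close>

text \<open>The second identity makes the recursion for the level sets scale invariant; the fourth
  is the origin of the factor 1/N in the threshold c*.\<close>

lemma crit_exp_facts:
  assumes "n \<ge> 3"
  shows "crit_exp n > 2" "crit_exp n * (2 / real n) = crit_exp n - 2" "1 - 2 / real n = 2 / crit_exp n"
    "1 / 2 - 1 / crit_exp n = 1 / real n"
  using assms by (auto simp: crit_exp_def field_simps)

lemma emeasure_level_set: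
  assumes t: "test_function \<Omega> \<phi>" and c: "c > 0"
  shows "{x. c \<le> \<bar>\<phi> x\<bar>} \<in> sets borel" "emeasure lborel {x. c \<le> \<bar>\<phi> x\<bar>} < \<infinity>"
proof -
  note [measurable] = test_function_borel[OF t]
  show "{x. c \<le> \<bar>\<phi> x\<bar>} \<in> sets borel" by measurable
  obtain K where K: "compact K" "K \<subseteq> \<Omega>" "\<And>x. x \<notin> K \<Longrightarrow> \<phi> x = 0" by (rule test_function_supp[OF t]) auto
  have "bounded {x. c \<le> \<bar>\<phi> x\<bar>}"
    by (rule bounded_subset[OF compact_imp_bounded[OF K(1)]]) (use K(3) c in force)
  thus "emeasure lborel {x. c \<le> \<bar>\<phi> x\<bar>} < \<infinity>" by (rule emeasure_bounded_finite)
qed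

lemma test_function_nn_integral_grad:
  assumes t: "test_function \<Omega> \<phi>"
  shows "integrable lborel (\<lambda>x. (norm (grad \<phi> x))\<^sup>2)"
proof -
  obtain K where K: "compact K" "K \<subseteq> \<Omega>" "\<And>x. x \<notin> K \<Longrightarrow> \<phi> x = 0" by (rule test_function_supp[OF t]) auto
  obtain B where B: "\<And>x. norm (grad \<phi> x) \<le> B" "B \<ge> 0" by (rule grad_bounded[OF t]) auto
  note [measurable] = grad_borel[OF t]
  show ?thesis
  proof (rule integrable_lborel_bounded_support[OF _ _ compact_imp_bounded[OF K(1)]])
    show "\<bar>(norm (grad \<phi> x))\<^sup>2\<bar> \<le> B\<^sup>2" for x using B(1)[of x] by (simp add: power_mono)
    fix x assume "x \<notin> K"
    hence "partial_deriv i \<phi> x = 0" for i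
      by (intro test_function_partial_deriv_outside[OF compact_imp_closed[OF K(1)]]) (use K(3) in auto)
    thus "(norm (grad \<phi> x))\<^sup>2 = 0" by (simp add: grad_def)
  qed measurable
qed

context
  fixes \<phi> :: "'a::euclidean_space \<Rightarrow> real" and \<Omega> :: "'a set"
  assumes t: "test_function \<Omega> \<phi>" and dim: "DIM('a) \<ge> 3"
begin

definition level_measure :: "nat \<Rightarrow> real" where
  "level_measure k = measure lborel {x. 2 ^ k \<le> \<bar>\<phi> x\<bar>}"

definition trunc_energy :: "nat \<Rightarrow> real" where
  "trunc_energy k = (LINT x|lborel. (trunc' k (\<phi> x))\<^sup>2 * (norm (grad \<phi> x))\<^sup>2)"

lemma trunc_energy_integrable: "integrable lborel (\<lambda>x. (trunc' k (\<phi> x))\<^sup>2 * (norm (grad \<phi> x))\<^sup>2)"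
proof (rule Bochner_Integration.integrable_bound)
  note [measurable] = grad_borel[OF t] test_function_borel[OF t] borel_measurable_continuous_onI[OF trunc'_cont[of k]]
  show "integrable lborel (\<lambda>x. 16 * (norm (grad \<phi> x))\<^sup>2)" using test_function_nn_integral_grad[OF t] by simp
  show "(\<lambda>x. (trunc' k (\<phi> x))\<^sup>2 * (norm (grad \<phi> x))\<^sup>2) \<in> borel_measurable lborel" by measurable
  show "AE x in lborel. norm ((trunc' k (\<phi> x))\<^sup>2 * (norm (grad \<phi> x))\<^sup>2) \<le> norm (16 * (norm (grad \<phi> x))\<^sup>2)"
    using trunc'_bound by (intro AE_I2) (simp add: mult_right_mono)
qed

lemma trunc_energy_nonneg: "0 \<le> trunc_energy k" by (simp add: trunc_energy_def)

lemma trunc_energy_sum: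
  assumes "(LINT x|lborel. (norm (grad \<phi> x))\<^sup>2) \<le> 1"
  shows "(\<Sum>k<K. trunc_energy k) \<le> 16"
proof -
  have "(\<Sum>k<K. trunc_energy k) = (LINT x|lborel. (\<Sum>k<K. (trunc' k (\<phi> x))\<^sup>2 * (norm (grad \<phi> x))\<^sup>2))"
    unfolding trunc_energy_def by (simp add: trunc_energy_integrable)
  also have "\<dots> \<le> (LINT x|lborel. 16 * (norm (grad \<phi> x))\<^sup>2)"
  proof (rule integral_mono)
    show "integrable lborel (\<lambda>x. 16 * (norm (grad \<phi> x))\<^sup>2)" using test_function_nn_integral_grad[OF t] by simp
    show "(\<Sum>k<K. (trunc' k (\<phi> x))\<^sup>2 * (norm (grad \<phi> x))\<^sup>2) \<le> 16 * (norm (grad \<phi> x))\<^sup>2" for x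
      unfolding sum_distrib_right[symmetric] by (intro mult_right_mono trunc'_sum) simp
  qed (simp add: trunc_energy_integrable)
  also have "\<dots> \<le> 16" using assms by simp
  finally show ?thesis .
qed

lemma trunc_has_derivative:
  "((\<lambda>x. trunc k (\<phi> x)) has_derivative (\<lambda>h. (trunc' k (\<phi> x) *\<^sub>R grad \<phi> x) \<bullet> h)) (at x)"
  using has_derivative_compose[OF test_function_has_derivative[OF t] trunc_deriv[unfolded has_field_derivative_def]]
  by simp

text \<open>\<open>level_step\<close> with the radius for which the ball has exactly twice the
  measure of the level set; r^2 is then a power 2/N of that measure, and m = 2^k gives the factor
  4^k.\<close>

lemma level_measure_step:
  "4 ^ k * level_measure (Suc k)
    \<le> 2 * (2 * level_measure k / measure lborel (ball (0::'a) 1)) powr (2 / real DIM('a)) * trunc_energy k"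
proof -
  let ?A = "{x. 2 ^ k \<le> \<bar>\<phi> x\<bar>}" and ?A' = "{x. 2 ^ Suc k \<le> \<bar>\<phi> x\<bar>}"
  define v where "v = measure lborel (ball (0::'a) 1)"
  have v: "v > 0" using content_ball_pos[of 1 "0::'a"] by (simp add: v_def)
  have mA: "?A \<in> sets borel" "emeasure lborel ?A < \<infinity>" and mA': "?A' \<in> sets borel"
    using emeasure_level_set[OF t, of "2 ^ k"] emeasure_level_set[OF t, of "2 ^ Suc k"] by auto
  have sub: "?A' \<subseteq> ?A" by auto
  show ?thesis
  \<comment> \<open>A null level set would give radius 0; the next level set is contained in it and
    is null too.\<close>
  proof (cases "level_measure k = 0")
    case True
    have "level_measure (Suc k) \<le> level_measure k"
      unfolding level_measure_def by (rule measure_mono_fmeasurable[OF sub]) (use mA mA' in \<open>auto simp: fmeasurable_def\<close>)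
    hence "level_measure (Suc k) = 0" using True by (simp add: level_measure_def order_antisym)
    thus ?thesis using True by simp
  next
    case False
    hence pos: "level_measure k > 0" by (simp add: level_measure_def zero_less_measure_iff)
    define r where "r = (2 * level_measure k / v) powr (1 / real DIM('a))"
    have r: "r > 0" using pos v by (simp add: r_def)
    have "r ^ DIM('a) = r powr real DIM('a)" using r by (simp add: powr_realpow)
    also have "\<dots> = 2 * level_measure k / v" unfolding r_def powr_powr using pos v by simp
    finally have rN: "r ^ DIM('a) * v = 2 * level_measure k" using v by simp
    have r2: "r\<^sup>2 = (2 * level_measure k / v) powr (2 / real DIM('a))"
    proof -
      have "r\<^sup>2 = r powr 2" using r by simp
      thus ?thesis unfolding r_def powr_powr by simp
    qed
    have "(2 ^ k)\<^sup>2 * measure lborel ?A' \<le> 2 * r\<^sup>2 * trunc_energy k"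
    proof (rule level_step[OF trunc_has_derivative _ mA(1) mA' mA(2) sub])
      show "continuous_on UNIV (\<lambda>x. trunc' k (\<phi> x) *\<^sub>R grad \<phi> x)"
        by (intro continuous_intros continuous_on_compose2[OF trunc'_cont test_function_continuous[OF t]] grad_continuous[OF t]) simp
      show "trunc k (\<phi> x) = 2 ^ k" if "x \<in> ?A'" for x using that trunc_1 by simp
      show "trunc k (\<phi> x) = 0" if "x \<notin> ?A" for x using that trunc_0 by simp
      show "2 * measure lborel ?A \<le> measure lborel (ball (0::'a) r)"
        using rN content_ball_conv_unit_ball[of r "0::'a"] r by (simp add: level_measure_def v_def)
      have "(\<integral>\<^sup>+x. ennreal ((trunc' k (\<phi> x))\<^sup>2 * (norm (grad \<phi> x))\<^sup>2) \<partial>lborel) = ennreal (trunc_energy k)"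
        unfolding trunc_energy_def by (rule nn_integral_eq_integral[OF trunc_energy_integrable]) simp
      thus "(\<integral>\<^sup>+x. ennreal ((norm (trunc' k (\<phi> x) *\<^sub>R grad \<phi> x))\<^sup>2) \<partial>lborel) \<le> ennreal (trunc_energy k)"
        by (simp add: power_mult_distrib)
    qed (use r trunc_energy_nonneg in auto)
    thus ?thesis using r2 by (simp add: four_power level_measure_def v_def)
  qed
qed

text \<open>Since $(p-2) = 2p/N$, the weights $2^{pk}$ make the recursion for the level sets scale invariant,
  and the energies of the truncations add up to at most a multiple of the whole energy.\<close>

lemma weighted_level_step:
  fixes p v D :: real
  defines "p \<equiv> crit_exp DIM('a)" and "v \<equiv> measure lborel (ball (0::'a) 1)"
  defines "D \<equiv> 2 powr p * 2 * (2 / v) powr (2 / real DIM('a))"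
  shows "2 powr (p * real (Suc k)) * level_measure (Suc k)
    \<le> D * (2 powr (p * real k) * level_measure k) powr (2 / real DIM('a)) * trunc_energy k"
proof -
  have v: "v > 0" using content_ball_pos[of 1 "0::'a"] by (simp add: v_def)
  have p: "p * (2 / real DIM('a)) = p - 2" unfolding p_def by (rule crit_exp_facts(2)[OF dim])
  have nn: "level_measure k \<ge> 0" by (simp add: level_measure_def)
  \<comment> \<open>The new weight splits into 2^p, the factor 4^k consumed by the level step, and
    2^((p-2)k), which is the power 2/N of the old weight 2^(pk).\<close>
  have e1: "2 powr (p * real (Suc k)) = 2 powr p * 2 powr ((p - 2) * real k) * (4::real) ^ k"
  proof -
    have "(4::real) ^ k = 2 powr (2 * real k)" by (simp add: powr_powr[symmetric] powr_realpow)
    moreover have "p * real (Suc k) = p + (p - 2) * real k + 2 * real k" by (simp add: algebra_simps)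
    ultimately show ?thesis by (simp add: powr_add)
  qed
  have e2: "(2 powr (p * real k) * level_measure k) powr (2 / real DIM('a)) = 2 powr ((p - 2) * real k) * level_measure k powr (2 / real DIM('a))"
  proof -
    have "p * real k * (2 / real DIM('a)) = (p * (2 / real DIM('a))) * real k" by simp
    hence "p * real k * (2 / real DIM('a)) = (p - 2) * real k" by (simp only: p)
    thus ?thesis using nn by (simp only: powr_mult powr_powr)
  qed
  have e3: "(2 * level_measure k / v) powr (2 / real DIM('a)) = (2 / v) powr (2 / real DIM('a)) * level_measure k powr (2 / real DIM('a))"
    using nn v by (simp add: powr_mult[symmetric])
  have "2 powr (p * real (Suc k)) * level_measure (Suc k) = 2 powr p * 2 powr ((p - 2) * real k) * (4 ^ k * level_measure (Suc k))"
    by (simp only: e1 mult.assoc)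
  also have "\<dots> \<le> 2 powr p * 2 powr ((p - 2) * real k) * (2 * (2 * level_measure k / v) powr (2 / real DIM('a)) * trunc_energy k)"
    unfolding v_def by (intro mult_left_mono level_measure_step) simp
  also have "\<dots> = D * (2 powr (p * real k) * level_measure k) powr (2 / real DIM('a)) * trunc_energy k"
    unfolding e2 e3 D_def by (simp add: mult_ac)
  finally show ?thesis .
qed

text \<open>For the weighted measures b_k and the energies e_k the recursion reads b_(k+1) <= D
  b_k^(2/N) e_k. Since e_k <= 16, induction gives b_k <= M; inserting this into the recursion once
  more and summing the e_k, whose sum is also at most 16, bounds the series.\<close>

lemma weighted_level_sum:
  fixes p v D W M :: real
  defines "p \<equiv> crit_exp DIM('a)" and "v \<equiv> measure lborel (ball (0::'a) 1)"
  defines "D \<equiv> 2 powr p * 2 * (2 / v) powr (2 / real DIM('a))"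
  defines "M \<equiv> max 1 (max W ((16 * D) ^ 3))"
  assumes W: "level_measure 0 \<le> W" and E: "(LINT x|lborel. (norm (grad \<phi> x))\<^sup>2) \<le> 1"
  shows "(\<Sum>k<K. 2 powr (p * real (Suc k)) * level_measure (Suc k)) \<le> M"
proof -
  define b where "b k = 2 powr (p * real k) * level_measure k" for k
  have v: "v > 0" using content_ball_pos[of 1 "0::'a"] by (simp add: v_def)
  have D: "D > 0" using v by (simp add: D_def)
  have M: "M \<ge> 1" "M \<ge> W" "M \<ge> (16 * D) ^ 3" by (auto simp: M_def)
  have step: "b (Suc k) \<le> D * b k powr (2 / real DIM('a)) * trunc_energy k" for k
    unfolding b_def p_def D_def v_def by (rule weighted_level_step)
  have b0: "b k \<ge> 0" for k by (simp add: b_def level_measure_def)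
  \<comment> \<open>Since N >= 3 and M >= 1, M^(2/N) is at most M^(2/3), so it suffices that 16 D is
    at most M^(1/3). This explains the cube in the definition of M.\<close>
  have key: "16 * D * M powr (2 / real DIM('a)) \<le> M"
  proof -
    have "(z ^ 3) powr (1 / 3) = z" if "z > 0" for z :: real
    proof -
      have "z ^ 3 = z powr real 3" using that by (subst powr_realpow) auto
      thus ?thesis using that by (simp only: powr_powr) simp
    qed
    from this[of "16 * D"] have "16 * D = ((16 * D) ^ 3) powr (1 / 3)" using D by simp
    also have "\<dots> \<le> M powr (1 / 3)" using M D by (intro powr_mono2) auto
    finally have 1: "16 * D \<le> M powr (1 / 3)" .
    have "2 / real DIM('a) \<le> 2 / 3" using dim by (intro divide_left_mono) auto
    hence 2: "M powr (2 / real DIM('a)) \<le> M powr (2 / 3)" using M by (intro powr_mono) auto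
    have "16 * D * M powr (2 / real DIM('a)) \<le> M powr (1 / 3) * M powr (2 / 3)"
      using 1 2 D by (intro mult_mono) auto
    also have "\<dots> = M" using M by (simp add: powr_add[symmetric])
    finally show ?thesis .
  qed
  have e16: "trunc_energy k \<le> 16" for k
  proof -
    have "trunc_energy k \<le> (\<Sum>k<Suc k. trunc_energy k)"
      using trunc_energy_nonneg by (intro member_le_sum) auto
    also have "\<dots> \<le> 16" by (rule trunc_energy_sum[OF E])
    finally show ?thesis .
  qed
  have bM: "b k \<le> M" for k
  proof (induction k)
    case 0
    show ?case using W M by (simp add: b_def)
  next
    case (Suc k)
    have "b (Suc k) \<le> D * b k powr (2 / real DIM('a)) * trunc_energy k" by (rule step)
    also have "\<dots> \<le> D * M powr (2 / real DIM('a)) * 16"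
      using Suc e16 trunc_energy_nonneg D b0 by (intro mult_mono powr_mono2) auto
    also have "\<dots> \<le> M" using key by (simp add: mult_ac)
    finally show ?case .
  qed
  have "(\<Sum>k<K. b (Suc k)) \<le> (\<Sum>k<K. D * M powr (2 / real DIM('a)) * trunc_energy k)"
  proof (rule sum_mono)
    fix k
    have "b (Suc k) \<le> D * b k powr (2 / real DIM('a)) * trunc_energy k" by (rule step)
    also have "\<dots> \<le> D * M powr (2 / real DIM('a)) * trunc_energy k"
      using bM trunc_energy_nonneg D b0 by (intro mult_mono powr_mono2) auto
    finally show "b (Suc k) \<le> D * M powr (2 / real DIM('a)) * trunc_energy k" .
  qed
  also have "\<dots> = D * M powr (2 / real DIM('a)) * (\<Sum>k<K. trunc_energy k)" by (simp add: sum_distrib_left)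
  also have "\<dots> \<le> D * M powr (2 / real DIM('a)) * 16"
    using D by (intro mult_left_mono trunc_energy_sum[OF E]) auto
  also have "\<dots> \<le> M" using key by (simp add: mult_ac)
  finally show ?thesis by (simp add: b_def)
qed

text \<open>A dyadic layer cake. Where |\<phi>| > 1, the term of the highest level reached already
  dominates the power; the indicator of the support covers the rest.\<close>

lemma powr_le_level_sum:
  fixes p :: real
  assumes K: "\<And>x. \<bar>\<phi> x\<bar> < 2 ^ K" and p: "p > 0"
  shows "\<bar>\<phi> x\<bar> powr p \<le> indicator {x. \<phi> x \<noteq> 0} x + (\<Sum>k<K. 2 powr (p * real (Suc k)) * indicator {x. 2 ^ k \<le> \<bar>\<phi> x\<bar>} x)"
proof -
  let ?S = "\<Sum>k<K. 2 powr (p * real (Suc k)) * indicator {x. 2 ^ k \<le> \<bar>\<phi> x\<bar>} x :: real"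
  have S: "?S \<ge> 0" by (intro sum_nonneg) auto
  consider "\<phi> x = 0" | "\<phi> x \<noteq> 0" "\<bar>\<phi> x\<bar> \<le> 1" | "1 < \<bar>\<phi> x\<bar>" by linarith
  thus ?thesis
  proof cases
    case 1
    thus ?thesis using p S by simp
  next
    case 2
    have "\<bar>\<phi> x\<bar> powr p \<le> 1 powr p" using 2 p by (intro powr_mono2) auto
    thus ?thesis using S 2 by simp
  next
    case 3
    \<comment> \<open>The least exponent, so that 2^(n-1) <= |\<phi>(x)| < 2^n.\<close>
    define n where "n = (LEAST n. \<bar>\<phi> x\<bar> < 2 ^ n)"
    have n: "\<bar>\<phi> x\<bar> < 2 ^ n" unfolding n_def using K[of x] by (rule LeastI)
    have nK: "n \<le> K" unfolding n_def using K[of x] by (rule Least_le)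
    have "n \<noteq> 0" using n 3 by (cases "n = 0") auto
    then obtain k where k: "n = Suc k" using not0_implies_Suc by blast
    have "\<not> \<bar>\<phi> x\<bar> < 2 ^ k" using not_less_Least[of k "\<lambda>n. \<bar>\<phi> x\<bar> < 2 ^ n"] k n_def by simp
    hence ge: "2 ^ k \<le> \<bar>\<phi> x\<bar>" by simp
    have "\<bar>\<phi> x\<bar> powr p \<le> (2 ^ n) powr p" using n p by (intro powr_mono2) auto
    also have "\<dots> = 2 powr (p * real (Suc k))" unfolding k by (simp only: powr_realpow[symmetric, of 2] powr_powr mult.commute zero_less_numeral)
    also have "\<dots> = 2 powr (p * real (Suc k)) * indicator {x. 2 ^ k \<le> \<bar>\<phi> x\<bar>} x" using ge by simp
    also have "\<dots> \<le> ?S" using nK k by (intro member_le_sum) auto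
    finally show ?thesis by (simp add: add_increasing)
  qed
qed

text \<open>The bound sees \<phi> only through the measure of its support and the normalization of
  its energy. On a bounded domain it is therefore uniform, and scaling later makes it
  homogeneous.\<close>

lemma sobolev_test:
  fixes p v D W M :: real
  defines "p \<equiv> crit_exp DIM('a)" and "v \<equiv> measure lborel (ball (0::'a) 1)"
  defines "D \<equiv> 2 powr p * 2 * (2 / v) powr (2 / real DIM('a))"
  defines "M \<equiv> max 1 (max W ((16 * D) ^ 3))"
  assumes supp: "measure lborel {x. \<phi> x \<noteq> 0} \<le> W" and E: "(LINT x|lborel. (norm (grad \<phi> x))\<^sup>2) \<le> 1"
  shows "integrable lborel (\<lambda>x. \<bar>\<phi> x\<bar> powr p)" "(LINT x|lborel. \<bar>\<phi> x\<bar> powr p) \<le> W + 2 powr p * (W + M)"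
proof -
  note [measurable] = test_function_borel[OF t]
  have p: "p > 2" unfolding p_def by (rule crit_exp_facts(1)[OF dim])
  obtain B where B: "\<And>x. \<bar>\<phi> x\<bar> \<le> B" "B > 0" by (rule test_function_bounded[OF t]) auto
  obtain K where K: "B < 2 ^ K" using real_arch_pow[of 2 B] by auto
  have K: "\<bar>\<phi> x\<bar> < 2 ^ K" for x using B(1)[of x] K by linarith
  obtain C where C: "compact C" "C \<subseteq> \<Omega>" "\<And>x. x \<notin> C \<Longrightarrow> \<phi> x = 0" by (rule test_function_supp[OF t]) auto
  have m0: "{x. \<phi> x \<noteq> 0} \<in> sets borel" by measurable
  have "bounded {x. \<phi> x \<noteq> 0}"
    by (rule bounded_subset[OF compact_imp_bounded[OF C(1)]]) (use C(3) in force)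
  hence f0: "emeasure lborel {x. \<phi> x \<noteq> 0} < \<infinity>" by (rule emeasure_bounded_finite)
  have lev: "{x. 2 ^ k \<le> \<bar>\<phi> x\<bar>} \<in> sets borel" "emeasure lborel {x. 2 ^ k \<le> \<bar>\<phi> x\<bar>} < \<infinity>" for k :: nat
    using emeasure_level_set[OF t, of "2 ^ k"] by auto
  have W: "level_measure 0 \<le> W"
  proof -
    have "level_measure 0 \<le> measure lborel {x. \<phi> x \<noteq> 0}"
      unfolding level_measure_def by (rule measure_mono_fmeasurable) (use m0 f0 lev(1)[of 0] in \<open>auto simp: fmeasurable_def\<close>)
    thus ?thesis using supp by linarith
  qed
  show I: "integrable lborel (\<lambda>x. \<bar>\<phi> x\<bar> powr p)"
  proof (rule integrable_lborel_bounded_support[OF _ _ compact_imp_bounded[OF C(1)]])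
    show "\<bar>\<bar>\<phi> x\<bar> powr p\<bar> \<le> B powr p" for x using B p by (simp add: powr_mono2)
  qed (use C(3) p in auto)
  have i0: "integrable lborel (indicator {x. \<phi> x \<noteq> 0} :: 'a \<Rightarrow> real)"
    using m0 f0 by (intro integrable_real_indicator) auto
  have ik: "integrable lborel (\<lambda>x. c * indicator {x. 2 ^ k \<le> \<bar>\<phi> x\<bar>} x :: real)" for c and k :: nat
    using lev by (intro integrable_mult_right integrable_real_indicator) auto
  have "(LINT x|lborel. \<bar>\<phi> x\<bar> powr p) \<le> (LINT x|lborel. indicator {x. \<phi> x \<noteq> 0} x + (\<Sum>k<K. 2 powr (p * real (Suc k)) * indicator {x. 2 ^ k \<le> \<bar>\<phi> x\<bar>} x))"
    using p by (intro integral_mono I Bochner_Integration.integrable_add i0 Bochner_Integration.integrable_sum ik powr_le_level_sum K) auto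
  also have "\<dots> = measure lborel {x. \<phi> x \<noteq> 0} + (\<Sum>k<K. 2 powr (p * real (Suc k)) * level_measure k)"
  proof -
    have "(LINT x|lborel. (\<Sum>k<K. 2 powr (p * real (Suc k)) * indicator {x. 2 ^ k \<le> \<bar>\<phi> x\<bar>} x :: real))
        = (\<Sum>k<K. LINT x|lborel. 2 powr (p * real (Suc k)) * indicator {x. 2 ^ k \<le> \<bar>\<phi> x\<bar>} x)"
      by (intro Bochner_Integration.integral_sum ik)
    also have "\<dots> = (\<Sum>k<K. 2 powr (p * real (Suc k)) * level_measure k)"
      using lev(1) by (intro sum.cong refl) (simp add: level_measure_def)
    finally show ?thesis
      using m0 by (subst Bochner_Integration.integral_add[OF i0 Bochner_Integration.integrable_sum[OF ik]]) simp
  qed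
  also have "(\<Sum>k<K. 2 powr (p * real (Suc k)) * level_measure k) = 2 powr p * (\<Sum>k<K. 2 powr (p * real k) * level_measure k)"
    by (simp add: sum_distrib_left powr_add distrib_left mult.assoc)
  \<comment> \<open>One term is added so that, once k = 0 is split off, exactly the sum of
    \<open>weighted_level_sum\<close> remains.\<close>
  also have "(\<Sum>k<K. 2 powr (p * real k) * level_measure k) \<le> (\<Sum>k<Suc K. 2 powr (p * real k) * level_measure k)"
    by (intro sum_mono2) (auto simp: level_measure_def)
  also have "\<dots> = level_measure 0 + (\<Sum>k<K. 2 powr (p * real (Suc k)) * level_measure (Suc k))"
    by (subst sum.lessThan_Suc_shift) simp
  also have "\<dots> \<le> W + M"
    unfolding p_def M_def D_def v_def by (intro add_mono W weighted_level_sum E)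
  finally show "(LINT x|lborel. \<bar>\<phi> x\<bar> powr p) \<le> W + 2 powr p * (W + M)" using supp by (simp add: mult_left_mono)
qed


end

section \<open>A compactness estimate\<close>

text \<open>\<phi>(x) is its mean over \<open>ball z r\<close> plus the mean of \<phi>(x) -
  \<phi>(y). The first is at most \<delta>, the second is bounded by Cauchy-Schwarz. As x lies in
  the same ball, all displacements y - x have length below 2 r.\<close>

lemma ball_mean_estimate:
  fixes \<phi> :: "'a::euclidean_space \<Rightarrow> real"
  assumes t: "test_function \<Omega> \<phi>" and r: "r > 0" and x: "x \<in> ball z r"
    and mean: "\<bar>LINT y|lborel. indicator (ball z r) y * \<phi> y\<bar> \<le> \<delta> * measure lborel (ball z r)"
  shows "ennreal ((\<phi> x)\<^sup>2) \<le> ennreal (2 * \<delta>\<^sup>2)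
    + ennreal (2 / measure lborel (ball (0::'a) r)) * (\<integral>\<^sup>+h. indicator (ball 0 (2 * r)) h * ennreal ((\<phi> (x + h) - \<phi> x)\<^sup>2) \<partial>lborel)"
proof -
  note [measurable] = test_function_borel[OF t]
  have [measurable]: "ball z r \<in> sets borel" by simp
  define B where "B = measure lborel (ball (0::'a) r)"
  have B: "B > 0" using content_ball_pos[OF r] by (simp add: B_def)
  have Bz: "measure lborel (ball z r) = B"
    using content_ball_conv_unit_ball[of r z] content_ball_conv_unit_ball[of r "0::'a"] r by (simp add: B_def)
  obtain C where C: "\<And>y. \<bar>\<phi> y\<bar> \<le> C" "C > 0" by (rule test_function_bounded[OF t]) auto
  have bint: "integrable lborel (\<lambda>y. indicator (ball z r) y * f y :: real)"
    if "f \<in> borel_measurable borel" "\<And>y. \<bar>f y\<bar> \<le> D" "D \<ge> 0" for f D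
  proof (rule integrable_lborel_bounded_support[where K = "ball z r" and B = D])
    show "\<bar>indicator (ball z r) y * f y\<bar> \<le> D" for y using that by (simp add: indicator_def)
    have "indicator (ball z r) \<in> borel_measurable (borel :: 'a measure)" by (rule borel_measurable_indicator) simp
    thus "(\<lambda>y. indicator (ball z r) y * f y :: real) \<in> borel_measurable borel"
      using that(1) by (rule borel_measurable_times)
  qed auto
  have d: "\<bar>\<phi> x - \<phi> y\<bar> \<le> 2 * C" for y using C(1)[of x] C(1)[of y] by linarith
  have d2: "\<bar>(\<phi> x - \<phi> y)\<^sup>2\<bar> \<le> (2 * C)\<^sup>2" for y using power_mono[OF d, of y 2] by simp
  define I where "I = (LINT y|lborel. indicator (ball z r) y * (\<phi> x - \<phi> y))"
  define J where "J = (LINT y|lborel. indicator (ball z r) y * (\<phi> x - \<phi> y)\<^sup>2)"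
  define P where "P = (LINT y|lborel. indicator (ball z r) y * \<phi> y)"
  have iJ: "integrable lborel (\<lambda>y. indicator (ball z r) y * (\<phi> x - \<phi> y)\<^sup>2)" by (rule bint[OF _ d2]) auto
  have i\<phi>: "integrable lborel (\<lambda>y. indicator (ball z r) y * \<phi> y)" by (rule bint[OF _ C(1)]) (use C in auto)
  have ic: "integrable lborel (\<lambda>y. indicator (ball z r) y * c :: real)" for c by (rule bint[of _ "\<bar>c\<bar>"]) auto
  have "I = (LINT y|lborel. indicator (ball z r) y * \<phi> x - indicator (ball z r) y * \<phi> y)"
    unfolding I_def by (simp add: right_diff_distrib)
  also have "\<dots> = B * \<phi> x - P"
    unfolding P_def by (subst Bochner_Integration.integral_diff[OF ic i\<phi>]) (simp add: Bz)
  finally have split: "B * \<phi> x = P + I" by simp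
  have IJ: "I\<^sup>2 \<le> B * J"
  proof -
    have s1: "sq_int lborel (\<lambda>y. indicator (ball z r) y :: real)"
    proof -
      have "(\<lambda>y. (norm (indicator (ball z r) y :: real))\<^sup>2) = (\<lambda>y. indicator (ball z r) y * 1)"
        by (rule ext) (simp split: split_indicator)
      thus ?thesis using ic[of 1] by (simp add: sq_int_def)
    qed
    have s2: "sq_int lborel (\<lambda>y. indicator (ball z r) y * (\<phi> x - \<phi> y))"
    proof -
      have "(\<lambda>y. (norm (indicator (ball z r) y * (\<phi> x - \<phi> y)))\<^sup>2) = (\<lambda>y. indicator (ball z r) y * (\<phi> x - \<phi> y)\<^sup>2)"
        by (rule ext) (simp split: split_indicator)
      moreover have "(\<lambda>y. indicator (ball z r) y * (\<phi> x - \<phi> y)) \<in> borel_measurable lborel"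
        using bint[of "\<lambda>y. \<phi> x - \<phi> y", OF _ d] C(2) by (intro borel_measurable_integrable) auto
      ultimately show ?thesis using iJ by (simp add: sq_int_def)
    qed
    have e1: "(l2_norm lborel (\<lambda>y. indicator (ball z r) y :: real))\<^sup>2 = B"
    proof -
      have "(\<lambda>y. (norm (indicator (ball z r) y :: real))\<^sup>2) = indicator (ball z r)" by (rule ext) (simp split: split_indicator)
      thus ?thesis unfolding l2_norm_sq by (simp add: Bz)
    qed
    have e2: "(l2_norm lborel (\<lambda>y. indicator (ball z r) y * (\<phi> x - \<phi> y)))\<^sup>2 = J"
      unfolding l2_norm_sq J_def by (intro Bochner_Integration.integral_cong) (auto split: split_indicator)
    have "(\<lambda>y. indicator (ball z r) y \<bullet> (indicator (ball z r) y * (\<phi> x - \<phi> y))) = (\<lambda>y. indicator (ball z r) y * (\<phi> x - \<phi> y))"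
      by (rule ext) (simp split: split_indicator)
    hence "\<bar>I\<bar> \<le> l2_norm lborel (\<lambda>y. indicator (ball z r) y :: real) * l2_norm lborel (\<lambda>y. indicator (ball z r) y * (\<phi> x - \<phi> y))"
      using l2_Cauchy_Schwarz[OF s1 s2] by (simp add: I_def)
    hence "\<bar>I\<bar>\<^sup>2 \<le> (l2_norm lborel (\<lambda>y. indicator (ball z r) y :: real) * l2_norm lborel (\<lambda>y. indicator (ball z r) y * (\<phi> x - \<phi> y)))\<^sup>2"
      by (intro power_mono) auto
    thus ?thesis by (simp only: power_mult_distrib e1 e2 power2_abs)
  qed
  have P2: "P\<^sup>2 \<le> (\<delta> * B)\<^sup>2"
    using mean power_mono[of "\<bar>P\<bar>" "\<delta> * B" 2] by (simp add: P_def Bz)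
  have "(B * \<phi> x)\<^sup>2 \<le> 2 * P\<^sup>2 + 2 * I\<^sup>2"
    unfolding split using sum_squares_bound[of P I] by (simp add: power2_sum)
  also have "\<dots> \<le> 2 * (\<delta> * B)\<^sup>2 + 2 * (B * J)" using P2 IJ by simp
  finally have "B\<^sup>2 * (\<phi> x)\<^sup>2 \<le> B\<^sup>2 * (2 * \<delta>\<^sup>2 + 2 / B * J)"
    using B by (simp add: power_mult_distrib distrib_left power2_eq_square mult_ac)
  hence real_est: "(\<phi> x)\<^sup>2 \<le> 2 * \<delta>\<^sup>2 + 2 / B * J" using B by simp
  have "ennreal J = (\<integral>\<^sup>+y. ennreal (indicator (ball z r) y * (\<phi> x - \<phi> y)\<^sup>2) \<partial>lborel)"
    unfolding J_def by (rule nn_integral_eq_integral[OF iJ, symmetric]) auto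
  also have "\<dots> = (\<integral>\<^sup>+h. ennreal (indicator (ball z r) (x + h) * (\<phi> x - \<phi> (x + h))\<^sup>2) \<partial>lborel)"
    by (rule nn_integral_lborel_shift[symmetric]) measurable
  also have "\<dots> \<le> (\<integral>\<^sup>+h. indicator (ball 0 (2 * r)) h * ennreal ((\<phi> (x + h) - \<phi> x)\<^sup>2) \<partial>lborel)"
  proof (rule nn_integral_mono)
    fix h
    show "ennreal (indicator (ball z r) (x + h) * (\<phi> x - \<phi> (x + h))\<^sup>2) \<le> indicator (ball 0 (2 * r)) h * ennreal ((\<phi> (x + h) - \<phi> x)\<^sup>2)"
    proof (cases "x + h \<in> ball z r")
      case True
      have "dist (x + h) x \<le> dist (x + h) z + dist z x" by (rule dist_triangle)
      hence "norm h < 2 * r" using True x norm_minus_commute[of z "x + h"] by (simp add: dist_norm)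
      thus ?thesis using True by (simp add: power2_commute)
    qed simp
  qed
  finally have J: "ennreal J \<le> (\<integral>\<^sup>+h. indicator (ball 0 (2 * r)) h * ennreal ((\<phi> (x + h) - \<phi> x)\<^sup>2) \<partial>lborel)" .
  have J0: "J \<ge> 0" unfolding J_def by (intro integral_nonneg_AE AE_I2) auto
  have "ennreal ((\<phi> x)\<^sup>2) \<le> ennreal (2 * \<delta>\<^sup>2 + 2 / B * J)" by (rule ennreal_leI[OF real_est])
  also have "\<dots> = ennreal (2 * \<delta>\<^sup>2) + ennreal (2 / B) * ennreal J"
    using B J0 by (subst ennreal_plus) (auto simp: ennreal_mult[symmetric])
  also have "\<dots> \<le> ennreal (2 * \<delta>\<^sup>2) + ennreal (2 / B) * (\<integral>\<^sup>+h. indicator (ball 0 (2 * r)) h * ennreal ((\<phi> (x + h) - \<phi> x)\<^sup>2) \<partial>lborel)"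
    by (intro add_left_mono mult_left_mono J) simp
  finally show ?thesis unfolding B_def .
qed

text \<open>Integrating the pointwise bound leaves a term controlled by the means over the covering
  balls and a term of order r^2 times the energy; this is what yields total boundedness in L2. The
  factor 2^N is the ratio of the volumes of the balls of radii 2 r and r.\<close>

lemma test_function_l2_estimate:
  fixes \<phi> :: "'a::euclidean_space \<Rightarrow> real"
  assumes t: "test_function \<Omega> \<phi>" and r: "r > 0" and S: "S \<in> sets borel" "emeasure lborel S < \<infinity>" "\<Omega> \<subseteq> S"
    and cover: "S \<subseteq> (\<Union>z\<in>Z. ball z r)"
    and mean: "\<And>z. z \<in> Z \<Longrightarrow> \<bar>LINT y|lborel. indicator (ball z r) y * \<phi> y\<bar> \<le> \<delta> * measure lborel (ball z r)"
  shows "(LINT x|lborel. (\<phi> x)\<^sup>2) \<le> 2 * \<delta>\<^sup>2 * measure lborel S + 2 * 2 ^ DIM('a) * (2 * r)\<^sup>2 * (LINT x|lborel. (norm (grad \<phi> x))\<^sup>2)"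
proof -
  note [measurable] = test_function_borel[OF t] S(1)
  have [measurable]: "ball (0::'a) (2 * r) \<in> sets borel" by simp
  define B where "B = measure lborel (ball (0::'a) r)"
  define E where "E = (LINT x|lborel. (norm (grad \<phi> x))\<^sup>2)"
  have E0: "E \<ge> 0" by (simp add: E_def)
  have B: "B > 0" using content_ball_pos[OF r] by (simp add: B_def)
  have B2: "measure lborel (ball (0::'a) (2 * r)) = 2 ^ DIM('a) * B"
    using content_ball_conv_unit_ball[of "2 * r" "0::'a"] content_ball_conv_unit_ball[of r "0::'a"] r
    by (simp add: B_def power_mult_distrib)
  have emB2: "emeasure lborel (ball (0::'a) (2 * r)) = ennreal (2 ^ DIM('a) * B)"
    unfolding B2[symmetric] using emeasure_lborel_ball_finite[of "0::'a" "2 * r"] by (intro emeasure_eq_ennreal_measure) auto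
  have emS: "emeasure lborel S = ennreal (measure lborel S)"
    using S(2) by (intro emeasure_eq_ennreal_measure) auto
  obtain C where C: "\<And>y. \<bar>\<phi> y\<bar> \<le> C" "C > 0" by (rule test_function_bounded[OF t]) auto
  obtain K where K: "compact K" "K \<subseteq> \<Omega>" "\<And>x. x \<notin> K \<Longrightarrow> \<phi> x = 0" by (rule test_function_supp[OF t]) auto
  have i2: "integrable lborel (\<lambda>x. (\<phi> x)\<^sup>2)"
  proof (rule integrable_lborel_bounded_support[OF _ _ compact_imp_bounded[OF K(1)]])
    show "\<bar>(\<phi> x)\<^sup>2\<bar> \<le> C\<^sup>2" for x using power_mono[OF C(1), of x 2] by simp
  qed (use K(3) in auto)
  let ?I = "\<lambda>x. \<integral>\<^sup>+h. indicator (ball 0 (2 * r)) h * ennreal ((\<phi> (x + h) - \<phi> x)\<^sup>2) \<partial>lborel"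
  have Im[measurable]: "?I \<in> borel_measurable lborel" by measurable
  have "ennreal (LINT x|lborel. (\<phi> x)\<^sup>2) = (\<integral>\<^sup>+x. ennreal ((\<phi> x)\<^sup>2) \<partial>lborel)"
    by (rule nn_integral_eq_integral[OF i2, symmetric]) simp
  also have "\<dots> \<le> (\<integral>\<^sup>+x. ennreal (2 * \<delta>\<^sup>2) * indicator S x + ennreal (2 / B) * ?I x \<partial>lborel)"
  proof (rule nn_integral_mono)
    fix x
    show "ennreal ((\<phi> x)\<^sup>2) \<le> ennreal (2 * \<delta>\<^sup>2) * indicator S x + ennreal (2 / B) * ?I x"
    proof (cases "x \<in> S")
      case True
      then obtain z where z: "z \<in> Z" "x \<in> ball z r" using cover by blast
      show ?thesis using ball_mean_estimate[OF t r z(2) mean[OF z(1)]] True unfolding B_def by simp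
    next
      case False
      hence "\<phi> x = 0" using S(3) test_function_outside[OF t] by blast
      thus ?thesis by simp
    qed
  qed
  also have "\<dots> = (\<integral>\<^sup>+x. ennreal (2 * \<delta>\<^sup>2) * indicator S x \<partial>lborel) + (\<integral>\<^sup>+x. ennreal (2 / B) * ?I x \<partial>lborel)"
    by (rule nn_integral_add) measurable
  also have "(\<integral>\<^sup>+x. ennreal (2 * \<delta>\<^sup>2) * indicator S x \<partial>lborel) = ennreal (2 * \<delta>\<^sup>2 * measure lborel S)"
    by (subst nn_integral_cmult_indicator) (auto simp: emS ennreal_mult)
  also have "(\<integral>\<^sup>+x. ennreal (2 / B) * ?I x \<partial>lborel) = ennreal (2 / B) * (\<integral>\<^sup>+x. ?I x \<partial>lborel)"
    by (rule nn_integral_cmult) measurable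
  also have "\<dots> \<le> ennreal (2 / B) * (emeasure lborel (ball (0::'a) (2 * r)) * ennreal ((2 * r)\<^sup>2) * (\<integral>\<^sup>+x. ennreal ((norm (grad \<phi> x))\<^sup>2) \<partial>lborel))"
    using r by (intro mult_left_mono ball_translation_estimate[OF test_function_has_derivative[OF t] grad_continuous[OF t]]) auto
  also have "(\<integral>\<^sup>+x. ennreal ((norm (grad \<phi> x))\<^sup>2) \<partial>lborel) = ennreal E"
    unfolding E_def by (rule nn_integral_eq_integral[OF test_function_nn_integral_grad[OF t]]) simp
  also have "ennreal (2 / B) * (emeasure lborel (ball (0::'a) (2 * r)) * ennreal ((2 * r)\<^sup>2) * ennreal E) = ennreal (2 * 2 ^ DIM('a) * (2 * r)\<^sup>2 * E)"
  proof -
    have "ennreal (2 / B) * (ennreal (2 ^ DIM('a) * B) * ennreal ((2 * r)\<^sup>2) * ennreal E) = ennreal (2 / B * (2 ^ DIM('a) * B * (2 * r)\<^sup>2 * E))"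
      using B E0 by (simp only: ennreal_mult[symmetric] mult_nonneg_nonneg zero_le_power2 divide_nonneg_pos zero_le_numeral zero_le_power less_imp_le)
    moreover have "2 / B * (2 ^ DIM('a) * B * (2 * r)\<^sup>2 * E) = 2 * 2 ^ DIM('a) * (2 * r)\<^sup>2 * E" using B by simp
    ultimately show ?thesis by (simp only: emB2)
  qed
  finally have "ennreal (LINT x|lborel. (\<phi> x)\<^sup>2) \<le> ennreal (2 * \<delta>\<^sup>2 * measure lborel S) + ennreal (2 * 2 ^ DIM('a) * (2 * r)\<^sup>2 * E)"
    by (simp add: add_left_mono)
  also have "\<dots> = ennreal (2 * \<delta>\<^sup>2 * measure lborel S + 2 * 2 ^ DIM('a) * (2 * r)\<^sup>2 * E)"
    using E0 by (intro ennreal_plus[symmetric]) auto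
  finally show ?thesis using E0 unfolding E_def[symmetric] by (subst (asm) ennreal_le_iff) auto
qed

section \<open>The space of weakly differentiable functions\<close>

lemma sq_int_inner_Basis:
  assumes "sq_int M g" "i \<in> Basis"
  shows "sq_int M (\<lambda>x. g x \<bullet> i)"
  unfolding sq_int_def
proof
  show m: "(\<lambda>x. g x \<bullet> i) \<in> borel_measurable M" using assms by (auto simp: sq_int_def)
  show "integrable M (\<lambda>x. (norm (g x \<bullet> i))\<^sup>2)"
  proof (rule Bochner_Integration.integrable_bound)
    show "integrable M (\<lambda>x. (norm (g x))\<^sup>2)" using assms by (simp add: sq_int_def)
    show "(\<lambda>x. (norm (g x \<bullet> i))\<^sup>2) \<in> borel_measurable M" using m by simp
    show "AE x in M. norm ((norm (g x \<bullet> i))\<^sup>2) \<le> norm ((norm (g x))\<^sup>2)"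
      by (intro AE_I2) (simp add: abs_le_square_iff[symmetric] Basis_le_norm[OF assms(2)])
  qed
qed

lemma l2_tendsto_integral_inner:
  assumes "\<And>n. sq_int M (f n)" "sq_int M f'" "sq_int M h" "(\<lambda>n. l2_norm M (\<lambda>x. f n x - f' x)) \<longlonglongrightarrow> 0"
  shows "(\<lambda>n. LINT x|M. f n x \<bullet> h x) \<longlonglongrightarrow> (LINT x|M. f' x \<bullet> h x)"
proof -
  have "(\<lambda>n. (LINT x|M. f n x \<bullet> h x) - (LINT x|M. f' x \<bullet> h x)) \<longlonglongrightarrow> 0"
  proof (rule Lim_null_comparison)
    show "(\<lambda>n. l2_norm M (\<lambda>x. f n x - f' x) * l2_norm M h) \<longlonglongrightarrow> 0"
      using tendsto_mult_right[OF assms(4), of "l2_norm M h"] by simp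
    have "\<bar>(LINT x|M. f n x \<bullet> h x) - (LINT x|M. f' x \<bullet> h x)\<bar> \<le> l2_norm M (\<lambda>x. f n x - f' x) * l2_norm M h" for n
      using l2_Cauchy_Schwarz[OF sq_int_diff[OF assms(1,2)] assms(3), of n]
        sq_int_inner_integrable[OF assms(1,3), of n] sq_int_inner_integrable[OF assms(2,3)]
      by (simp add: inner_diff_left)
    thus "\<forall>\<^sub>F n in sequentially. norm ((LINT x|M. f n x \<bullet> h x) - (LINT x|M. f' x \<bullet> h x)) \<le> l2_norm M (\<lambda>x. f n x - f' x) * l2_norm M h"
      by simp
  qed
  thus ?thesis by (simp add: LIM_zero_iff)
qed

lemma l2_norm_reverse_triangle:
  assumes "sq_int M f" "sq_int M g"
  shows "\<bar>l2_norm M f - l2_norm M g\<bar> \<le> l2_norm M (\<lambda>x. f x - g x)"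
proof -
  have "l2_norm M f \<le> l2_norm M (\<lambda>x. f x - g x) + l2_norm M g"
    using l2_norm_triangle[OF sq_int_diff[OF assms] assms(2)] by simp
  moreover have "l2_norm M g \<le> l2_norm M (\<lambda>x. g x - f x) + l2_norm M f"
    using l2_norm_triangle[OF sq_int_diff[OF assms(2,1)] assms(1)] by simp
  ultimately show ?thesis using l2_norm_minus_commute[of M f g] by linarith
qed

lemma l2_norm_cong_AE:
  assumes "AE x in M. f x = g x" "f \<in> borel_measurable M" "g \<in> borel_measurable M"
  shows "l2_norm M f = l2_norm M g"
proof -
  have "AE x in M. (norm (f x))\<^sup>2 = (norm (g x))\<^sup>2" using assms(1) by eventually_elim simp
  thus ?thesis unfolding l2_norm_def
    by (intro arg_cong[where f = sqrt] integral_cong_AE) (use assms in auto)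
qed

lemma l2_norm_eq_0:
  assumes "sq_int M f" "l2_norm M f = 0"
  shows "AE x in M. f x = 0"
proof -
  have "(LINT x|M. (norm (f x))\<^sup>2) = 0" using assms(2) by (simp add: l2_norm_def)
  hence "AE x in M. (norm (f x))\<^sup>2 = 0"
    using assms(1) by (subst (asm) integral_nonneg_eq_0_iff_AE) (auto simp: sq_int_def)
  thus ?thesis by eventually_elim simp
qed

locale sobolev_domain =
  fixes \<Omega> :: "'a::euclidean_space set" and p :: real
  assumes p_def: "p = crit_exp DIM('a)" and op: "open \<Omega>" and bd: "bounded \<Omega>" and ne: "\<Omega> \<noteq> {}" and dim: "DIM('a) \<ge> 3"
begin

text \<open>Inside the locale \<open>N\<close> is the measure on \<Omega>; the dimension is written
  \<open>DIM('a)\<close>.\<close>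

abbreviation "N \<equiv> lebesgue_on \<Omega>"
abbreviation "wg \<equiv> weak_gradient \<Omega>"
abbreviation "nrm \<equiv> H10_norm \<Omega>"
abbreviation "l2 \<equiv> (l2_norm (lebesgue_on \<Omega>) :: ('a \<Rightarrow> real) \<Rightarrow> real)"

lemma Om_sets: "\<Omega> \<in> sets lebesgue" using op by simp

lemma finite_N: "finite_measure N"
  using bd op by (intro finite_measure_lebesgue_on lmeasurable_open)

sublocale fm: finite_measure "lebesgue_on \<Omega>" by (rule finite_N)

lemma hwg_sq_int: "has_weak_gradient \<Omega> u g \<Longrightarrow> sq_int N u" "has_weak_gradient \<Omega> u g \<Longrightarrow> sq_int N g"
  by (auto simp: has_weak_gradient_def L2_eq_sq_int)

lemma sq_int_bounded:
  fixes f :: "'a \<Rightarrow> 'b::euclidean_space"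
  assumes "f \<in> borel_measurable N" "\<And>x. norm (f x) \<le> B"
  shows "sq_int N f"
  unfolding sq_int_def
proof
  show "integrable N (\<lambda>x. (norm (f x))\<^sup>2)"
  proof (rule fm.integrable_const_bound[of _ "B\<^sup>2"])
    show "AE x in N. norm ((norm (f x))\<^sup>2) \<le> B\<^sup>2" using assms(2) by (intro AE_I2) (simp add: power_mono)
  qed (use assms in simp)
qed (rule assms)

lemma test_sq_int: "test_function \<Omega> \<phi> \<Longrightarrow> sq_int N \<phi>"
proof -
  assume t: "test_function \<Omega> \<phi>"
  obtain B where B: "\<And>x. \<bar>\<phi> x\<bar> \<le> B" by (rule test_function_bounded[OF t]) auto
  show ?thesis
    by (rule sq_int_bounded[OF borel_measurable_lebesgue_on_borel[OF test_function_borel[OF t]]]) (use B in simp)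
qed

lemma grad_sq_int: "test_function \<Omega> \<phi> \<Longrightarrow> sq_int N (grad \<phi>)"
proof -
  assume t: "test_function \<Omega> \<phi>"
  obtain B where B: "\<And>x. norm (grad \<phi> x) \<le> B" by (rule grad_bounded[OF t]) auto
  show ?thesis
    by (rule sq_int_bounded[OF borel_measurable_lebesgue_on_borel[OF grad_borel[OF t]] B])
qed

text \<open>Each component of the difference of the two gradients is orthogonal to all test
  functions. Admitting two functions equal almost everywhere shows that the weak gradient depends
  only on the class.\<close>

lemma hwg_unique:
  assumes "has_weak_gradient \<Omega> u g" "has_weak_gradient \<Omega> u' g'" "AE x in N. u x = u' x"
  shows "AE x in N. g x = g' x"
proof -
  note s = hwg_sq_int[OF assms(1)] hwg_sq_int[OF assms(2)]
  have "AE x in N. (g x - g' x) \<bullet> i = 0" if i: "i \<in> Basis" for i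
  proof (rule test_function_ortho_AE_zero[OF op bd])
    have si: "sq_int N (\<lambda>x. (g x - g' x) \<bullet> i)" by (rule sq_int_inner_Basis[OF sq_int_diff[OF s(2) s(4)] i])
    thus "integrable N (\<lambda>x. (g x - g' x) \<bullet> i)"
      using fm.sq_int_integrable_norm(1)[OF si] by (subst (asm) integrable_norm_iff) (auto simp: sq_int_def)
    fix \<phi> assume t: "test_function \<Omega> \<phi>"
    have t': "test_function \<Omega> (partial_deriv i \<phi>)" by (rule test_function_partial_deriv[OF t i])
    have I: "integrable N (\<lambda>x. (g x \<bullet> i) * \<phi> x)" "integrable N (\<lambda>x. (g' x \<bullet> i) * \<phi> x)"
      using sq_int_inner_integrable[OF sq_int_inner_Basis[OF s(2) i] test_sq_int[OF t]]
        sq_int_inner_integrable[OF sq_int_inner_Basis[OF s(4) i] test_sq_int[OF t]] by simp_all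
    have mu: "u \<in> borel_measurable N" "u' \<in> borel_measurable N" "partial_deriv i \<phi> \<in> borel_measurable N"
      using s test_sq_int[OF t'] by (auto simp: sq_int_def)
    have "(LINT x|N. u x * partial_deriv i \<phi> x) = (LINT x|N. u' x * partial_deriv i \<phi> x)"
    proof (rule integral_cong_AE)
      show "AE x in N. u x * partial_deriv i \<phi> x = u' x * partial_deriv i \<phi> x" using assms(3) by eventually_elim simp
    qed (use mu in auto)
    hence "(LINT x|N. (g x \<bullet> i) * \<phi> x) = (LINT x|N. (g' x \<bullet> i) * \<phi> x)"
      using assms(1,2) t i unfolding has_weak_gradient_def by auto
    thus "(LINT x|N. ((g x - g' x) \<bullet> i) * \<phi> x) = 0"
      using I by (simp add: inner_diff_left left_diff_distrib)
  qed
  hence "AE x in N. \<forall>i\<in>Basis. (g x - g' x) \<bullet> i = 0" by (subst AE_ball_countable) (auto intro: countable_finite)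
  thus ?thesis
  proof eventually_elim
    case (elim x)
    hence "g x - g' x = 0" using euclidean_all_zero_iff[of "g x - g' x"] by blast
    thus ?case by simp
  qed
qed

lemma hwg_add:
  assumes "has_weak_gradient \<Omega> u g" "has_weak_gradient \<Omega> v h"
  shows "has_weak_gradient \<Omega> (\<lambda>x. u x + v x) (\<lambda>x. g x + h x)"
  unfolding has_weak_gradient_def L2_eq_sq_int
proof (intro conjI allI impI ballI)
  note s = hwg_sq_int[OF assms(1)] hwg_sq_int[OF assms(2)]
  show "sq_int N (\<lambda>x. u x + v x)" "sq_int N (\<lambda>x. g x + h x)" using s by (auto intro: sq_int_add)
  fix \<phi> i assume t: "test_function \<Omega> \<phi>" and i: "(i::'a) \<in> Basis"
  have t': "test_function \<Omega> (partial_deriv i \<phi>)" by (rule test_function_partial_deriv[OF t i])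
  have I: "integrable N (\<lambda>x. (g x \<bullet> i) * \<phi> x)" "integrable N (\<lambda>x. (h x \<bullet> i) * \<phi> x)"
    using sq_int_inner_integrable[OF sq_int_inner_Basis[OF s(2) i] test_sq_int[OF t]]
      sq_int_inner_integrable[OF sq_int_inner_Basis[OF s(4) i] test_sq_int[OF t]] by simp_all
  have I': "integrable N (\<lambda>x. u x * partial_deriv i \<phi> x)" "integrable N (\<lambda>x. v x * partial_deriv i \<phi> x)"
    using sq_int_inner_integrable[OF s(1) test_sq_int[OF t']] sq_int_inner_integrable[OF s(3) test_sq_int[OF t']] by simp_all
  show "(LINT x|N. (u x + v x) * partial_deriv i \<phi> x) = - (LINT x|N. ((g x + h x) \<bullet> i) * \<phi> x)"
    using I I' assms t i unfolding has_weak_gradient_def by (simp add: inner_add_left distrib_right)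
qed

lemma hwg_scale:
  assumes "has_weak_gradient \<Omega> u g"
  shows "has_weak_gradient \<Omega> (\<lambda>x. c * u x) (\<lambda>x. c *\<^sub>R g x)"
  unfolding has_weak_gradient_def L2_eq_sq_int
proof (intro conjI allI impI ballI)
  note s = hwg_sq_int[OF assms(1)]
  show "sq_int N (\<lambda>x. c * u x)" using sq_int_scaleR[OF s(1), of c] by simp
  show "sq_int N (\<lambda>x. c *\<^sub>R g x)" by (rule sq_int_scaleR[OF s(2)])
  fix \<phi> i assume t: "test_function \<Omega> \<phi>" and i: "(i::'a) \<in> Basis"
  have "(LINT x|N. c * u x * partial_deriv i \<phi> x) = c * (LINT x|N. u x * partial_deriv i \<phi> x)" by (simp add: mult.assoc)
  also have "\<dots> = - (c * (LINT x|N. (g x \<bullet> i) * \<phi> x))" using assms t i unfolding has_weak_gradient_def by simp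
  also have "\<dots> = - (LINT x|N. (c *\<^sub>R g x \<bullet> i) * \<phi> x)" by (simp add: mult.assoc)
  finally show "(LINT x|N. c * u x * partial_deriv i \<phi> x) = - (LINT x|N. (c *\<^sub>R g x \<bullet> i) * \<phi> x)" .
qed

text \<open>Both sides of the defining identity are L2 pairings with fixed functions, hence
  continuous. So the weak gradient is a closed operator, on which completeness of the Sobolev space
  rests.\<close>

lemma hwg_limit:
  assumes "\<And>n. has_weak_gradient \<Omega> (u n) (g n)" "sq_int N v" "sq_int N h"
    "(\<lambda>n. l2 (\<lambda>x. u n x - v x)) \<longlonglongrightarrow> 0" "(\<lambda>n. l2_norm N (\<lambda>x. g n x - h x)) \<longlonglongrightarrow> 0"
  shows "has_weak_gradient \<Omega> v h"
  unfolding has_weak_gradient_def L2_eq_sq_int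
proof (intro conjI allI impI ballI assms(2,3))
  note s = hwg_sq_int[OF assms(1)]
  fix \<phi> i assume t: "test_function \<Omega> \<phi>" and i: "(i::'a) \<in> Basis"
  have t': "test_function \<Omega> (partial_deriv i \<phi>)" by (rule test_function_partial_deriv[OF t i])
  have si: "sq_int N (\<lambda>x. \<phi> x *\<^sub>R i)"
    using test_sq_int[OF t] i by (auto simp: sq_int_def)
  have 1: "(\<lambda>n. LINT x|N. u n x * partial_deriv i \<phi> x) \<longlonglongrightarrow> (LINT x|N. v x * partial_deriv i \<phi> x)"
    using l2_tendsto_integral_inner[OF s(1) assms(2) test_sq_int[OF t'] assms(4)] by simp
  have 2: "(\<lambda>n. LINT x|N. (g n x \<bullet> i) * \<phi> x) \<longlonglongrightarrow> (LINT x|N. (h x \<bullet> i) * \<phi> x)"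
    using l2_tendsto_integral_inner[OF s(2) assms(3) si assms(5)] by (simp add: mult.commute)
  have "(\<lambda>n. LINT x|N. u n x * partial_deriv i \<phi> x) = (\<lambda>n. - (LINT x|N. (g n x \<bullet> i) * \<phi> x))"
    using assms(1) t i unfolding has_weak_gradient_def by auto
  hence "(\<lambda>n. LINT x|N. u n x * partial_deriv i \<phi> x) \<longlonglongrightarrow> - (LINT x|N. (h x \<bullet> i) * \<phi> x)"
    using tendsto_minus[OF 2] by simp
  with 1 show "(LINT x|N. v x * partial_deriv i \<phi> x) = - (LINT x|N. (h x \<bullet> i) * \<phi> x)"
    by (rule LIMSEQ_unique)
qed

text \<open>Both integrands of the classical integration by parts vanish off \<Omega>, so it can be
  carried out on the whole space.\<close>

lemma hwg_test:
  assumes t: "test_function \<Omega> \<phi>"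
  shows "has_weak_gradient \<Omega> \<phi> (grad \<phi>)"
  unfolding has_weak_gradient_def L2_eq_sq_int
proof (intro conjI allI impI ballI test_sq_int[OF t] grad_sq_int[OF t])
  fix \<psi> i assume t2: "test_function \<Omega> \<psi>" and i: "(i::'a) \<in> Basis"
  have "(LINT x|N. \<phi> x * partial_deriv i \<psi> x) = (LINT x|lborel. \<phi> x * partial_deriv i \<psi> x)"
    by (rule LINT_lebesgue_on_eq_lborel[OF Om_sets])
      (auto intro: borel_measurable_times test_function_borel[OF t] test_function_borel[OF test_function_partial_deriv[OF t2 i]] simp: test_function_outside[OF t])
  also have "\<dots> = - (LINT x|lborel. partial_deriv i \<phi> x * \<psi> x)" by (rule test_function_parts[OF t t2 i])
  also have "(LINT x|lborel. partial_deriv i \<phi> x * \<psi> x) = (LINT x|N. partial_deriv i \<phi> x * \<psi> x)"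
    by (rule LINT_lebesgue_on_eq_lborel[OF Om_sets, symmetric])
      (auto intro: borel_measurable_times test_function_borel[OF t2] test_function_borel[OF test_function_partial_deriv[OF t i]] simp: test_function_outside[OF t2])
  finally show "(LINT x|N. \<phi> x * partial_deriv i \<psi> x) = - (LINT x|N. (grad \<phi> x \<bullet> i) * \<psi> x)"
    by (simp add: grad_inner_Basis[OF i])
qed

section \<open>Linearity of the weak gradient and the two inner products\<close>

lemma H1_hwg: "u \<in> H1 \<Omega> \<Longrightarrow> has_weak_gradient \<Omega> u (wg u)"
  unfolding H1_def weak_gradient_def using someI_ex[of "has_weak_gradient \<Omega> u"] by simp

lemma hwg_H1: "has_weak_gradient \<Omega> u g \<Longrightarrow> u \<in> H1 \<Omega>"
  unfolding H1_def by auto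

lemma H1_sq_int: "u \<in> H1 \<Omega> \<Longrightarrow> sq_int N u" "u \<in> H1 \<Omega> \<Longrightarrow> sq_int N (wg u)"
  by (rule hwg_sq_int[OF H1_hwg], assumption)+

lemma wg_eq: "has_weak_gradient \<Omega> u g \<Longrightarrow> AE x in N. wg u x = g x"
  by (rule hwg_unique[OF H1_hwg[OF hwg_H1]], assumption, assumption, simp)

lemma H1_add: "u \<in> H1 \<Omega> \<Longrightarrow> v \<in> H1 \<Omega> \<Longrightarrow> (\<lambda>x. u x + v x) \<in> H1 \<Omega>"
  by (rule hwg_H1[OF hwg_add[OF H1_hwg H1_hwg]])

lemma H1_scale: "u \<in> H1 \<Omega> \<Longrightarrow> (\<lambda>x. c * u x) \<in> H1 \<Omega>"
  by (rule hwg_H1[OF hwg_scale[OF H1_hwg]])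

lemma H1_diff: "u \<in> H1 \<Omega> \<Longrightarrow> v \<in> H1 \<Omega> \<Longrightarrow> (\<lambda>x. u x - v x) \<in> H1 \<Omega>"
  using H1_add[OF _ H1_scale, of u v "-1"] by simp

lemma test_H1: "test_function \<Omega> \<phi> \<Longrightarrow> \<phi> \<in> H1 \<Omega>"
  by (rule hwg_H1[OF hwg_test])

lemma wg_add: "u \<in> H1 \<Omega> \<Longrightarrow> v \<in> H1 \<Omega> \<Longrightarrow> AE x in N. wg (\<lambda>x. u x + v x) x = wg u x + wg v x"
  by (rule wg_eq[OF hwg_add[OF H1_hwg H1_hwg]])

lemma wg_scale: "u \<in> H1 \<Omega> \<Longrightarrow> AE x in N. wg (\<lambda>x. c * u x) x = c *\<^sub>R wg u x"
  by (rule wg_eq[OF hwg_scale[OF H1_hwg]])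

text \<open>The inner product that belongs to \<open>H10_norm\<close>; its companion
  \<open>lip\<close> is the inner product of L2 and is unrelated to the Lipschitz condition
  \<open>lip_C1\<close>.\<close>

definition gip :: "('a \<Rightarrow> real) \<Rightarrow> ('a \<Rightarrow> real) \<Rightarrow> real" where
  "gip u v = (LINT x|N. wg u x \<bullet> wg v x)"

definition lip :: "('a \<Rightarrow> real) \<Rightarrow> ('a \<Rightarrow> real) \<Rightarrow> real" where
  "lip u v = (LINT x|N. u x * v x)"

lemma gip_commute: "gip u v = gip v u" by (simp add: gip_def inner_commute)
lemma lip_commute: "lip u v = lip v u" by (simp add: lip_def mult.commute)

text \<open>\<open>weak_gradient\<close> is a choice and so is additive only almost everywhere; the
  integral does not notice.\<close>

lemma gip_add:
  assumes "u \<in> H1 \<Omega>" "v \<in> H1 \<Omega>" "w \<in> H1 \<Omega>"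
  shows "gip (\<lambda>x. u x + v x) w = gip u w + gip v w"
proof -
  note s = H1_sq_int(2)[OF assms(1)] H1_sq_int(2)[OF assms(2)] H1_sq_int(2)[OF assms(3)] H1_sq_int(2)[OF H1_add[OF assms(1,2)]]
  have "gip (\<lambda>x. u x + v x) w = (LINT x|N. wg u x \<bullet> wg w x + wg v x \<bullet> wg w x)"
    unfolding gip_def
  proof (rule integral_cong_AE)
    show "AE x in N. wg (\<lambda>x. u x + v x) x \<bullet> wg w x = wg u x \<bullet> wg w x + wg v x \<bullet> wg w x"
      using wg_add[OF assms(1,2)] by eventually_elim (simp add: inner_add_left)
  qed (use sq_int_inner_integrable[OF s(4) s(3)] sq_int_inner_integrable[OF s(1) s(3)] sq_int_inner_integrable[OF s(2) s(3)] in auto)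
  thus ?thesis using sq_int_inner_integrable[OF s(1) s(3)] sq_int_inner_integrable[OF s(2) s(3)] by (simp add: gip_def)
qed

lemma gip_scale:
  assumes "u \<in> H1 \<Omega>" "w \<in> H1 \<Omega>"
  shows "gip (\<lambda>x. c * u x) w = c * gip u w"
proof -
  note s = H1_sq_int(2)[OF assms(1)] H1_sq_int(2)[OF assms(2)] H1_sq_int(2)[OF H1_scale[OF assms(1)]]
  have "gip (\<lambda>x. c * u x) w = (LINT x|N. c * (wg u x \<bullet> wg w x))"
    unfolding gip_def
  proof (rule integral_cong_AE)
    show "AE x in N. wg (\<lambda>x. c * u x) x \<bullet> wg w x = c * (wg u x \<bullet> wg w x)"
      using wg_scale[OF assms(1), of c] by eventually_elim simp
  qed (use sq_int_inner_integrable[OF s(3) s(2)] sq_int_inner_integrable[OF s(1) s(2)] in auto)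
  thus ?thesis by (simp add: gip_def)
qed

lemma lip_add:
  assumes "sq_int N u" "sq_int N v" "sq_int N w"
  shows "lip (\<lambda>x. u x + v x) w = lip u w + lip v w"
  using sq_int_inner_integrable[OF assms(1,3)] sq_int_inner_integrable[OF assms(2,3)]
  by (simp add: lip_def distrib_right)

lemma lip_scale: "lip (\<lambda>x. c * u x) w = c * lip u w"
  by (simp add: lip_def mult.assoc)

lemma gip_diff:
  assumes "u \<in> H1 \<Omega>" "v \<in> H1 \<Omega>" "w \<in> H1 \<Omega>"
  shows "gip (\<lambda>x. u x - v x) w = gip u w - gip v w"
  using gip_add[OF assms(1) H1_scale[OF assms(2)] assms(3), of "-1"] gip_scale[OF assms(2,3), of "-1"] by simp

lemma lip_diff:
  assumes "sq_int N u" "sq_int N v" "sq_int N w"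
  shows "lip (\<lambda>x. u x - v x) w = lip u w - lip v w"
  using sq_int_inner_integrable[OF assms(1,3)] sq_int_inner_integrable[OF assms(2,3)]
  by (simp add: lip_def left_diff_distrib)

lemma energy_eq_gip: "dirichlet_energy \<Omega> u = gip u u"
  by (simp add: dirichlet_energy_def gip_def power2_norm_eq_inner)

lemma nrm_eq: "nrm u = l2_norm N (wg u)"
  by (simp add: H10_norm_def dirichlet_energy_def l2_norm_def)

lemma nrm_nonneg: "0 \<le> nrm u" by (simp add: nrm_eq l2_norm_nonneg)

lemma nrm_sq: "(nrm u)\<^sup>2 = gip u u"
  by (simp add: nrm_eq l2_norm_sq gip_def power2_norm_eq_inner)

lemma energy_eq_nrm: "dirichlet_energy \<Omega> u = (nrm u)\<^sup>2"
  by (simp add: nrm_sq energy_eq_gip)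

lemma l2_sq: "(l2 u)\<^sup>2 = lip u u"
  unfolding l2_norm_sq lip_def by (simp add: power2_eq_square)

lemma gip_CS: "u \<in> H1 \<Omega> \<Longrightarrow> v \<in> H1 \<Omega> \<Longrightarrow> \<bar>gip u v\<bar> \<le> nrm u * nrm v"
  unfolding gip_def nrm_eq by (rule l2_Cauchy_Schwarz[OF H1_sq_int(2) H1_sq_int(2)])

lemma lip_CS: "sq_int N u \<Longrightarrow> sq_int N v \<Longrightarrow> \<bar>lip u v\<bar> \<le> l2 u * l2 v"
  unfolding lip_def using l2_Cauchy_Schwarz[of N u v] by simp

lemma nrm_add_sq:
  assumes "u \<in> H1 \<Omega>" "v \<in> H1 \<Omega>"
  shows "(nrm (\<lambda>x. u x + v x))\<^sup>2 = (nrm u)\<^sup>2 + 2 * gip u v + (nrm v)\<^sup>2"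
  unfolding nrm_sq using gip_add[OF assms H1_add[OF assms]] gip_add[OF assms assms(1)] gip_add[OF assms assms(2)]
  by (simp add: gip_commute[of u "\<lambda>x. u x + v x"] gip_commute[of v "\<lambda>x. u x + v x"] gip_commute[of v u])

lemma nrm_diff_sq:
  assumes "u \<in> H1 \<Omega>" "v \<in> H1 \<Omega>"
  shows "(nrm (\<lambda>x. u x - v x))\<^sup>2 = (nrm u)\<^sup>2 - 2 * gip u v + (nrm v)\<^sup>2"
  unfolding nrm_sq using gip_diff[OF assms H1_diff[OF assms]] gip_diff[OF assms assms(1)] gip_diff[OF assms assms(2)]
  by (simp add: gip_commute[of u "\<lambda>x. u x - v x"] gip_commute[of v "\<lambda>x. u x - v x"] gip_commute[of v u])

lemma nrm_triangle:
  assumes "u \<in> H1 \<Omega>" "v \<in> H1 \<Omega>"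
  shows "nrm (\<lambda>x. u x + v x) \<le> nrm u + nrm v"
proof (rule power2_le_imp_le)
  show "(nrm (\<lambda>x. u x + v x))\<^sup>2 \<le> (nrm u + nrm v)\<^sup>2"
    using nrm_add_sq[OF assms] gip_CS[OF assms] by (simp add: power2_sum)
qed (simp add: nrm_nonneg)

lemma nrm_scale: "u \<in> H1 \<Omega> \<Longrightarrow> nrm (\<lambda>x. c * u x) = \<bar>c\<bar> * nrm u"
proof -
  assume u: "u \<in> H1 \<Omega>"
  have "gip (\<lambda>x. c * u x) (\<lambda>x. c * u x) = c * gip u (\<lambda>x. c * u x)" by (rule gip_scale[OF u H1_scale[OF u]])
  also have "gip u (\<lambda>x. c * u x) = c * gip u u" by (subst gip_commute) (rule gip_scale[OF u u])
  finally have "(nrm (\<lambda>x. c * u x))\<^sup>2 = c * (c * gip u u)" by (simp only: nrm_sq)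
  also have "\<dots> = (\<bar>c\<bar> * nrm u)\<^sup>2" by (simp only: power_mult_distrib power2_abs nrm_sq) (simp add: power2_eq_square)
  finally show ?thesis by (rule power2_eq_imp_eq) (simp_all add: nrm_nonneg)
qed

lemma l2_scale: "l2 (\<lambda>x. c * u x) = \<bar>c\<bar> * l2 u"
  using l2_norm_scaleR[of N c u] by simp

lemma nrm_minus_commute: "u \<in> H1 \<Omega> \<Longrightarrow> v \<in> H1 \<Omega> \<Longrightarrow> nrm (\<lambda>x. u x - v x) = nrm (\<lambda>x. v x - u x)"
  using nrm_scale[OF H1_diff, of u v "-1"] by simp

lemma nrm_triangle_diff:
  assumes "u \<in> H1 \<Omega>" "v \<in> H1 \<Omega>"
  shows "nrm u \<le> nrm (\<lambda>x. u x - v x) + nrm v" "nrm (\<lambda>x. u x - v x) \<le> nrm u + nrm v"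
proof -
  show "nrm u \<le> nrm (\<lambda>x. u x - v x) + nrm v" using nrm_triangle[OF H1_diff[OF assms] assms(2)] by simp
  show "nrm (\<lambda>x. u x - v x) \<le> nrm u + nrm v"
    using nrm_triangle[OF assms(1) H1_scale[OF assms(2), of "-1"]] nrm_scale[OF assms(2), of "-1"] by simp
qed

lemma nrm_cong_AE:
  assumes "u \<in> H1 \<Omega>" "v \<in> H1 \<Omega>" "AE x in N. u x = v x"
  shows "nrm u = nrm v"
  unfolding nrm_eq
  by (rule l2_norm_cong_AE[OF hwg_unique[OF H1_hwg[OF assms(1)] H1_hwg[OF assms(2)] assms(3)]])
    (use H1_sq_int(2)[OF assms(1)] H1_sq_int(2)[OF assms(2)] in \<open>auto simp: sq_int_def\<close>)

lemma nrm_test: "test_function \<Omega> \<phi> \<Longrightarrow> (nrm \<phi>)\<^sup>2 = (LINT x|lborel. (norm (grad \<phi> x))\<^sup>2)"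
proof -
  assume t: "test_function \<Omega> \<phi>"
  have "nrm \<phi> = l2_norm N (grad \<phi>)"
    unfolding nrm_eq by (rule l2_norm_cong_AE[OF wg_eq[OF hwg_test[OF t]]])
      (use H1_sq_int(2)[OF test_H1[OF t]] grad_sq_int[OF t] in \<open>auto simp: sq_int_def\<close>)
  hence "(nrm \<phi>)\<^sup>2 = (LINT x|N. (norm (grad \<phi> x))\<^sup>2)" by (simp add: l2_norm_sq)
  also have "\<dots> = (LINT x|lborel. (norm (grad \<phi> x))\<^sup>2)"
    by (rule LINT_lebesgue_on_eq_lborel[OF Om_sets]) (use grad_borel[OF t] grad_outside[OF t] in auto)
  finally show ?thesis .
qed

lemma H1_norm_eq: "H1_norm \<Omega> u = sqrt ((l2 u)\<^sup>2 + (nrm u)\<^sup>2)"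
  by (simp add: H1_norm_def l2_norm_sq energy_eq_nrm)

lemma H1_norm_tendsto_iff:
  "(\<lambda>k::nat. H1_norm \<Omega> (f k)) \<longlonglongrightarrow> 0 \<longleftrightarrow> (\<lambda>k. l2 (f k)) \<longlonglongrightarrow> 0 \<and> (\<lambda>k. nrm (f k)) \<longlonglongrightarrow> 0"
proof (intro iffI conjI)
  assume a: "(\<lambda>k. H1_norm \<Omega> (f k)) \<longlonglongrightarrow> 0"
  show "(\<lambda>k. l2 (f k)) \<longlonglongrightarrow> 0"
  proof (rule tendsto_sandwich[OF _ _ tendsto_const a])
    show "\<forall>\<^sub>F k in sequentially. l2 (f k) \<le> H1_norm \<Omega> (f k)"
      unfolding H1_norm_eq by (intro always_eventually allI real_le_rsqrt) simp
  qed (simp add: l2_norm_nonneg)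
  show "(\<lambda>k. nrm (f k)) \<longlonglongrightarrow> 0"
  proof (rule tendsto_sandwich[OF _ _ tendsto_const a])
    show "\<forall>\<^sub>F k in sequentially. nrm (f k) \<le> H1_norm \<Omega> (f k)"
      unfolding H1_norm_eq by (intro always_eventually allI real_le_rsqrt) simp
  qed (simp add: nrm_nonneg)
next
  assume "(\<lambda>k. l2 (f k)) \<longlonglongrightarrow> 0 \<and> (\<lambda>k. nrm (f k)) \<longlonglongrightarrow> 0"
  hence "(\<lambda>k. sqrt ((l2 (f k))\<^sup>2 + (nrm (f k))\<^sup>2)) \<longlonglongrightarrow> sqrt (0\<^sup>2 + 0\<^sup>2)" by (intro tendsto_intros) auto
  thus "(\<lambda>k. H1_norm \<Omega> (f k)) \<longlonglongrightarrow> 0" by (simp add: H1_norm_eq)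
qed

section \<open>The space $H^1_0$\<close>

lemma H10_H1: "u \<in> H10 \<Omega> \<Longrightarrow> u \<in> H1 \<Omega>" by (simp add: H10_def)

lemma H10_approx:
  assumes "u \<in> H10 \<Omega>"
  obtains \<phi> where "\<And>k. test_function \<Omega> (\<phi> k)" "(\<lambda>k::nat. l2 (\<lambda>x. \<phi> k x - u x)) \<longlonglongrightarrow> 0" "(\<lambda>k. nrm (\<lambda>x. \<phi> k x - u x)) \<longlonglongrightarrow> 0"
proof -
  from assms obtain \<phi> where "\<forall>k. test_function \<Omega> (\<phi> k)" "(\<lambda>k::nat. H1_norm \<Omega> (\<lambda>x. \<phi> k x - u x)) \<longlonglongrightarrow> 0"
    unfolding H10_def by auto
  thus ?thesis by (intro that[of \<phi>]) (auto simp: H1_norm_tendsto_iff)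
qed

lemma H10_I:
  assumes "u \<in> H1 \<Omega>" "\<And>k. test_function \<Omega> (\<phi> k)" "(\<lambda>k::nat. l2 (\<lambda>x. \<phi> k x - u x)) \<longlonglongrightarrow> 0" "(\<lambda>k. nrm (\<lambda>x. \<phi> k x - u x)) \<longlonglongrightarrow> 0"
  shows "u \<in> H10 \<Omega>"
proof -
  have "(\<lambda>k. H1_norm \<Omega> (\<lambda>x. \<phi> k x - u x)) \<longlonglongrightarrow> 0" using assms(3,4) by (simp add: H1_norm_tendsto_iff)
  thus ?thesis using assms(1,2) unfolding H10_def by blast
qed

lemma H10_approx1:
  assumes "u \<in> H10 \<Omega>" "e > 0"
  obtains \<phi> where "test_function \<Omega> \<phi>" "l2 (\<lambda>x. \<phi> x - u x) < e" "nrm (\<lambda>x. \<phi> x - u x) < e"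
proof -
  obtain \<phi> where \<phi>: "\<And>k. test_function \<Omega> (\<phi> k)" "(\<lambda>k::nat. l2 (\<lambda>x. \<phi> k x - u x)) \<longlonglongrightarrow> 0" "(\<lambda>k. nrm (\<lambda>x. \<phi> k x - u x)) \<longlonglongrightarrow> 0"
    by (rule H10_approx[OF assms(1)]) auto
  have "\<forall>\<^sub>F k in sequentially. l2 (\<lambda>x. \<phi> k x - u x) < e \<and> nrm (\<lambda>x. \<phi> k x - u x) < e"
    using order_tendstoD(2)[OF \<phi>(2) assms(2)] order_tendstoD(2)[OF \<phi>(3) assms(2)] by (rule eventually_conj)
  then obtain k where "l2 (\<lambda>x. \<phi> k x - u x) < e" "nrm (\<lambda>x. \<phi> k x - u x) < e"
    unfolding eventually_sequentially by blast
  with \<phi>(1) show ?thesis by (rule that)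
qed

lemma H10_I1:
  assumes "u \<in> H1 \<Omega>" "\<And>e. e > 0 \<Longrightarrow> \<exists>\<phi>. test_function \<Omega> \<phi> \<and> l2 (\<lambda>x. \<phi> x - u x) \<le> e \<and> nrm (\<lambda>x. \<phi> x - u x) \<le> e"
  shows "u \<in> H10 \<Omega>"
proof -
  have "\<exists>\<phi>. test_function \<Omega> \<phi> \<and> l2 (\<lambda>x. \<phi> x - u x) \<le> inverse (real (Suc k)) \<and> nrm (\<lambda>x. \<phi> x - u x) \<le> inverse (real (Suc k))" for k
    by (rule assms(2)) simp
  then obtain \<phi> where \<phi>: "\<And>k. test_function \<Omega> (\<phi> k)" "\<And>k. l2 (\<lambda>x. \<phi> k x - u x) \<le> inverse (real (Suc k))" "\<And>k. nrm (\<lambda>x. \<phi> k x - u x) \<le> inverse (real (Suc k))"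
    by metis
  show ?thesis
  proof (rule H10_I[OF assms(1) \<phi>(1)])
    show "(\<lambda>k. l2 (\<lambda>x. \<phi> k x - u x)) \<longlonglongrightarrow> 0"
      by (rule tendsto_sandwich[OF _ _ tendsto_const LIMSEQ_inverse_real_of_nat]) (auto simp: l2_norm_nonneg \<phi>(2) simp del: of_nat_Suc)
    show "(\<lambda>k. nrm (\<lambda>x. \<phi> k x - u x)) \<longlonglongrightarrow> 0"
      by (rule tendsto_sandwich[OF _ _ tendsto_const LIMSEQ_inverse_real_of_nat]) (auto simp: nrm_nonneg \<phi>(3) simp del: of_nat_Suc)
  qed
qed

lemma test_H10: "test_function \<Omega> \<phi> \<Longrightarrow> \<phi> \<in> H10 \<Omega>"
proof (rule H10_I1[OF test_H1])
  assume t: "test_function \<Omega> \<phi>"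
  fix e :: real assume "e > 0"
  have "nrm (\<lambda>x. \<phi> x - \<phi> x) = 0" using nrm_scale[OF test_H1[OF t], of 0] by simp
  moreover have "l2 (\<lambda>x. \<phi> x - \<phi> x) = 0" by (simp add: l2_norm_def)
  ultimately show "\<exists>\<phi>'. test_function \<Omega> \<phi>' \<and> l2 (\<lambda>x. \<phi>' x - \<phi> x) \<le> e \<and> nrm (\<lambda>x. \<phi>' x - \<phi> x) \<le> e"
    using t \<open>e > 0\<close> by (intro exI[of _ \<phi>]) simp
qed

lemma l2_triangle: "sq_int N u \<Longrightarrow> sq_int N v \<Longrightarrow> l2 (\<lambda>x. u x + v x) \<le> l2 u + l2 v"
  by (rule l2_norm_triangle)

text \<open>\<open>H10 \<Omega>\<close> is a closure, so an element within e/2 of u has a test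
  function within e/2 of itself. Both norms must be controlled, because membership is defined by
  \<open>H1_norm\<close>.\<close>

lemma H10_closed:
  assumes u: "u \<in> H1 \<Omega>" and ex: "\<And>e. e > 0 \<Longrightarrow> \<exists>v\<in>H10 \<Omega>. l2 (\<lambda>x. v x - u x) \<le> e \<and> nrm (\<lambda>x. v x - u x) \<le> e"
  shows "u \<in> H10 \<Omega>"
proof (rule H10_I1[OF u])
  fix e :: real assume e: "e > 0"
  then obtain v where v: "v \<in> H10 \<Omega>" "l2 (\<lambda>x. v x - u x) \<le> e / 2" "nrm (\<lambda>x. v x - u x) \<le> e / 2"
    using ex[of "e / 2"] by auto
  have e2: "e / 2 > 0" using e by simp
  obtain \<phi> where \<phi>: "test_function \<Omega> \<phi>" "l2 (\<lambda>x. \<phi> x - v x) < e / 2" "nrm (\<lambda>x. \<phi> x - v x) < e / 2"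
    by (rule H10_approx1[OF v(1) e2])
  have h: "(\<lambda>x. \<phi> x - v x) \<in> H1 \<Omega>" "(\<lambda>x. v x - u x) \<in> H1 \<Omega>"
    using H1_diff test_H1[OF \<phi>(1)] H10_H1[OF v(1)] u by auto
  have "nrm (\<lambda>x. \<phi> x - u x) \<le> e" using nrm_triangle[OF h] \<phi>(3) v(3) by simp
  moreover have "l2 (\<lambda>x. \<phi> x - u x) \<le> e" using l2_triangle[OF H1_sq_int(1)[OF h(1)] H1_sq_int(1)[OF h(2)]] \<phi>(2) v(2) by simp
  ultimately show "\<exists>\<phi>. test_function \<Omega> \<phi> \<and> l2 (\<lambda>x. \<phi> x - u x) \<le> e \<and> nrm (\<lambda>x. \<phi> x - u x) \<le> e"
    using \<phi>(1) by blast
qed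

lemma H10_add:
  assumes "u \<in> H10 \<Omega>" "v \<in> H10 \<Omega>"
  shows "(\<lambda>x. u x + v x) \<in> H10 \<Omega>"
proof (rule H10_I1)
  note h = H10_H1[OF assms(1)] H10_H1[OF assms(2)]
  show "(\<lambda>x. u x + v x) \<in> H1 \<Omega>" by (rule H1_add[OF h])
  fix e :: real assume "e > 0"
  hence e2: "e / 2 > 0" by simp
  obtain \<phi> where \<phi>: "test_function \<Omega> \<phi>" "l2 (\<lambda>x. \<phi> x - u x) < e / 2" "nrm (\<lambda>x. \<phi> x - u x) < e / 2"
    by (rule H10_approx1[OF assms(1) e2])
  obtain \<psi> where \<psi>: "test_function \<Omega> \<psi>" "l2 (\<lambda>x. \<psi> x - v x) < e / 2" "nrm (\<lambda>x. \<psi> x - v x) < e / 2"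
    by (rule H10_approx1[OF assms(2) e2])
  have d: "(\<lambda>x. \<phi> x - u x) \<in> H1 \<Omega>" "(\<lambda>x. \<psi> x - v x) \<in> H1 \<Omega>"
    using H1_diff test_H1 \<phi>(1) \<psi>(1) h by auto
  have eq: "(\<lambda>x. (\<phi> x + \<psi> x) - (u x + v x)) = (\<lambda>x. (\<phi> x - u x) + (\<psi> x - v x))" by auto
  have "nrm (\<lambda>x. (\<phi> x + \<psi> x) - (u x + v x)) \<le> e" unfolding eq using nrm_triangle[OF d] \<phi>(3) \<psi>(3) by simp
  moreover have "l2 (\<lambda>x. (\<phi> x + \<psi> x) - (u x + v x)) \<le> e"
    unfolding eq using l2_triangle[OF H1_sq_int(1)[OF d(1)] H1_sq_int(1)[OF d(2)]] \<phi>(2) \<psi>(2) by simp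
  ultimately show "\<exists>w. test_function \<Omega> w \<and> l2 (\<lambda>x. w x - (u x + v x)) \<le> e \<and> nrm (\<lambda>x. w x - (u x + v x)) \<le> e"
    using test_function_add[OF \<phi>(1) \<psi>(1)] by (intro exI[of _ "\<lambda>x. \<phi> x + \<psi> x"]) simp
qed

lemma test_function_scale: "test_function \<Omega> \<phi> \<Longrightarrow> test_function \<Omega> (\<lambda>x. c * \<phi> x)"
  by (rule test_function_mult) (auto intro: Ck_const)

lemma H10_scale:
  assumes "u \<in> H10 \<Omega>"
  shows "(\<lambda>x. c * u x) \<in> H10 \<Omega>"
proof (rule H10_I1)
  note h = H10_H1[OF assms(1)]
  show "(\<lambda>x. c * u x) \<in> H1 \<Omega>" by (rule H1_scale[OF h])
  fix e :: real assume e: "e > 0"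
  hence e2: "e / (\<bar>c\<bar> + 1) > 0" by (simp add: add_nonneg_pos)
  obtain \<phi> where \<phi>: "test_function \<Omega> \<phi>" "l2 (\<lambda>x. \<phi> x - u x) < e / (\<bar>c\<bar> + 1)" "nrm (\<lambda>x. \<phi> x - u x) < e / (\<bar>c\<bar> + 1)"
    by (rule H10_approx1[OF assms(1) e2])
  have d: "(\<lambda>x. \<phi> x - u x) \<in> H1 \<Omega>" using H1_diff test_H1 \<phi>(1) h by auto
  have eq: "(\<lambda>x. c * \<phi> x - c * u x) = (\<lambda>x. c * (\<phi> x - u x))" by (auto simp: algebra_simps)
  have le: "\<bar>c\<bar> * z \<le> e" if "z < e / (\<bar>c\<bar> + 1)" "0 \<le> z" for z
  proof -
    have "\<bar>c\<bar> * z \<le> (\<bar>c\<bar> + 1) * z" using that by (intro mult_right_mono) auto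
    also have "\<dots> < e" using that by (simp add: pos_less_divide_eq add_nonneg_pos mult.commute)
    finally show ?thesis by simp
  qed
  have "nrm (\<lambda>x. c * \<phi> x - c * u x) \<le> e" unfolding eq nrm_scale[OF d] by (rule le[OF \<phi>(3) nrm_nonneg])
  moreover have "l2 (\<lambda>x. c * \<phi> x - c * u x) \<le> e" unfolding eq l2_scale by (rule le[OF \<phi>(2) l2_norm_nonneg])
  ultimately show "\<exists>w. test_function \<Omega> w \<and> l2 (\<lambda>x. w x - c * u x) \<le> e \<and> nrm (\<lambda>x. w x - c * u x) \<le> e"
    using test_function_scale[OF \<phi>(1)] by (intro exI[of _ "\<lambda>x. c * \<phi> x"]) simp
qed

lemma H10_diff: "u \<in> H10 \<Omega> \<Longrightarrow> v \<in> H10 \<Omega> \<Longrightarrow> (\<lambda>x. u x - v x) \<in> H10 \<Omega>"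
  using H10_add[OF _ H10_scale, of u v "-1"] by simp

lemma H10_zero: "(\<lambda>x. 0) \<in> H10 \<Omega>"
  by (rule test_H10[OF test_function_zero])

text \<open>Limits in L2 are known up to null sets only, while membership speaks of functions. The
  weak gradient of u serves for v, by \<open>hwg_limit\<close> applied to a constant
  sequence.\<close>

lemma H10_cong_AE:
  assumes "u \<in> H10 \<Omega>" "AE x in N. u x = v x" "v \<in> borel_measurable N"
  shows "v \<in> H10 \<Omega>"
proof (rule H10_closed)
  have su: "sq_int N u" by (rule H1_sq_int(1)[OF H10_H1[OF assms(1)]])
  have "integrable N (\<lambda>x. (norm (v x))\<^sup>2)"
  proof (subst integrable_cong_AE[of _ _ "\<lambda>x. (norm (u x))\<^sup>2"])
    show "AE x in N. (norm (v x))\<^sup>2 = (norm (u x))\<^sup>2" using assms(2) by eventually_elim simp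
  qed (use su assms(3) in \<open>auto simp: sq_int_def\<close>)
  hence sv: "sq_int N v" using assms(3) by (simp add: sq_int_def)
  have z: "l2 (\<lambda>x. u x - v x) = 0"
  proof -
    have "l2 (\<lambda>x. u x - v x) = l2 (\<lambda>x. 0)"
      by (rule l2_norm_cong_AE) (use assms(2) sq_int_diff[OF su sv] in \<open>auto simp: sq_int_def\<close>)
    thus ?thesis by (simp add: l2_norm_def)
  qed
  have "has_weak_gradient \<Omega> v (wg u)"
    by (rule hwg_limit[of "\<lambda>n. u" "\<lambda>n. wg u", OF H1_hwg[OF H10_H1[OF assms(1)]] sv H1_sq_int(2)[OF H10_H1[OF assms(1)]]])
      (simp_all add: z, simp add: l2_norm_def)
  thus v: "v \<in> H1 \<Omega>" by (rule hwg_H1)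
  have d: "(\<lambda>x. u x - v x) \<in> H1 \<Omega>" by (rule H1_diff[OF H10_H1[OF assms(1)] v])
  have "nrm (\<lambda>x. u x - v x) = nrm (\<lambda>x. 0)"
    by (rule nrm_cong_AE[OF d H10_H1[OF H10_zero]]) (use assms(2) in auto)
  also have "\<dots> = 0" using nrm_scale[OF H10_H1[OF H10_zero], of 0] by simp
  finally have "nrm (\<lambda>x. u x - v x) = 0" .
  thus "\<exists>w\<in>H10 \<Omega>. l2 (\<lambda>x. w x - v x) \<le> e \<and> nrm (\<lambda>x. w x - v x) \<le> e" if "e > 0" for e
    using that z assms(1) by (intro bexI[of _ u]) auto
qed

end

text \<open>Tails of the sequence obey the constant bound L + e, to which
  \<open>integral_fatou_bound\<close> applies; then e tends to 0.\<close>

lemma integral_fatou_lim: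
  fixes g :: "nat \<Rightarrow> 'x \<Rightarrow> real"
  assumes "\<And>k. integrable M (g k)" "\<And>k x. 0 \<le> g k x" "h \<in> borel_measurable M"
    "AE x in M. (\<lambda>k. g k x) \<longlonglongrightarrow> h x" "\<And>k. (LINT x|M. g k x) \<le> c k" "c \<longlonglongrightarrow> L"
  shows "integrable M h" "(LINT x|M. h x) \<le> L"
proof -
  have *: "integrable M h \<and> (LINT x|M. h x) \<le> L + e" if e: "e > 0" for e
  proof -
    have "\<forall>\<^sub>F k in sequentially. c k < L + e" using order_tendstoD(2)[OF assms(6), of "L + e"] e by simp
    then obtain n where n: "\<And>k. k \<ge> n \<Longrightarrow> c k < L + e" unfolding eventually_sequentially by blast
    have a: "AE x in M. (\<lambda>k. g (k + n) x) \<longlonglongrightarrow> h x"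
      using assms(4) by eventually_elim (rule LIMSEQ_ignore_initial_segment)
    have b: "(LINT x|M. g (k + n) x) \<le> L + e" for k
      using assms(5)[of "k + n"] n[of "k + n"] by simp
    show ?thesis
      using integral_fatou_bound[of M "\<lambda>k. g (k + n)", OF assms(1) assms(2) assms(3) a b] by blast
  qed
  show "integrable M h" using *[of 1] by simp
  show "(LINT x|M. h x) \<le> L" by (rule field_le_epsilon) (use * in blast)
qed

text \<open>Turns a bound on the unit ball into a homogeneous inequality. For n = 0 every scaling c
  is admissible, which forces X = 0.\<close>

lemma homogeneous_bound:
  fixes X n P :: real
  assumes "X \<ge> 0" "n \<ge> 0" "P \<ge> 0" "\<And>c. c > 0 \<Longrightarrow> c * n \<le> 1 \<Longrightarrow> c * X \<le> P"
  shows "X \<le> P * n"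
proof (cases "n = 0")
  case True
  have "X = 0"
  proof (rule ccontr)
    assume "X \<noteq> 0"
    hence X: "X > 0" using assms(1) by simp
    \<comment> \<open>This scaling would raise X to P + 1.\<close>
    hence "(P + 1) / X * X \<le> P" using assms(3) True by (intro assms(4)) (auto simp: add_nonneg_pos)
    thus False using X by simp
  qed
  thus ?thesis using True by simp
next
  case False
  hence "n > 0" using assms(2) by simp
  hence "1 / n * X \<le> P" by (intro assms(4)) auto
  thus ?thesis using \<open>n > 0\<close> by (simp add: field_simps)
qed

context sobolev_domain
begin

section \<open>The Sobolev and Poincare inequalities on \<open>H10 \<Omega>\<close>\<close>

lemma p_gt_2: "p > 2" unfolding p_def by (rule crit_exp_facts(1)[OF dim])

lemma test_powr_integrable:
  assumes t: "test_function \<Omega> \<phi>"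
  shows "integrable N (\<lambda>x. \<bar>\<phi> x\<bar> powr p)"
proof -
  obtain B where B: "\<And>x. \<bar>\<phi> x\<bar> \<le> B" by (rule test_function_bounded[OF t]) auto
  show ?thesis
  proof (rule fm.integrable_const_bound[of _ "B powr p"])
    show "AE x in N. norm (\<bar>\<phi> x\<bar> powr p) \<le> B powr p"
      using B p_gt_2 by (intro AE_I2) (simp add: powr_mono2)
    have "\<phi> \<in> borel_measurable N" using test_sq_int[OF t] by (simp add: sq_int_def)
    thus "(\<lambda>x. \<bar>\<phi> x\<bar> powr p) \<in> borel_measurable N" by measurable
  qed
qed

text \<open>All supports lie in \<Omega>, so its measure can serve as W in
  \<open>sobolev_test\<close> for every test function at once.\<close>

lemma sobolev_test_unit: "\<exists>C>0. \<forall>\<phi>. test_function \<Omega> \<phi> \<and> nrm \<phi> \<le> 1 \<longrightarrow> (LINT x|N. \<bar>\<phi> x\<bar> powr p) \<le> C"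
proof -
  define W where "W = measure lborel \<Omega>"
  define D where "D = 2 powr p * 2 * (2 / measure lborel (ball (0::'a) 1)) powr (2 / real DIM('a))"
  define M where "M = max 1 (max W ((16 * D) ^ 3))"
  define C where "C = W + 2 powr p * (W + M)"
  have W: "W \<ge> 0" by (simp add: W_def)
  have "M \<ge> 1" by (simp add: M_def)
  hence "0 < 2 powr p * (W + M)" using W by (intro mult_pos_pos) auto
  hence C: "C > 0" using W by (simp add: C_def)
  have "(LINT x|N. \<bar>\<phi> x\<bar> powr p) \<le> C" if t: "test_function \<Omega> \<phi>" and n: "nrm \<phi> \<le> 1" for \<phi>
  proof -
    note [measurable] = test_function_borel[OF t]
    have m0: "{x. \<phi> x \<noteq> 0} \<in> sets borel" by measurable
    have "measure lborel {x. \<phi> x \<noteq> 0} \<le> W"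
      unfolding W_def
    proof (rule measure_mono_fmeasurable)
      show "{x. \<phi> x \<noteq> 0} \<subseteq> \<Omega>" using test_function_outside[OF t] by blast
      show "\<Omega> \<in> fmeasurable lborel" using op emeasure_bounded_finite[OF bd] by (simp add: fmeasurable_def)
    qed (use m0 in simp)
    moreover have "(LINT x|lborel. (norm (grad \<phi> x))\<^sup>2) \<le> 1"
      using n nrm_nonneg[of \<phi>] by (simp add: nrm_test[OF t, symmetric] power_le_one)
    ultimately have "(LINT x|lborel. \<bar>\<phi> x\<bar> powr p) \<le> C"
      unfolding C_def M_def D_def p_def by (rule sobolev_test(2)[OF t dim])
    moreover have "(LINT x|N. \<bar>\<phi> x\<bar> powr p) = (LINT x|lborel. \<bar>\<phi> x\<bar> powr p)"
      by (rule LINT_lebesgue_on_eq_lborel[OF Om_sets]) (use test_function_outside[OF t] p_gt_2 in auto)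
    ultimately show ?thesis by simp
  qed
  with C show ?thesis by blast
qed

text \<open>The p-th root of the integral is homogeneous of degree one, as
  \<open>homogeneous_bound\<close> requires.\<close>

lemma sobolev_test_scaled: "\<exists>C>0. \<forall>\<phi>. test_function \<Omega> \<phi> \<longrightarrow> (LINT x|N. \<bar>\<phi> x\<bar> powr p) \<le> C * nrm \<phi> powr p"
proof -
  obtain C where C: "C > 0" "\<And>\<phi>. test_function \<Omega> \<phi> \<Longrightarrow> nrm \<phi> \<le> 1 \<Longrightarrow> (LINT x|N. \<bar>\<phi> x\<bar> powr p) \<le> C"
    using sobolev_test_unit by blast
  have "(LINT x|N. \<bar>\<phi> x\<bar> powr p) \<le> C * nrm \<phi> powr p" if t: "test_function \<Omega> \<phi>" for \<phi>
  proof -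
    define X where "X = (LINT x|N. \<bar>\<phi> x\<bar> powr p)"
    have X: "X \<ge> 0" by (simp add: X_def)
    have inv: "(z powr (1 / p)) powr p = z" if "z \<ge> 0" for z :: real
      using that p_gt_2 by (simp add: powr_powr)
    have "X powr (1 / p) \<le> C powr (1 / p) * nrm \<phi>"
    proof (rule homogeneous_bound)
      fix c :: real assume c: "c > 0" "c * nrm \<phi> \<le> 1"
      have "nrm (\<lambda>x. c * \<phi> x) \<le> 1" using c by (simp add: nrm_scale[OF test_H1[OF t]])
      hence "(LINT x|N. \<bar>c * \<phi> x\<bar> powr p) \<le> C" by (rule C(2)[OF test_function_scale[OF t]])
      also have "(LINT x|N. \<bar>c * \<phi> x\<bar> powr p) = c powr p * X"
        using c unfolding X_def by (simp add: abs_mult powr_mult)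
      finally have "(c powr p * X) powr (1 / p) \<le> C powr (1 / p)" using c X p_gt_2 by (intro powr_mono2) auto
      moreover have "(c powr p * X) powr (1 / p) = c * X powr (1 / p)"
        using c X p_gt_2 by (simp add: powr_mult powr_powr)
      ultimately show "c * X powr (1 / p) \<le> C powr (1 / p)" by simp
    qed (auto simp: nrm_nonneg)
    hence "(X powr (1 / p)) powr p \<le> (C powr (1 / p) * nrm \<phi>) powr p" using p_gt_2 by (intro powr_mono2) auto
    also have "\<dots> = C * nrm \<phi> powr p" using C(1) nrm_nonneg[of \<phi>] inv[of C] by (simp add: powr_mult)
    finally show ?thesis using inv[OF X] by (simp add: X_def)
  qed
  with C(1) show ?thesis by blast
qed

text \<open>On the unit ball, s^2 <= 1 + |s|^p and the finite measure of \<Omega> reduce the claim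
  to the Sobolev bound; homogeneity gives the rest.\<close>

lemma poincare_test: "\<exists>P>0. \<forall>\<phi>. test_function \<Omega> \<phi> \<longrightarrow> l2 \<phi> \<le> P * nrm \<phi>"
proof -
  obtain C where C: "C > 0" "\<And>\<phi>. test_function \<Omega> \<phi> \<Longrightarrow> nrm \<phi> \<le> 1 \<Longrightarrow> (LINT x|N. \<bar>\<phi> x\<bar> powr p) \<le> C"
    using sobolev_test_unit by blast
  define P where "P = sqrt (measure N (space N) + C)"
  have P: "P > 0" unfolding P_def using C(1) by (simp add: add_nonneg_pos)
  have unit: "l2 \<phi> \<le> P" if t: "test_function \<Omega> \<phi>" and n: "nrm \<phi> \<le> 1" for \<phi>
  proof -
    have "(LINT x|N. (norm (\<phi> x))\<^sup>2) \<le> (LINT x|N. 1 + \<bar>\<phi> x\<bar> powr p)"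
    proof (rule integral_mono)
      show "integrable N (\<lambda>x. (norm (\<phi> x))\<^sup>2)" using test_sq_int[OF t] by (simp add: sq_int_def)
      show "integrable N (\<lambda>x. 1 + \<bar>\<phi> x\<bar> powr p)" using test_powr_integrable[OF t] by simp
      fix x
      show "(norm (\<phi> x))\<^sup>2 \<le> 1 + \<bar>\<phi> x\<bar> powr p"
      proof (cases "\<bar>\<phi> x\<bar> \<le> 1")
        case True
        hence "\<bar>\<phi> x\<bar>\<^sup>2 \<le> 1" by (intro power_le_one) auto
        thus ?thesis by (simp add: add_increasing2)
      next
        case False
        hence "\<bar>\<phi> x\<bar> powr 2 \<le> \<bar>\<phi> x\<bar> powr p" using p_gt_2 by (intro powr_mono) auto
        moreover have "\<bar>\<phi> x\<bar> powr 2 = \<bar>\<phi> x\<bar>\<^sup>2" using False by (intro powr_numeral) auto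
        ultimately show ?thesis by simp
      qed
    qed
    also have "\<dots> \<le> measure N (space N) + C"
      using test_powr_integrable[OF t] C(2)[OF t n] by simp
    finally show ?thesis unfolding P_def l2_norm_def by (rule real_sqrt_le_mono)
  qed
  have "l2 \<phi> \<le> P * nrm \<phi>" if t: "test_function \<Omega> \<phi>" for \<phi>
  proof (rule homogeneous_bound)
    fix c :: real assume c: "c > 0" "c * nrm \<phi> \<le> 1"
    have "nrm (\<lambda>x. c * \<phi> x) \<le> 1" using c by (simp add: nrm_scale[OF test_H1[OF t]])
    hence "l2 (\<lambda>x. c * \<phi> x) \<le> P" by (rule unit[OF test_function_scale[OF t]])
    thus "c * l2 \<phi> \<le> P" using c by (simp add: l2_scale)
  qed (use P in \<open>auto simp: nrm_nonneg l2_norm_nonneg\<close>)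
  with P show ?thesis by blast
qed

lemma nrm_reverse_triangle: "u \<in> H1 \<Omega> \<Longrightarrow> v \<in> H1 \<Omega> \<Longrightarrow> \<bar>nrm u - nrm v\<bar> \<le> nrm (\<lambda>x. u x - v x)"
  using nrm_triangle_diff(1)[of u v] nrm_triangle_diff(1)[of v u] nrm_minus_commute[of u v] by (simp add: abs_le_iff)

lemma nrm_tendsto:
  assumes "\<And>k. u k \<in> H1 \<Omega>" "v \<in> H1 \<Omega>" "(\<lambda>k. nrm (\<lambda>x. u k x - v x)) \<longlonglongrightarrow> 0"
  shows "(\<lambda>k. nrm (u k)) \<longlonglongrightarrow> nrm v"
proof -
  have "(\<lambda>k. nrm (u k) - nrm v) \<longlonglongrightarrow> 0"
    by (rule Lim_null_comparison[OF _ assms(3)]) (use nrm_reverse_triangle[OF assms(1,2)] in simp)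
  thus ?thesis by (simp add: LIM_zero_iff)
qed

lemma l2_tendsto:
  assumes "\<And>k. sq_int N (u k)" "sq_int N v" "(\<lambda>k. l2 (\<lambda>x. u k x - v x)) \<longlonglongrightarrow> 0"
  shows "(\<lambda>k. l2 (u k)) \<longlonglongrightarrow> l2 v"
proof -
  have "(\<lambda>k. l2 (u k) - l2 v) \<longlonglongrightarrow> 0"
    by (rule Lim_null_comparison[OF _ assms(3)]) (use l2_norm_reverse_triangle[OF assms(1,2)] in simp)
  thus ?thesis by (simp add: LIM_zero_iff)
qed

text \<open>Approximating test functions converge almost everywhere along a subsequence, and their
  norms converge; Fatou's lemma carries the inequality, and integrability with it, to the
  limit.\<close>

lemma sobolev_H10_ex: "\<exists>C>0. \<forall>u\<in>H10 \<Omega>. integrable N (\<lambda>x. \<bar>u x\<bar> powr p) \<and> (LINT x|N. \<bar>u x\<bar> powr p) \<le> C * nrm u powr p"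
proof -
  obtain C where C: "C > 0" "\<And>\<phi>. test_function \<Omega> \<phi> \<Longrightarrow> (LINT x|N. \<bar>\<phi> x\<bar> powr p) \<le> C * nrm \<phi> powr p"
    using sobolev_test_scaled by blast
  have "integrable N (\<lambda>x. \<bar>u x\<bar> powr p) \<and> (LINT x|N. \<bar>u x\<bar> powr p) \<le> C * nrm u powr p" if u: "u \<in> H10 \<Omega>" for u
  proof -
    obtain \<phi> where \<phi>: "\<And>k. test_function \<Omega> (\<phi> k)" "(\<lambda>k::nat. l2 (\<lambda>x. \<phi> k x - u x)) \<longlonglongrightarrow> 0" "(\<lambda>k. nrm (\<lambda>x. \<phi> k x - u x)) \<longlonglongrightarrow> 0"
      by (rule H10_approx[OF u]) auto
    have su: "sq_int N u" by (rule H1_sq_int(1)[OF H10_H1[OF u]])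
    obtain r where r: "strict_mono r" "AE x in N. (\<lambda>n. \<phi> (r n) x) \<longlonglongrightarrow> u x"
      by (rule fm.l2_AE_subseq[OF test_sq_int[OF \<phi>(1)] su \<phi>(2)]) auto
    have a: "AE x in N. (\<lambda>k. \<bar>\<phi> (r k) x\<bar> powr p) \<longlonglongrightarrow> \<bar>u x\<bar> powr p"
      using r(2)
    proof eventually_elim
      case (elim x)
      thus ?case using p_gt_2 by (intro tendsto_powr2 tendsto_intros) auto
    qed
    have "(\<lambda>k. nrm (\<phi> k)) \<longlonglongrightarrow> nrm u" by (rule nrm_tendsto[OF test_H1[OF \<phi>(1)] H10_H1[OF u] \<phi>(3)])
    hence "(\<lambda>k. nrm (\<phi> (r k))) \<longlonglongrightarrow> nrm u" using LIMSEQ_subseq_LIMSEQ[OF _ r(1)] by (simp add: o_def)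
    hence b: "(\<lambda>k. C * nrm (\<phi> (r k)) powr p) \<longlonglongrightarrow> C * nrm u powr p"
      using p_gt_2 by (intro tendsto_mult tendsto_const tendsto_powr2) (auto simp: nrm_nonneg)
    have m: "(\<lambda>x. \<bar>u x\<bar> powr p) \<in> borel_measurable N"
    proof -
      have [measurable]: "u \<in> borel_measurable N" using su by (simp add: sq_int_def)
      show ?thesis by measurable
    qed
    show ?thesis
      using integral_fatou_lim[of N "\<lambda>k x. \<bar>\<phi> (r k) x\<bar> powr p", OF test_powr_integrable[OF \<phi>(1)] _ m a C(2)[OF \<phi>(1)] b] by simp
  qed
  with C(1) show ?thesis by blast
qed

lemma poincare_H10_ex: "\<exists>P>0. \<forall>u\<in>H10 \<Omega>. l2 u \<le> P * nrm u"
proof -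
  obtain P where P: "P > 0" "\<And>\<phi>. test_function \<Omega> \<phi> \<Longrightarrow> l2 \<phi> \<le> P * nrm \<phi>"
    using poincare_test by blast
  have "l2 u \<le> P * nrm u" if u: "u \<in> H10 \<Omega>" for u
  proof -
    obtain \<phi> where \<phi>: "\<And>k. test_function \<Omega> (\<phi> k)" "(\<lambda>k::nat. l2 (\<lambda>x. \<phi> k x - u x)) \<longlonglongrightarrow> 0" "(\<lambda>k. nrm (\<lambda>x. \<phi> k x - u x)) \<longlonglongrightarrow> 0"
      by (rule H10_approx[OF u]) auto
    have su: "sq_int N u" by (rule H1_sq_int(1)[OF H10_H1[OF u]])
    have "(\<lambda>k. P * nrm (\<phi> k)) \<longlonglongrightarrow> P * nrm u"
      by (intro tendsto_mult tendsto_const nrm_tendsto[OF test_H1[OF \<phi>(1)] H10_H1[OF u] \<phi>(3)])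
    moreover have "(\<lambda>k. l2 (\<phi> k)) \<longlonglongrightarrow> l2 u" by (rule l2_tendsto[OF test_sq_int[OF \<phi>(1)] su \<phi>(2)])
    ultimately show ?thesis using P(2)[OF \<phi>(1)] by (intro LIMSEQ_le[of "\<lambda>k. l2 (\<phi> k)"]) auto
  qed
  with P(1) show ?thesis by blast
qed

text \<open>Some admissible constant, fixed by choice. It serves integrability, Lipschitz constants
  and the positivity of S; the sharp inequality is \<open>pint_le\<close>.\<close>

definition sob_const :: real where
  "sob_const = (SOME C. C > 0 \<and> (\<forall>u\<in>H10 \<Omega>. integrable N (\<lambda>x. \<bar>u x\<bar> powr p) \<and> (LINT x|N. \<bar>u x\<bar> powr p) \<le> C * nrm u powr p))"

definition poin_const :: real where
  "poin_const = (SOME P. P > 0 \<and> (\<forall>u\<in>H10 \<Omega>. l2 u \<le> P * nrm u))"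

lemma sobolev_H10:
  shows sob_const_pos: "sob_const > 0"
    and H10_powr_integrable: "u \<in> H10 \<Omega> \<Longrightarrow> integrable N (\<lambda>x. \<bar>u x\<bar> powr p)"
    and sobolev_H10_le: "u \<in> H10 \<Omega> \<Longrightarrow> (LINT x|N. \<bar>u x\<bar> powr p) \<le> sob_const * nrm u powr p"
proof -
  have "sob_const > 0 \<and> (\<forall>u\<in>H10 \<Omega>. integrable N (\<lambda>x. \<bar>u x\<bar> powr p) \<and> (LINT x|N. \<bar>u x\<bar> powr p) \<le> sob_const * nrm u powr p)"
    unfolding sob_const_def by (rule someI_ex) (use sobolev_H10_ex in blast)
  thus "sob_const > 0" "u \<in> H10 \<Omega> \<Longrightarrow> integrable N (\<lambda>x. \<bar>u x\<bar> powr p)"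
    "u \<in> H10 \<Omega> \<Longrightarrow> (LINT x|N. \<bar>u x\<bar> powr p) \<le> sob_const * nrm u powr p" by auto
qed

lemma poincare_H10:
  shows poin_const_pos: "poin_const > 0" and poincare_H10_le: "u \<in> H10 \<Omega> \<Longrightarrow> l2 u \<le> poin_const * nrm u"
proof -
  have "poin_const > 0 \<and> (\<forall>u\<in>H10 \<Omega>. l2 u \<le> poin_const * nrm u)"
    unfolding poin_const_def by (rule someI_ex) (use poincare_H10_ex in blast)
  thus "poin_const > 0" "u \<in> H10 \<Omega> \<Longrightarrow> l2 u \<le> poin_const * nrm u" by auto
qed

section \<open>Completeness of \<open>H10 \<Omega>\<close> in the gradient norm\<close>

lemma H10_sq_int: "u \<in> H10 \<Omega> \<Longrightarrow> sq_int N u"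
  by (rule H1_sq_int(1)[OF H10_H1])

lemma H10_measurable: "u \<in> H10 \<Omega> \<Longrightarrow> u \<in> borel_measurable N"
  using H10_sq_int by (auto simp: sq_int_def)

lemma nrm_diff_eq:
  assumes "u \<in> H1 \<Omega>" "v \<in> H1 \<Omega>"
  shows "nrm (\<lambda>x. u x - v x) = l2_norm N (\<lambda>x. wg u x - wg v x)"
  unfolding nrm_eq
proof (rule l2_norm_cong_AE)
  have "has_weak_gradient \<Omega> (\<lambda>x. u x - v x) (\<lambda>x. wg u x - wg v x)"
    using hwg_add[OF H1_hwg[OF assms(1)] hwg_scale[OF H1_hwg[OF assms(2)], of "-1"]] by simp
  thus "AE x in N. wg (\<lambda>x. u x - v x) x = wg u x - wg v x" by (rule wg_eq)
  show "wg (\<lambda>x. u x - v x) \<in> borel_measurable N" using H1_sq_int(2)[OF H1_diff[OF assms]] by (simp add: sq_int_def)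
  show "(\<lambda>x. wg u x - wg v x) \<in> borel_measurable N"
    using sq_int_diff[OF H1_sq_int(2)[OF assms(1)] H1_sq_int(2)[OF assms(2)]] by (simp add: sq_int_def)
qed

text \<open>By the Poincare inequality the sequence is also Cauchy in L2, so functions and gradients
  converge separately; \<open>hwg_limit\<close> identifies the second limit as the gradient of the
  first.\<close>

lemma H10_complete:
  assumes u: "\<And>n. u n \<in> H10 \<Omega>"
    and C: "\<And>e. e > 0 \<Longrightarrow> \<exists>N. \<forall>i\<ge>N. \<forall>j\<ge>N. nrm (\<lambda>x. u i x - u j x) < e"
  obtains v where "v \<in> H10 \<Omega>" "(\<lambda>n::nat. nrm (\<lambda>x. u n x - v x)) \<longlonglongrightarrow> 0" "(\<lambda>n. l2 (\<lambda>x. u n x - v x)) \<longlonglongrightarrow> 0"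
proof -
  note h1 = H10_H1[OF u]
  have "\<exists>K. \<forall>i\<ge>K. \<forall>j\<ge>K. l2 (\<lambda>x. u i x - u j x) < e" if e: "e > 0" for e
  proof -
    have "e / poin_const > 0" using e poin_const_pos by simp
    then obtain K where K: "\<And>i j. i \<ge> K \<Longrightarrow> j \<ge> K \<Longrightarrow> nrm (\<lambda>x. u i x - u j x) < e / poin_const" using C by blast
    have "l2 (\<lambda>x. u i x - u j x) < e" if "i \<ge> K" "j \<ge> K" for i j
    proof -
      have "l2 (\<lambda>x. u i x - u j x) \<le> poin_const * nrm (\<lambda>x. u i x - u j x)" by (rule poincare_H10_le[OF H10_diff[OF u u]])
      also have "\<dots> < e" using K[OF that] poin_const_pos by (simp add: field_simps)
      finally show ?thesis .
    qed
    thus ?thesis by blast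
  qed
  from fm.l2_complete[OF H1_sq_int(1)[OF h1] this] obtain v where v: "sq_int N v" "(\<lambda>n. l2 (\<lambda>x. u n x - v x)) \<longlonglongrightarrow> 0" by blast
  have "\<exists>K. \<forall>i\<ge>K. \<forall>j\<ge>K. l2_norm N (\<lambda>x. wg (u i) x - wg (u j) x) < e" if e: "e > 0" for e
    using C[OF e] by (simp add: nrm_diff_eq[OF h1 h1])
  from fm.l2_complete[OF H1_sq_int(2)[OF h1] this] obtain h where h: "sq_int N h" "(\<lambda>n. l2_norm N (\<lambda>x. wg (u n) x - h x)) \<longlonglongrightarrow> 0" by blast
  have hw: "has_weak_gradient \<Omega> v h" by (rule hwg_limit[OF H1_hwg[OF h1] v(1) h(1) v(2) h(2)])
  hence vH1: "v \<in> H1 \<Omega>" by (rule hwg_H1)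
  have "nrm (\<lambda>x. u n x - v x) = l2_norm N (\<lambda>x. wg (u n) x - h x)" for n
    unfolding nrm_diff_eq[OF h1 vH1]
  proof (rule l2_norm_cong_AE)
    show "AE x in N. wg (u n) x - wg v x = wg (u n) x - h x" using wg_eq[OF hw] by eventually_elim simp
    show "(\<lambda>x. wg (u n) x - wg v x) \<in> borel_measurable N" "(\<lambda>x. wg (u n) x - h x) \<in> borel_measurable N"
      using sq_int_diff[OF H1_sq_int(2)[OF h1[of n]] H1_sq_int(2)[OF vH1]] sq_int_diff[OF H1_sq_int(2)[OF h1[of n]] h(1)]
      by (auto simp: sq_int_def)
  qed
  hence n0: "(\<lambda>n. nrm (\<lambda>x. u n x - v x)) \<longlonglongrightarrow> 0" using h(2) by simp
  have "v \<in> H10 \<Omega>"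
  proof (rule H10_closed[OF vH1])
    fix e :: real assume e: "e > 0"
    have "\<forall>\<^sub>F n in sequentially. l2 (\<lambda>x. u n x - v x) < e \<and> nrm (\<lambda>x. u n x - v x) < e"
      using order_tendstoD(2)[OF v(2) e] order_tendstoD(2)[OF n0 e] by (rule eventually_conj)
    then obtain n where "l2 (\<lambda>x. u n x - v x) < e" "nrm (\<lambda>x. u n x - v x) < e"
      unfolding eventually_sequentially by blast
    thus "\<exists>w\<in>H10 \<Omega>. l2 (\<lambda>x. w x - v x) \<le> e \<and> nrm (\<lambda>x. w x - v x) \<le> e"
      using u[of n] by (intro bexI[of _ "u n"]) auto
  qed
  with n0 v(2) show ?thesis by (intro that)
qed

section \<open>The compact embedding into L2\<close>

lemma test_function_diff: "test_function \<Omega> \<phi> \<Longrightarrow> test_function \<Omega> \<psi> \<Longrightarrow> test_function \<Omega> (\<lambda>x. \<phi> x - \<psi> x)"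
  using test_function_add[OF _ test_function_scale, of \<phi> \<psi> "-1"] by simp

lemma finite_ball_cover:
  assumes "r > 0"
  obtains Z where "finite Z" "\<Omega> \<subseteq> (\<Union>z\<in>Z. ball z r)"
proof -
  have "compact (closure \<Omega>)" using bd by (simp add: compact_closure)
  then obtain Z where Z: "finite Z" "closure \<Omega> \<subseteq> (\<Union>z\<in>Z. ball z r)"
    unfolding compact_eq_totally_bounded using assms by auto
  show ?thesis by (rule that[OF Z(1) subset_trans[OF closure_subset Z(2)]])
qed

definition ball_int :: "('a \<Rightarrow> real) \<Rightarrow> 'a \<Rightarrow> real \<Rightarrow> real" where
  "ball_int \<phi> z r = (LINT y|lborel. indicator (ball z r) y * \<phi> y)"

lemma test_ball_integrable:
  assumes t: "test_function \<Omega> \<phi>"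
  shows "integrable lborel (\<lambda>y. indicator (ball z r) y * \<phi> y)"
proof -
  obtain B where B: "\<And>x. \<bar>\<phi> x\<bar> \<le> B" "B > 0" by (rule test_function_bounded[OF t]) auto
  show ?thesis
  proof (rule integrable_lborel_bounded_support[where K = "ball z r" and B = B])
    show "(\<lambda>y. indicator (ball z r) y * \<phi> y) \<in> borel_measurable borel"
      by (intro borel_measurable_times test_function_borel[OF t] borel_measurable_indicator) simp
    show "\<bar>indicator (ball z r) y * \<phi> y\<bar> \<le> B" for y using B by (simp split: split_indicator)
  qed auto
qed

lemma ball_int_bound:
  assumes t: "test_function \<Omega> \<phi>"
  shows "\<bar>ball_int \<phi> z r\<bar> \<le> sqrt (measure N (space N)) * l2 \<phi>"
proof -
  have i: "integrable lborel (\<lambda>y. \<bar>\<phi> y\<bar>)"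
  proof -
    obtain B where B: "\<And>x. \<bar>\<phi> x\<bar> \<le> B" "B > 0" by (rule test_function_bounded[OF t]) auto
    show ?thesis
      by (rule integrable_lborel_bounded_support[OF _ _ bd]) (use B test_function_borel[OF t] test_function_outside[OF t] in auto)
  qed
  have "\<bar>ball_int \<phi> z r\<bar> \<le> (LINT y|lborel. \<bar>indicator (ball z r) y * \<phi> y\<bar>)"
    unfolding ball_int_def by (rule integral_abs_bound)
  also have "\<dots> \<le> (LINT y|lborel. \<bar>\<phi> y\<bar>)"
    by (intro integral_mono i integrable_abs test_ball_integrable[OF t]) (simp split: split_indicator)
  also have "\<dots> = (LINT y|N. \<bar>\<phi> y\<bar>)"
    by (rule LINT_lebesgue_on_eq_lborel[OF Om_sets, symmetric]) (use test_function_borel[OF t] test_function_outside[OF t] in auto)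
  also have "\<dots> \<le> sqrt (measure N (space N)) * l2 \<phi>"
    using fm.sq_int_integrable_norm(2)[OF test_sq_int[OF t]] by simp
  finally show ?thesis .
qed

text \<open>The finite covers for all radii 1/(m+1) involve countably many balls, so a diagonal
  subsequence makes all ball integrals converge. For two late members the means over one cover are
  close, and \<open>test_function_l2_estimate\<close> applied to their difference shows that the
  subsequence is Cauchy.\<close>

lemma rellich_test:
  assumes t: "\<And>n::nat. test_function \<Omega> (\<phi> n)" and K: "\<And>n. nrm (\<phi> n) \<le> K"
  obtains k v where "strict_mono k" "sq_int N v" "(\<lambda>n. l2 (\<lambda>x. \<phi> (k n) x - v x)) \<longlonglongrightarrow> 0"
proof -
  have "\<exists>Z. finite Z \<and> \<Omega> \<subseteq> (\<Union>z\<in>Z. ball z (inverse (real (Suc m))))" for m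
    by (rule finite_ball_cover[of "inverse (real (Suc m))"]) auto
  then obtain Z where Z: "\<And>m. finite (Z m)" "\<And>m. \<Omega> \<subseteq> (\<Union>z\<in>Z m. ball z (inverse (real (Suc m))))"
    by metis
  define S where "S = (\<Union>m. (\<lambda>z. (m, z)) ` Z m)"
  define F where "F n s = ball_int (\<phi> n) (snd s) (inverse (real (Suc (fst s))))" for n and s :: "nat \<times> 'a"
  have "countable S" unfolding S_def using Z(1) by (auto intro: countable_finite)
  moreover have "norm (F n s) \<le> sqrt (measure N (space N)) * (poin_const * K)" for n s
  proof -
    have "l2 (\<phi> n) \<le> poin_const * K"
      using poincare_H10_le[OF test_H10[OF t]] K poin_const_pos by (meson less_imp_le mult_left_mono order_trans)
    hence "sqrt (measure N (space N)) * l2 (\<phi> n) \<le> sqrt (measure N (space N)) * (poin_const * K)"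
      by (intro mult_left_mono) auto
    thus ?thesis using ball_int_bound[OF t, of n "snd s" "inverse (real (Suc (fst s)))"] unfolding F_def real_norm_def by linarith
  qed
  ultimately obtain k where k: "strict_mono k" "\<And>s. s \<in> S \<Longrightarrow> \<exists>l. (\<lambda>n. F (k n) s) \<longlonglongrightarrow> l"
    using function_convergent_subsequence[of S F] by metis
  define V where "V = measure lborel \<Omega>"
  have V: "V \<ge> 0" by (simp add: V_def)
  have "\<exists>M. \<forall>i\<ge>M. \<forall>j\<ge>M. l2 (\<lambda>x. \<phi> (k i) x - \<phi> (k j) x) < e" if e: "e > 0" for e
  proof -
    \<comment> \<open>A r^2 is the gradient term of the estimate, since the difference of two
      members has norm at most 2 K. The choice of r makes it at most e^2/4, that of \<delta> makes
      the mean term at most e^2/2; together they stay below e^2.\<close>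
    define A where "A = 2 * 2 ^ DIM('a) * 4 * (2 * K)\<^sup>2"
    have A: "A \<ge> 0" by (simp add: A_def)
    obtain m where m: "inverse (real (Suc m)) < e / (sqrt A + 1) / 2"
      using reals_Archimedean[of "e / (sqrt A + 1) / 2"] e A by (auto simp: add_nonneg_pos)
    define r where "r = inverse (real (Suc m))"
    have r: "r > 0" by (simp add: r_def)
    have Ar: "A * r\<^sup>2 \<le> e\<^sup>2 / 4"
    proof -
      have "sqrt A * r \<le> (sqrt A + 1) * r" using r by (intro mult_right_mono) auto
      also have "\<dots> \<le> (sqrt A + 1) * (e / (sqrt A + 1) / 2)"
        using m A unfolding r_def by (intro mult_left_mono) (auto simp: add_nonneg_nonneg)
      also have "\<dots> = e / 2" using A real_sqrt_ge_zero[OF A] by (simp add: field_simps add_nonneg_eq_0_iff)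
      finally have "(sqrt A * r)\<^sup>2 \<le> (e / 2)\<^sup>2" using r A by (intro power_mono) auto
      thus ?thesis using A by (simp add: power_mult_distrib power_divide)
    qed
    define \<delta> where "\<delta> = e / (2 * (sqrt V + 1))"
    have \<delta>: "\<delta> > 0" using e V by (simp add: \<delta>_def add_nonneg_pos)
    have V\<delta>: "2 * \<delta>\<^sup>2 * V \<le> e\<^sup>2 / 2"
    proof -
      have "\<delta> * sqrt V \<le> \<delta> * (sqrt V + 1)" using \<delta> by (intro mult_left_mono) auto
      also have "\<dots> = e / 2" using real_sqrt_ge_zero[OF V] by (simp add: \<delta>_def field_simps add_nonneg_eq_0_iff)
      finally have "(\<delta> * sqrt V)\<^sup>2 \<le> (e / 2)\<^sup>2" using \<delta> V by (intro power_mono) auto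
      thus ?thesis using V by (simp add: power_mult_distrib power_divide)
    qed
    define B where "B = measure lborel (ball (0::'a) r)"
    have B: "B > 0" using content_ball_pos[OF r] by (simp add: B_def)
    have Bz: "measure lborel (ball z r) = B" for z :: 'a
      using content_ball_conv_unit_ball[of r z] content_ball_conv_unit_ball[of r "0::'a"] r by (simp add: B_def)
    have "\<forall>z\<in>Z m. \<exists>M. \<forall>i\<ge>M. \<forall>j\<ge>M. \<bar>F (k i) (m, z) - F (k j) (m, z)\<bar> < \<delta> * B"
    proof
      fix z assume "z \<in> Z m"
      hence "(m, z) \<in> S" by (auto simp: S_def)
      then obtain l where "(\<lambda>n. F (k n) (m, z)) \<longlonglongrightarrow> l" using k(2) by blast
      hence "Cauchy (\<lambda>n. F (k n) (m, z))" by (rule LIMSEQ_imp_Cauchy)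
      from CauchyD[OF this, of "\<delta> * B"] show "\<exists>M. \<forall>i\<ge>M. \<forall>j\<ge>M. \<bar>F (k i) (m, z) - F (k j) (m, z)\<bar> < \<delta> * B"
        using \<delta> B by auto
    qed
    then obtain M where M: "\<And>z i j. z \<in> Z m \<Longrightarrow> i \<ge> M z \<Longrightarrow> j \<ge> M z \<Longrightarrow> \<bar>F (k i) (m, z) - F (k j) (m, z)\<bar> < \<delta> * B"
      by metis
    \<comment> \<open>The inserted 0 guarantees a maximum over a nonempty set.\<close>
    define M' where "M' = Max (insert 0 (M ` Z m))"
    have M': "M z \<le> M'" if "z \<in> Z m" for z unfolding M'_def using that Z(1) by (intro Max_ge) auto
    have "l2 (\<lambda>x. \<phi> (k i) x - \<phi> (k j) x) < e" if ij: "i \<ge> M'" "j \<ge> M'" for i j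
    proof -
      define \<psi> where "\<psi> = (\<lambda>x. \<phi> (k i) x - \<phi> (k j) x)"
      have t\<psi>: "test_function \<Omega> \<psi>" unfolding \<psi>_def by (rule test_function_diff[OF t t])
      have base: "(LINT x|lborel. (\<psi> x)\<^sup>2) \<le> 2 * \<delta>\<^sup>2 * measure lborel \<Omega> + 2 * 2 ^ DIM('a) * (2 * r)\<^sup>2 * (LINT x|lborel. (norm (grad \<psi> x))\<^sup>2)"
      proof (rule test_function_l2_estimate[OF t\<psi> r, of \<Omega> "Z m"])
        show "\<Omega> \<in> sets borel" using op by simp
        show "emeasure lborel \<Omega> < \<infinity>" by (rule emeasure_bounded_finite[OF bd])
        show "\<Omega> \<subseteq> (\<Union>z\<in>Z m. ball z r)" unfolding r_def by (rule Z(2))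
        fix z assume z: "z \<in> Z m"
        have "(LINT y|lborel. indicator (ball z r) y * \<psi> y) = F (k i) (m, z) - F (k j) (m, z)"
          unfolding \<psi>_def F_def ball_int_def fst_conv snd_conv r_def[symmetric]
          using test_ball_integrable[OF t, where z = z and r = r] by (simp add: right_diff_distrib)
        moreover have "\<bar>F (k i) (m, z) - F (k j) (m, z)\<bar> < \<delta> * B"
          using M[OF z] M'[OF z] ij by force
        ultimately show "\<bar>LINT y|lborel. indicator (ball z r) y * \<psi> y\<bar> \<le> \<delta> * measure lborel (ball z r)"
          by (simp add: Bz)
      qed simp
      have gr: "(LINT x|lborel. (norm (grad \<psi> x))\<^sup>2) \<le> (2 * K)\<^sup>2"
      proof -
        have "nrm \<psi> \<le> 2 * K" unfolding \<psi>_def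
          using nrm_triangle_diff(2)[OF test_H1[OF t] test_H1[OF t], of "k i" "k j"] K[of "k i"] K[of "k j"] by linarith
        hence "(nrm \<psi>)\<^sup>2 \<le> (2 * K)\<^sup>2" by (rule power_mono[OF _ nrm_nonneg])
        thus ?thesis by (simp only: nrm_test[OF t\<psi>])
      qed
      have "2 * 2 ^ DIM('a) * (2 * r)\<^sup>2 * (LINT x|lborel. (norm (grad \<psi> x))\<^sup>2) \<le> 2 * 2 ^ DIM('a) * (2 * r)\<^sup>2 * (2 * K)\<^sup>2"
        by (rule mult_left_mono[OF gr]) simp
      also have "\<dots> = A * r\<^sup>2" by (simp add: A_def power_mult_distrib)
      finally have "(LINT x|lborel. (\<psi> x)\<^sup>2) \<le> 2 * \<delta>\<^sup>2 * V + A * r\<^sup>2"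
        using base by (simp add: V_def)
      also have "\<dots> < e\<^sup>2" 
      proof -
        have "e\<^sup>2 > 0" using e by simp
        thus ?thesis using V\<delta> Ar by linarith
      qed
      finally have "(LINT x|lborel. (\<psi> x)\<^sup>2) < e\<^sup>2" .
      moreover have "(LINT x|N. (\<psi> x)\<^sup>2) = (LINT x|lborel. (\<psi> x)\<^sup>2)"
        by (rule LINT_lebesgue_on_eq_lborel[OF Om_sets]) (use test_function_borel[OF t\<psi>] test_function_outside[OF t\<psi>] in auto)
      ultimately have "(l2 \<psi>)\<^sup>2 < e\<^sup>2" by (simp add: l2_norm_sq)
      hence "l2 \<psi> < e" by (rule power_less_imp_less_base) (use e in simp)
      thus ?thesis by (simp add: \<psi>_def)
    qed
    thus ?thesis by blast
  qed
  from fm.l2_complete[OF test_sq_int[OF t] this] obtain v where "sq_int N v" "(\<lambda>n. l2 (\<lambda>x. \<phi> (k n) x - v x)) \<longlonglongrightarrow> 0" by blast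
  with k(1) show ?thesis by (rule that)
qed

text \<open>Each member is replaced by a test function within 1/(n+1) in both norms, which preserves
  boundedness and the L2 limit.\<close>

lemma rellich:
  assumes u: "\<And>n::nat. u n \<in> H10 \<Omega>" and K: "\<And>n. nrm (u n) \<le> K"
  obtains k v where "strict_mono k" "sq_int N v" "(\<lambda>n. l2 (\<lambda>x. u (k n) x - v x)) \<longlonglongrightarrow> 0"
proof -
  have "\<exists>\<phi>. test_function \<Omega> \<phi> \<and> l2 (\<lambda>x. \<phi> x - u n x) < inverse (real (Suc n)) \<and> nrm (\<lambda>x. \<phi> x - u n x) < inverse (real (Suc n))" for n
    by (rule H10_approx1[OF u[of n], of "inverse (real (Suc n))"]) auto
  then obtain \<phi> where \<phi>: "\<And>n. test_function \<Omega> (\<phi> n)" "\<And>n. l2 (\<lambda>x. \<phi> n x - u n x) < inverse (real (Suc n))" "\<And>n. nrm (\<lambda>x. \<phi> n x - u n x) < inverse (real (Suc n))"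
    by metis
  have nb: "nrm (\<phi> n) \<le> K + 1" for n
  proof -
    have "nrm (\<phi> n) \<le> nrm (\<lambda>x. \<phi> n x - u n x) + nrm (u n)" by (rule nrm_triangle_diff(1)[OF test_H1[OF \<phi>(1)] H10_H1[OF u]])
    moreover have "inverse (real (Suc n)) \<le> 1" by (simp add: field_simps)
    ultimately show ?thesis using \<phi>(3)[of n] K[of n] by linarith
  qed
  obtain k v where k: "strict_mono k" "sq_int N v" "(\<lambda>n. l2 (\<lambda>x. \<phi> (k n) x - v x)) \<longlonglongrightarrow> 0"
    by (rule rellich_test[of \<phi>, OF \<phi>(1) nb]) blast
  have "(\<lambda>n. l2 (\<lambda>x. u (k n) x - v x)) \<longlonglongrightarrow> 0"
  proof (rule tendsto_sandwich[OF _ _ tendsto_const])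
    show "\<forall>\<^sub>F n in sequentially. l2 (\<lambda>x. u (k n) x - v x) \<le> inverse (real (Suc n)) + l2 (\<lambda>x. \<phi> (k n) x - v x)"
    proof (intro always_eventually allI)
      fix n
      have s: "sq_int N (\<lambda>x. u (k n) x - \<phi> (k n) x)" "sq_int N (\<lambda>x. \<phi> (k n) x - v x)"
        using sq_int_diff[OF H10_sq_int[OF u] test_sq_int[OF \<phi>(1)]] sq_int_diff[OF test_sq_int[OF \<phi>(1)] k(2)] by auto
      have "l2 (\<lambda>x. u (k n) x - v x) \<le> l2 (\<lambda>x. u (k n) x - \<phi> (k n) x) + l2 (\<lambda>x. \<phi> (k n) x - v x)"
        using l2_triangle[OF s] by simp
      moreover have "l2 (\<lambda>x. u (k n) x - \<phi> (k n) x) < inverse (real (Suc (k n)))"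
        using \<phi>(2)[of "k n"] l2_norm_minus_commute[of N "u (k n)" "\<phi> (k n)"] by simp
      moreover have "inverse (real (Suc (k n))) \<le> inverse (real (Suc n))"
        using seq_suble[OF k(1), of n] by (intro le_imp_inverse_le) auto
      ultimately show "l2 (\<lambda>x. u (k n) x - v x) \<le> inverse (real (Suc n)) + l2 (\<lambda>x. \<phi> (k n) x - v x)" by linarith
    qed
    show "(\<lambda>n. inverse (real (Suc n)) + l2 (\<lambda>x. \<phi> (k n) x - v x)) \<longlonglongrightarrow> 0"
      using tendsto_add[OF LIMSEQ_inverse_real_of_nat k(3)] by simp
  qed (simp add: l2_norm_nonneg)
  with k(1,2) show ?thesis by (rule that)
qed

end

section \<open>Weak limits\<close>

context sobolev_domain
begin

lemma nrm_parallelogram: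
  assumes "u \<in> H1 \<Omega>" "v \<in> H1 \<Omega>"
  shows "(nrm (\<lambda>x. u x - v x))\<^sup>2 + (nrm (\<lambda>x. u x + v x))\<^sup>2 = 2 * (nrm u)\<^sup>2 + 2 * (nrm v)\<^sup>2"
  using nrm_add_sq[OF assms] nrm_diff_sq[OF assms] by simp

lemma l2_add_sq:
  assumes "sq_int N u" "sq_int N v"
  shows "(l2 (\<lambda>x. u x + v x))\<^sup>2 = (l2 u)\<^sup>2 + 2 * lip u v + (l2 v)\<^sup>2"
  using integral_norm_add_sq[OF assms] by (simp add: l2_norm_sq lip_def)

lemma l2_diff_sq:
  assumes "sq_int N u" "sq_int N v"
  shows "(l2 (\<lambda>x. u x - v x))\<^sup>2 = (l2 u)\<^sup>2 - 2 * lip u v + (l2 v)\<^sup>2"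
proof -
  have s: "sq_int N (\<lambda>x. - 1 * v x)" using sq_int_scaleR[OF assms(2), of "-1"] by simp
  have "lip u (\<lambda>x. - 1 * v x) = - lip u v" by (simp add: lip_def)
  moreover have "l2 (\<lambda>x. - 1 * v x) = l2 v" using l2_scale[of "-1" v] by simp
  ultimately show ?thesis using l2_add_sq[OF assms(1) s] by simp
qed

text \<open>By symmetry an estimate for ordered pairs is enough, provided that it depends on the
  smaller index only.\<close>

lemma seq_Cauchy_from_bound:
  fixes c :: "nat \<Rightarrow> nat \<Rightarrow> real"
  assumes "\<And>i j. 0 \<le> f i j" "\<And>i j. i \<le> j \<Longrightarrow> (f i j)\<^sup>2 \<le> g i" "\<And>i j. f i j = f j i" "g \<longlonglongrightarrow> (0::real)" "e > 0"
  shows "\<exists>M. \<forall>i\<ge>M. \<forall>j\<ge>M. f i j < (e::real)"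
proof -
  have "\<forall>\<^sub>F i in sequentially. g i < e\<^sup>2" by (rule order_tendstoD(2)[OF assms(4)]) (use assms(5) in simp)
  then obtain M where M: "\<And>i. i \<ge> M \<Longrightarrow> g i < e\<^sup>2" unfolding eventually_sequentially by blast
  have le: "f i j < e" if "i \<ge> M" "i \<le> j" for i j
  proof (rule power_less_imp_less_base)
    show "(f i j)\<^sup>2 < e\<^sup>2" using assms(2)[OF that(2)] M[OF that(1)] by linarith
  qed (use assms(5) in simp)
  have "f i j < e" if "i \<ge> M" "j \<ge> M" for i j
    using le[of i j] le[of j i] assms(3)[of i j] that by (cases "i \<le> j") auto
  thus ?thesis by blast
qed

text \<open>The limit is found as the limit of elements of almost minimal norm in the convex sets
  of admissible functions that are ever closer to the limit in the mean; these minimizers form a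
  Cauchy sequence by the parallelogram law, and no representation theorem is needed.\<close>

lemma bounded_l2_limit_H10:
  assumes u: "\<And>n::nat. u n \<in> H10 \<Omega>" and K: "\<And>n. nrm (u n) \<le> K" and v: "sq_int N v"
    and lim: "(\<lambda>n. l2 (\<lambda>x. u n x - v x)) \<longlonglongrightarrow> 0"
  shows "v \<in> H10 \<Omega>"
proof -
  \<comment> \<open>Convex sets that shrink as n grows; late members of u show that none is
    empty.\<close>
  define C where "C n = {w \<in> H10 \<Omega>. nrm w \<le> K \<and> l2 (\<lambda>x. w x - v x) \<le> inverse (real (Suc n))}" for n
  define d where "d n = (INF w\<in>C n. (nrm w)\<^sup>2)" for n
  have ne: "C n \<noteq> {}" for n
  proof -
    have "\<forall>\<^sub>F j in sequentially. l2 (\<lambda>x. u j x - v x) < inverse (real (Suc n))"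
      by (rule order_tendstoD(2)[OF lim]) simp
    then obtain j where "l2 (\<lambda>x. u j x - v x) < inverse (real (Suc n))" unfolding eventually_sequentially by blast
    hence "u j \<in> C n" using u K by (simp add: C_def)
    thus ?thesis by blast
  qed
  have bdd: "bdd_below ((\<lambda>w. (nrm w)\<^sup>2) ` C n)" for n by (rule bdd_belowI[of _ 0]) auto
  have d_le: "d n \<le> (nrm w)\<^sup>2" if "w \<in> C n" for n w unfolding d_def by (rule cINF_lower[OF bdd that])
  have "\<exists>w\<in>C n. (nrm w)\<^sup>2 < d n + inverse (real (Suc n))" for n
  proof -
    have "d n < d n + inverse (real (Suc n))" by simp
    thus ?thesis unfolding d_def using cINF_less_iff[OF ne bdd] by blast
  qed
  then obtain y where y: "\<And>n. y n \<in> C n" "\<And>n. (nrm (y n))\<^sup>2 < d n + inverse (real (Suc n))" by metis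
  have yH: "y n \<in> H10 \<Omega>" "nrm (y n) \<le> K" "l2 (\<lambda>x. y n x - v x) \<le> inverse (real (Suc n))" for n
    using y(1)[of n] by (auto simp: C_def)
  have mono_C: "C m \<subseteq> C n" if "n \<le> m" for n m
  proof -
    have "inverse (real (Suc m)) \<le> inverse (real (Suc n))" using that by (intro le_imp_inverse_le) auto
    thus ?thesis unfolding C_def by (auto simp del: of_nat_Suc intro: order_trans)
  qed
  have d_mono: "d n \<le> d m" if "n \<le> m" for n m
    unfolding d_def[of m] using d_le mono_C[OF that] by (intro cINF_greatest ne) blast
  have "d n \<le> K\<^sup>2" for n
  proof -
    have "d n \<le> (nrm (y n))\<^sup>2" by (rule d_le[OF y(1)])
    also have "\<dots> \<le> K\<^sup>2" by (rule power_mono[OF yH(2) nrm_nonneg])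
    finally show ?thesis .
  qed
  then obtain D where D: "d \<longlonglongrightarrow> D" "\<And>n. d n \<le> D"
    using incseq_convergent[of d] d_mono unfolding incseq_def by metis
  \<comment> \<open>By the parallelogram law the squared distance of y n and y m is 2 |y n|^2 + 2 |y
    m|^2 minus four times the squared norm of their midpoint. The midpoint lies in
    \<open>C n\<close> for n <= m, so that norm is at least \<open>d n\<close>; with d m <= D this
    leaves at most \<open>g n\<close>.\<close>
  define g where "g n = 2 * (D - d n) + 4 * inverse (real (Suc n))" for n
  have "(\<lambda>n. 2 * (D - d n) + 4 * inverse (real (Suc n))) \<longlonglongrightarrow> 2 * (D - D) + 4 * 0"
    by (intro tendsto_intros D(1) LIMSEQ_inverse_real_of_nat)
  hence g0: "g \<longlonglongrightarrow> 0" by (simp add: g_def[abs_def])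
  have est: "(nrm (\<lambda>x. y n x - y m x))\<^sup>2 \<le> g n" if nm: "n \<le> m" for n m
  proof -
    note hn = H10_H1[OF yH(1)]
    define w where "w = (\<lambda>x. (1/2) * (y n x + y m x))"
    have wH: "w \<in> H10 \<Omega>" unfolding w_def by (intro H10_scale H10_add yH)
    have nw: "nrm w = (1/2) * nrm (\<lambda>x. y n x + y m x)"
      unfolding w_def using nrm_scale[OF H1_add[OF hn hn], of "1/2" n m] by simp
    have "nrm w \<le> K" using nw nrm_triangle[OF hn hn, of n m] yH(2)[of n] yH(2)[of m] by simp
    moreover have "l2 (\<lambda>x. w x - v x) \<le> inverse (real (Suc n))"
    proof -
      have "(\<lambda>x. w x - v x) = (\<lambda>x. (1/2) * ((y n x - v x) + (y m x - v x)))"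
        by (rule ext) (simp add: w_def field_simps)
      hence "l2 (\<lambda>x. w x - v x) = (1/2) * l2 (\<lambda>x. (y n x - v x) + (y m x - v x))"
        using l2_scale[of "1/2" "\<lambda>x. (y n x - v x) + (y m x - v x)"] by simp
      also have "\<dots> \<le> (1/2) * (l2 (\<lambda>x. y n x - v x) + l2 (\<lambda>x. y m x - v x))"
        by (intro mult_left_mono l2_triangle sq_int_diff H10_sq_int yH v) simp
      also have "\<dots> \<le> inverse (real (Suc n))"
      proof -
        have "inverse (real (Suc m)) \<le> inverse (real (Suc n))" using nm by (intro le_imp_inverse_le) auto
        hence "l2 (\<lambda>x. y m x - v x) \<le> inverse (real (Suc n))" by (rule order_trans[OF yH(3)])
        from add_mono[OF yH(3)[of n] this] show ?thesis by (simp del: of_nat_Suc)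
      qed
      finally show ?thesis .
    qed
    ultimately have "w \<in> C n" using wH by (simp add: C_def)
    hence "d n \<le> (nrm w)\<^sup>2" by (rule d_le)
    hence a: "4 * d n \<le> (nrm (\<lambda>x. y n x + y m x))\<^sup>2" unfolding nw by (simp add: power_mult_distrib power2_eq_square)
    have "inverse (real (Suc m)) \<le> inverse (real (Suc n))" using nm by (intro le_imp_inverse_le) auto
    moreover have "P \<le> 2 * (D - dn) + 4 * A"
      if "B \<le> A" "4 * dn \<le> S" "P + S = 2 * a + 2 * b" "a < dn + A" "b < dm + B" "dm \<le> D" for A B S P a b dn dm :: real
      using that by argo
    ultimately show ?thesis
      using a nrm_parallelogram[OF hn hn, of n m] y(2)[of n] y(2)[of m] D(2)[of m] unfolding g_def by blast
  qed
  have "\<exists>M. \<forall>i\<ge>M. \<forall>j\<ge>M. nrm (\<lambda>x. y i x - y j x) < e" if "e > 0" for e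
    by (rule seq_Cauchy_from_bound[OF nrm_nonneg est nrm_minus_commute[OF H10_H1[OF yH(1)] H10_H1[OF yH(1)]] g0 that])
  then obtain z where z: "z \<in> H10 \<Omega>" "(\<lambda>n. nrm (\<lambda>x. y n x - z x)) \<longlonglongrightarrow> 0" "(\<lambda>n. l2 (\<lambda>x. y n x - z x)) \<longlonglongrightarrow> 0"
    by (rule H10_complete[of y, OF yH(1)]) blast
  \<comment> \<open>z is also the L2 limit of the y n, whose distance to v is at most 1/(n+1); so z
    and v represent the same class.\<close>
  have "l2 (\<lambda>x. z x - v x) \<le> 0"
  proof (rule LIMSEQ_le_const)
    show "(\<lambda>n. l2 (\<lambda>x. y n x - z x) + inverse (real (Suc n))) \<longlonglongrightarrow> 0"
      using tendsto_add[OF z(3) LIMSEQ_inverse_real_of_nat] by simp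
    have "l2 (\<lambda>x. z x - v x) \<le> l2 (\<lambda>x. y n x - z x) + inverse (real (Suc n))" for n
    proof -
      have "l2 (\<lambda>x. z x - v x) \<le> l2 (\<lambda>x. z x - y n x) + l2 (\<lambda>x. y n x - v x)"
        using l2_triangle[OF sq_int_diff[OF H10_sq_int[OF z(1)] H10_sq_int[OF yH(1)]] sq_int_diff[OF H10_sq_int[OF yH(1)] v], of n n] by simp
      thus ?thesis using yH(3)[of n] l2_norm_minus_commute[of N z "y n"] by linarith
    qed
    thus "\<exists>M. \<forall>n\<ge>M. l2 (\<lambda>x. z x - v x) \<le> l2 (\<lambda>x. y n x - z x) + inverse (real (Suc n))" by blast
  qed
  hence "l2 (\<lambda>x. z x - v x) = 0" using l2_norm_nonneg[of N "\<lambda>x. z x - v x"] by linarith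
  hence "AE x in N. z x - v x = 0" by (rule l2_norm_eq_0[OF sq_int_diff[OF H10_sq_int[OF z(1)] v]])
  hence ae: "AE x in N. z x = v x" by eventually_elim simp
  show ?thesis by (rule H10_cong_AE[OF z(1) ae]) (use v in \<open>simp add: sq_int_def\<close>)
qed

text \<open>A further integration by parts expresses the pairing through u and the Laplacian of
  \<phi>, so that L2 convergence alone controls \<open>gip\<close> against test functions.\<close>

lemma gip_test:
  assumes u: "u \<in> H1 \<Omega>" and t: "test_function \<Omega> \<phi>"
  shows "gip u \<phi> = - (\<Sum>i\<in>Basis. lip u (partial_deriv i (partial_deriv i \<phi>)))"
proof -
  note s = H1_sq_int(2)[OF u]
  have I: "integrable N (\<lambda>x. (wg u x \<bullet> i) * partial_deriv i \<phi> x)" if i: "i \<in> Basis" for i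
    using sq_int_inner_integrable[OF sq_int_inner_Basis[OF s i] test_sq_int[OF test_function_partial_deriv[OF t i]]] by simp
  have "gip u \<phi> = (LINT x|N. wg u x \<bullet> grad \<phi> x)"
    unfolding gip_def
  proof (rule integral_cong_AE)
    show "AE x in N. wg u x \<bullet> wg \<phi> x = wg u x \<bullet> grad \<phi> x" using wg_eq[OF hwg_test[OF t]] by eventually_elim simp
  qed (use sq_int_inner_integrable[OF s H1_sq_int(2)[OF test_H1[OF t]]] sq_int_inner_integrable[OF s grad_sq_int[OF t]] in auto)
  also have "\<dots> = (LINT x|N. (\<Sum>i\<in>Basis. (wg u x \<bullet> i) * partial_deriv i \<phi> x))"
    by (simp add: grad_def inner_sum_right mult.commute)
  also have "\<dots> = (\<Sum>i\<in>Basis. LINT x|N. (wg u x \<bullet> i) * partial_deriv i \<phi> x)"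
    by (rule Bochner_Integration.integral_sum[OF I])
  also have "\<dots> = (\<Sum>i\<in>Basis. - lip u (partial_deriv i (partial_deriv i \<phi>)))"
  proof (rule sum.cong[OF refl])
    fix i assume i: "(i::'a) \<in> Basis"
    show "(LINT x|N. (wg u x \<bullet> i) * partial_deriv i \<phi> x) = - lip u (partial_deriv i (partial_deriv i \<phi>))"
      using H1_hwg[OF u] test_function_partial_deriv[OF t i] i unfolding has_weak_gradient_def lip_def by simp
  qed
  finally show ?thesis by (simp add: sum_negf)
qed

lemma lip_tendsto:
  assumes "\<And>n. sq_int N (u n)" "sq_int N v" "sq_int N w" "(\<lambda>n. l2 (\<lambda>x. u n x - v x)) \<longlonglongrightarrow> 0"
  shows "(\<lambda>n. lip (u n) w) \<longlonglongrightarrow> lip v w"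
  using l2_tendsto_integral_inner[OF assms] by (simp add: lip_def)

text \<open>For test functions w this is \<open>gip_test\<close>; the uniform bound on the norms
  extends it by density. Weak convergence is thus encoded as L2 convergence with bounded gradient
  norms.\<close>

lemma weak_convergence:
  assumes u: "\<And>n::nat. u n \<in> H10 \<Omega>" and K: "\<And>n. nrm (u n) \<le> K" and v: "v \<in> H10 \<Omega>"
    and lim: "(\<lambda>n. l2 (\<lambda>x. u n x - v x)) \<longlonglongrightarrow> 0" and w: "w \<in> H10 \<Omega>"
  shows "(\<lambda>n. gip (u n) w) \<longlonglongrightarrow> gip v w"
proof (rule LIMSEQ_I)
  fix e :: real assume e: "e > 0"
  have K0: "K \<ge> 0" using K[of 0] nrm_nonneg order_trans by blast
  \<comment> \<open>A strictly positive bound for the norms of all u n - v.\<close>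
  define B where "B = K + nrm v + 1"
  have B: "B > 0" using K0 nrm_nonneg[of v] by (simp add: B_def)
  have e2: "e / (2 * B) > 0" using e B by simp
  obtain \<phi> where \<phi>: "test_function \<Omega> \<phi>" "l2 (\<lambda>x. \<phi> x - w x) < e / (2 * B)" "nrm (\<lambda>x. \<phi> x - w x) < e / (2 * B)"
    by (rule H10_approx1[OF w e2])
  have tt: "test_function \<Omega> (partial_deriv i (partial_deriv i \<phi>))" if "i \<in> Basis" for i
    using test_function_partial_deriv[OF test_function_partial_deriv[OF \<phi>(1) that] that] .
  have "(\<lambda>n. - (\<Sum>i\<in>Basis. lip (u n) (partial_deriv i (partial_deriv i \<phi>)))) \<longlonglongrightarrow> - (\<Sum>i\<in>Basis. lip v (partial_deriv i (partial_deriv i \<phi>)))"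
    by (intro tendsto_minus tendsto_sum lip_tendsto H10_sq_int u v test_sq_int tt lim)
  hence "(\<lambda>n. gip (u n) \<phi>) \<longlonglongrightarrow> gip v \<phi>" by (simp only: gip_test[OF H10_H1[OF u] \<phi>(1)] gip_test[OF H10_H1[OF v] \<phi>(1)])
  then obtain n0 where n0: "\<And>n. n \<ge> n0 \<Longrightarrow> \<bar>gip (u n) \<phi> - gip v \<phi>\<bar> < e / 2"
    using LIMSEQ_D[of "\<lambda>n. gip (u n) \<phi>" "gip v \<phi>" "e / 2"] e by auto
  have "norm (gip (u n) w - gip v w) < e" if "n \<ge> n0" for n
  proof -
    note h = H10_H1[OF u[of n]] H10_H1[OF v] H10_H1[OF w] test_H1[OF \<phi>(1)]
    define z where "z = (\<lambda>x. u n x - v x)"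
    have z: "z \<in> H1 \<Omega>" unfolding z_def by (rule H1_diff[OF h(1,2)])
    have "gip z \<phi> - gip z w = gip z (\<lambda>x. \<phi> x - w x)"
      using gip_diff[OF h(4) h(3) z] by (simp add: gip_commute[of z])
    moreover have "\<bar>gip z (\<lambda>x. \<phi> x - w x)\<bar> \<le> nrm z * nrm (\<lambda>x. \<phi> x - w x)"
      by (rule gip_CS[OF z H1_diff[OF h(4) h(3)]])
    moreover have "nrm z * nrm (\<lambda>x. \<phi> x - w x) \<le> B * (e / (2 * B))"
    proof (rule mult_mono)
      show "nrm z \<le> B" unfolding z_def B_def using nrm_triangle_diff(2)[OF h(1,2)] K[of n] by linarith
    qed (use \<phi>(3) B nrm_nonneg in auto)
    moreover have "B * (e / (2 * B)) = e / 2" using B by simp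
    moreover have "\<bar>gip z \<phi>\<bar> < e / 2" using n0[OF that] gip_diff[OF h(1,2) h(4)] by (simp add: z_def)
    ultimately have "\<bar>gip z w\<bar> < e" by linarith
    thus ?thesis using gip_diff[OF h(1,2) h(3)] by (simp add: z_def)
  qed
  thus "\<exists>n0. \<forall>n\<ge>n0. norm (gip (u n) w - gip v w) < e" by blast
qed

section \<open>The first eigenvalue and the best Sobolev constant\<close>

text \<open>If all test functions vanished almost everywhere, the constant 1 would be orthogonal to
  them and hence zero on \<Omega>, but a nonempty open set is not negligible. This gives nonempty
  index sets for the infima below.\<close>

lemma H10_nontrivial: "\<exists>u\<in>H10 \<Omega>. \<not> ae_zero \<Omega> u"
proof (rule ccontr)
  assume "\<not> ?thesis"
  hence z: "AE x in N. \<phi> x = 0" if "test_function \<Omega> \<phi>" for \<phi>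
    using test_H10[OF that] by (auto simp: ae_zero_def)
  have "AE x in N. (1::real) = 0"
  proof (rule test_function_ortho_AE_zero[OF op bd])
    fix \<phi> assume t: "test_function \<Omega> \<phi>"
    have "AE x in N. 1 * \<phi> x = 0" using z[OF t] by eventually_elim simp
    thus "(LINT x|N. 1 * \<phi> x) = 0" by (rule integral_eq_zero_AE)
  qed simp
  hence "AE x in lebesgue. x \<notin> \<Omega>" by (subst (asm) AE_restrict_space_iff) (use Om_sets in auto)
  hence "\<Omega> \<in> null_sets lebesgue" using Om_sets by (simp add: AE_iff_null_sets)
  hence "negligible \<Omega>" by (simp add: negligible_iff_null_sets)
  thus False using open_not_negligible[OF op ne] by blast
qed

lemma l2_pos: "u \<in> H10 \<Omega> \<Longrightarrow> \<not> ae_zero \<Omega> u \<Longrightarrow> l2 u > 0"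
  using l2_norm_eq_0[OF H10_sq_int, of u] l2_norm_nonneg[of N u] unfolding ae_zero_def by fastforce

definition rayleigh :: real where
  "rayleigh = (INF u\<in>{u \<in> H10 \<Omega>. l2 u = 1}. (nrm u)\<^sup>2)"

lemma rayleigh_set_nonempty: "{u \<in> H10 \<Omega>. l2 u = 1} \<noteq> {}"
proof -
  obtain u where u: "u \<in> H10 \<Omega>" "\<not> ae_zero \<Omega> u" using H10_nontrivial by blast
  have "(\<lambda>x. (1 / l2 u) * u x) \<in> {u \<in> H10 \<Omega>. l2 u = 1}"
    using H10_scale[OF u(1), of "1 / l2 u"] l2_scale[of "1 / l2 u" u] l2_pos[OF u] by simp
  thus ?thesis by blast
qed

lemma rayleigh_le:
  assumes u: "u \<in> H10 \<Omega>"
  shows "rayleigh * (l2 u)\<^sup>2 \<le> (nrm u)\<^sup>2"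
proof (cases "l2 u = 0")
  case False
  hence pos: "l2 u > 0" using l2_norm_nonneg[of N u] by linarith
  define w where "w = (\<lambda>x. (1 / l2 u) * u x)"
  have w: "w \<in> H10 \<Omega>" "l2 w = 1" unfolding w_def using H10_scale[OF u, of "1 / l2 u"] l2_scale[of "1 / l2 u" u] pos by auto
  have "rayleigh \<le> (nrm w)\<^sup>2"
    unfolding rayleigh_def by (rule cINF_lower) (use w in \<open>auto intro: bdd_belowI[of _ 0]\<close>)
  also have "(nrm w)\<^sup>2 = (nrm u)\<^sup>2 / (l2 u)\<^sup>2"
    unfolding w_def using nrm_scale[OF H10_H1[OF u], of "1 / l2 u"] pos by (simp add: power_divide)
  finally show ?thesis using pos by (simp add: pos_le_divide_eq)
qed simp

text \<open>A minimizing sequence has an L2-convergent subsequence by \<open>rellich\<close>. The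
  parallelogram law in both norms upgrades this to a Cauchy sequence for \<open>nrm\<close>, so the
  minimum is attained by a strong limit.\<close>

lemma rayleigh_attained: "\<exists>u\<in>H10 \<Omega>. l2 u = 1 \<and> (nrm u)\<^sup>2 = rayleigh"
proof -
  have bdd: "bdd_below ((\<lambda>u. (nrm u)\<^sup>2) ` {u \<in> H10 \<Omega>. l2 u = 1})" by (rule bdd_belowI[of _ 0]) auto
  have "\<exists>u\<in>{u \<in> H10 \<Omega>. l2 u = 1}. (nrm u)\<^sup>2 < rayleigh + inverse (real (Suc n))" for n
  proof -
    have "rayleigh < rayleigh + inverse (real (Suc n))" by simp
    thus ?thesis unfolding rayleigh_def using cINF_less_iff[OF rayleigh_set_nonempty bdd] by blast
  qed
  then obtain u where u0: "\<And>n. u n \<in> {u \<in> H10 \<Omega>. l2 u = 1}" "\<And>n. (nrm (u n))\<^sup>2 < rayleigh + inverse (real (Suc n))" by metis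
  hence u: "\<And>n. u n \<in> H10 \<Omega>" "\<And>n. l2 (u n) = 1" by auto
  have L0: "rayleigh \<ge> 0"
    unfolding rayleigh_def by (rule cINF_greatest[OF rayleigh_set_nonempty]) simp
  have K: "nrm (u n) \<le> sqrt (rayleigh + 1)" for n
  proof (rule real_le_rsqrt)
    have "inverse (real (Suc n)) \<le> 1" by (simp add: field_simps)
    thus "(nrm (u n))\<^sup>2 \<le> rayleigh + 1" using u0(2)[of n] by linarith
  qed
  obtain k v where k: "strict_mono k" "sq_int N v" "(\<lambda>n. l2 (\<lambda>x. u (k n) x - v x)) \<longlonglongrightarrow> 0"
    by (rule rellich[of u, OF u(1) K]) blast
  define w where "w n = u (k n)" for n
  have w: "w n \<in> H10 \<Omega>" "l2 (w n) = 1" for n using u by (auto simp: w_def)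
  have wn: "(nrm (w n))\<^sup>2 < rayleigh + inverse (real (Suc n))" for n
  proof -
    have "inverse (real (Suc (k n))) \<le> inverse (real (Suc n))" using seq_suble[OF k(1), of n] by (intro le_imp_inverse_le) auto
    thus ?thesis using u0(2)[of "k n"] unfolding w_def by linarith
  qed
  have wl: "(\<lambda>n. l2 (\<lambda>x. w n x - v x)) \<longlonglongrightarrow> 0" using k(3) by (simp add: w_def)
  have "\<exists>M. \<forall>i\<ge>M. \<forall>j\<ge>M. nrm (\<lambda>x. w i x - w j x) < e" if e: "e > 0" for e
  proof -
    \<comment> \<open>With this choice \<open>rayleigh\<close> times the square of 2 \<delta> is
      below e^2; the gap leaves room for the errors 1/(i+1) and 1/(j+1), each less than a quarter of
      it.\<close>
    define \<delta> where "\<delta> = e / (2 * (sqrt rayleigh + 1))"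
    have \<delta>: "\<delta> > 0" using e L0 by (simp add: \<delta>_def add_nonneg_pos)
    have L\<delta>: "rayleigh * (2 * \<delta>)\<^sup>2 < e\<^sup>2"
    proof -
      have "sqrt rayleigh * (2 * \<delta>) < (sqrt rayleigh + 1) * (2 * \<delta>)" using \<delta> by (intro mult_strict_right_mono) auto
      also have "\<dots> = e" using real_sqrt_ge_zero[OF L0] by (simp add: \<delta>_def field_simps add_nonneg_eq_0_iff)
      finally have "(sqrt rayleigh * (2 * \<delta>))\<^sup>2 < e\<^sup>2" using \<delta> L0 by (intro power_strict_mono) auto
      thus ?thesis using L0 by (simp add: power_mult_distrib)
    qed
    have "\<forall>\<^sub>F n in sequentially. l2 (\<lambda>x. w n x - v x) < \<delta>" by (rule order_tendstoD(2)[OF wl \<delta>])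
    then obtain M1 where M1: "\<And>n. n \<ge> M1 \<Longrightarrow> l2 (\<lambda>x. w n x - v x) < \<delta>" unfolding eventually_sequentially by blast
    have "(e\<^sup>2 - rayleigh * (2 * \<delta>)\<^sup>2) / 4 > 0" using L\<delta> by simp
    from order_tendstoD(2)[OF LIMSEQ_inverse_real_of_nat this]
    obtain M2 where M2: "\<And>n. n \<ge> M2 \<Longrightarrow> inverse (real (Suc n)) < (e\<^sup>2 - rayleigh * (2 * \<delta>)\<^sup>2) / 4"
      unfolding eventually_sequentially by blast
    have "nrm (\<lambda>x. w i x - w j x) < e" if "i \<ge> max M1 M2" "j \<ge> max M1 M2" for i j
    proof (rule power_less_imp_less_base)
      note h = H10_H1[OF w(1)[of i]] H10_H1[OF w(1)[of j]] and s = H10_sq_int[OF w(1)[of i]] H10_sq_int[OF w(1)[of j]]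
      have "l2 (\<lambda>x. w i x - w j x) \<le> l2 (\<lambda>x. w i x - v x) + l2 (\<lambda>x. v x - w j x)"
        using l2_triangle[OF sq_int_diff[OF s(1) k(2)] sq_int_diff[OF k(2) s(2)]] by simp
      also have "\<dots> \<le> 2 * \<delta>" using M1[of i] M1[of j] that l2_norm_minus_commute[of N v "w j"] by simp
      finally have "(l2 (\<lambda>x. w i x - w j x))\<^sup>2 \<le> (2 * \<delta>)\<^sup>2" by (rule power_mono[OF _ l2_norm_nonneg])
      hence a: "rayleigh * (l2 (\<lambda>x. w i x - w j x))\<^sup>2 \<le> rayleigh * (2 * \<delta>)\<^sup>2" by (rule mult_left_mono[OF _ L0])
      \<comment> \<open>The sum has L2 norm close to 2, so its energy is nearly four times the
        infimum; this forces the energy of the difference to be small.\<close>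
      have "rayleigh * (l2 (\<lambda>x. w i x + w j x))\<^sup>2 \<le> (nrm (\<lambda>x. w i x + w j x))\<^sup>2"
        by (rule rayleigh_le[OF H10_add[OF w(1) w(1)]])
      moreover have "(l2 (\<lambda>x. w i x + w j x))\<^sup>2 = 4 - (l2 (\<lambda>x. w i x - w j x))\<^sup>2"
        using l2_add_sq[OF s] l2_diff_sq[OF s] w(2) by simp
      ultimately have "rayleigh * (4 - (l2 (\<lambda>x. w i x - w j x))\<^sup>2) \<le> (nrm (\<lambda>x. w i x + w j x))\<^sup>2" by simp
      hence b: "4 * rayleigh - rayleigh * (l2 (\<lambda>x. w i x - w j x))\<^sup>2 \<le> (nrm (\<lambda>x. w i x + w j x))\<^sup>2" by (simp add: algebra_simps)
      have c: "inverse (real (Suc i)) < (e\<^sup>2 - rayleigh * (2 * \<delta>)\<^sup>2) / 4" "inverse (real (Suc j)) < (e\<^sup>2 - rayleigh * (2 * \<delta>)\<^sup>2) / 4"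
        using M2[of i] M2[of j] that by auto
      show "(nrm (\<lambda>x. w i x - w j x))\<^sup>2 < e\<^sup>2"
        using nrm_parallelogram[OF h] wn[of i] wn[of j] a b c by argo
    qed (use e in simp)
    thus ?thesis by blast
  qed
  then obtain z where z: "z \<in> H10 \<Omega>" "(\<lambda>n. nrm (\<lambda>x. w n x - z x)) \<longlonglongrightarrow> 0" "(\<lambda>n. l2 (\<lambda>x. w n x - z x)) \<longlonglongrightarrow> 0"
    by (rule H10_complete[of w, OF w(1)]) blast
  have "(\<lambda>n. l2 (w n)) \<longlonglongrightarrow> l2 z" by (rule l2_tendsto[OF H10_sq_int[OF w(1)] H10_sq_int[OF z(1)] z(3)])
  hence lz: "l2 z = 1" by (simp add: w(2) LIMSEQ_const_iff)
  have nz: "(\<lambda>n. (nrm (w n))\<^sup>2) \<longlonglongrightarrow> (nrm z)\<^sup>2"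
    by (intro tendsto_power nrm_tendsto[OF H10_H1[OF w(1)] H10_H1[OF z(1)] z(2)])
  have "(\<lambda>n. rayleigh + inverse (real (Suc n))) \<longlonglongrightarrow> rayleigh + 0" by (intro tendsto_intros LIMSEQ_inverse_real_of_nat)
  from LIMSEQ_le[OF nz this] have "(nrm z)\<^sup>2 \<le> rayleigh" using wn less_imp_le by auto
  moreover have "rayleigh \<le> (nrm z)\<^sup>2" using rayleigh_le[OF z(1)] lz by simp
  ultimately show ?thesis using z(1) lz by auto
qed

text \<open>\<open>LEAST\<close> on the reals is informative only when a least eigenvalue exists,
  and the attained infimum provides one. Conversely, every eigenvalue is the Rayleigh quotient of
  its eigenfunction.\<close>

lemma first_eigenvalue_eq: "first_eigenvalue \<Omega> = rayleigh"
  unfolding first_eigenvalue_def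
proof (rule Least_equality)
  obtain u where u: "u \<in> H10 \<Omega>" "l2 u = 1" "(nrm u)\<^sup>2 = rayleigh" using rayleigh_attained by blast
  have "\<not> ae_zero \<Omega> u"
  proof
    assume "ae_zero \<Omega> u"
    hence "AE x in N. (norm (u x))\<^sup>2 = 0" unfolding ae_zero_def by eventually_elim simp
    hence "(LINT x|N. (norm (u x))\<^sup>2) = 0" by (rule integral_eq_zero_AE)
    hence "l2 u = 0" by (simp add: l2_norm_def)
    thus False using u(2) by simp
  qed
  moreover have "gip u v = rayleigh * lip u v" if v: "v \<in> H10 \<Omega>" for v
  proof -
    define B where "B = gip u v - rayleigh * lip u v"
    define C where "C = (nrm v)\<^sup>2 - rayleigh * (l2 v)\<^sup>2"
    have C: "C \<ge> 0" using rayleigh_le[OF v] by (simp add: C_def)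
    \<comment> \<open>The excess of the energy over \<open>rayleigh\<close> times the mass at u + t
      v. Its constant term is 0 by minimality, so the linear coefficient B must vanish, which is the
      eigenvalue equation.\<close>
    have "0 \<le> 0 + 2 * t * B + t\<^sup>2 * C" for t
    proof -
      note tv = H10_scale[OF v, of t]
      have 1: "(nrm (\<lambda>x. u x + t * v x))\<^sup>2 = rayleigh + 2 * (t * gip u v) + t\<^sup>2 * (nrm v)\<^sup>2"
        using nrm_add_sq[OF H10_H1[OF u(1)] H10_H1[OF tv]] gip_scale[OF H10_H1[OF v] H10_H1[OF u(1)], of t]
          nrm_scale[OF H10_H1[OF v], of t] u(3)
        by (simp add: gip_commute[of u] power_mult_distrib)
      have "lip u (\<lambda>x. t * v x) = t * lip u v" by (simp add: lip_def mult.left_commute)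
      hence 2: "(l2 (\<lambda>x. u x + t * v x))\<^sup>2 = 1 + 2 * (t * lip u v) + t\<^sup>2 * (l2 v)\<^sup>2"
        using l2_add_sq[OF H10_sq_int[OF u(1)] H10_sq_int[OF tv]] u(2) l2_scale[of t v] by (simp add: power_mult_distrib)
      have "rayleigh * (l2 (\<lambda>x. u x + t * v x))\<^sup>2 \<le> (nrm (\<lambda>x. u x + t * v x))\<^sup>2"
        by (rule rayleigh_le[OF H10_add[OF u(1) tv]])
      thus ?thesis unfolding 1 2 B_def C_def by (simp add: algebra_simps)
    qed
    hence "\<bar>B\<bar> \<le> sqrt 0 * sqrt C" by (rule real_quadratic_CS) (use C in auto)
    thus ?thesis by (simp add: B_def)
  qed
  ultimately show "dirichlet_eigenvalue \<Omega> rayleigh"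
    using u(1) unfolding dirichlet_eigenvalue_def gip_def lip_def by blast
next
  fix \<mu> assume "dirichlet_eigenvalue \<Omega> \<mu>"
  then obtain u where u: "u \<in> H10 \<Omega>" "\<not> ae_zero \<Omega> u" "\<forall>v\<in>H10 \<Omega>. gip u v = \<mu> * lip u v"
    unfolding dirichlet_eigenvalue_def gip_def lip_def by blast
  have "(nrm u)\<^sup>2 = \<mu> * (l2 u)\<^sup>2" using u(1,3) by (simp add: nrm_sq l2_sq)
  hence "rayleigh * (l2 u)\<^sup>2 \<le> \<mu> * (l2 u)\<^sup>2" using rayleigh_le[OF u(1)] by simp
  thus "rayleigh \<le> \<mu>" using l2_pos[OF u(1,2)] by simp
qed

lemma first_eigenvalue_le: "u \<in> H10 \<Omega> \<Longrightarrow> first_eigenvalue \<Omega> * (l2 u)\<^sup>2 \<le> (nrm u)\<^sup>2"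
  unfolding first_eigenvalue_eq by (rule rayleigh_le)

section \<open>The critical integral and the best Sobolev constant\<close>

definition pint :: "('a \<Rightarrow> real) \<Rightarrow> real" where "pint u = (LINT x|N. \<bar>u x\<bar> powr p)"

lemma pint_nonneg: "pint u \<ge> 0" by (simp add: pint_def)

lemma pint_pos:
  assumes "u \<in> H10 \<Omega>" "\<not> ae_zero \<Omega> u"
  shows "pint u > 0"
proof (rule ccontr)
  assume "\<not> pint u > 0"
  hence "pint u = 0" using pint_nonneg[of u] by linarith
  hence "AE x in N. \<bar>u x\<bar> powr p = 0"
    unfolding pint_def using H10_powr_integrable[OF assms(1)] by (subst (asm) integral_nonneg_eq_0_iff_AE) auto
  hence "AE x in N. u x = 0" by eventually_elim simp
  thus False using assms(2) by (simp add: ae_zero_def)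
qed

lemma sobolev_constant_eq:
  "sobolev_constant \<Omega> = (INF u\<in>{u \<in> H10 \<Omega>. \<not> ae_zero \<Omega> u}. (nrm u)\<^sup>2 / pint u powr (2 / p))"
  unfolding sobolev_constant_def pint_def p_def[symmetric] energy_eq_nrm ..

text \<open>The crude Sobolev inequality bounds every quotient from below. Positivity gives the
  hypotheses on b their meaning: \<open>0 powr x\<close> is 0, so S = 0 would turn
  \<open>S powr (- p / 2)\<close> into 0.\<close>

lemma sobolev_constant_pos: "sobolev_constant \<Omega> > 0"
proof -
  have "sob_const powr (- 2 / p) \<le> sobolev_constant \<Omega>"
    unfolding sobolev_constant_eq
  proof (rule cINF_greatest)
    show "{u \<in> H10 \<Omega>. \<not> ae_zero \<Omega> u} \<noteq> {}" using H10_nontrivial by blast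
    fix u assume "u \<in> {u \<in> H10 \<Omega>. \<not> ae_zero \<Omega> u}"
    hence u: "u \<in> H10 \<Omega>" "\<not> ae_zero \<Omega> u" by auto
    have pp: "pint u powr (2 / p) > 0" using pint_pos[OF u] by simp
    have "pint u powr (2 / p) \<le> (sob_const * nrm u powr p) powr (2 / p)"
      using sobolev_H10_le[OF u(1)] p_gt_2 pint_nonneg[of u] by (intro powr_mono2) (auto simp: pint_def)
    also have "\<dots> = sob_const powr (2 / p) * (nrm u)\<^sup>2"
    proof (cases "nrm u = 0")
      case False
      hence "nrm u > 0" using nrm_nonneg[of u] by linarith
      thus ?thesis using p_gt_2 sob_const_pos by (simp add: powr_mult powr_powr)
    qed simp
    finally have "sob_const powr (- 2 / p) * pint u powr (2 / p) \<le> sob_const powr (- 2 / p) * (sob_const powr (2 / p) * (nrm u)\<^sup>2)"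
      by (intro mult_left_mono) auto
    also have "\<dots> = (nrm u)\<^sup>2" using sob_const_pos by (simp add: powr_minus mult.assoc[symmetric])
    finally show "sob_const powr (- 2 / p) \<le> (nrm u)\<^sup>2 / pint u powr (2 / p)" using pp by (simp add: pos_le_divide_eq)
  qed
  moreover have "0 < sob_const powr (- 2 / p)" using sob_const_pos by simp
  ultimately show ?thesis by linarith
qed

lemma nrm_sq_powr: "((nrm u)\<^sup>2) powr (q / 2) = nrm u powr q"
proof (cases "nrm u = 0")
  case False
  hence "nrm u > 0" using nrm_nonneg[of u] by linarith
  hence "(nrm u)\<^sup>2 = nrm u powr 2" by simp
  thus ?thesis by (simp only: powr_powr) simp
qed simp

text \<open>The definition of S solved for the integral; functions vanishing almost everywhere are
  outside the infimum and are treated apart. This is the sharp estimate that competes with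
  b.\<close>

lemma pint_le:
  assumes u: "u \<in> H10 \<Omega>"
  shows "pint u \<le> sobolev_constant \<Omega> powr (- p / 2) * nrm u powr p"
proof (cases "ae_zero \<Omega> u")
  case True
  hence "AE x in N. u x = 0" by (simp add: ae_zero_def)
  hence "AE x in N. \<bar>u x\<bar> powr p = 0" by eventually_elim (use p_gt_2 in simp)
  hence "pint u = 0" unfolding pint_def by (rule integral_eq_zero_AE)
  thus ?thesis by simp
next
  case False
  define S where "S = sobolev_constant \<Omega>"
  have S: "S > 0" unfolding S_def by (rule sobolev_constant_pos)
  have pp: "pint u > 0" by (rule pint_pos[OF u False])
  have "S \<le> (nrm u)\<^sup>2 / pint u powr (2 / p)"
    unfolding S_def sobolev_constant_eq by (rule cINF_lower) (use u False in \<open>auto intro: bdd_belowI[of _ 0]\<close>)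
  hence "S * pint u powr (2 / p) \<le> (nrm u)\<^sup>2" using pp by (simp add: pos_le_divide_eq)
  hence "(S * pint u powr (2 / p)) powr (p / 2) \<le> ((nrm u)\<^sup>2) powr (p / 2)"
    using S p_gt_2 by (intro powr_mono2) auto
  moreover have "(S * pint u powr (2 / p)) powr (p / 2) = S powr (p / 2) * pint u"
    using S pp p_gt_2 by (simp add: powr_mult powr_powr)
  moreover have "((nrm u)\<^sup>2) powr (p / 2) = nrm u powr p" by (rule nrm_sq_powr)
  ultimately have "S powr (p / 2) * pint u \<le> nrm u powr p" by simp
  hence "S powr (- p / 2) * (S powr (p / 2) * pint u) \<le> S powr (- p / 2) * nrm u powr p" by (intro mult_left_mono) auto
  moreover have "S powr (- p / 2) * S powr (p / 2) = 1" using S by (simp add: powr_add[symmetric])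
  hence "S powr (- p / 2) * (S powr (p / 2) * pint u) = pint u" by (simp only: mult.assoc[symmetric] mult_1)
  ultimately show ?thesis unfolding S_def[symmetric] by (simp only:)
qed

end

section \<open>Elementary inequalities for powers\<close>

text \<open>For q = p - 2 below 1 the power is not Lipschitz at 0. The extra factor y repairs this:
  at the intermediate point z of the mean value theorem, z^(q-1) y is at most z^q.\<close>

lemma powr_diff_mult_le:
  fixes x y q :: real
  assumes "0 \<le> y" "y \<le> x" "q > 0"
  shows "(x powr q - y powr q) * y \<le> q * x powr q * (x - y)"
proof (cases "y = 0 \<or> x = y")
  case True
  thus ?thesis using assms by auto
next
  case False
  hence y: "0 < y" "y < x" using assms by auto
  have "\<exists>z. y < z \<and> z < x \<and> x powr q - y powr q = (x - y) * (q * z powr (q - 1))"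
    by (rule MVT2[OF y(2)]) (use y in \<open>auto intro!: derivative_eq_intros simp: has_real_derivative_powr\<close>)
  then obtain z where z: "y < z" "z < x" "x powr q - y powr q = (x - y) * (q * z powr (q - 1))" by blast
  have "(x powr q - y powr q) * y = q * (x - y) * (z powr (q - 1) * y)" by (simp add: z(3))
  also have "\<dots> \<le> q * (x - y) * (z powr (q - 1) * z)"
    using z y assms by (intro mult_left_mono) auto
  also have "z powr (q - 1) * z = z powr q" using z y by (simp add: powr_diff)
  also have "q * (x - y) * z powr q \<le> q * (x - y) * x powr q"
    using z y assms by (intro mult_left_mono powr_mono2) auto
  finally show ?thesis by (simp add: mult_ac)
qed

text \<open>The odd power; for q = p - 2 it is the derivative of |s|^p divided by p.\<close>

definition spow :: "real \<Rightarrow> real \<Rightarrow> real" where "spow q s = \<bar>s\<bar> powr q * s"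

lemma spow_diff_le:
  fixes s t q :: real
  assumes q: "q > 0"
  shows "\<bar>spow q s - spow q t\<bar> \<le> (q + 1) * max \<bar>s\<bar> \<bar>t\<bar> powr q * \<bar>s - t\<bar>"
proof -
  have *: "\<bar>spow q s - spow q t\<bar> \<le> (q + 1) * \<bar>s\<bar> powr q * \<bar>s - t\<bar>" if st: "\<bar>t\<bar> \<le> \<bar>s\<bar>" for s t
  proof -
    \<comment> \<open>Split so that the difference of powers is multiplied by t, the smaller in
      absolute value, as \<open>powr_diff_mult_le\<close> demands.\<close>
    have "spow q s - spow q t = \<bar>s\<bar> powr q * (s - t) + (\<bar>s\<bar> powr q - \<bar>t\<bar> powr q) * t"
      by (simp add: spow_def algebra_simps)
    also have "\<bar>\<dots>\<bar> \<le> \<bar>\<bar>s\<bar> powr q * (s - t)\<bar> + \<bar>(\<bar>s\<bar> powr q - \<bar>t\<bar> powr q) * t\<bar>" by (rule abs_triangle_ineq)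
    also have "\<bar>(\<bar>s\<bar> powr q - \<bar>t\<bar> powr q) * t\<bar> = (\<bar>s\<bar> powr q - \<bar>t\<bar> powr q) * \<bar>t\<bar>"
      using st q by (simp add: abs_mult powr_mono2)
    also have "\<dots> \<le> q * \<bar>s\<bar> powr q * (\<bar>s\<bar> - \<bar>t\<bar>)" using st q by (intro powr_diff_mult_le) auto
    also have "\<dots> \<le> q * \<bar>s\<bar> powr q * \<bar>s - t\<bar>" using q by (intro mult_left_mono) auto
    finally show ?thesis unfolding abs_mult by (simp add: distrib_right)
  qed
  show ?thesis
  proof (cases "\<bar>t\<bar> \<le> \<bar>s\<bar>")
    case True
    thus ?thesis using *[OF True] by (simp add: max_def)
  next
    case False
    thus ?thesis using *[of s t] by (simp add: max_def abs_minus_commute)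
  qed
qed

text \<open>Negative s are reflected; at 0 the difference quotient has absolute value |h|^(p-1),
  which tends to 0.\<close>

lemma abs_powr_deriv:
  fixes p s :: real
  assumes p: "p > 1"
  shows "((\<lambda>s. \<bar>s\<bar> powr p) has_real_derivative p * spow (p - 2) s) (at s)"
proof -
  consider "s > 0" | "s < 0" | "s = 0" by linarith
  thus ?thesis
  proof cases
    case 1
    have "s powr (p - 1) = s powr (p - 2) * s powr 1" using 1 by (simp only: powr_add[symmetric]) simp
    hence "((\<lambda>s. s powr p) has_real_derivative p * spow (p - 2) s) (at s)"
      using has_real_derivative_powr[OF 1, of p] 1 by (simp add: spow_def)
    moreover have "\<forall>\<^sub>F y in nhds s. y powr p = \<bar>y\<bar> powr p"
      using eventually_nhds_in_open[of "{0<..}" s] 1 by (auto elim!: eventually_mono)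
    ultimately show ?thesis by (rule DERIV_transfer_ev)
  next
    case 2
    have e: "(- s) powr (p - 1) = (- s) powr (p - 2) * (- s) powr 1" using 2 by (simp only: powr_add[symmetric]) simp
    have "((\<lambda>s. (- s) powr p) has_real_derivative (p * (- s) powr (p - 1)) * (- 1)) (at s)"
      by (rule DERIV_chain2[OF has_real_derivative_powr]) (use 2 in \<open>auto intro!: derivative_eq_intros\<close>)
    hence "((\<lambda>s. (- s) powr p) has_real_derivative p * spow (p - 2) s) (at s)"
      using e 2 by (simp add: spow_def)
    moreover have "\<forall>\<^sub>F y in nhds s. (- y) powr p = \<bar>y\<bar> powr p"
      using eventually_nhds_in_open[of "{..<0}" s] 2 by (auto elim!: eventually_mono)
    ultimately show ?thesis by (rule DERIV_transfer_ev)
  next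
    case 3
    have "((\<lambda>h::real. \<bar>h\<bar> powr (p - 1)) \<longlongrightarrow> 0) (at 0)"
    proof -
      have "((\<lambda>h::real. \<bar>h\<bar> powr (p - 1)) \<longlongrightarrow> \<bar>0\<bar> powr (p - 1)) (at 0)"
        using p by (intro tendsto_powr2 tendsto_intros) auto
      thus ?thesis using p by simp
    qed
    hence "((\<lambda>h::real. \<bar>h\<bar> powr p / h) \<longlongrightarrow> 0) (at 0)"
    proof (rule Lim_null_comparison[rotated])
      have "norm (\<bar>h\<bar> powr p / h) \<le> \<bar>h\<bar> powr (p - 1)" if "h \<noteq> 0" for h :: real
        using that by (simp add: powr_diff)
      thus "\<forall>\<^sub>F h in at 0. norm (\<bar>h\<bar> powr p / h) \<le> \<bar>h\<bar> powr (p - 1)"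
        by (auto simp: eventually_at_filter)
    qed
    thus ?thesis using 3 p by (simp add: DERIV_def spow_def)
  qed
qed

text \<open>The mean value theorem yields the derivative at an intermediate point \<xi>, and
  \<open>spow_diff_le\<close> compares it with the derivative at t; this supplies the second factor
  s - t.\<close>

lemma abs_powr_taylor:
  fixes p s t :: real
  assumes p: "p > 2"
  shows "\<bar>\<bar>s\<bar> powr p - \<bar>t\<bar> powr p - p * spow (p - 2) t * (s - t)\<bar> \<le> p * (p - 1) * max \<bar>s\<bar> \<bar>t\<bar> powr (p - 2) * (s - t)\<^sup>2"
proof (cases "s = t")
  case False
  have "\<exists>\<xi>. \<bar>\<xi> - t\<bar> \<le> \<bar>s - t\<bar> \<and> \<bar>\<xi>\<bar> \<le> max \<bar>s\<bar> \<bar>t\<bar> \<and> \<bar>s\<bar> powr p - \<bar>t\<bar> powr p = (s - t) * (p * spow (p - 2) \<xi>)"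
  proof (cases "t < s")
    case True
    have "\<exists>z. t < z \<and> z < s \<and> \<bar>s\<bar> powr p - \<bar>t\<bar> powr p = (s - t) * (p * spow (p - 2) z)"
      by (rule MVT2[OF True]) (use p in \<open>intro abs_powr_deriv, simp\<close>)
    then obtain z where z: "t < z" "z < s" "\<bar>s\<bar> powr p - \<bar>t\<bar> powr p = (s - t) * (p * spow (p - 2) z)" by blast
    show ?thesis by (rule exI[of _ z]) (use z in auto)
  next
    case F: False
    hence lt: "s < t" using False by simp
    have "\<exists>z. s < z \<and> z < t \<and> \<bar>t\<bar> powr p - \<bar>s\<bar> powr p = (t - s) * (p * spow (p - 2) z)"
      by (rule MVT2[OF lt]) (use p in \<open>intro abs_powr_deriv, simp\<close>)
    then obtain z where z: "s < z" "z < t" "\<bar>t\<bar> powr p - \<bar>s\<bar> powr p = (t - s) * (p * spow (p - 2) z)" by blast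
    have "\<bar>s\<bar> powr p - \<bar>t\<bar> powr p = (s - t) * (p * spow (p - 2) z)" using z(3) by (simp add: algebra_simps)
    thus ?thesis by (intro exI[of _ z]) (use z in auto)
  qed
  then obtain \<xi> where \<xi>: "\<bar>\<xi> - t\<bar> \<le> \<bar>s - t\<bar>" "\<bar>\<xi>\<bar> \<le> max \<bar>s\<bar> \<bar>t\<bar>" "\<bar>s\<bar> powr p - \<bar>t\<bar> powr p = (s - t) * (p * spow (p - 2) \<xi>)" by blast
  have "\<bar>s\<bar> powr p - \<bar>t\<bar> powr p - p * spow (p - 2) t * (s - t) = p * (s - t) * (spow (p - 2) \<xi> - spow (p - 2) t)"
    by (simp add: \<xi>(3) algebra_simps)
  hence "\<bar>\<bar>s\<bar> powr p - \<bar>t\<bar> powr p - p * spow (p - 2) t * (s - t)\<bar> = p * \<bar>s - t\<bar> * \<bar>spow (p - 2) \<xi> - spow (p - 2) t\<bar>"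
    using p by (simp add: abs_mult)
  also have "\<dots> \<le> p * \<bar>s - t\<bar> * ((p - 2 + 1) * max \<bar>\<xi>\<bar> \<bar>t\<bar> powr (p - 2) * \<bar>\<xi> - t\<bar>)"
    using p by (intro mult_left_mono spow_diff_le) auto
  also have "\<dots> \<le> p * \<bar>s - t\<bar> * ((p - 2 + 1) * max \<bar>s\<bar> \<bar>t\<bar> powr (p - 2) * \<bar>s - t\<bar>)"
  proof -
    have "max \<bar>\<xi>\<bar> \<bar>t\<bar> powr (p - 2) \<le> max \<bar>s\<bar> \<bar>t\<bar> powr (p - 2)" using p \<xi>(2) by (intro powr_mono2) auto
    hence "(p - 2 + 1) * max \<bar>\<xi>\<bar> \<bar>t\<bar> powr (p - 2) \<le> (p - 2 + 1) * max \<bar>s\<bar> \<bar>t\<bar> powr (p - 2)"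
      using p by (intro mult_left_mono) auto
    hence "(p - 2 + 1) * max \<bar>\<xi>\<bar> \<bar>t\<bar> powr (p - 2) * \<bar>\<xi> - t\<bar> \<le> (p - 2 + 1) * max \<bar>s\<bar> \<bar>t\<bar> powr (p - 2) * \<bar>s - t\<bar>"
      using p by (intro mult_mono \<xi>(1)) auto
    thus ?thesis using p by (intro mult_left_mono) auto
  qed
  also have "\<dots> = p * (p - 1) * max \<bar>s\<bar> \<bar>t\<bar> powr (p - 2) * (s - t)\<^sup>2"
  proof -
    have e: "p - 2 + 1 = p - 1" by simp
    show ?thesis unfolding e power2_eq_square abs_mult_self_eq[of "s - t", symmetric] by (simp only: mult_ac)
  qed
  finally show ?thesis .
qed simp

section \<open>Functionals with locally Lipschitz derivative\<close>

context sobolev_domain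
begin

text \<open>Stronger than class C1: on each ball the derivative is Lipschitz and the remainder
  quadratic. Such bounds add up and scale with explicit constants, so the functional can be
  assembled term by term. Vanishing of the derivative at 0 makes it bounded at every u.\<close>

definition lip_C1 :: "(('a \<Rightarrow> real) \<Rightarrow> real) \<Rightarrow> (('a \<Rightarrow> real) \<Rightarrow> ('a \<Rightarrow> real) \<Rightarrow> real) \<Rightarrow> bool" where
  "lip_C1 J J' \<longleftrightarrow>
     (\<forall>u\<in>H10 \<Omega>. \<forall>v\<in>H10 \<Omega>. \<forall>w\<in>H10 \<Omega>. J' u (\<lambda>x. v x + w x) = J' u v + J' u w) \<and>
     (\<forall>u\<in>H10 \<Omega>. \<forall>v\<in>H10 \<Omega>. \<forall>c. J' u (\<lambda>x. c * v x) = c * J' u v) \<and>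
     (\<forall>v\<in>H10 \<Omega>. J' (\<lambda>x. 0) v = 0) \<and>
     (\<forall>R. \<exists>K\<ge>0. \<forall>u\<in>H10 \<Omega>. \<forall>v\<in>H10 \<Omega>. nrm u \<le> R \<longrightarrow> nrm v \<le> R \<longrightarrow>
        \<bar>J v - J u - J' u (\<lambda>x. v x - u x)\<bar> \<le> K * (nrm (\<lambda>x. v x - u x))\<^sup>2 \<and>
        (\<forall>h\<in>H10 \<Omega>. \<bar>J' v h - J' u h\<bar> \<le> K * nrm (\<lambda>x. v x - u x) * nrm h))"

lemma lip_C1D:
  assumes "lip_C1 J J'"
  shows "u \<in> H10 \<Omega> \<Longrightarrow> v \<in> H10 \<Omega> \<Longrightarrow> w \<in> H10 \<Omega> \<Longrightarrow> J' u (\<lambda>x. v x + w x) = J' u v + J' u w"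
    and "u \<in> H10 \<Omega> \<Longrightarrow> v \<in> H10 \<Omega> \<Longrightarrow> J' u (\<lambda>x. c * v x) = c * J' u v"
    and "v \<in> H10 \<Omega> \<Longrightarrow> J' (\<lambda>x. 0) v = 0"
    and "\<exists>K\<ge>0. \<forall>u\<in>H10 \<Omega>. \<forall>v\<in>H10 \<Omega>. nrm u \<le> R \<longrightarrow> nrm v \<le> R \<longrightarrow>
        \<bar>J v - J u - J' u (\<lambda>x. v x - u x)\<bar> \<le> K * (nrm (\<lambda>x. v x - u x))\<^sup>2 \<and>
        (\<forall>h\<in>H10 \<Omega>. \<bar>J' v h - J' u h\<bar> \<le> K * nrm (\<lambda>x. v x - u x) * nrm h)"
  using assms unfolding lip_C1_def by simp_all

lemma lip_C1_add:
  assumes "lip_C1 I I'" "lip_C1 J J'"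
  shows "lip_C1 (\<lambda>u. I u + J u) (\<lambda>u h. I' u h + J' u h)"
proof -
  have "\<exists>K\<ge>0. \<forall>u\<in>H10 \<Omega>. \<forall>v\<in>H10 \<Omega>. nrm u \<le> R \<longrightarrow> nrm v \<le> R \<longrightarrow>
        \<bar>(I v + J v) - (I u + J u) - (I' u (\<lambda>x. v x - u x) + J' u (\<lambda>x. v x - u x))\<bar> \<le> K * (nrm (\<lambda>x. v x - u x))\<^sup>2 \<and>
        (\<forall>h\<in>H10 \<Omega>. \<bar>(I' v h + J' v h) - (I' u h + J' u h)\<bar> \<le> K * nrm (\<lambda>x. v x - u x) * nrm h)" for R
  proof -
    obtain K where K: "K \<ge> 0" "\<And>u v. u \<in> H10 \<Omega> \<Longrightarrow> v \<in> H10 \<Omega> \<Longrightarrow> nrm u \<le> R \<Longrightarrow> nrm v \<le> R \<Longrightarrow>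
        \<bar>I v - I u - I' u (\<lambda>x. v x - u x)\<bar> \<le> K * (nrm (\<lambda>x. v x - u x))\<^sup>2 \<and>
        (\<forall>h\<in>H10 \<Omega>. \<bar>I' v h - I' u h\<bar> \<le> K * nrm (\<lambda>x. v x - u x) * nrm h)"
      using lip_C1D(4)[OF assms(1), of R] by blast
    obtain L where L: "L \<ge> 0" "\<And>u v. u \<in> H10 \<Omega> \<Longrightarrow> v \<in> H10 \<Omega> \<Longrightarrow> nrm u \<le> R \<Longrightarrow> nrm v \<le> R \<Longrightarrow>
        \<bar>J v - J u - J' u (\<lambda>x. v x - u x)\<bar> \<le> L * (nrm (\<lambda>x. v x - u x))\<^sup>2 \<and>
        (\<forall>h\<in>H10 \<Omega>. \<bar>J' v h - J' u h\<bar> \<le> L * nrm (\<lambda>x. v x - u x) * nrm h)"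
      using lip_C1D(4)[OF assms(2), of R] by blast
    show ?thesis
    proof (intro exI[of _ "K + L"] conjI ballI impI)
      fix u v assume uv: "u \<in> H10 \<Omega>" "v \<in> H10 \<Omega>" "nrm u \<le> R" "nrm v \<le> R"
      show "\<bar>(I v + J v) - (I u + J u) - (I' u (\<lambda>x. v x - u x) + J' u (\<lambda>x. v x - u x))\<bar> \<le> (K + L) * (nrm (\<lambda>x. v x - u x))\<^sup>2"
        using K(2)[OF uv] L(2)[OF uv] unfolding distrib_right by linarith
      fix h assume "h \<in> H10 \<Omega>"
      thus "\<bar>(I' v h + J' v h) - (I' u h + J' u h)\<bar> \<le> (K + L) * nrm (\<lambda>x. v x - u x) * nrm h"
        using conjunct2[OF K(2)[OF uv], rule_format, of h] conjunct2[OF L(2)[OF uv], rule_format, of h] unfolding distrib_right by linarith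
    qed (use K(1) L(1) in simp)
  qed
  thus ?thesis using lip_C1D(1-3)[OF assms(1)] lip_C1D(1-3)[OF assms(2)] unfolding lip_C1_def by (simp add: algebra_simps)
qed

lemma lip_C1_cmult:
  assumes "lip_C1 I I'"
  shows "lip_C1 (\<lambda>u. c * I u) (\<lambda>u h. c * I' u h)"
proof -
  have "\<exists>K\<ge>0. \<forall>u\<in>H10 \<Omega>. \<forall>v\<in>H10 \<Omega>. nrm u \<le> R \<longrightarrow> nrm v \<le> R \<longrightarrow>
        \<bar>c * I v - c * I u - c * I' u (\<lambda>x. v x - u x)\<bar> \<le> K * (nrm (\<lambda>x. v x - u x))\<^sup>2 \<and>
        (\<forall>h\<in>H10 \<Omega>. \<bar>c * I' v h - c * I' u h\<bar> \<le> K * nrm (\<lambda>x. v x - u x) * nrm h)" for R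
  proof -
    obtain K where K: "K \<ge> 0" "\<And>u v. u \<in> H10 \<Omega> \<Longrightarrow> v \<in> H10 \<Omega> \<Longrightarrow> nrm u \<le> R \<Longrightarrow> nrm v \<le> R \<Longrightarrow>
        \<bar>I v - I u - I' u (\<lambda>x. v x - u x)\<bar> \<le> K * (nrm (\<lambda>x. v x - u x))\<^sup>2 \<and>
        (\<forall>h\<in>H10 \<Omega>. \<bar>I' v h - I' u h\<bar> \<le> K * nrm (\<lambda>x. v x - u x) * nrm h)"
      using lip_C1D(4)[OF assms(1), of R] by blast
    have m: "\<bar>c * z\<bar> \<le> \<bar>c\<bar> * y" if "\<bar>z\<bar> \<le> y" for z y
      using that by (simp add: abs_mult mult_left_mono)
    show ?thesis
    proof (intro exI[of _ "\<bar>c\<bar> * K"] conjI ballI impI)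
      fix u v assume uv: "u \<in> H10 \<Omega>" "v \<in> H10 \<Omega>" "nrm u \<le> R" "nrm v \<le> R"
      have "c * I v - c * I u - c * I' u (\<lambda>x. v x - u x) = c * (I v - I u - I' u (\<lambda>x. v x - u x))" by (simp add: algebra_simps)
      thus "\<bar>c * I v - c * I u - c * I' u (\<lambda>x. v x - u x)\<bar> \<le> \<bar>c\<bar> * K * (nrm (\<lambda>x. v x - u x))\<^sup>2"
        using m[OF conjunct1[OF K(2)[OF uv]]] by (simp add: mult.assoc)
      fix h assume h: "h \<in> H10 \<Omega>"
      have "c * I' v h - c * I' u h = c * (I' v h - I' u h)" by (simp add: algebra_simps)
      thus "\<bar>c * I' v h - c * I' u h\<bar> \<le> \<bar>c\<bar> * K * nrm (\<lambda>x. v x - u x) * nrm h"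
        using m[OF conjunct2[OF K(2)[OF uv], rule_format, OF h]] by (simp add: mult.assoc)
    qed (use K(1) in simp)
  qed
  thus ?thesis using lip_C1D(1-3)[OF assms(1)] unfolding lip_C1_def by (simp add: algebra_simps)
qed

section \<open>Dual norms and the passage to class C1\<close>

lemma nrm_zero: "nrm (\<lambda>x. 0) = 0"
  using nrm_scale[OF H10_H1[OF H10_zero], of 0] by simp

text \<open>The Lipschitz bound between u and the origin, where the derivative is zero, is a bound
  for the derivative at u.\<close>

lemma lip_C1_dual:
  assumes J: "lip_C1 J J'" and u: "u \<in> H10 \<Omega>"
  shows "J' u \<in> H10_dual \<Omega>"
proof -
  obtain K where K: "K \<ge> 0" "\<And>v w. v \<in> H10 \<Omega> \<Longrightarrow> w \<in> H10 \<Omega> \<Longrightarrow> nrm v \<le> nrm u \<Longrightarrow> nrm w \<le> nrm u \<Longrightarrow>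
      (\<forall>h\<in>H10 \<Omega>. \<bar>J' w h - J' v h\<bar> \<le> K * nrm (\<lambda>x. w x - v x) * nrm h)"
    using lip_C1D(4)[OF J, of "nrm u"] by blast
  have "\<bar>J' u h\<bar> \<le> (K * nrm u) * nrm h" if h: "h \<in> H10 \<Omega>" for h
    using K(2)[OF H10_zero u, rule_format, OF _ _ h] lip_C1D(3)[OF J h] by (simp add: nrm_zero nrm_nonneg)
  thus ?thesis unfolding H10_dual_def using lip_C1D(1,2)[OF J u] by auto
qed

lemma dual_norm_le:
  assumes "\<And>h. h \<in> H10 \<Omega> \<Longrightarrow> \<bar>L h\<bar> \<le> B * nrm h" "B \<ge> 0"
  shows "dual_norm \<Omega> L \<le> B"
  unfolding dual_norm_def
proof (rule cSUP_least)
  have "(\<lambda>x. 0) \<in> {v \<in> H10 \<Omega>. nrm v \<le> 1}" using H10_zero by (simp add: nrm_zero)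
  thus "{v \<in> H10 \<Omega>. nrm v \<le> 1} \<noteq> {}" by blast
  fix v assume v: "v \<in> {v \<in> H10 \<Omega>. nrm v \<le> 1}"
  hence "\<bar>L v\<bar> \<le> B * nrm v" using assms(1) by simp
  also have "\<dots> \<le> B * 1" using v assms(2) by (intro mult_left_mono) auto
  finally show "\<bar>L v\<bar> \<le> B" by simp
qed

text \<open>Membership in the dual supplies the boundedness without which a real \<open>SUP\<close>
  carries no information; it also settles the case of norm 0.\<close>

lemma dual_norm_bound:
  assumes L: "L \<in> H10_dual \<Omega>" and v: "v \<in> H10 \<Omega>"
  shows "\<bar>L v\<bar> \<le> dual_norm \<Omega> L * nrm v"
proof -
  obtain C where C: "\<And>u. u \<in> H10 \<Omega> \<Longrightarrow> \<bar>L u\<bar> \<le> C * nrm u" using L unfolding H10_dual_def by blast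
  show ?thesis
  proof (cases "nrm v = 0")
    case True
    thus ?thesis using C[OF v] by simp
  next
    case False
    hence pos: "nrm v > 0" using nrm_nonneg[of v] by linarith
    define w where "w = (\<lambda>x. (1 / nrm v) * v x)"
    have w: "w \<in> H10 \<Omega>" "nrm w = 1" unfolding w_def using H10_scale[OF v, of "1 / nrm v"] nrm_scale[OF H10_H1[OF v], of "1 / nrm v"] pos by auto
    have "\<bar>L w\<bar> \<le> dual_norm \<Omega> L"
      unfolding dual_norm_def
    proof (rule cSUP_upper)
      show "bdd_above ((\<lambda>v. \<bar>L v\<bar>) ` {v \<in> H10 \<Omega>. nrm v \<le> 1})"
      proof (rule bdd_aboveI2)
        fix x assume x: "x \<in> {v \<in> H10 \<Omega>. nrm v \<le> 1}"
        have "\<bar>L x\<bar> \<le> C * nrm x" using C x by simp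
        also have "\<dots> \<le> \<bar>C\<bar> * 1" using x nrm_nonneg[of x] by (intro mult_mono) auto
        finally show "\<bar>L x\<bar> \<le> \<bar>C\<bar>" by simp
      qed
    qed (use w in simp)
    moreover have "L w = (1 / nrm v) * L v" unfolding w_def using L v unfolding H10_dual_def by blast
    ultimately have "(1 / nrm v) * \<bar>L v\<bar> \<le> dual_norm \<Omega> L" using pos by (simp add: abs_mult)
    thus ?thesis using pos by (simp add: field_simps)
  qed
qed

lemma lip_C1_imp_C1:
  assumes J: "lip_C1 J J'"
  shows "C1_with_derivative \<Omega> J J'"
  unfolding C1_with_derivative_def has_H10_derivative_def
proof (intro conjI ballI allI impI lip_C1_dual[OF J])
  fix u e assume u: "u \<in> H10 \<Omega>" and e: "(e::real) > 0"
  obtain K where K: "K \<ge> 0" "\<And>u' v. u' \<in> H10 \<Omega> \<Longrightarrow> v \<in> H10 \<Omega> \<Longrightarrow> nrm u' \<le> nrm u + 1 \<Longrightarrow> nrm v \<le> nrm u + 1 \<Longrightarrow>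
        \<bar>J v - J u' - J' u' (\<lambda>x. v x - u' x)\<bar> \<le> K * (nrm (\<lambda>x. v x - u' x))\<^sup>2 \<and>
        (\<forall>h\<in>H10 \<Omega>. \<bar>J' v h - J' u' h\<bar> \<le> K * nrm (\<lambda>x. v x - u' x) * nrm h)"
    using lip_C1D(4)[OF J, of "nrm u + 1"] by blast
  \<comment> \<open>The cap 1 keeps all points in the ball of radius nrm u + 1, on which K is
    valid.\<close>
  define \<delta> where "\<delta> = min 1 (e / (K + 1))"
  have \<delta>: "\<delta> > 0" "\<delta> \<le> 1" using e K(1) by (auto simp: \<delta>_def add_nonneg_pos)
  have K\<delta>: "K * y < e" if "y < \<delta>" "y \<ge> 0" for y
  proof -
    have "K * y \<le> (K + 1) * y" using that by (intro mult_right_mono) auto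
    also have "\<dots> < (K + 1) * (e / (K + 1))" using that K(1) by (intro mult_strict_left_mono) (auto simp: \<delta>_def)
    also have "\<dots> = e" using K(1) by simp
    finally show ?thesis .
  qed
  show "\<exists>\<delta>>0. \<forall>h\<in>H10 \<Omega>. nrm h < \<delta> \<longrightarrow> \<bar>J (\<lambda>x. u x + h x) - J u - J' u h\<bar> \<le> e * nrm h"
  proof (intro exI[of _ \<delta>] conjI ballI impI \<delta>(1))
    fix h assume h: "h \<in> H10 \<Omega>" "nrm h < \<delta>"
    have v: "(\<lambda>x. u x + h x) \<in> H10 \<Omega>" by (rule H10_add[OF u h(1)])
    have nv: "nrm (\<lambda>x. u x + h x) \<le> nrm u + 1" using nrm_triangle[OF H10_H1[OF u] H10_H1[OF h(1)]] h(2) \<delta>(2) by linarith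
    have "\<bar>J (\<lambda>x. u x + h x) - J u - J' u h\<bar> \<le> K * (nrm h)\<^sup>2"
      using K(2)[OF u v _ nv] by simp
    also have "\<dots> = (K * nrm h) * nrm h" by (simp add: power2_eq_square)
    also have "\<dots> \<le> e * nrm h" using K\<delta>[OF h(2) nrm_nonneg] by (intro mult_right_mono) (auto simp: nrm_nonneg)
    finally show "\<bar>J (\<lambda>x. u x + h x) - J u - J' u h\<bar> \<le> e * nrm h" .
  qed
  show "\<exists>\<delta>>0. \<forall>v\<in>H10 \<Omega>. nrm (\<lambda>x. v x - u x) < \<delta> \<longrightarrow> dual_norm \<Omega> (\<lambda>h. J' v h - J' u h) < e"
  proof (intro exI[of _ \<delta>] conjI ballI impI \<delta>(1))
    fix v assume v: "v \<in> H10 \<Omega>" "nrm (\<lambda>x. v x - u x) < \<delta>"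
    have nv: "nrm v \<le> nrm u + 1" using nrm_triangle_diff(1)[OF H10_H1[OF v(1)] H10_H1[OF u]] v(2) \<delta>(2) by linarith
    have "dual_norm \<Omega> (\<lambda>h. J' v h - J' u h) \<le> K * nrm (\<lambda>x. v x - u x)"
      using K(2)[OF u v(1) _ nv] K(1) nrm_nonneg by (intro dual_norm_le) auto
    also have "\<dots> < e" by (rule K\<delta>[OF v(2) nrm_nonneg])
    finally show "dual_norm \<Omega> (\<lambda>h. J' v h - J' u h) < e" .
  qed
qed

section \<open>Differentiability of the four terms of the functional\<close>

lemma gip_add_right: "u \<in> H10 \<Omega> \<Longrightarrow> v \<in> H10 \<Omega> \<Longrightarrow> w \<in> H10 \<Omega> \<Longrightarrow> gip u (\<lambda>x. v x + w x) = gip u v + gip u w"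
  using gip_add[of v w u] H10_H1 by (simp add: gip_commute[of u])

lemma gip_scale_right: "u \<in> H10 \<Omega> \<Longrightarrow> v \<in> H10 \<Omega> \<Longrightarrow> gip u (\<lambda>x. c * v x) = c * gip u v"
  using gip_scale[of v u c] H10_H1 by (simp add: gip_commute[of u])

lemma gip_zero: "v \<in> H10 \<Omega> \<Longrightarrow> gip (\<lambda>x. 0) v = 0"
  using gip_scale[OF H10_H1[OF H10_zero] H10_H1, of v 0] by simp

lemma lip_add_right: "u \<in> H10 \<Omega> \<Longrightarrow> v \<in> H10 \<Omega> \<Longrightarrow> w \<in> H10 \<Omega> \<Longrightarrow> lip u (\<lambda>x. v x + w x) = lip u v + lip u w"
  using lip_add[of v w u] H10_sq_int by (simp add: lip_commute[of u])

lemma lip_scale_right: "lip u (\<lambda>x. c * v x) = c * lip u v"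
  using lip_scale[of c v u] by (simp add: lip_commute[of u])

lemma gip_diff_self:
  assumes "u \<in> H1 \<Omega>" "v \<in> H1 \<Omega>"
  shows "gip u (\<lambda>x. v x - u x) = gip u v - (nrm u)\<^sup>2"
  unfolding nrm_sq gip_commute[of u "\<lambda>x. v x - u x"] gip_commute[of u v] by (rule gip_diff[OF assms(2,1,1)])

lemma lip_diff_self:
  assumes "sq_int N u" "sq_int N v"
  shows "lip u (\<lambda>x. v x - u x) = lip u v - (l2 u)\<^sup>2"
  unfolding l2_sq lip_commute[of u "\<lambda>x. v x - u x"] lip_commute[of u v] by (rule lip_diff[OF assms(2,1,1)])

text \<open>The functional is quadratic, so the remainder is exactly the squared norm of v -
  u.\<close>

lemma lip_C1_energy: "lip_C1 (\<lambda>u. (nrm u)\<^sup>2) (\<lambda>u h. 2 * gip u h)"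
  unfolding lip_C1_def
proof (intro conjI ballI allI)
  fix R
  show "\<exists>K\<ge>0. \<forall>u\<in>H10 \<Omega>. \<forall>v\<in>H10 \<Omega>. nrm u \<le> R \<longrightarrow> nrm v \<le> R \<longrightarrow>
        \<bar>(nrm v)\<^sup>2 - (nrm u)\<^sup>2 - 2 * gip u (\<lambda>x. v x - u x)\<bar> \<le> K * (nrm (\<lambda>x. v x - u x))\<^sup>2 \<and>
        (\<forall>h\<in>H10 \<Omega>. \<bar>2 * gip v h - 2 * gip u h\<bar> \<le> K * nrm (\<lambda>x. v x - u x) * nrm h)"
  proof (intro exI[of _ 2] conjI ballI impI)
    fix u v assume uv: "u \<in> H10 \<Omega>" "v \<in> H10 \<Omega>"
    note h1 = H10_H1[OF uv(1)] H10_H1[OF uv(2)]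
    have "gip u (\<lambda>x. v x - u x) = gip u v - (nrm u)\<^sup>2"
      by (rule gip_diff_self[OF h1])
    hence "(nrm v)\<^sup>2 - (nrm u)\<^sup>2 - 2 * gip u (\<lambda>x. v x - u x) = (nrm (\<lambda>x. v x - u x))\<^sup>2"
      using nrm_diff_sq[OF h1(2,1)] by (simp add: gip_commute[of v u])
    thus "\<bar>(nrm v)\<^sup>2 - (nrm u)\<^sup>2 - 2 * gip u (\<lambda>x. v x - u x)\<bar> \<le> 2 * (nrm (\<lambda>x. v x - u x))\<^sup>2" by simp
    fix h assume h: "h \<in> H10 \<Omega>"
    have "\<bar>gip (\<lambda>x. v x - u x) h\<bar> \<le> nrm (\<lambda>x. v x - u x) * nrm h" by (rule gip_CS[OF H1_diff[OF h1(2,1)] H10_H1[OF h]])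
    thus "\<bar>2 * gip v h - 2 * gip u h\<bar> \<le> 2 * nrm (\<lambda>x. v x - u x) * nrm h"
      using gip_diff[OF h1(2,1) H10_H1[OF h]] by simp
  qed simp
qed (simp_all add: gip_add_right gip_scale_right gip_zero)

text \<open>The remainder is the squared L2 norm of v - u, which the Poincare inequality converts to
  \<open>nrm\<close>.\<close>

lemma lip_C1_mass: "lip_C1 (\<lambda>u. (l2 u)\<^sup>2) (\<lambda>u h. 2 * lip u h)"
  unfolding lip_C1_def
proof (intro conjI ballI allI)
  fix R
  show "\<exists>K\<ge>0. \<forall>u\<in>H10 \<Omega>. \<forall>v\<in>H10 \<Omega>. nrm u \<le> R \<longrightarrow> nrm v \<le> R \<longrightarrow>
        \<bar>(l2 v)\<^sup>2 - (l2 u)\<^sup>2 - 2 * lip u (\<lambda>x. v x - u x)\<bar> \<le> K * (nrm (\<lambda>x. v x - u x))\<^sup>2 \<and>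
        (\<forall>h\<in>H10 \<Omega>. \<bar>2 * lip v h - 2 * lip u h\<bar> \<le> K * nrm (\<lambda>x. v x - u x) * nrm h)"
  proof (intro exI[of _ "2 * poin_const\<^sup>2"] conjI ballI impI)
    fix u v assume uv: "u \<in> H10 \<Omega>" "v \<in> H10 \<Omega>"
    note s = H10_sq_int[OF uv(1)] H10_sq_int[OF uv(2)]
    have P: "l2 (\<lambda>x. v x - u x) \<le> poin_const * nrm (\<lambda>x. v x - u x)" by (rule poincare_H10_le[OF H10_diff[OF uv(2,1)]])
    have "lip u (\<lambda>x. v x - u x) = lip u v - (l2 u)\<^sup>2"
      by (rule lip_diff_self[OF s])
    hence E: "(l2 v)\<^sup>2 - (l2 u)\<^sup>2 - 2 * lip u (\<lambda>x. v x - u x) = (l2 (\<lambda>x. v x - u x))\<^sup>2"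
      using l2_diff_sq[OF s(2,1)] by (simp add: lip_commute[of v u])
    have "(l2 (\<lambda>x. v x - u x))\<^sup>2 \<le> (poin_const * nrm (\<lambda>x. v x - u x))\<^sup>2" by (rule power_mono[OF P l2_norm_nonneg])
    hence "(l2 (\<lambda>x. v x - u x))\<^sup>2 \<le> poin_const\<^sup>2 * (nrm (\<lambda>x. v x - u x))\<^sup>2" by (simp only: power_mult_distrib)
    moreover have "0 \<le> poin_const\<^sup>2 * (nrm (\<lambda>x. v x - u x))\<^sup>2" by simp
    ultimately show "\<bar>(l2 v)\<^sup>2 - (l2 u)\<^sup>2 - 2 * lip u (\<lambda>x. v x - u x)\<bar> \<le> 2 * poin_const\<^sup>2 * (nrm (\<lambda>x. v x - u x))\<^sup>2"
      unfolding E abs_power2 by linarith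
    fix h assume h: "h \<in> H10 \<Omega>"
    have "\<bar>lip (\<lambda>x. v x - u x) h\<bar> \<le> l2 (\<lambda>x. v x - u x) * l2 h" by (rule lip_CS[OF sq_int_diff[OF s(2,1)] H10_sq_int[OF h]])
    also have "\<dots> \<le> (poin_const * nrm (\<lambda>x. v x - u x)) * (poin_const * nrm h)"
      using poin_const_pos nrm_nonneg by (intro mult_mono P poincare_H10_le[OF h]) (auto simp: l2_norm_nonneg)
    finally show "\<bar>2 * lip v h - 2 * lip u h\<bar> \<le> 2 * poin_const\<^sup>2 * nrm (\<lambda>x. v x - u x) * nrm h"
      using lip_diff[OF s(2,1) H10_sq_int[OF h]] by (simp add: power2_eq_square mult_ac)
  qed simp
qed (simp_all add: lip_add_right lip_scale_right, simp add: lip_def)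

text \<open>The radial part of the remainder is the scalar Taylor formula for the numbers n and m,
  the norms of u and v. What remains is the Cauchy-Schwarz defect n m - \<open>gip u v\<close>, of
  second order in v - u. The constant p^2 collects p (p-1) from the first part and p from the
  second.\<close>

lemma lip_C1_energy_powr: "lip_C1 (\<lambda>u. nrm u powr p) (\<lambda>u h. p * nrm u powr (p - 2) * gip u h)"
  unfolding lip_C1_def
proof (intro conjI ballI allI)
  fix R
  show "\<exists>K\<ge>0. \<forall>u\<in>H10 \<Omega>. \<forall>v\<in>H10 \<Omega>. nrm u \<le> R \<longrightarrow> nrm v \<le> R \<longrightarrow>
        \<bar>nrm v powr p - nrm u powr p - p * nrm u powr (p - 2) * gip u (\<lambda>x. v x - u x)\<bar> \<le> K * (nrm (\<lambda>x. v x - u x))\<^sup>2 \<and>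
        (\<forall>h\<in>H10 \<Omega>. \<bar>p * nrm v powr (p - 2) * gip v h - p * nrm u powr (p - 2) * gip u h\<bar> \<le> K * nrm (\<lambda>x. v x - u x) * nrm h)"
  proof (intro exI[of _ "p * p * R powr (p - 2)"] conjI ballI impI)
    fix u v assume uv: "u \<in> H10 \<Omega>" "v \<in> H10 \<Omega>" "nrm u \<le> R" "nrm v \<le> R"
    note h1 = H10_H1[OF uv(1)] H10_H1[OF uv(2)]
    define n m d q where "n = nrm u" and "m = nrm v" and "d = nrm (\<lambda>x. v x - u x)" and "q = p - 2"
    have nn: "n \<ge> 0" "m \<ge> 0" "d \<ge> 0" by (auto simp: n_def m_def d_def nrm_nonneg)
    have q: "q > 0" using p_gt_2 by (simp add: q_def)
    have le: "n \<le> R" "m \<le> R" using uv by (auto simp: n_def m_def)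
    have Rn: "n powr q \<le> R powr q" "m powr q \<le> R powr q" using le nn q by (auto intro: powr_mono2)
    have mn: "\<bar>m - n\<bar> \<le> d" unfolding m_def n_def d_def by (rule nrm_reverse_triangle[OF h1(2,1)])
    have d2: "d\<^sup>2 = m\<^sup>2 - 2 * gip u v + n\<^sup>2"
      unfolding d_def m_def n_def using nrm_diff_sq[OF h1(2,1)] by (simp add: gip_commute[of v u])
    have g: "gip u (\<lambda>x. v x - u x) = gip u v - n\<^sup>2"
      unfolding n_def by (rule gip_diff_self[OF h1])
    have CS: "\<bar>gip u v\<bar> \<le> n * m" unfolding n_def m_def by (rule gip_CS[OF h1])
    have "n powr q * n\<^sup>2 = n powr q * n * n" by (simp add: power2_eq_square)
    hence split: "m powr p - n powr p - p * n powr q * (gip u v - n\<^sup>2)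
        = (m powr p - n powr p - p * (n powr q * n) * (m - n)) + p * n powr q * (n * m - gip u v)"
      by (simp add: algebra_simps)
    have "\<bar>m powr p - n powr p - p * (n powr q * n) * (m - n)\<bar> \<le> p * (p - 1) * max m n powr q * (m - n)\<^sup>2"
      using abs_powr_taylor[OF p_gt_2, of m n] nn by (simp add: spow_def q_def)
    also have "\<dots> \<le> p * (p - 1) * R powr q * d\<^sup>2"
    proof (intro mult_mono)
      show "max m n powr q \<le> R powr q" using Rn by (simp add: max_def)
      show "(m - n)\<^sup>2 \<le> d\<^sup>2" using power_mono[OF mn abs_ge_zero, of 2] by simp
    qed (use p_gt_2 in auto)
    finally have A: "\<bar>m powr p - n powr p - p * (n powr q * n) * (m - n)\<bar> \<le> p * (p - 1) * R powr q * d\<^sup>2" .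
    have B: "\<bar>p * n powr q * (n * m - gip u v)\<bar> \<le> p * R powr q * d\<^sup>2"
    proof -
      have "0 \<le> n * m - gip u v" using CS by linarith
      \<comment> \<open>From 2 n m <= n^2 + m^2, even twice the defect is at most d^2.\<close>
      moreover have "n * m - gip u v \<le> d\<^sup>2" using d2 sum_squares_bound[of n m] \<open>0 \<le> n * m - gip u v\<close> by simp
      ultimately have "\<bar>n * m - gip u v\<bar> \<le> d\<^sup>2" by simp
      hence "p * n powr q * \<bar>n * m - gip u v\<bar> \<le> p * R powr q * d\<^sup>2"
        using Rn p_gt_2 by (intro mult_mono) auto
      thus ?thesis using p_gt_2 by (simp add: abs_mult)
    qed
    have "p * (p - 1) * R powr q * d\<^sup>2 + p * R powr q * d\<^sup>2 = p * p * R powr q * d\<^sup>2" by (simp add: algebra_simps)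
    hence "\<bar>m powr p - n powr p - p * n powr q * (gip u v - n\<^sup>2)\<bar> \<le> p * p * R powr q * d\<^sup>2"
      unfolding split using A B by linarith
    thus "\<bar>nrm v powr p - nrm u powr p - p * nrm u powr (p - 2) * gip u (\<lambda>x. v x - u x)\<bar> \<le> p * p * R powr (p - 2) * (nrm (\<lambda>x. v x - u x))\<^sup>2"
      unfolding g by (simp add: n_def m_def d_def q_def)
    fix h assume h: "h \<in> H10 \<Omega>"
    note hh = H10_H1[OF h]
    have gd: "gip (\<lambda>x. v x - u x) h = gip v h - gip u h" by (rule gip_diff[OF h1(2,1) hh])
    have c1: "\<bar>gip v h - gip u h\<bar> \<le> d * nrm h" unfolding gd[symmetric] d_def by (rule gip_CS[OF H1_diff[OF h1(2,1)] hh])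
    have c2: "\<bar>gip u h\<bar> \<le> n * nrm h" "\<bar>gip v h\<bar> \<le> m * nrm h" unfolding n_def m_def by (rule gip_CS[OF h1(1) hh] gip_CS[OF h1(2) hh])+
    \<comment> \<open>The order t <= s puts the smaller norm beside the difference of powers, so
      that \<open>powr_diff_mult_le\<close> applies; the other order follows by exchanging u and
      v.\<close>
    have key: "\<bar>s powr q * x - t powr q * y\<bar> \<le> (q + 1) * R powr q * d * nrm h"
      if st: "0 \<le> t" "t \<le> s" "s \<le> R" "s - t \<le> d" and xy: "\<bar>x - y\<bar> \<le> d * nrm h" "\<bar>y\<bar> \<le> t * nrm h" for s t x y
    proof -
      have sR: "s powr q \<le> R powr q" using st q by (intro powr_mono2) auto
      have "s powr q * x - t powr q * y = s powr q * (x - y) + (s powr q - t powr q) * y" by (simp add: algebra_simps)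
      also have "\<bar>\<dots>\<bar> \<le> \<bar>s powr q * (x - y)\<bar> + \<bar>(s powr q - t powr q) * y\<bar>" by (rule abs_triangle_ineq)
      also have "\<bar>s powr q * (x - y)\<bar> \<le> R powr q * (d * nrm h)"
        unfolding abs_mult using sR xy by (intro mult_mono) auto
      also have "\<bar>(s powr q - t powr q) * y\<bar> \<le> (s powr q - t powr q) * (t * nrm h)"
        unfolding abs_mult using st q xy by (intro mult_mono) (auto intro: powr_mono2)
      also have "\<dots> = ((s powr q - t powr q) * t) * nrm h" by simp
      also have "\<dots> \<le> (q * s powr q * (s - t)) * nrm h"
        using st q nrm_nonneg[of h] by (intro mult_right_mono powr_diff_mult_le) auto
      also have "\<dots> \<le> (q * R powr q * d) * nrm h"
        using st q sR nrm_nonneg[of h] by (intro mult_right_mono mult_mono) auto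
      finally show ?thesis by (simp add: algebra_simps)
    qed
    have "\<bar>m powr q * gip v h - n powr q * gip u h\<bar> \<le> (q + 1) * R powr q * d * nrm h"
    proof (cases "n \<le> m")
      case True
      show ?thesis by (rule key) (use True nn le mn c1 c2 in auto)
    next
      case False
      have "\<bar>n powr q * gip u h - m powr q * gip v h\<bar> \<le> (q + 1) * R powr q * d * nrm h"
        by (rule key) (use False nn le mn c1 c2 in auto)
      thus ?thesis by (simp add: abs_minus_commute)
    qed
    also have "\<dots> \<le> p * R powr q * d * nrm h"
      using nn nrm_nonneg[of h] by (intro mult_right_mono) (auto simp: q_def)
    finally have "p * \<bar>m powr q * gip v h - n powr q * gip u h\<bar> \<le> p * (p * R powr q * d * nrm h)"
      using p_gt_2 by (intro mult_left_mono) auto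
    moreover have "\<bar>p * m powr q * gip v h - p * n powr q * gip u h\<bar> = p * \<bar>m powr q * gip v h - n powr q * gip u h\<bar>"
    proof -
      have "p * m powr q * gip v h - p * n powr q * gip u h = p * (m powr q * gip v h - n powr q * gip u h)" by (simp add: algebra_simps)
      thus ?thesis using p_gt_2 by (simp add: abs_mult)
    qed
    ultimately show "\<bar>p * nrm v powr (p - 2) * gip v h - p * nrm u powr (p - 2) * gip u h\<bar> \<le> p * p * R powr (p - 2) * nrm (\<lambda>x. v x - u x) * nrm h"
      by (simp add: m_def n_def d_def q_def mult_ac)
  qed (use p_gt_2 in simp)
qed (simp_all add: gip_add_right gip_scale_right gip_zero distrib_left distrib_right mult_ac)

definition pform :: "('a \<Rightarrow> real) \<Rightarrow> ('a \<Rightarrow> real) \<Rightarrow> real" where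
  "pform u h = (LINT x|N. spow (p - 2) (u x) * h x)"

lemma spow_borel [measurable]: "spow q \<in> borel_measurable borel"
  unfolding spow_def[abs_def] by measurable

text \<open>The factor 2 leaves room for two functions: the maximum of |u| and |v| to the power p is
  at most |u|^p + |v|^p.\<close>

definition sob_root :: real where "sob_root = (2 * sob_const) powr (1 / p)"

lemma sob_root_pos: "sob_root > 0" using sob_const_pos by (simp add: sob_root_def)

lemma pint_root:
  assumes "u \<in> H10 \<Omega>" "nrm u \<le> R"
  shows "2 * pint u \<le> (sob_root * R) powr p"
proof -
  have R: "R \<ge> 0" using assms(2) nrm_nonneg[of u] by linarith
  have "2 * pint u \<le> 2 * sob_const * nrm u powr p" using sobolev_H10_le[OF assms(1)] by (simp add: pint_def)
  also have "\<dots> \<le> 2 * sob_const * R powr p"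
    using sob_const_pos assms(2) nrm_nonneg p_gt_2 by (intro mult_left_mono powr_mono2) auto
  also have "2 * sob_const = sob_root powr p" using sob_const_pos p_gt_2 by (simp add: sob_root_def powr_powr)
  finally show ?thesis using sob_root_pos R by (simp add: powr_mult)
qed

text \<open>\<open>Holder_three\<close> in the shape produced by \<open>spow_diff_le\<close> and
  \<open>abs_powr_taylor\<close>, where the maximum of two functions carries the power p -
  2.\<close>

lemma pform_Holder:
  assumes u: "u \<in> H10 \<Omega>" "v \<in> H10 \<Omega>" "nrm u \<le> R" "nrm v \<le> R" and w: "w \<in> H10 \<Omega>" and h: "h \<in> H10 \<Omega>"
  shows "integrable N (\<lambda>x. max \<bar>u x\<bar> \<bar>v x\<bar> powr (p - 2) * \<bar>w x\<bar> * \<bar>h x\<bar>)"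
    and "(LINT x|N. max \<bar>u x\<bar> \<bar>v x\<bar> powr (p - 2) * \<bar>w x\<bar> * \<bar>h x\<bar>) \<le> 3 * (sob_root * R) powr (p - 2) * (sob_root * nrm w) * (sob_root * nrm h)"
proof -
  have R: "R \<ge> 0" using u(3) nrm_nonneg[of u] by linarith
  note [measurable] = H10_measurable[OF u(1)] H10_measurable[OF u(2)] H10_measurable[OF w] H10_measurable[OF h]
  have pw: "max \<bar>u x\<bar> \<bar>v x\<bar> powr p \<le> \<bar>u x\<bar> powr p + \<bar>v x\<bar> powr p" for x by (simp add: max_def)
  have i: "integrable N (\<lambda>x. \<bar>u x\<bar> powr p + \<bar>v x\<bar> powr p)"
    using H10_powr_integrable[OF u(1)] H10_powr_integrable[OF u(2)] by simp
  have im: "integrable N (\<lambda>x. max \<bar>u x\<bar> \<bar>v x\<bar> powr p)"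
  proof (rule Bochner_Integration.integrable_bound[OF i])
    show "AE x in N. norm (max \<bar>u x\<bar> \<bar>v x\<bar> powr p) \<le> norm (\<bar>u x\<bar> powr p + \<bar>v x\<bar> powr p)"
      using pw by (intro AE_I2) simp
  qed measurable
  have "(LINT x|N. max \<bar>u x\<bar> \<bar>v x\<bar> powr p) \<le> (LINT x|N. \<bar>u x\<bar> powr p + \<bar>v x\<bar> powr p)"
    by (rule integral_mono[OF im i pw])
  also have "\<dots> = pint u + pint v" using H10_powr_integrable[OF u(1)] H10_powr_integrable[OF u(2)] by (simp add: pint_def)
  also have "\<dots> \<le> (sob_root * R) powr p" using pint_root[OF u(1,3)] pint_root[OF u(2,4)] by linarith
  finally have 1: "(LINT x|N. max \<bar>u x\<bar> \<bar>v x\<bar> powr p) \<le> (sob_root * R) powr p" .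
  have 2: "(LINT x|N. \<bar>z x\<bar> powr p) \<le> (sob_root * nrm z) powr p" if "z \<in> H10 \<Omega>" for z
    using pint_root[OF that order_refl] pint_nonneg[of z] unfolding pint_def by linarith
  show "integrable N (\<lambda>x. max \<bar>u x\<bar> \<bar>v x\<bar> powr (p - 2) * \<bar>w x\<bar> * \<bar>h x\<bar>)"
    by (rule Holder_three(1)[OF p_gt_2 _ _ _ _ _ _ im H10_powr_integrable[OF w] H10_powr_integrable[OF h] 1 2[OF w] 2[OF h]])
      (use sob_root_pos R nrm_nonneg in auto)
  show "(LINT x|N. max \<bar>u x\<bar> \<bar>v x\<bar> powr (p - 2) * \<bar>w x\<bar> * \<bar>h x\<bar>) \<le> 3 * (sob_root * R) powr (p - 2) * (sob_root * nrm w) * (sob_root * nrm h)"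
    by (rule Holder_three(2)[OF p_gt_2 _ _ _ _ _ _ im H10_powr_integrable[OF w] H10_powr_integrable[OF h] 1 2[OF w] 2[OF h]])
      (use sob_root_pos R nrm_nonneg in auto)
qed

lemma pform_integrable:
  assumes u: "u \<in> H10 \<Omega>" and h: "h \<in> H10 \<Omega>"
  shows "integrable N (\<lambda>x. spow (p - 2) (u x) * h x)"
proof (rule Bochner_Integration.integrable_bound)
  note [measurable] = H10_measurable[OF u] H10_measurable[OF h]
  show "integrable N (\<lambda>x. max \<bar>u x\<bar> \<bar>u x\<bar> powr (p - 2) * \<bar>u x\<bar> * \<bar>h x\<bar>)"
    by (rule pform_Holder(1)[OF u u order_refl order_refl u h])
  show "(\<lambda>x. spow (p - 2) (u x) * h x) \<in> borel_measurable N" by measurable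
  show "AE x in N. norm (spow (p - 2) (u x) * h x) \<le> norm (max \<bar>u x\<bar> \<bar>u x\<bar> powr (p - 2) * \<bar>u x\<bar> * \<bar>h x\<bar>)"
    by (intro AE_I2) (simp add: spow_def abs_mult)
qed

lemma pform_self: "pform u u = pint u"
  unfolding pform_def pint_def
proof (rule Bochner_Integration.integral_cong[OF refl])
  fix x
  show "spow (p - 2) (u x) * u x = \<bar>u x\<bar> powr p"
  proof (cases "u x = 0")
    case False
    have "\<bar>u x\<bar> powr p = \<bar>u x\<bar> powr (p - 2) * \<bar>u x\<bar> powr 2" by (simp only: powr_add[symmetric]) simp
    also have "\<bar>u x\<bar> powr 2 = u x * u x" using False by (simp add: power2_eq_square)
    finally show ?thesis by (simp add: spow_def)
  qed (simp add: spow_def)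
qed

text \<open>Integrate the pointwise inequalities \<open>abs_powr_taylor\<close> and
  \<open>spow_diff_le\<close>; the Sobolev inequality, through \<open>pform_Holder\<close>, turns
  the results into bounds in \<open>nrm\<close>.\<close>

lemma lip_C1_pint: "lip_C1 pint (\<lambda>u h. p * pform u h)"
  unfolding lip_C1_def
proof (intro conjI ballI allI)
  fix u v w assume "u \<in> H10 \<Omega>" "v \<in> H10 \<Omega>" "w \<in> H10 \<Omega>"
  thus "p * pform u (\<lambda>x. v x + w x) = p * pform u v + p * pform u w"
    using pform_integrable[of u v] pform_integrable[of u w] by (simp add: pform_def distrib_left)
next
  fix u v c show "p * pform u (\<lambda>x. c * v x) = c * (p * pform u v)"
    by (simp add: pform_def mult.left_commute)
next
  fix v show "p * pform (\<lambda>x. 0) v = 0" by (simp add: pform_def spow_def)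
next
  fix R
  define M where "M = 3 * (sob_root * R) powr (p - 2) * sob_root * sob_root"
  have M: "M \<ge> 0" using sob_root_pos by (simp add: M_def)
  show "\<exists>K\<ge>0. \<forall>u\<in>H10 \<Omega>. \<forall>v\<in>H10 \<Omega>. nrm u \<le> R \<longrightarrow> nrm v \<le> R \<longrightarrow>
        \<bar>pint v - pint u - p * pform u (\<lambda>x. v x - u x)\<bar> \<le> K * (nrm (\<lambda>x. v x - u x))\<^sup>2 \<and>
        (\<forall>h\<in>H10 \<Omega>. \<bar>p * pform v h - p * pform u h\<bar> \<le> K * nrm (\<lambda>x. v x - u x) * nrm h)"
  proof (intro exI[of _ "p * (p - 1) * M"] conjI ballI impI)
    fix u v assume uv: "u \<in> H10 \<Omega>" "v \<in> H10 \<Omega>" "nrm u \<le> R" "nrm v \<le> R"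
    have d: "(\<lambda>x. v x - u x) \<in> H10 \<Omega>" by (rule H10_diff[OF uv(2,1)])
    note I = H10_powr_integrable[OF uv(2)] H10_powr_integrable[OF uv(1)] pform_integrable[OF uv(1) d]
    have eq: "pint v - pint u - p * pform u (\<lambda>x. v x - u x) = (LINT x|N. \<bar>v x\<bar> powr p - \<bar>u x\<bar> powr p - p * (spow (p - 2) (u x) * (v x - u x)))"
      using I by (simp add: pint_def pform_def)
    have "\<bar>LINT x|N. \<bar>v x\<bar> powr p - \<bar>u x\<bar> powr p - p * (spow (p - 2) (u x) * (v x - u x))\<bar> \<le> (LINT x|N. \<bar>\<bar>v x\<bar> powr p - \<bar>u x\<bar> powr p - p * (spow (p - 2) (u x) * (v x - u x))\<bar>)"
      by (rule integral_abs_bound)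
    also have "\<dots> \<le> (LINT x|N. p * (p - 1) * (max \<bar>v x\<bar> \<bar>u x\<bar> powr (p - 2) * \<bar>v x - u x\<bar> * \<bar>v x - u x\<bar>))"
    proof (rule integral_mono)
      show "integrable N (\<lambda>x. \<bar>\<bar>v x\<bar> powr p - \<bar>u x\<bar> powr p - p * (spow (p - 2) (u x) * (v x - u x))\<bar>)"
        by (rule integrable_abs[OF Bochner_Integration.integrable_diff[OF Bochner_Integration.integrable_diff[OF I(1) I(2)] integrable_mult_right[OF I(3)]]])
      show "integrable N (\<lambda>x. p * (p - 1) * (max \<bar>v x\<bar> \<bar>u x\<bar> powr (p - 2) * \<bar>v x - u x\<bar> * \<bar>v x - u x\<bar>))"
        by (rule integrable_mult_right[OF pform_Holder(1)[OF uv(2,1,4,3) d d]])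
      fix x
      show "\<bar>\<bar>v x\<bar> powr p - \<bar>u x\<bar> powr p - p * (spow (p - 2) (u x) * (v x - u x))\<bar> \<le> p * (p - 1) * (max \<bar>v x\<bar> \<bar>u x\<bar> powr (p - 2) * \<bar>v x - u x\<bar> * \<bar>v x - u x\<bar>)"
      proof -
        have "(v x - u x)\<^sup>2 = \<bar>v x - u x\<bar> * \<bar>v x - u x\<bar>" by (simp add: power2_eq_square)
        thus ?thesis using abs_powr_taylor[OF p_gt_2, of "v x" "u x"] by (simp only: mult.assoc)
      qed
    qed
    also have "\<dots> = p * (p - 1) * (LINT x|N. max \<bar>v x\<bar> \<bar>u x\<bar> powr (p - 2) * \<bar>v x - u x\<bar> * \<bar>v x - u x\<bar>)" by simp
    also have "\<dots> \<le> p * (p - 1) * (3 * (sob_root * R) powr (p - 2) * (sob_root * nrm (\<lambda>x. v x - u x)) * (sob_root * nrm (\<lambda>x. v x - u x)))"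
      using p_gt_2 by (intro mult_left_mono pform_Holder(2)[OF uv(2,1,4,3) d d]) auto
    finally show "\<bar>pint v - pint u - p * pform u (\<lambda>x. v x - u x)\<bar> \<le> p * (p - 1) * M * (nrm (\<lambda>x. v x - u x))\<^sup>2"
      unfolding eq by (simp add: M_def power2_eq_square mult_ac)
    fix h assume h: "h \<in> H10 \<Omega>"
    note I' = pform_integrable[OF uv(2) h] pform_integrable[OF uv(1) h]
    have eq2: "pform v h - pform u h = (LINT x|N. (spow (p - 2) (v x) - spow (p - 2) (u x)) * h x)"
      using I' by (simp add: pform_def left_diff_distrib)
    have "\<bar>LINT x|N. (spow (p - 2) (v x) - spow (p - 2) (u x)) * h x\<bar> \<le> (LINT x|N. \<bar>(spow (p - 2) (v x) - spow (p - 2) (u x)) * h x\<bar>)" by (rule integral_abs_bound)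
    also have "\<dots> \<le> (LINT x|N. (p - 1) * (max \<bar>v x\<bar> \<bar>u x\<bar> powr (p - 2) * \<bar>v x - u x\<bar> * \<bar>h x\<bar>))"
    proof (rule integral_mono)
      show "integrable N (\<lambda>x. \<bar>(spow (p - 2) (v x) - spow (p - 2) (u x)) * h x\<bar>)"
        unfolding left_diff_distrib by (rule integrable_abs[OF Bochner_Integration.integrable_diff[OF I']])
      show "integrable N (\<lambda>x. (p - 1) * (max \<bar>v x\<bar> \<bar>u x\<bar> powr (p - 2) * \<bar>v x - u x\<bar> * \<bar>h x\<bar>))"
        by (rule integrable_mult_right[OF pform_Holder(1)[OF uv(2,1,4,3) d h]])
      fix x
      have "\<bar>spow (p - 2) (v x) - spow (p - 2) (u x)\<bar> * \<bar>h x\<bar> \<le> ((p - 2 + 1) * max \<bar>v x\<bar> \<bar>u x\<bar> powr (p - 2) * \<bar>v x - u x\<bar>) * \<bar>h x\<bar>"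
        using p_gt_2 by (intro mult_right_mono spow_diff_le) auto
      thus "\<bar>(spow (p - 2) (v x) - spow (p - 2) (u x)) * h x\<bar> \<le> (p - 1) * (max \<bar>v x\<bar> \<bar>u x\<bar> powr (p - 2) * \<bar>v x - u x\<bar> * \<bar>h x\<bar>)"
        by (simp add: abs_mult mult.assoc)
    qed
    also have "\<dots> = (p - 1) * (LINT x|N. max \<bar>v x\<bar> \<bar>u x\<bar> powr (p - 2) * \<bar>v x - u x\<bar> * \<bar>h x\<bar>)" by simp
    also have "\<dots> \<le> (p - 1) * (3 * (sob_root * R) powr (p - 2) * (sob_root * nrm (\<lambda>x. v x - u x)) * (sob_root * nrm h))"
      using p_gt_2 by (intro mult_left_mono pform_Holder(2)[OF uv(2,1,4,3) d h]) auto
    finally have "\<bar>pform v h - pform u h\<bar> \<le> (p - 1) * (3 * (sob_root * R) powr (p - 2) * (sob_root * nrm (\<lambda>x. v x - u x)) * (sob_root * nrm h))"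
      unfolding eq2 .
    hence "p * \<bar>pform v h - pform u h\<bar> \<le> p * ((p - 1) * (3 * (sob_root * R) powr (p - 2) * (sob_root * nrm (\<lambda>x. v x - u x)) * (sob_root * nrm h)))"
      using p_gt_2 by (intro mult_left_mono) auto
    moreover have "\<bar>p * pform v h - p * pform u h\<bar> = p * \<bar>pform v h - pform u h\<bar>"
      using p_gt_2 by (simp add: abs_mult right_diff_distrib[symmetric])
    ultimately show "\<bar>p * pform v h - p * pform u h\<bar> \<le> p * (p - 1) * M * nrm (\<lambda>x. v x - u x) * nrm h"
      by (simp add: M_def mult_ac)
  qed (use M p_gt_2 in simp)
qed

definition kir' :: "real \<Rightarrow> real \<Rightarrow> real \<Rightarrow> ('a \<Rightarrow> real) \<Rightarrow> ('a \<Rightarrow> real) \<Rightarrow> real" where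
  "kir' a b lam u h = a * gip u h + b * nrm u powr (p - 2) * gip u h - lam * lip u h - pform u h"

lemma kirchhoff_eq:
  "kirchhoff_functional a b lam \<Omega> u = a / 2 * (nrm u)\<^sup>2 + b / p * nrm u powr p - lam / 2 * (l2 u)\<^sup>2 - 1 / p * pint u"
  unfolding kirchhoff_functional_def Let_def p_def[symmetric] energy_eq_nrm pint_def nrm_sq_powr
  by (simp add: l2_norm_sq)

lemma lip_C1_kirchhoff: "lip_C1 (kirchhoff_functional a b lam \<Omega>) (kir' a b lam)"
proof -
  have "lip_C1 (\<lambda>u. a / 2 * (nrm u)\<^sup>2 + (b / p * nrm u powr p + (- lam / 2 * (l2 u)\<^sup>2 + - 1 / p * pint u)))
     (\<lambda>u h. a / 2 * (2 * gip u h) + (b / p * (p * nrm u powr (p - 2) * gip u h) + (- lam / 2 * (2 * lip u h) + - 1 / p * (p * pform u h))))"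
    by (intro lip_C1_add lip_C1_cmult lip_C1_energy lip_C1_mass lip_C1_energy_powr lip_C1_pint)
  moreover have "(\<lambda>u. a / 2 * (nrm u)\<^sup>2 + (b / p * nrm u powr p + (- lam / 2 * (l2 u)\<^sup>2 + - 1 / p * pint u))) = kirchhoff_functional a b lam \<Omega>"
    by (rule ext) (simp add: kirchhoff_eq)
  moreover have "(\<lambda>u h. a / 2 * (2 * gip u h) + (b / p * (p * nrm u powr (p - 2) * gip u h) + (- lam / 2 * (2 * lip u h) + - 1 / p * (p * pform u h)))) = kir' a b lam"
    using p_gt_2 by (intro ext) (simp add: kir'_def)
  ultimately show ?thesis by simp
qed

end

section \<open>Bounded Palais-Smale sequences\<close>

lemma bounded_seq_convergent_subseq:
  fixes f :: "nat \<Rightarrow> real"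
  assumes "\<And>n. 0 \<le> f n" "\<And>n. f n \<le> B"
  obtains l k where "0 \<le> l" "strict_mono k" "(\<lambda>n. f (k n)) \<longlonglongrightarrow> l"
proof -
  have "seq_compact {0..B}" using compact_Icc[of 0 B] by (simp add: compact_eq_seq_compact_metric)
  moreover have "\<forall>n. f n \<in> {0..B}" using assms by auto
  ultimately obtain l k where "l \<in> {0..B}" "strict_mono k" "(f \<circ> k) \<longlonglongrightarrow> l" by (rule seq_compactE)
  thus ?thesis by (intro that[of l k]) (auto simp: o_def)
qed

context sobolev_domain
begin

text \<open>Either |t| <= \<delta> |s|, and the product is a small part of |s|^p, or |s| <
  |t|/\<delta>, and everything is bounded by a multiple of |t|^p.\<close>

lemma max_powr_split:
  fixes s t \<delta> :: real
  assumes \<delta>: "0 < \<delta>" "\<delta> \<le> 1"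
  shows "max \<bar>s\<bar> \<bar>t\<bar> powr (p - 2) * \<bar>t\<bar> * \<bar>s\<bar> \<le> \<delta> * \<bar>s\<bar> powr p + (1 / \<delta>) powr p * \<bar>t\<bar> powr p"
proof -
  have pw: "x powr (p - 2) * x * x = x powr p" if "x \<ge> 0" for x :: real
  proof (cases "x = 0")
    case False
    hence "x powr p = x powr (p - 2) * x powr 2" by (simp only: powr_add[symmetric]) simp
    also have "x powr 2 = x * x" using that False by (simp add: power2_eq_square)
    finally show ?thesis by simp
  qed (use p_gt_2 in simp)
  show ?thesis
  proof (cases "\<bar>t\<bar> \<le> \<delta> * \<bar>s\<bar>")
    case True
    have "\<delta> * \<bar>s\<bar> \<le> 1 * \<bar>s\<bar>" using \<delta> by (intro mult_right_mono) auto
    hence "max \<bar>s\<bar> \<bar>t\<bar> = \<bar>s\<bar>" using True by simp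
    hence "max \<bar>s\<bar> \<bar>t\<bar> powr (p - 2) * \<bar>t\<bar> * \<bar>s\<bar> \<le> \<bar>s\<bar> powr (p - 2) * (\<delta> * \<bar>s\<bar>) * \<bar>s\<bar>"
      using True by (simp add: mult_left_mono mult_right_mono)
    also have "\<dots> = \<delta> * (\<bar>s\<bar> powr (p - 2) * \<bar>s\<bar> * \<bar>s\<bar>)" by (simp only: mult_ac)
    also have "\<dots> = \<delta> * \<bar>s\<bar> powr p" by (simp only: pw abs_ge_zero)
    finally show ?thesis by (simp add: add_increasing2)
  next
    case False
    define m where "m = (1 / \<delta>) * \<bar>t\<bar>"
    have s: "\<bar>s\<bar> \<le> m" using False \<delta> by (simp add: m_def field_simps)
    have "1 * \<bar>t\<bar> \<le> m" unfolding m_def using \<delta> by (intro mult_right_mono) auto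
    hence t: "\<bar>t\<bar> \<le> m" by simp
    have "max \<bar>s\<bar> \<bar>t\<bar> powr (p - 2) * \<bar>t\<bar> * \<bar>s\<bar> \<le> m powr (p - 2) * m * m"
      using s t p_gt_2 by (intro mult_mono powr_mono2) auto
    also have "\<dots> = m powr p" using t by (intro pw) auto
    also have "\<dots> = (1 / \<delta>) powr p * \<bar>t\<bar> powr p" unfolding m_def using \<delta> by (simp add: powr_mult powr_divide)
    finally show ?thesis using \<delta> by (simp add: add_increasing)
  qed
qed

text \<open>Dominated convergence removes the excess W; what is left is at most \<delta> times the
  critical integrals of the z j, which are uniformly bounded by the Sobolev inequality.\<close>

lemma mixed_integral_tendsto_0:
  assumes z: "\<And>j::nat. z j \<in> H10 \<Omega>" and K: "\<And>j. nrm (z j) \<le> K" and v: "v \<in> H10 \<Omega>"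
    and ae: "AE x in N. (\<lambda>j. z j x) \<longlonglongrightarrow> 0"
  shows "(\<lambda>j. LINT x|N. max \<bar>z j x\<bar> \<bar>v x\<bar> powr (p - 2) * \<bar>v x\<bar> * \<bar>z j x\<bar>) \<longlonglongrightarrow> 0"
proof (rule LIMSEQ_I)
  fix e :: real assume e: "e > 0"
  note [measurable] = H10_measurable[OF z] H10_measurable[OF v]
  define G where "G j x = max \<bar>z j x\<bar> \<bar>v x\<bar> powr (p - 2) * \<bar>v x\<bar> * \<bar>z j x\<bar>" for j x
  have Gi: "integrable N (G j)" for j
    unfolding G_def using pform_Holder(1)[OF z v _ _ v z, of j "max (nrm (z j)) (nrm v)" j] by simp
  have G0: "0 \<le> G j x" for j x by (simp add: G_def)
  define B where "B = (sob_root * K) powr p"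
  have B0: "B \<ge> 0" by (simp add: B_def)
  have B: "pint (z j) \<le> B" for j using pint_root[OF z[of j] K[of j]] pint_nonneg[of "z j"] unfolding B_def by linarith
  define \<delta> where "\<delta> = min 1 (e / (2 * (B + 1)))"
  have \<delta>: "0 < \<delta>" "\<delta> \<le> 1" using e B0 by (auto simp: \<delta>_def)
  have \<delta>B: "\<delta> * B \<le> e / 2"
  proof -
    have "\<delta> * B \<le> e / (2 * (B + 1)) * (B + 1)" using B0 e by (intro mult_mono) (auto simp: \<delta>_def)
    also have "\<dots> = e / 2" using B0 by (simp add: field_simps)
    finally show ?thesis .
  qed
  \<comment> \<open>The cut at 0 gives W between 0 and G, so that it inherits the pointwise limit
    0.\<close>
  define W where "W j x = max 0 (G j x - \<delta> * \<bar>z j x\<bar> powr p)" for j x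
  have Wb: "norm (W j x) \<le> (1 / \<delta>) powr p * \<bar>v x\<bar> powr p" for j x
    using max_powr_split[OF \<delta>, of "z j x" "v x"] by (simp add: W_def G_def abs_le_iff) 
  have Wm: "W j \<in> borel_measurable N" for j unfolding W_def G_def by measurable
  have Ii: "integrable N (\<lambda>x. (1 / \<delta>) powr p * \<bar>v x\<bar> powr p)" by (rule integrable_mult_right[OF H10_powr_integrable[OF v]])
  have Wi: "integrable N (W j)" for j
    by (rule Bochner_Integration.integrable_bound[OF Ii Wm]) (use Wb in \<open>simp add: abs_le_iff\<close>)
  have "(\<lambda>j. LINT x|N. W j x) \<longlonglongrightarrow> (LINT x|N. 0)"
  proof (rule integral_dominated_convergence[OF _ Wm Ii])
    show "AE x in N. (\<lambda>j. W j x) \<longlonglongrightarrow> 0"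
      using ae
    proof eventually_elim
      case (elim x)
      have "(\<lambda>j. max \<bar>z j x\<bar> \<bar>v x\<bar> powr (p - 2) * \<bar>v x\<bar> * \<bar>z j x\<bar>) \<longlonglongrightarrow> max \<bar>0\<bar> \<bar>v x\<bar> powr (p - 2) * \<bar>v x\<bar> * \<bar>0\<bar>"
        using p_gt_2 by (intro tendsto_mult tendsto_powr2 tendsto_max tendsto_rabs tendsto_const elim)
          (auto intro!: always_eventually simp: le_max_iff_disj)
      hence g: "(\<lambda>j. G j x) \<longlonglongrightarrow> 0" by (simp add: G_def)
      show ?case
      proof (rule tendsto_sandwich[OF _ _ tendsto_const g])
        show "\<forall>\<^sub>F j in sequentially. W j x \<le> G j x"
          using G0 \<delta> by (intro always_eventually allI) (simp add: W_def)
      qed (simp add: W_def)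
    qed
    show "AE x in N. norm (W j x) \<le> (1 / \<delta>) powr p * \<bar>v x\<bar> powr p" for j using Wb by (intro AE_I2)
  qed simp
  hence "(\<lambda>j. LINT x|N. W j x) \<longlonglongrightarrow> 0" by simp
  from order_tendstoD(2)[OF this, of "e / 2"] obtain n0 where n0: "\<And>j. j \<ge> n0 \<Longrightarrow> (LINT x|N. W j x) < e / 2"
    using e unfolding eventually_sequentially by auto
  have "norm ((LINT x|N. G j x) - 0) < e" if "j \<ge> n0" for j
  proof -
    have "(LINT x|N. G j x) \<le> (LINT x|N. W j x + \<delta> * \<bar>z j x\<bar> powr p)"
      by (intro integral_mono Gi Bochner_Integration.integrable_add Wi integrable_mult_right H10_powr_integrable z) (simp add: W_def)
    also have "\<dots> = (LINT x|N. W j x) + \<delta> * pint (z j)"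
      using Wi H10_powr_integrable[OF z] by (simp add: pint_def)
    also have "\<dots> \<le> (LINT x|N. W j x) + \<delta> * B" using B \<delta> by (intro add_left_mono mult_left_mono) auto
    also have "\<dots> < e" using n0[OF that] \<delta>B by linarith
    finally have "(LINT x|N. G j x) < e" .
    moreover have "0 \<le> (LINT x|N. G j x)" by (intro integral_nonneg_AE AE_I2 G0)
    ultimately show ?thesis by simp
  qed
  thus "\<exists>n0. \<forall>j\<ge>n0. norm ((LINT x|N. max \<bar>z j x\<bar> \<bar>v x\<bar> powr (p - 2) * \<bar>v x\<bar> * \<bar>z j x\<bar>) - 0) < e"
    unfolding G_def by blast
qed

text \<open>A form of the Brezis-Lieb lemma. Almost everywhere convergence suffices since, by
  \<open>max_powr_split\<close>, the part of the mixed term exceeding $\delta |z_j|^p$ is dominated by a multiple of $|v|^p$.\<close>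

lemma pform_splitting:
  assumes z: "\<And>j::nat. z j \<in> H10 \<Omega>" and K: "\<And>j. nrm (z j) \<le> K" and v: "v \<in> H10 \<Omega>"
    and ae: "AE x in N. (\<lambda>j. z j x) \<longlonglongrightarrow> 0"
  shows "(\<lambda>j. pform (\<lambda>x. z j x + v x) (z j) - pint (z j)) \<longlonglongrightarrow> 0"
proof -
  define G where "G j x = max \<bar>z j x\<bar> \<bar>v x\<bar> powr (p - 2) * \<bar>v x\<bar> * \<bar>z j x\<bar>" for j x
  define C where "C = (p - 1) * 2 powr (p - 2)"
  have Gi: "integrable N (G j)" for j
    unfolding G_def using pform_Holder(1)[OF z v _ _ v z, of j "max (nrm (z j)) (nrm v)" j] by simp
  have le: "\<bar>pform (\<lambda>x. z j x + v x) (z j) - pint (z j)\<bar> \<le> C * (LINT x|N. G j x)" for j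
  proof -
    note I = pform_integrable[OF H10_add[OF z v] z, of j j] pform_integrable[OF z z, of j j]
    have eq: "pform (\<lambda>x. z j x + v x) (z j) - pint (z j) = (LINT x|N. spow (p - 2) (z j x + v x) * z j x - spow (p - 2) (z j x) * z j x)"
      unfolding pform_self[symmetric] pform_def by (rule Bochner_Integration.integral_diff[OF I, symmetric])
    have "\<bar>LINT x|N. spow (p - 2) (z j x + v x) * z j x - spow (p - 2) (z j x) * z j x\<bar>
        \<le> (LINT x|N. \<bar>spow (p - 2) (z j x + v x) * z j x - spow (p - 2) (z j x) * z j x\<bar>)" by (rule integral_abs_bound)
    also have "\<dots> \<le> (LINT x|N. C * G j x)"
    proof (rule integral_mono)
      show "integrable N (\<lambda>x. \<bar>spow (p - 2) (z j x + v x) * z j x - spow (p - 2) (z j x) * z j x\<bar>)"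
        by (rule integrable_abs[OF Bochner_Integration.integrable_diff[OF I]])
      show "integrable N (\<lambda>x. C * G j x)" by (rule integrable_mult_right[OF Gi])
      fix x
      \<comment> \<open>Doubling absorbs the sum into the maximum; hence the factor 2^(p-2) in
        C.\<close>
      have m: "max \<bar>z j x + v x\<bar> \<bar>z j x\<bar> \<le> 2 * max \<bar>z j x\<bar> \<bar>v x\<bar>" by linarith
      have "\<bar>spow (p - 2) (z j x + v x) - spow (p - 2) (z j x)\<bar> \<le> (p - 2 + 1) * max \<bar>z j x + v x\<bar> \<bar>z j x\<bar> powr (p - 2) * \<bar>z j x + v x - z j x\<bar>"
        using p_gt_2 by (intro spow_diff_le) simp
      also have "\<dots> \<le> (p - 2 + 1) * (2 * max \<bar>z j x\<bar> \<bar>v x\<bar>) powr (p - 2) * \<bar>v x\<bar>"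
      proof -
        have "max \<bar>z j x + v x\<bar> \<bar>z j x\<bar> powr (p - 2) \<le> (2 * max \<bar>z j x\<bar> \<bar>v x\<bar>) powr (p - 2)"
          using p_gt_2 m by (intro powr_mono2) auto
        thus ?thesis using p_gt_2 by (simp add: mult_left_mono mult_right_mono)
      qed
      also have "\<dots> = C * (max \<bar>z j x\<bar> \<bar>v x\<bar> powr (p - 2) * \<bar>v x\<bar>)" by (simp add: C_def powr_mult)
      finally have "\<bar>spow (p - 2) (z j x + v x) - spow (p - 2) (z j x)\<bar> * \<bar>z j x\<bar> \<le> C * (max \<bar>z j x\<bar> \<bar>v x\<bar> powr (p - 2) * \<bar>v x\<bar>) * \<bar>z j x\<bar>"
        by (intro mult_right_mono) auto
      thus "\<bar>spow (p - 2) (z j x + v x) * z j x - spow (p - 2) (z j x) * z j x\<bar> \<le> C * G j x"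
        unfolding left_diff_distrib[symmetric] abs_mult G_def by (simp only: mult.assoc)
    qed
    also have "\<dots> = C * (LINT x|N. G j x)" by simp
    finally show ?thesis unfolding eq .
  qed
  have "(\<lambda>j. C * (LINT x|N. G j x)) \<longlonglongrightarrow> C * 0"
    unfolding G_def by (intro tendsto_mult tendsto_const mixed_integral_tendsto_0[OF z K v ae])
  hence "(\<lambda>j. C * (LINT x|N. G j x)) \<longlonglongrightarrow> 0" by simp
  thus ?thesis
  proof (rule Lim_null_comparison[rotated])
    show "\<forall>\<^sub>F j in sequentially. norm (pform (\<lambda>x. z j x + v x) (z j) - pint (z j)) \<le> C * (LINT x|N. G j x)"
      unfolding real_norm_def by (intro always_eventually allI le)
  qed
qed

text \<open>The subsequence is refined three times: for L2 convergence, for almost everywhere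
  convergence, and for convergence of the norms of u - v. Strong convergence amounts to \<sigma> =
  0, and the last inequality condenses what the derivatives say about \<sigma>.\<close>

lemma palais_smale_extract:
  fixes u :: "nat \<Rightarrow> 'a \<Rightarrow> real"
  assumes u: "\<And>j. u j \<in> H10 \<Omega>" and K: "\<And>j. nrm (u j) \<le> K" and b: "b \<ge> 0"
    and d: "(\<lambda>j. dual_norm \<Omega> (kir' a b lam (u j))) \<longlonglongrightarrow> 0"
  obtains r v \<sigma> where "strict_mono r" "v \<in> H10 \<Omega>" "\<sigma> \<ge> 0"
    "(\<lambda>j. nrm (\<lambda>x. u (r j) x - v x)) \<longlonglongrightarrow> \<sigma>"
    "(\<lambda>j. (nrm (u (r j)))\<^sup>2) \<longlonglongrightarrow> (nrm v)\<^sup>2 + \<sigma>\<^sup>2"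
    "(\<lambda>j. (l2 (u (r j)))\<^sup>2) \<longlonglongrightarrow> (l2 v)\<^sup>2"
    "(a + b * \<sigma> powr (p - 2)) * \<sigma>\<^sup>2 \<le> sobolev_constant \<Omega> powr (- p / 2) * \<sigma> powr p"
proof -
  obtain k1 v where k1: "strict_mono k1" "sq_int N v" "(\<lambda>n. l2 (\<lambda>x. u (k1 n) x - v x)) \<longlonglongrightarrow> 0"
    by (rule rellich[of u, OF u K]) blast
  have v: "v \<in> H10 \<Omega>" by (rule bounded_l2_limit_H10[of "\<lambda>n. u (k1 n)", OF u K k1(2,3)])
  obtain k2 where k2: "strict_mono k2" "AE x in N. (\<lambda>n. u (k1 (k2 n)) x) \<longlonglongrightarrow> v x"
    by (rule fm.l2_AE_subseq[of "\<lambda>n. u (k1 n)", OF H10_sq_int[OF u] k1(2,3)]) blast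
  have zb: "nrm (\<lambda>x. u j x - v x) \<le> K + nrm v" for j
    using nrm_triangle_diff(2)[OF H10_H1[OF u] H10_H1[OF v], of j] K[of j] by linarith
  obtain \<sigma> k3 where k3: "0 \<le> \<sigma>" "strict_mono k3" "(\<lambda>n. nrm (\<lambda>x. u (k1 (k2 (k3 n))) x - v x)) \<longlonglongrightarrow> \<sigma>"
    by (rule bounded_seq_convergent_subseq[of "\<lambda>n. nrm (\<lambda>x. u (k1 (k2 n)) x - v x)", OF nrm_nonneg zb]) blast
  define r where "r n = k1 (k2 (k3 n))" for n
  have r: "strict_mono r" using k1(1) k2(1) k3(2) by (auto simp: r_def strict_mono_def)
  define w where "w n = u (r n)" for n
  define z where "z n = (\<lambda>x. w n x - v x)" for n
  have wH: "w n \<in> H10 \<Omega>" for n by (simp add: w_def u)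
  have zH: "z n \<in> H10 \<Omega>" for n unfolding z_def by (rule H10_diff[OF wH v])
  have wz: "w n = (\<lambda>x. z n x + v x)" for n by (simp add: z_def)
  have zK: "nrm (z n) \<le> K + nrm v" for n unfolding z_def w_def by (rule zb)
  have wK: "nrm (w n) \<le> K" for n unfolding w_def by (rule K)
  have z\<sigma>: "(\<lambda>n. nrm (z n)) \<longlonglongrightarrow> \<sigma>" using k3(3) by (simp add: z_def w_def r_def)
  have k23: "strict_mono (\<lambda>n. k2 (k3 n))" using k2(1) k3(2) by (auto simp: strict_mono_def)
  have zl: "(\<lambda>n. l2 (z n)) \<longlonglongrightarrow> 0"
    using LIMSEQ_subseq_LIMSEQ[OF k1(3) k23] by (simp add: z_def w_def r_def o_def)
  have zae: "AE x in N. (\<lambda>n. z n x) \<longlonglongrightarrow> 0"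
    using k2(2)
  proof eventually_elim
    case (elim x)
    have "(\<lambda>n. u (k1 (k2 (k3 n))) x) \<longlonglongrightarrow> v x" using LIMSEQ_subseq_LIMSEQ[OF elim k3(2)] by (simp add: o_def)
    thus ?case by (simp add: z_def w_def r_def LIM_zero_iff)
  qed
  have "(\<lambda>n. gip (w n) v) \<longlonglongrightarrow> gip v v"
    by (rule weak_convergence[OF wH wK v _ v]) (use zl in \<open>simp add: z_def\<close>)
  hence wv: "(\<lambda>n. gip (w n) v) \<longlonglongrightarrow> (nrm v)\<^sup>2" by (simp add: nrm_sq)
  have gzv: "gip (z n) v = gip (w n) v - (nrm v)\<^sup>2" for n
    unfolding z_def nrm_sq by (rule gip_diff[OF H10_H1[OF wH] H10_H1[OF v] H10_H1[OF v]])
  have zv: "(\<lambda>n. gip (z n) v) \<longlonglongrightarrow> 0" unfolding gzv using tendsto_diff[OF wv tendsto_const[of "(nrm v)\<^sup>2"]] by simp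
  have z2: "(\<lambda>n. (nrm (z n))\<^sup>2) \<longlonglongrightarrow> \<sigma>\<^sup>2" by (rule tendsto_power[OF z\<sigma>])
  have wn2: "(nrm (w n))\<^sup>2 = (nrm (z n))\<^sup>2 + 2 * gip (z n) v + (nrm v)\<^sup>2" for n
    unfolding wz by (rule nrm_add_sq[OF H10_H1[OF zH] H10_H1[OF v]])
  have "(\<lambda>n. (nrm (z n))\<^sup>2 + 2 * gip (z n) v + (nrm v)\<^sup>2) \<longlonglongrightarrow> \<sigma>\<^sup>2 + 2 * 0 + (nrm v)\<^sup>2"
    by (intro tendsto_intros z2 zv)
  hence w2: "(\<lambda>n. (nrm (w n))\<^sup>2) \<longlonglongrightarrow> (nrm v)\<^sup>2 + \<sigma>\<^sup>2" by (simp add: wn2 add.commute)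
  \<comment> \<open>Weak convergence gives the Pythagorean relation for the norms, so n is the limit
    in the nonlocal coefficient.\<close>
  define n where "n = sqrt ((nrm v)\<^sup>2 + \<sigma>\<^sup>2)"
  have wn: "(\<lambda>j. nrm (w j)) \<longlonglongrightarrow> n"
    using tendsto_real_sqrt[OF w2] by (simp add: n_def nrm_nonneg)
  have n\<sigma>: "\<sigma> \<le> n" unfolding n_def by (rule real_le_rsqrt) simp
  have wq: "(\<lambda>j. nrm (w j) powr (p - 2)) \<longlonglongrightarrow> n powr (p - 2)"
    using p_gt_2 by (intro tendsto_powr2 wn tendsto_const) (auto simp: nrm_nonneg)
  have gwz: "gip (w j) (z j) = (nrm (z j))\<^sup>2 + gip (z j) v" for j
    using gip_add[OF H10_H1[OF zH] H10_H1[OF v] H10_H1[OF zH], of j j] gip_commute[of v "z j"]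
    unfolding wz[symmetric] nrm_sq by simp
  have g: "(\<lambda>j. gip (w j) (z j)) \<longlonglongrightarrow> \<sigma>\<^sup>2" unfolding gwz using tendsto_add[OF z2 zv] by simp
  have wl: "(\<lambda>j. l2 (w j)) \<longlonglongrightarrow> l2 v"
    by (rule l2_tendsto[OF H10_sq_int[OF wH] k1(2)]) (use zl in \<open>simp add: z_def\<close>)
  have l: "(\<lambda>j. lip (w j) (z j)) \<longlonglongrightarrow> 0"
  proof (rule Lim_null_comparison)
    show "(\<lambda>j. l2 (w j) * l2 (z j)) \<longlonglongrightarrow> 0" using tendsto_mult[OF wl zl] by simp
    show "\<forall>\<^sub>F j in sequentially. norm (lip (w j) (z j)) \<le> l2 (w j) * l2 (z j)"
      using lip_CS[OF H10_sq_int[OF wH] H10_sq_int[OF zH]] by simp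
  qed
  have dw: "(\<lambda>j. dual_norm \<Omega> (kir' a b lam (w j))) \<longlonglongrightarrow> 0"
    using LIMSEQ_subseq_LIMSEQ[OF d r] by (simp add: w_def o_def)
  have k: "(\<lambda>j. kir' a b lam (w j) (z j)) \<longlonglongrightarrow> 0"
  proof (rule Lim_null_comparison)
    show "(\<lambda>j. dual_norm \<Omega> (kir' a b lam (w j)) * nrm (z j)) \<longlonglongrightarrow> 0" using tendsto_mult[OF dw z\<sigma>] by simp
    show "\<forall>\<^sub>F j in sequentially. norm (kir' a b lam (w j) (z j)) \<le> dual_norm \<Omega> (kir' a b lam (w j)) * nrm (z j)"
      using dual_norm_bound[OF lip_C1_dual[OF lip_C1_kirchhoff wH] zH] by simp
  qed
  have s: "(\<lambda>j. pform (w j) (z j) - pint (z j)) \<longlonglongrightarrow> 0"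
    unfolding wz by (rule pform_splitting[OF zH zK v zae])
  \<comment> \<open>The definition of \<open>kir'\<close>, tested with z, solved for the critical
    integral of z; the last bracket is the error of the splitting.\<close>
  have e: "pint (z j) = a * gip (w j) (z j) + b * nrm (w j) powr (p - 2) * gip (w j) (z j) - lam * lip (w j) (z j)
      - kir' a b lam (w j) (z j) - (pform (w j) (z j) - pint (z j))" for j
    by (simp add: kir'_def)
  have "(\<lambda>j. a * gip (w j) (z j) + b * nrm (w j) powr (p - 2) * gip (w j) (z j) - lam * lip (w j) (z j)
      - kir' a b lam (w j) (z j) - (pform (w j) (z j) - pint (z j))) \<longlonglongrightarrow> a * \<sigma>\<^sup>2 + b * n powr (p - 2) * \<sigma>\<^sup>2 - lam * 0 - 0 - 0"
    by (intro tendsto_diff tendsto_add tendsto_mult tendsto_const g wq l k s)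
  hence "(\<lambda>j. pint (z j)) \<longlonglongrightarrow> a * \<sigma>\<^sup>2 + b * n powr (p - 2) * \<sigma>\<^sup>2 - lam * 0 - 0 - 0"
    by (simp only: e[symmetric])
  hence pz: "(\<lambda>j. pint (z j)) \<longlonglongrightarrow> a * \<sigma>\<^sup>2 + b * n powr (p - 2) * \<sigma>\<^sup>2" by simp
  have "(\<lambda>j. sobolev_constant \<Omega> powr (- p / 2) * nrm (z j) powr p) \<longlonglongrightarrow> sobolev_constant \<Omega> powr (- p / 2) * \<sigma> powr p"
    using p_gt_2 by (intro tendsto_mult tendsto_const tendsto_powr2 z\<sigma>) (auto simp: nrm_nonneg)
  from LIMSEQ_le[OF pz this] have le: "a * \<sigma>\<^sup>2 + b * n powr (p - 2) * \<sigma>\<^sup>2 \<le> sobolev_constant \<Omega> powr (- p / 2) * \<sigma> powr p"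
    using pint_le[OF zH] by blast
  \<comment> \<open>Since \<open>b \<ge> 0\<close>, the coefficient may be lowered from n to
    \<sigma>, which frees the inequality from v.\<close>
  have "\<sigma> powr (p - 2) \<le> n powr (p - 2)" using n\<sigma> k3(1) p_gt_2 by (intro powr_mono2) auto
  hence "b * \<sigma> powr (p - 2) * \<sigma>\<^sup>2 \<le> b * n powr (p - 2) * \<sigma>\<^sup>2" using b by (intro mult_right_mono mult_left_mono) auto
  hence fin: "(a + b * \<sigma> powr (p - 2)) * \<sigma>\<^sup>2 \<le> sobolev_constant \<Omega> powr (- p / 2) * \<sigma> powr p"
    using le unfolding distrib_right by linarith
  show ?thesis
  proof (rule that[OF r v k3(1) _ _ _ fin])
    show "(\<lambda>j. nrm (\<lambda>x. u (r j) x - v x)) \<longlonglongrightarrow> \<sigma>" using z\<sigma> by (simp add: z_def w_def)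
    show "(\<lambda>j. (nrm (u (r j)))\<^sup>2) \<longlonglongrightarrow> (nrm v)\<^sup>2 + \<sigma>\<^sup>2" using w2 by (simp add: w_def)
    show "(\<lambda>j. (l2 (u (r j)))\<^sup>2) \<longlonglongrightarrow> (l2 v)\<^sup>2" using tendsto_power[OF wl, of 2] by (simp add: w_def)
  qed
qed

text \<open>\<open>palais_smale\<close> asks for some C1 derivative; \<open>kir'\<close> is supplied
  here once and for all.\<close>

lemma palais_smaleI:
  assumes "\<And>u. (\<And>j. u j \<in> H10 \<Omega>) \<Longrightarrow> (\<lambda>j. kirchhoff_functional a b lam \<Omega> (u j)) \<longlonglongrightarrow> c \<Longrightarrow>
      (\<lambda>j. dual_norm \<Omega> (kir' a b lam (u j))) \<longlonglongrightarrow> 0 \<Longrightarrow>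
      \<exists>r v. strict_mono (r :: nat \<Rightarrow> nat) \<and> v \<in> H10 \<Omega> \<and> (\<lambda>k. nrm (\<lambda>x. u (r k) x - v x)) \<longlonglongrightarrow> 0"
  shows "palais_smale \<Omega> (kirchhoff_functional a b lam \<Omega>) c"
  unfolding palais_smale_def
  by (rule exI[of _ "kir' a b lam"]) (use assms lip_C1_imp_C1[OF lip_C1_kirchhoff] in auto)

section \<open>Boundedness of Palais-Smale sequences and the two cases\<close>

lemma convergent_bound:
  fixes X :: "nat \<Rightarrow> real"
  assumes "X \<longlonglongrightarrow> c"
  obtains M where "M \<ge> 0" "\<And>j. \<bar>X j\<bar> \<le> M"
proof -
  have "Bseq X" using convergentI[OF assms] by (rule convergent_imp_Bseq)
  then obtain M where "M > 0" "\<And>j. norm (X j) \<le> M" by (auto elim: BseqE)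
  thus ?thesis by (intro that[of M]) auto
qed

lemma nrm_powr_split: "nrm u powr (p - 2) * (nrm u)\<^sup>2 = nrm u powr p"
  using nrm_nonneg[of u] p_gt_2
proof (cases "nrm u = 0")
  case False
  hence "nrm u powr p = nrm u powr (p - 2) * nrm u powr 2" by (simp only: powr_add[symmetric]) simp
  thus ?thesis using False nrm_nonneg[of u] by simp
qed simp

text \<open>Subtracting 1/p of the derivative in direction u cancels all terms of degree p, the
  nonlocal and the critical one alike; the quadratic terms keep the factor 1/2 - 1/p = 1/N.\<close>

lemma energy_identity:
  "kirchhoff_functional a b lam \<Omega> u - 1 / p * kir' a b lam u u = 1 / real DIM('a) * (a * (nrm u)\<^sup>2 - lam * (l2 u)\<^sup>2)"
proof -
  have k: "kir' a b lam u u = a * (nrm u)\<^sup>2 + b * nrm u powr p - lam * (l2 u)\<^sup>2 - pint u"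
    unfolding kir'_def nrm_sq[symmetric] l2_sq[symmetric] pform_self mult.assoc nrm_powr_split ..
  have "kirchhoff_functional a b lam \<Omega> u - 1 / p * kir' a b lam u u = (1 / 2 - 1 / p) * (a * (nrm u)\<^sup>2 - lam * (l2 u)\<^sup>2)"
    unfolding kirchhoff_eq k by (simp add: algebra_simps add_divide_distrib diff_divide_distrib)
  also have "1 / 2 - 1 / p = 1 / real DIM('a)" unfolding p_def by (rule crit_exp_facts(4)[OF dim])
  finally show ?thesis .
qed

text \<open>Boundedness comes from the values of the functional: by \<open>pint_le\<close> the terms
  of degree p amount to at least \<epsilon> n^p, which beats the negative quadratic term because p >
  2. The Poincare constant bounds that term for every \<open>lam\<close>.\<close>

lemma palais_smale_case_ii:
  assumes a: "a \<ge> 0" and b: "b > sobolev_constant \<Omega> powr (- p / 2)" and lam: "lam > 0"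
  shows "palais_smale \<Omega> (kirchhoff_functional a b lam \<Omega>) c"
proof (rule palais_smaleI)
  fix u assume u: "\<And>j. u j \<in> H10 \<Omega>" and J: "(\<lambda>j. kirchhoff_functional a b lam \<Omega> (u j)) \<longlonglongrightarrow> c"
    and d: "(\<lambda>j. dual_norm \<Omega> (kir' a b lam (u j))) \<longlonglongrightarrow> 0"
  define Sp where "Sp = sobolev_constant \<Omega> powr (- p / 2)"
  have b0: "b \<ge> 0" using b powr_ge_zero[of "sobolev_constant \<Omega>" "- p / 2"] by linarith
  obtain M where M: "M \<ge> 0" "\<And>j. \<bar>kirchhoff_functional a b lam \<Omega> (u j)\<bar> \<le> M" by (rule convergent_bound[OF J]) blast
  define \<epsilon> B where "\<epsilon> = (b - Sp) / p" and "B = lam / 2 * poin_const\<^sup>2"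
  have \<epsilon>: "\<epsilon> > 0" using b p_gt_2 by (simp add: \<epsilon>_def Sp_def)
  have B: "B \<ge> 0" using lam by (simp add: B_def)
  \<comment> \<open>For n > 1 the constant M is at most M n^2, and division by n^2 leaves \<epsilon>
    n^(p-2) <= M + B. K is this bound solved for n, or 1 otherwise.\<close>
  define K where "K = max 1 (((M + B) / \<epsilon>) powr (1 / (p - 2)))"
  have K: "nrm (u j) \<le> K" for j
  proof (cases "nrm (u j) \<le> 1")
    case False
    define n where "n = nrm (u j)"
    have n: "n > 1" using False by (simp add: n_def)
    have "(l2 (u j))\<^sup>2 \<le> (poin_const * n)\<^sup>2"
      unfolding n_def by (rule power_mono[OF poincare_H10_le[OF u] l2_norm_nonneg])
    hence "lam / 2 * (l2 (u j))\<^sup>2 \<le> lam / 2 * (poin_const * n)\<^sup>2" using lam by (intro mult_left_mono) auto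
    hence l: "lam / 2 * (l2 (u j))\<^sup>2 \<le> B * n\<^sup>2" by (simp add: B_def power_mult_distrib)
    have "1 / p * pint (u j) \<le> 1 / p * (Sp * n powr p)"
      unfolding Sp_def n_def using p_gt_2 by (intro mult_left_mono pint_le u) auto
    moreover have "b / p * n powr p - 1 / p * (Sp * n powr p) = \<epsilon> * n powr p" by (simp add: \<epsilon>_def left_diff_distrib diff_divide_distrib)
    moreover have "0 \<le> a / 2 * n\<^sup>2" using a by simp
    ultimately have "\<epsilon> * n powr p - B * n\<^sup>2 \<le> kirchhoff_functional a b lam \<Omega> (u j)"
      using l unfolding kirchhoff_eq n_def[symmetric] by linarith
    hence "\<epsilon> * n powr p \<le> M + B * n\<^sup>2" using M(2)[of j] by linarith
    also have "\<dots> \<le> M * n\<^sup>2 + B * n\<^sup>2"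
      using M(1) n mult_left_mono[of 1 "n\<^sup>2" M] by (simp add: one_le_power)
    finally have "(\<epsilon> * n powr (p - 2)) * n\<^sup>2 \<le> (M + B) * n\<^sup>2"
      using nrm_powr_split[of "u j"] by (simp add: n_def distrib_right mult.assoc)
    hence "\<epsilon> * n powr (p - 2) \<le> M + B" using n by simp
    hence "n powr (p - 2) \<le> (M + B) / \<epsilon>" using \<epsilon> by (simp add: field_simps)
    hence "(n powr (p - 2)) powr (1 / (p - 2)) \<le> ((M + B) / \<epsilon>) powr (1 / (p - 2))" using p_gt_2 by (intro powr_mono2) auto
    moreover have "(n powr (p - 2)) powr (1 / (p - 2)) = n" using n p_gt_2 by (simp add: powr_powr)
    ultimately show ?thesis by (simp add: K_def n_def)
  qed (simp add: K_def)
  obtain r v \<sigma> where ps: "strict_mono r" "v \<in> H10 \<Omega>" "\<sigma> \<ge> 0"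
    "(\<lambda>j. nrm (\<lambda>x. u (r j) x - v x)) \<longlonglongrightarrow> \<sigma>"
    "(a + b * \<sigma> powr (p - 2)) * \<sigma>\<^sup>2 \<le> Sp * \<sigma> powr p"
    unfolding Sp_def by (rule palais_smale_extract[OF u K b0 d]) blast
  have "\<sigma> = 0"
  proof (rule ccontr)
    assume "\<sigma> \<noteq> 0"
    hence s: "\<sigma> > 0" using ps(3) by simp
    have "\<sigma> powr p = \<sigma> powr (p - 2) * \<sigma> powr 2" by (simp only: powr_add[symmetric]) simp
    hence sp: "\<sigma> powr p = \<sigma> powr (p - 2) * \<sigma>\<^sup>2" using s by simp
    have "(a + b * \<sigma> powr (p - 2)) * \<sigma>\<^sup>2 \<le> (Sp * \<sigma> powr (p - 2)) * \<sigma>\<^sup>2" using ps(5) unfolding sp by (simp only: mult.assoc)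
    hence "a + b * \<sigma> powr (p - 2) \<le> Sp * \<sigma> powr (p - 2)" using s by simp
    moreover have "Sp * \<sigma> powr (p - 2) < b * \<sigma> powr (p - 2)" using b s by (intro mult_strict_right_mono) (auto simp: Sp_def)
    ultimately show False using a by linarith
  qed
  thus "\<exists>r v. strict_mono r \<and> v \<in> H10 \<Omega> \<and> (\<lambda>k. nrm (\<lambda>x. u (r k) x - v x)) \<longlonglongrightarrow> 0"
    using ps(1,2,4) by blast
qed

text \<open>The part of degree p has no definite sign now, so the derivative is needed for
  boundedness: by the energy identity, \<theta> n^2 / N is at most M + D n, which is linear in the
  norm n.\<close>

lemma palais_smale_case_i:
  assumes a: "a > 0" and b: "0 < b" "b < sobolev_constant \<Omega> powr (- p / 2)"
    and lam: "0 < lam" "lam < a * first_eigenvalue \<Omega>"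
    and c: "c < 1 / real DIM('a) * (a powr (p / 2) / (sobolev_constant \<Omega> powr (- p / 2) - b)) powr (2 / (p - 2))"
  shows "palais_smale \<Omega> (kirchhoff_functional a b lam \<Omega>) c"
proof (rule palais_smaleI)
  fix u assume u: "\<And>j. u j \<in> H10 \<Omega>" and J: "(\<lambda>j. kirchhoff_functional a b lam \<Omega> (u j)) \<longlonglongrightarrow> c"
    and d: "(\<lambda>j. dual_norm \<Omega> (kir' a b lam (u j))) \<longlonglongrightarrow> 0"
  define Sp where "Sp = sobolev_constant \<Omega> powr (- p / 2)"
  define l1 where "l1 = first_eigenvalue \<Omega>"
  have dimpos: "real DIM('a) > 0" using dim by simp
  \<comment> \<open>Positivity of the eigenvalue is forced by 0 < lam < a l1 and a > 0.\<close>
  have l1: "l1 > 0"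
  proof (rule ccontr)
    assume "\<not> l1 > 0"
    hence "a * l1 \<le> 0" using a by (simp add: mult_nonneg_nonpos)
    thus False using lam by (simp add: l1_def)
  qed
  \<comment> \<open>The coercivity constant of the quadratic part, from the bound of lam times the
    squared L2 norm by lam / l1 times the energy.\<close>
  define \<theta> where "\<theta> = a - lam / l1"
  have \<theta>: "\<theta> > 0" using lam l1 by (simp add: \<theta>_def l1_def field_simps)
  have quad: "\<theta> * (nrm w)\<^sup>2 \<le> a * (nrm w)\<^sup>2 - lam * (l2 w)\<^sup>2" if "w \<in> H10 \<Omega>" for w
  proof -
    have "l1 * (l2 w)\<^sup>2 \<le> (nrm w)\<^sup>2" unfolding l1_def by (rule first_eigenvalue_le[OF that])
    hence "lam / l1 * (l1 * (l2 w)\<^sup>2) \<le> lam / l1 * (nrm w)\<^sup>2" using lam l1 by (intro mult_left_mono) auto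
    thus ?thesis using l1 by (simp add: \<theta>_def left_diff_distrib)
  qed
  obtain M where M: "M \<ge> 0" "\<And>j. \<bar>kirchhoff_functional a b lam \<Omega> (u j)\<bar> \<le> M" by (rule convergent_bound[OF J]) blast
  obtain D where D: "D \<ge> 0" "\<And>j. \<bar>dual_norm \<Omega> (kir' a b lam (u j))\<bar> \<le> D" by (rule convergent_bound[OF d]) blast
  have dual: "\<bar>kir' a b lam (u j) (u j)\<bar> \<le> dual_norm \<Omega> (kir' a b lam (u j)) * nrm (u j)" for j
    by (rule dual_norm_bound[OF lip_C1_dual[OF lip_C1_kirchhoff u] u])
  define K where "K = max 1 (real DIM('a) * (M + D) / \<theta>)"
  have K: "nrm (u j) \<le> K" for j
  proof (cases "nrm (u j) \<le> 1")
    case False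
    define n where "n = nrm (u j)"
    have n: "n > 1" using False by (simp add: n_def)
    have "dual_norm \<Omega> (kir' a b lam (u j)) * n \<le> D * n" using D(2)[of j] n by (intro mult_right_mono) auto
    hence kD: "\<bar>kir' a b lam (u j) (u j)\<bar> \<le> D * n" using dual[of j] by (simp add: n_def)
    \<comment> \<open>Estimating 1/p by 1 costs nothing where only boundedness matters.\<close>
    have "\<bar>1 / p * kir' a b lam (u j) (u j)\<bar> \<le> 1 * (D * n)"
      unfolding abs_mult using kD p_gt_2 by (intro mult_mono) auto
    hence "1 / real DIM('a) * (a * n\<^sup>2 - lam * (l2 (u j))\<^sup>2) \<le> M + D * n"
      using energy_identity[of a b lam "u j"] M(2)[of j] unfolding n_def by linarith
    moreover have "1 / real DIM('a) * (\<theta> * n\<^sup>2) \<le> 1 / real DIM('a) * (a * n\<^sup>2 - lam * (l2 (u j))\<^sup>2)"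
      unfolding n_def using quad[OF u] by (intro mult_left_mono) auto
    moreover have "M \<le> M * n" using M(1) n mult_left_mono[of 1 n M] by simp
    ultimately have "1 / real DIM('a) * (\<theta> * n\<^sup>2) \<le> M * n + D * n" by linarith
    hence "\<theta> * n\<^sup>2 \<le> real DIM('a) * (M * n + D * n)" using dimpos by (simp add: field_simps)
    hence "(\<theta> * n) * n \<le> (real DIM('a) * (M + D)) * n" by (simp add: power2_eq_square algebra_simps)
    hence "\<theta> * n \<le> real DIM('a) * (M + D)" using n by simp
    hence "n \<le> real DIM('a) * (M + D) / \<theta>" using \<theta> by (simp add: field_simps)
    thus ?thesis by (simp add: K_def n_def)
  qed (simp add: K_def)
  obtain r v \<sigma> where ps: "strict_mono r" "v \<in> H10 \<Omega>" "\<sigma> \<ge> 0"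
    "(\<lambda>j. nrm (\<lambda>x. u (r j) x - v x)) \<longlonglongrightarrow> \<sigma>"
    "(\<lambda>j. (nrm (u (r j)))\<^sup>2) \<longlonglongrightarrow> (nrm v)\<^sup>2 + \<sigma>\<^sup>2"
    "(\<lambda>j. (l2 (u (r j)))\<^sup>2) \<longlonglongrightarrow> (l2 v)\<^sup>2"
    "(a + b * \<sigma> powr (p - 2)) * \<sigma>\<^sup>2 \<le> Sp * \<sigma> powr p"
    unfolding Sp_def by (rule palais_smale_extract[OF u K less_imp_le[OF b(1)] d]) blast
  have "\<sigma> = 0"
  proof (rule ccontr)
    assume "\<sigma> \<noteq> 0"
    hence s: "\<sigma> > 0" using ps(3) by simp
    have "\<sigma> powr p = \<sigma> powr (p - 2) * \<sigma> powr 2" by (simp only: powr_add[symmetric]) simp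
    hence sp: "\<sigma> powr p = \<sigma> powr (p - 2) * \<sigma>\<^sup>2" using s by simp
    have "(a + b * \<sigma> powr (p - 2)) * \<sigma>\<^sup>2 \<le> (Sp * \<sigma> powr (p - 2)) * \<sigma>\<^sup>2" using ps(7) unfolding sp by (simp only: mult.assoc)
    hence "a + b * \<sigma> powr (p - 2) \<le> Sp * \<sigma> powr (p - 2)" using s by simp
    hence "a \<le> (Sp - b) * \<sigma> powr (p - 2)" by (simp add: left_diff_distrib)
    moreover have Spb: "Sp - b > 0" using b by (simp add: Sp_def)
    ultimately have "a / (Sp - b) \<le> \<sigma> powr (p - 2)" by (simp add: field_simps)
    hence "(a / (Sp - b)) powr (2 / (p - 2)) \<le> (\<sigma> powr (p - 2)) powr (2 / (p - 2))"
      using a Spb p_gt_2 by (intro powr_mono2) auto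
    also have "\<dots> = \<sigma> powr 2"
    proof -
      have "(p - 2) * (2 / (p - 2)) = 2" using p_gt_2 by (simp add: field_simps)
      thus ?thesis by (simp only: powr_powr)
    qed
    also have "\<dots> = \<sigma>\<^sup>2" using s by simp
    finally have "a * (a / (Sp - b)) powr (2 / (p - 2)) \<le> a * \<sigma>\<^sup>2" using a by (intro mult_left_mono) auto
    \<comment> \<open>The outer factor a is absorbed because p/(p-2) = 1 + 2/(p-2); this brings the
      lower bound into the form of c*.\<close>
    moreover have "a * (a / (Sp - b)) powr (2 / (p - 2)) = (a powr (p / 2) / (Sp - b)) powr (2 / (p - 2))"
    proof -
      have "p / 2 * (2 / (p - 2)) = 1 + 2 / (p - 2)" using p_gt_2 by (simp add: field_simps)
      hence "(a powr (p / 2)) powr (2 / (p - 2)) = a powr (1 + 2 / (p - 2))" by (simp only: powr_powr)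
      also have "\<dots> = a * a powr (2 / (p - 2))" unfolding powr_add using a by simp
      finally show ?thesis using a Spb by (simp add: powr_divide)
    qed
    ultimately have low: "(a powr (p / 2) / (Sp - b)) powr (2 / (p - 2)) \<le> a * \<sigma>\<^sup>2" by simp
    have k0: "(\<lambda>j. kir' a b lam (u (r j)) (u (r j))) \<longlonglongrightarrow> 0"
    proof (rule Lim_null_comparison)
      have "(\<lambda>j. dual_norm \<Omega> (kir' a b lam (u (r j)))) \<longlonglongrightarrow> 0" using LIMSEQ_subseq_LIMSEQ[OF d ps(1)] by (simp add: o_def)
      thus "(\<lambda>j. \<bar>dual_norm \<Omega> (kir' a b lam (u (r j)))\<bar> * K) \<longlonglongrightarrow> 0"
        using tendsto_mult_left_zero[of "\<lambda>j. \<bar>dual_norm \<Omega> (kir' a b lam (u (r j)))\<bar>" sequentially K] by (simp add: tendsto_rabs_zero)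
      show "\<forall>\<^sub>F j in sequentially. norm (kir' a b lam (u (r j)) (u (r j))) \<le> \<bar>dual_norm \<Omega> (kir' a b lam (u (r j)))\<bar> * K"
      proof (intro always_eventually allI)
        fix j
        have "\<bar>kir' a b lam (u (r j)) (u (r j))\<bar> \<le> dual_norm \<Omega> (kir' a b lam (u (r j))) * nrm (u (r j))" by (rule dual)
        also have "\<dots> \<le> \<bar>dual_norm \<Omega> (kir' a b lam (u (r j)))\<bar> * K"
          using K[of "r j"] nrm_nonneg[of "u (r j)"] by (intro mult_mono) auto
        finally show "norm (kir' a b lam (u (r j)) (u (r j))) \<le> \<bar>dual_norm \<Omega> (kir' a b lam (u (r j)))\<bar> * K" by simp
      qed
    qed
    have "(\<lambda>j. kirchhoff_functional a b lam \<Omega> (u (r j)) - 1 / p * kir' a b lam (u (r j)) (u (r j))) \<longlonglongrightarrow> c - 1 / p * 0"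
      using LIMSEQ_subseq_LIMSEQ[OF J ps(1)] by (intro tendsto_diff tendsto_mult tendsto_const k0) (simp add: o_def)
    moreover have "(\<lambda>j. 1 / real DIM('a) * (a * (nrm (u (r j)))\<^sup>2 - lam * (l2 (u (r j)))\<^sup>2))
        \<longlonglongrightarrow> 1 / real DIM('a) * (a * ((nrm v)\<^sup>2 + \<sigma>\<^sup>2) - lam * (l2 v)\<^sup>2)"
      by (intro tendsto_diff tendsto_mult tendsto_const ps(5,6))
    ultimately have ceq: "c = 1 / real DIM('a) * (a * ((nrm v)\<^sup>2 + \<sigma>\<^sup>2) - lam * (l2 v)\<^sup>2)"
      unfolding energy_identity by (simp add: LIMSEQ_unique)
    \<comment> \<open>The contribution of v to the limit level is nonnegative by
      \<open>quad\<close>, which leaves c at least a \<sigma>^2 / N.\<close>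
    have "0 \<le> \<theta> * (nrm v)\<^sup>2" using \<theta> by simp
    hence "a * \<sigma>\<^sup>2 \<le> a * ((nrm v)\<^sup>2 + \<sigma>\<^sup>2) - lam * (l2 v)\<^sup>2" using quad[OF ps(2)] by (simp add: distrib_left)
    hence "1 / real DIM('a) * (a powr (p / 2) / (Sp - b)) powr (2 / (p - 2)) \<le> c"
      unfolding ceq using low dimpos by (intro mult_left_mono) auto
    thus False using c by (simp add: Sp_def)
  qed
  thus "\<exists>r v. strict_mono r \<and> v \<in> H10 \<Omega> \<and> (\<lambda>k. nrm (\<lambda>x. u (r k) x - v x)) \<longlonglongrightarrow> 0"
    using ps(1,2,4) by blast
qed

end

theorem theorem1p2:
  fixes \<Omega> :: "'a::euclidean_space set" and a b lam :: real
  defines "N \<equiv> DIM('a)"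
  defines "p \<equiv> crit_exp N"
  defines "S \<equiv> sobolev_constant \<Omega>"
  defines "c_star \<equiv> 1 / real N * (a powr (p / 2) / (S powr (- p / 2) - b)) powr (2 / (p - 2))"
  assumes "N \<ge> 3"
    and "open \<Omega>" "connected \<Omega>" "\<Omega> \<noteq> {}" "bounded \<Omega>"
  shows "(a > 0 \<and> 0 < b \<and> b < S powr (- p / 2) \<and> 0 < lam \<and> lam < a * first_eigenvalue \<Omega> \<longrightarrow>
            (\<forall>c < c_star. palais_smale \<Omega> (kirchhoff_functional a b lam \<Omega>) c)) \<and>
         (a \<ge> 0 \<and> b > S powr (- p / 2) \<and> lam > 0 \<longrightarrow>
            (\<forall>c. palais_smale \<Omega> (kirchhoff_functional a b lam \<Omega>) c))"
proof -
  interpret sobolev_domain \<Omega> p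
    by unfold_locales (use assms in auto)
  show ?thesis
  proof (intro conjI impI allI)
    fix c
    assume "a > 0 \<and> 0 < b \<and> b < S powr (- p / 2) \<and> 0 < lam \<and> lam < a * first_eigenvalue \<Omega>" "c < c_star"
    thus "palais_smale \<Omega> (kirchhoff_functional a b lam \<Omega>) c"
      by (intro palais_smale_case_i) (simp_all add: S_def c_star_def N_def)
  next
    fix c
    assume "a \<ge> 0 \<and> b > S powr (- p / 2) \<and> lam > 0"
    thus "palais_smale \<Omega> (kirchhoff_functional a b lam \<Omega>) c"
      by (intro palais_smale_case_ii) (simp_all add: S_def)
  qed
qed

end
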